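(* Let $k$ be a field of characteristic $0$ and let $f,g\in k[X]\setminus k$ be polynomials such that $\mathrm{Mon}_k(f)$ and $\mathrm{Mon}_k(g)$ are solvable and $f(X)-g(Y)$ is reducible in $k[X,Y]$. Then either (1) there exist $h,f_1,g_1\in k[X]\setminus k$ with $\deg(h)\ge 2$, $f=h\circ f_1$ and $g=h\circ g_1$; or (2) $f=(\mu\circ D_{4,\alpha})\circ f_1$ and $g=(\mu\circ(-\tfrac14D_{4,2\alpha}))\circ g_1$ for some linear $\mu\in k[X]$, some $\alpha\in k$, and some $f_1,g_1\in k[X]$.
   Context: For $f\in k[X]\setminus k$ and $t$ transcendental over $k$, the monodromy group $\mathrm{Mon}_k(f)$ is the Galois group of $f(X)-t$ over $k(t)$, viewed as a permutation group on its roots. $D_{n,\alpha}$ is the Dickson polynomial defined by $D_{n,\alpha}(X+\alpha/X)=X^n+(\alpha/X)^n$, so $D_{4,\alpha}=X^4-4\alpha X^2+2\alpha^2$. *)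

theory Defs
  imports
    "HOL-Algebra.Algebraic_Closure_Type"
    "HOL-Algebra.Generated_Fields"
    "HOL-Algebra.Solvable_Groups"
    "HOL-Algebra.Bij"
begin

subsection \<open>Galois groups of polynomials\<close>

definition ac_roots :: "'a::field poly \<Rightarrow> 'a alg_closure set" where
  "ac_roots p = {x. poly (map_poly to_ac p) x = 0}"

definition splitting_field :: "'a::field poly \<Rightarrow> 'a alg_closure ring" where
  "splitting_field p =
     ring_of_type_algebra
       \<lparr>carrier := generate_field ring_of_type_algebra (range to_ac \<union> ac_roots p)\<rparr>"

definition galois_group ::
    "'a::field poly \<Rightarrow> ('a alg_closure \<Rightarrow> 'a alg_closure) monoid" where
  "galois_group p =
     BijGroup (carrier (splitting_field p))
       \<lparr>carrier := {\<sigma> \<in> Bij (carrier (splitting_field p)).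
          \<sigma> \<in> ring_hom (splitting_field p) (splitting_field p) \<and>
          (\<forall>a. \<sigma> (to_ac a) = to_ac a)}\<rparr>"

text \<open>The Galois group viewed as a permutation group on the roots.\<close>

definition galois_perm_group ::
    "'a::field poly \<Rightarrow> ('a alg_closure \<Rightarrow> 'a alg_closure) monoid" where
  "galois_perm_group p =
     BijGroup (ac_roots p)
       \<lparr>carrier := (\<lambda>\<sigma>. restrict \<sigma> (ac_roots p)) ` carrier (galois_group p)\<rparr>"

lemma generate_field_closed:
  fixes H :: "'b::field set"
  defines "L \<equiv> generate_field ring_of_type_algebra H"
  shows "x \<in> L \<Longrightarrow> y \<in> L \<Longrightarrow> x + y \<in> L" "x \<in> L \<Longrightarrow> y \<in> L \<Longrightarrow> x * y \<in> L"
  unfolding L_def using generate_field.eng_add[of x ring_of_type_algebra H y]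
    generate_field.eng_mult[of x ring_of_type_algebra H y]
  by (auto simp add: ring_of_type_algebra_def)

lemma ring_splitting_field: "ring (splitting_field (p :: 'a::field poly))"
proof -
  interpret R: field "ring_of_type_algebra :: 'a alg_closure ring" by (rule field_from_type_algebra)
  have "range to_ac \<union> ac_roots p \<subseteq> carrier ring_of_type_algebra"
    by (simp add: ring_of_type_algebra_def)
  hence "subfield (carrier (splitting_field p)) ring_of_type_algebra"
    by (simp add: splitting_field_def R.generate_field_is_subfield)
  hence "field (ring_of_type_algebra \<lparr>carrier := carrier (splitting_field p)\<rparr>)"
    by (rule R.subfield_iff(2))
  thus ?thesis by (simp add: splitting_field_def field_def domain_def cring_def)
qed

lemma splitting_field_ops:
  "ring.add (splitting_field p) = (+)" "monoid.mult (splitting_field p) = (*)" "monoid.one (splitting_field p) = 1"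
  by (simp_all add: splitting_field_def ring_of_type_algebra_def)

lemma subgroup_galois_group:
  "subgroup (carrier (galois_group p)) (BijGroup (carrier (splitting_field p)))"
proof -
  let ?L = "splitting_field p" and ?B = "BijGroup (carrier (splitting_field p))"
  interpret B: group ?B by (rule group_BijGroup)
  interpret L: ring ?L by (rule ring_splitting_field)
  have K: "to_ac a \<in> carrier ?L" for a
    by (auto simp: splitting_field_def intro: generate_field.incl)
  have C: "carrier ?B = Bij (carrier ?L)" by (simp add: BijGroup_def)
  show ?thesis
  proof (rule B.subgroupI)
    have "(\<lambda>x\<in>carrier ?L. x) \<in> carrier (galois_group p)"
      using K by (auto simp: galois_group_def id_Bij ring_hom_def)
    thus "carrier (galois_group p) \<noteq> {}" by blast
  next
    fix s assume s: "s \<in> carrier (galois_group p)"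
    hence sB: "s \<in> Bij (carrier ?L)" by (simp add: galois_group_def)
    from s have "s \<in> ring_iso ?L ?L" by (simp add: galois_group_def ring_iso_def Bij_def)
    hence "inv_into (carrier ?L) s \<in> ring_iso ?L ?L"
      by (rule ring_iso_set_sym[OF ring_splitting_field])
    hence "restrict (inv_into (carrier ?L) s) (carrier ?L) \<in> ring_hom ?L ?L"
      by (auto simp: ring_iso_def ring_hom_def Pi_def)
    moreover have "inv_into (carrier ?L) s (to_ac a) = to_ac a" for a
      by (rule inv_into_f_eq)
        (use s K[of a] in \<open>auto simp: galois_group_def Bij_def bij_betw_def\<close>)
    ultimately show "inv\<^bsub>?B\<^esub> s \<in> carrier (galois_group p)"
      using K restrict_inv_into_Bij[OF sB] by (simp add: inv_BijGroup[OF sB] galois_group_def)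
  next
    fix s r assume sr: "s \<in> carrier (galois_group p)" "r \<in> carrier (galois_group p)"
    hence srB: "s \<in> Bij (carrier ?L)" "r \<in> Bij (carrier ?L)" by (simp_all add: galois_group_def)
    have "compose (carrier ?L) s r \<in> ring_hom ?L ?L"
      using sr by (auto simp: galois_group_def ring_hom_def compose_def Pi_def)
    moreover have "compose (carrier ?L) s r (to_ac a) = to_ac a" for a
      using sr K[of a] by (simp add: galois_group_def compose_def)
    ultimately show "s \<otimes>\<^bsub>?B\<^esub> r \<in> carrier (galois_group p)"
      using srB by (simp add: galois_group_def BijGroup_def compose_Bij)
  qed (simp add: C galois_group_def)
qed

lemma galois_group_maps_roots:
  fixes p :: "'a::field poly"
  assumes s: "s \<in> carrier (galois_group p)" and x: "x \<in> ac_roots p"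
  shows "s x \<in> ac_roots p"
proof -
  let ?L = "carrier (splitting_field p)"
  have K: "to_ac a \<in> ?L" for a
    by (auto simp: splitting_field_def intro: generate_field.incl)
  have xL: "x \<in> ?L" using x by (auto simp: splitting_field_def intro: generate_field.incl)
  have hom: "s (u + v) = s u + s v" "s (u * v) = s u * s v" if "u \<in> ?L" "v \<in> ?L" for u v
    using s that by (auto simp: galois_group_def ring_hom_def splitting_field_ops)
  have fix': "s (to_ac a) = to_ac a" for a using s by (simp add: galois_group_def)
  have "poly (map_poly to_ac q) x \<in> ?L \<and>
      s (poly (map_poly to_ac q) x) = poly (map_poly to_ac q) (s x)" for q
  proof (induction q)
    case 0
    show ?case using K[of 0] fix'[of 0] by simp
  next
    case (pCons a q)
    have *: "x * poly (map_poly to_ac q) x \<in> ?L"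
      using pCons xL generate_field_closed(2) by (auto simp: splitting_field_def)
    have "to_ac a + x * poly (map_poly to_ac q) x \<in> ?L"
      using K[of a] * generate_field_closed(1) by (auto simp: splitting_field_def)
    thus ?case using pCons xL * K[of a] by (simp add: map_poly_pCons hom fix')
  qed
  from this[of p] show ?thesis using x fix'[of 0] by (simp add: ac_roots_def)
qed

lemma subgroup_galois_perm_group:
  "subgroup (carrier (galois_perm_group p)) (BijGroup (ac_roots p))"
proof -
  let ?L = "carrier (splitting_field p)" and ?R = "ac_roots p"
  let ?r = "\<lambda>s. restrict s ?R"
  interpret B: group "BijGroup ?L" by (rule group_BijGroup)
  interpret S: subgroup "carrier (galois_group p)" "BijGroup ?L" by (rule subgroup_galois_group)
  have grp: "group (galois_group p)"
    using B.subgroup_imp_group[OF subgroup_galois_group[of p]] by (simp add: galois_group_def)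
  have RL: "?R \<subseteq> ?L" by (auto simp: splitting_field_def intro: generate_field.incl)
  have bij: "?r s \<in> Bij ?R" if s: "s \<in> carrier (galois_group p)" for s
  proof -
    have sB: "s \<in> Bij ?L" using s by (simp add: galois_group_def)
    have "inv\<^bsub>BijGroup ?L\<^esub> s \<in> carrier (galois_group p)" using s by simp
    hence inv: "(\<lambda>x\<in>?L. inv_into ?L s x) \<in> carrier (galois_group p)"
      by (simp add: inv_BijGroup[OF sB])
    have "s ` ?R = ?R"
    proof (intro equalityI subsetI)
      fix x assume x: "x \<in> ?R"
      with RL galois_group_maps_roots[OF inv x] have "inv_into ?L s x \<in> ?R" by auto
      moreover have "s (inv_into ?L s x) = x"
        using sB x RL by (auto simp: Bij_def bij_betw_def intro!: f_inv_into_f)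
      ultimately show "x \<in> s ` ?R" by (metis imageI)
    qed (use galois_group_maps_roots[OF s] in auto)
    moreover have "inj_on s ?R" using sB RL by (auto simp: Bij_def bij_betw_def intro: inj_on_subset)
    ultimately show ?thesis by (simp add: Bij_def bij_betw_def)
  qed
  have hom: "?r \<in> hom (galois_group p) (BijGroup ?R)"
  proof (rule homI)
    fix s t assume st: "s \<in> carrier (galois_group p)" "t \<in> carrier (galois_group p)"
    have "?r (compose ?L s t) = compose ?R (?r s) (?r t)"
      using RL galois_group_maps_roots[OF st(2)] by (auto simp: compose_def fun_eq_iff)
    moreover have "s \<in> Bij ?L" "t \<in> Bij ?L" using st by (simp_all add: galois_group_def)
    ultimately show "?r (s \<otimes>\<^bsub>galois_group p\<^esub> t) = ?r s \<otimes>\<^bsub>BijGroup ?R\<^esub> ?r t"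
      using bij[OF st(1)] bij[OF st(2)] by (simp add: galois_group_def BijGroup_def)
  qed (simp add: bij BijGroup_def)
  interpret H: group_hom "galois_group p" "BijGroup ?R" ?r
    by (intro group_hom.intro grp group_BijGroup group_hom_axioms.intro hom)
  show ?thesis using H.img_is_subgroup by (simp add: galois_perm_group_def)
qed

lemma group_galois_perm_group: "group (galois_perm_group p)"
  using group.subgroup_imp_group[OF group_BijGroup subgroup_galois_perm_group[of p]]
  by (simp add: galois_perm_group_def)



subsection \<open>Rational functions and monodromy groups\<close>

text \<open>The rational function field in one variable over \<open>'a\<close> is \<open>'a poly fract\<close>.\<close>

definition rf_const :: "'a::field \<Rightarrow> 'a poly fract" where
  "rf_const c = to_fract [:c:]"

definition rf_var :: "'a::field poly fract" where
  "rf_var = to_fract [:0, 1:]"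

definition monodromy_group ::
    "'a::field poly \<Rightarrow> ('a poly fract alg_closure \<Rightarrow> 'a poly fract alg_closure) monoid" where
  "monodromy_group f = galois_perm_group (map_poly rf_const f - [:rf_var:])"


subsection \<open>The bivariate polynomial $f(X) - g(Y)$\<close>

text \<open>In \<open>'a poly poly\<close> the outer variable is $X$ and the inner one is $Y$.\<close>

definition bivariate_diff :: "'a::field poly \<Rightarrow> 'a poly \<Rightarrow> 'a poly poly" where
  "bivariate_diff f g = map_poly (\<lambda>c. [:c:]) f - [:g:]"


subsection \<open>Dickson polynomials\<close>

definition dickson :: "nat \<Rightarrow> 'a::field \<Rightarrow> 'a poly" where
  "dickson n \<alpha> =
     (THE D. poly (map_poly rf_const D) (rf_var + rf_const \<alpha> / rf_var)
             = rf_var ^ n + (rf_const \<alpha> / rf_var) ^ n)"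

lemma rf_const_hom [simp]:
  "rf_const 0 = 0" "rf_const 1 = 1"
  "rf_const (a + b) = rf_const a + rf_const b"
  "rf_const (a * b) = rf_const a * rf_const b"
  "rf_const (a - b) = rf_const a - rf_const b"
  by (simp_all add: rf_const_def flip: to_fract_add to_fract_mult to_fract_diff one_pCons)

lemma rf_var_nz [simp]: "rf_var \<noteq> 0"
  by (simp add: rf_var_def)

lemma rf_eval_hom:
  "poly (map_poly rf_const (p + q)) x = poly (map_poly rf_const p) x + poly (map_poly rf_const q) x"
  "poly (map_poly rf_const (p - q)) x = poly (map_poly rf_const p) x - poly (map_poly rf_const q) x"
  "poly (map_poly rf_const (Polynomial.smult c p)) x = rf_const c * poly (map_poly rf_const p) x"
  "poly (map_poly rf_const (pCons c p)) x = rf_const c + x * poly (map_poly rf_const p) x"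
proof -
  show 1: "poly (map_poly rf_const (p + q)) x
      = poly (map_poly rf_const p) x + poly (map_poly rf_const q) x" for p q
  proof -
    have "map_poly rf_const (p + q) = map_poly rf_const p + map_poly rf_const q"
      by (rule poly_eqI) (simp add: Polynomial.coeff_map_poly)
    thus ?thesis by simp
  qed
  show "poly (map_poly rf_const (p - q)) x
      = poly (map_poly rf_const p) x - poly (map_poly rf_const q) x"
    using 1[of "p - q" q] by simp
  have "map_poly rf_const (Polynomial.smult c p) = Polynomial.smult (rf_const c) (map_poly rf_const p)"
    by (rule poly_eqI) (simp add: Polynomial.coeff_map_poly)
  thus "poly (map_poly rf_const (Polynomial.smult c p)) x = rf_const c * poly (map_poly rf_const p) x"
    by simp
  have "map_poly rf_const (pCons c p) = pCons (rf_const c) (map_poly rf_const p)"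
    by (rule poly_eqI) (simp add: Polynomial.coeff_map_poly coeff_pCons split: nat.split)
  thus "poly (map_poly rf_const (pCons c p)) x = rf_const c + x * poly (map_poly rf_const p) x"
    by simp
qed

fun dickson_rec :: "nat \<Rightarrow> 'a::field \<Rightarrow> 'a poly" where
  "dickson_rec 0 \<alpha> = [:2:]"
| "dickson_rec (Suc 0) \<alpha> = [:0, 1:]"
| "dickson_rec (Suc (Suc n)) \<alpha> = pCons 0 (dickson_rec (Suc n) \<alpha>) - Polynomial.smult \<alpha> (dickson_rec n \<alpha>)"

lemma dickson_rec_functional_eq:
  "poly (map_poly rf_const (dickson_rec n \<alpha>)) (rf_var + rf_const \<alpha> / rf_var)
     = rf_var ^ n + (rf_const \<alpha> / rf_var) ^ n"
proof (induction n \<alpha> rule: dickson_rec.induct)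
  case (1 \<alpha>)
  have "rf_const (2::'a) = 2"
    using rf_const_hom(3)[of "1::'a" 1] by simp
  thus ?case by (simp add: rf_eval_hom)
next
  case (2 \<alpha>)
  show ?case by (simp add: rf_eval_hom)
next
  case (3 n \<alpha>)
  define u where "u = rf_const \<alpha> / rf_var"
  have u: "rf_const \<alpha> = u * rf_var" by (simp add: u_def)
  have "poly (map_poly rf_const (dickson_rec (Suc (Suc n)) \<alpha>)) (rf_var + u)
      = (rf_var + u) * (rf_var ^ Suc n + u ^ Suc n) - u * rf_var * (rf_var ^ n + u ^ n)"
    using 3 by (simp add: rf_eval_hom u flip: u_def)
  also have "\<dots> = rf_var ^ Suc (Suc n) + u ^ Suc (Suc n)"
    by (simp add: algebra_simps)
  finally show ?case by (simp add: u_def)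
qed

lemma rf_eval_inj:
  fixes p :: "'a::field poly"
  assumes "poly (map_poly rf_const p) (rf_var + rf_const \<alpha> / rf_var) = 0"
  shows "p = 0"
proof (rule ccontr)
  assume "p \<noteq> 0"
  define d where "d = Polynomial.degree p"
  define Xv :: "'a poly" where "Xv = [:0, 1:]"
  define Q :: "'a poly" where "Q = [:\<alpha>, 0, 1:]"
  define F where "F = (\<Sum>i\<le>d. Polynomial.smult (Polynomial.coeff p i) (Q ^ i * Xv ^ (d - i)))"
  have pow: "to_fract (q ^ n) = to_fract q ^ n" for q :: "'a poly" and n
    by (induction n) simp_all
  have sm: "to_fract (sum h A) = (\<Sum>i\<in>A. to_fract (h i))" if "finite A"
    for h :: "nat \<Rightarrow> 'a poly" and A
    using that by (induction A) simp_all
  have smu: "to_fract (Polynomial.smult c q) = rf_const c * to_fract q" for c and q :: "'a poly"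
    by (simp add: rf_const_def flip: to_fract_mult)
  have degp: "Polynomial.degree (map_poly rf_const p) = d"
    unfolding d_def by (rule degree_map_poly) (simp add: rf_const_def)
  have Q: "to_fract Q = rf_var * (rf_var + rf_const \<alpha> / rf_var)"
  proof -
    have "Q = Xv * Xv + [:\<alpha>:]" by (simp add: Q_def Xv_def)
    hence "to_fract Q = rf_var * rf_var + rf_const \<alpha>"
      by (simp only: to_fract_add to_fract_mult Xv_def rf_var_def rf_const_def)
    thus ?thesis by (simp add: algebra_simps)
  qed
  have "to_fract F = (\<Sum>i\<le>d. rf_const (Polynomial.coeff p i) * (to_fract Q ^ i * rf_var ^ (d - i)))"
    by (simp add: F_def sm smu pow Xv_def rf_var_def)
  also have "\<dots> = (\<Sum>i\<le>d. rf_var ^ d *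
      (rf_const (Polynomial.coeff p i) * (rf_var + rf_const \<alpha> / rf_var) ^ i))"
  proof (rule sum.cong)
    fix i assume "i \<in> {..d}"
    hence "(rf_var :: 'a poly fract) ^ d = rf_var ^ i * rf_var ^ (d - i)"
      by (simp flip: power_add)
    thus "rf_const (Polynomial.coeff p i) * (to_fract Q ^ i * rf_var ^ (d - i)) = rf_var ^ d *
      (rf_const (Polynomial.coeff p i) * (rf_var + rf_const \<alpha> / rf_var) ^ i)"
      by (simp add: Q power_mult_distrib mult_ac)
  qed simp
  also have "\<dots> = rf_var ^ d * poly (map_poly rf_const p) (rf_var + rf_const \<alpha> / rf_var)"
    by (simp add: poly_altdef degp sum_distrib_left Polynomial.coeff_map_poly)
  also have "\<dots> = 0" using assms by simp
  finally have F0: "F = 0" by simp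
  have degQ: "Polynomial.degree (Q ^ i * Xv ^ (d - i)) = d + i" if "i \<le> d" for i
    using that by (simp add: Polynomial.degree_mult_eq degree_power_eq Q_def Xv_def)
  have "Polynomial.coeff F (2 * d) = (\<Sum>i\<le>d. if i = d then Polynomial.coeff p d else 0)"
    unfolding F_def coeff_sum
  proof (rule sum.cong)
    fix i assume i: "i \<in> {..d}"
    show "Polynomial.coeff (Polynomial.smult (Polynomial.coeff p i) (Q ^ i * Xv ^ (d - i))) (2 * d)
        = (if i = d then Polynomial.coeff p d else 0)"
    proof (cases "i = d")
      case True
      have "Polynomial.coeff (Q ^ d) (2 * d) = lead_coeff (Q ^ d)"
        using degQ[of d] by (simp add: mult_2)
      also have "\<dots> = 1" by (simp add: lead_coeff_power Q_def)
      finally show ?thesis using True by simp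
    next
      case False
      with i degQ[of i] have "Polynomial.coeff (Q ^ i * Xv ^ (d - i)) (2 * d) = 0"
        by (intro coeff_eq_0) auto
      with False show ?thesis by simp
    qed
  qed simp
  also have "\<dots> = lead_coeff p" by (simp add: d_def)
  finally show False using F0 \<open>p \<noteq> 0\<close> by simp
qed

lemma dickson_eq_rec: "dickson n \<alpha> = dickson_rec n \<alpha>"
  unfolding dickson_def
proof (rule the_equality)
  fix D
  assume "poly (map_poly rf_const D) (rf_var + rf_const \<alpha> / rf_var)
      = rf_var ^ n + (rf_const \<alpha> / rf_var) ^ n"
  hence "D - dickson_rec n \<alpha> = 0"
    by (intro rf_eval_inj[of _ \<alpha>]) (simp add: rf_eval_hom dickson_rec_functional_eq)
  thus "D = dickson_rec n \<alpha>" by simp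
qed (rule dickson_rec_functional_eq)

lemma dickson_functional_eq:
  "poly (map_poly rf_const (dickson n \<alpha>)) (rf_var + rf_const \<alpha> / rf_var)
     = rf_var ^ n + (rf_const \<alpha> / rf_var) ^ n"
  by (simp add: dickson_eq_rec dickson_rec_functional_eq)

lemma dickson_4: "dickson 4 \<alpha> = [:2 * \<alpha>\<^sup>2, 0, - 4 * \<alpha>, 0, 1:]"
  by (simp add: dickson_eq_rec numeral_eq_Suc algebra_simps)

end

theory Submission
  imports Defs "HOL-Library.Set_Algebras" "HOL-Combinatorics.Perm" "HOL-Algebra.Sylow"
begin

text \<open>
  Let \<open>G\<close> be the Galois group over \<open>k(t)\<close> of the splitting field of \<open>f(X) - t\<close> and \<open>g(X) - t\<close>, and let \<open>A\<close> and
  \<open>B\<close> be the stabilizers of a root of either polynomial. Reducibility of \<open>f(X) - g(Y)\<close> means that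
  \<open>A B \<noteq> G\<close>. Groups between \<open>A\<close> and \<open>G\<close> correspond to decompositions of \<open>f\<close>, and a proper subgroup
  containing conjugates of \<open>A\<close> and \<open>B\<close> yields a common left factor of \<open>f\<close> and \<open>g\<close>. An embedding into Laurent
  series in \<open>t ^ (- 1 / N)\<close> provides a cyclic group \<open>I\<close>, the inertia group at infinity, with \<open>A I = B I = G\<close>.

  Suppose that \<open>G\<close> is solvable and generated by any two conjugates of \<open>A\<close> and \<open>B\<close>. Modulo a normal subgroup \<open>N\<close>
  maximal with \<open>A N B \<noteq> G\<close>, a minimal normal subgroup \<open>V\<close> of \<open>G\<close> is a \<open>p\<close>-group on which a part of the cyclic
  group \<open>I\<close> acts by affine maps with a regular orbit on \<open>V / (A \<inter> V)\<close>; this bounds the index of \<open>A \<inter> V\<close> by \<open>p\<close> or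
  \<open>4\<close>, and a study of Sylow subgroups shows \<open>|I| = 4\<close>. Hence some \<open>A'\<close> containing \<open>A\<close> has index four and
  satisfies \<open>A' B \<noteq> G\<close>, so that \<open>f = h \<circ> w\<close> with \<open>h\<close> of degree four and \<open>h(X) - g(Y)\<close> reducible. Comparing
  coefficients of the two quadratic factors gives the Dickson polynomials.
\<close>

section \<open>Finite groups\<close>

text \<open>Over \<open>k(y)\<close> with \<open>g(y) = t\<close>, the irreducible factors of
  \<open>f(X) - g(y)\<close> are the orbits of \<open>B\<close> on the roots of
  \<open>f(X) - t\<close>, so reducibility is a failure of transitivity. A polynomial map is totally
  ramified at infinity, which is why one cyclic group is transitive on both sets of roots. The
  maximality of \<open>N\<close> makes \<open>A N' B = G\<close> for every larger normal subgroup
  \<open>N'\<close>; modulo \<open>N\<close> the whole defect of \<open>A B\<close> therefore sits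
  in each minimal normal subgroup \<open>V\<close>, which can lie in no product of conjugates of
  \<open>A\<close> and \<open>B\<close>. The constant four is the one exception to the rule that a
  cyclic \<open>p\<close>-group has no regular affine action in dimension above one: a group of
  order four on the plane over the field with two elements. The hardest configuration is the
  opposite one, where \<open>V\<close> has order \<open>p\<close>: nothing is visible inside
  \<open>V\<close>, and a Sylow subgroup has to be determined modulo a core. The field
  \<open>k\<close> may lack roots of unity, so \<open>G\<close> is the arithmetic group;
  \<open>I\<close> still fixes \<open>k\<close>, because the Laurent series have coefficients in an
  algebraic closure of \<open>k\<close> on which \<open>s \<mapsto> \<zeta> s\<close> acts
  trivially.\<close>

class grp = monoid_mult + inverse +
 assumes grp_left_inverse [simp]: "inverse a * a = 1"
begin

lemma grp_left_cancel [simp]: "inverse a * (a * b) = b"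
 by (simp flip: mult.assoc)

lemma grp_right_inverse [simp]: "a * inverse a = 1"
proof -
 have "a * inverse a = inverse (inverse a) * (inverse a * (a * inverse a))"
  by (metis grp_left_cancel)
 then show ?thesis by simp
qed

lemma grp_right_cancel [simp]: "a * (inverse a * b) = b"
 by (simp flip: mult.assoc)

lemma grp_mult_left_cancel [simp]: "a * b = a * c \<longleftrightarrow> b = c"
 by (metis grp_left_cancel)

lemma grp_mult_right_cancel [simp]: "b * a = c * a \<longleftrightarrow> b = c"
 by (metis grp_right_inverse mult.assoc mult_1_right)

lemma grp_inverse_unique: "a * b = 1 ==> inverse a = b"
 by (metis grp_left_cancel mult_1_right)

lemma grp_inverse_inverse [simp]: "inverse (inverse a) = a"
 by (simp add: grp_inverse_unique)

lemma grp_inverse_mult [simp]: "inverse (a * b) = inverse b * inverse a"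
 by (rule grp_inverse_unique) (simp add: mult.assoc)

lemma grp_inverse_one [simp]: "inverse 1 = 1"
 by (simp add: grp_inverse_unique)

lemma grp_inverse_eq_iff [simp]: "inverse a = inverse b \<longleftrightarrow> a = b"
 by (metis grp_inverse_inverse)

lemma grp_inverse_eq_1_iff [simp]: "inverse a = 1 \<longleftrightarrow> a = 1"
 by (metis grp_inverse_inverse grp_inverse_one)

end

text \<open>Finitely supported permutations carry the concrete groups of the development: quotients
  act on cosets (\<open>quotient_exists\<close>) and the Galois group acts on two fibres, so both
  stay inside the class.\<close>

instance Perm.perm :: (type) grp
 by standard simp

section \<open>Subgroups, normal subgroups, products and conjugates as sets\<close>

definition subgrp :: "'a::grp set \<Rightarrow> bool" where
 "subgrp H \<longleftrightarrow> 1 \<in> H \<and> (\<forall>x\<in>H. \<forall>y\<in>H. x * y \<in> H) \<and> (\<forall>x\<in>H. inverse x \<in> H)"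

definition nrm :: "'a::grp set \<Rightarrow> 'a set \<Rightarrow> bool" where
 "nrm N G \<longleftrightarrow> subgrp N \<and> N \<subseteq> G \<and> (\<forall>g\<in>G. \<forall>n\<in>N. g * n * inverse g \<in> N)"

definition cnj :: "'a::grp \<Rightarrow> 'a set \<Rightarrow> 'a set" where
 "cnj g A = (\<lambda>a. g * a * inverse g) ` A"

lemma subgrp_one [simp]: "subgrp H ==> 1 \<in> H"
 and subgrp_mult: "subgrp H ==> x \<in> H ==> y \<in> H ==> x * y \<in> H"
 and subgrp_inverse: "subgrp H ==> x \<in> H ==> inverse x \<in> H"
 by (auto simp: subgrp_def)

lemma subgrp_power: "subgrp H ==> x \<in> H ==> x ^ n \<in> H"
 by (induction n) (auto intro: subgrp_mult)

lemma subgrp_inverse_iff: "subgrp H ==> inverse x \<in> H \<longleftrightarrow> x \<in> H"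
 by (metis grp_inverse_inverse subgrp_inverse)

lemma subgrp_mult_iff1: "subgrp H ==> x \<in> H ==> x * y \<in> H \<longleftrightarrow> y \<in> H"
 by (metis grp_left_cancel subgrp_inverse subgrp_mult)

lemma subgrp_mult_iff2: "subgrp H ==> y \<in> H ==> x * y \<in> H \<longleftrightarrow> x \<in> H"
 using subgrp_mult[of H "x * y" "inverse y"] by (auto simp: mult.assoc subgrp_mult subgrp_inverse)

lemma subgrp_Int: "subgrp H ==> subgrp K ==> subgrp (H \<inter> K)"
 by (auto simp: subgrp_def)

lemma subgrp_singleton_1 [simp]: "subgrp {1}"
 by (simp add: subgrp_def)

lemma nrmD:
 assumes "nrm N G"
 shows "subgrp N" "N \<subseteq> G" "\<And>g n. g \<in> G ==> n \<in> N ==> g * n * inverse g \<in> N"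
 using assms by (auto simp: nrm_def)

lemma nrm_conj':
 assumes "nrm N G" "subgrp G" "g \<in> G" "n \<in> N"
 shows "inverse g * n * g \<in> N"
 using nrmD(3)[OF assms(1) subgrp_inverse[OF assms(2,3)] assms(4)] by simp

lemma in_set_timesE:
 assumes "x \<in> A * (B :: 'a::grp set)"
 obtains a b where "a \<in> A" "b \<in> B" "x = a * b"
 using assms by (auto simp: set_times_def)

lemma subset_set_times1: "subgrp B ==> A \<subseteq> A * B"
proof
 fix a assume "subgrp B" "a \<in> A"
 then show "a \<in> A * B" using set_times_intro[of a A 1 B] by simp
qed

lemma subset_set_times2: "subgrp A ==> B \<subseteq> A * B"
proof
 fix b assume "subgrp A" "b \<in> B"
 then show "b \<in> A * B" using set_times_intro[of 1 A b B] by simp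
qed

lemma set_times_subset: "subgrp H ==> A \<subseteq> H ==> B \<subseteq> H ==> A * B \<subseteq> H"
 by (auto simp: set_times_def intro: subgrp_mult)

lemma subgrp_times_self: "subgrp H ==> H * H = H"
 by (simp add: set_times_subset subset_antisym subset_set_times1)

lemma subgrp_times_nrm:
 assumes "nrm N G" "subgrp G" "subgrp A" "A \<subseteq> G"
 shows "subgrp (A * N)"
 unfolding subgrp_def
proof (intro conjI ballI)
 note N = nrmD[OF assms(1)]
 show "1 \<in> A * N" using set_times_intro[of 1 A 1 N] assms(3) N(1) by simp
 fix x assume "x \<in> A * N"
 then obtain a n where x: "a \<in> A" "n \<in> N" "x = a * n" by (rule in_set_timesE)
 have "inverse x = inverse a * (a * inverse n * inverse a)" by (simp add: x mult.assoc)
 moreover have "a * inverse n * inverse a \<in> N" using N x assms(4) by (blast intro: subgrp_inverse)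
 ultimately show "inverse x \<in> A * N" using x assms(3) by (auto intro: set_times_intro subgrp_inverse)
 fix y assume "y \<in> A * N"
 then obtain b m where y: "b \<in> A" "m \<in> N" "y = b * m" by (rule in_set_timesE)
 have "x * y = (a * b) * ((inverse b * n * b) * m)" by (simp add: x y mult.assoc)
 moreover have "inverse b * n * b \<in> N" using nrm_conj'[OF assms(1,2)] y x assms(4) by blast
 ultimately show "x * y \<in> A * N" using x y assms(3) N(1) by (auto intro!: set_times_intro subgrp_mult)
qed

lemma nrm_times_commute:
 assumes "nrm N G" "subgrp G" "A \<subseteq> G"
 shows "A * N = N * A"
proof (intro equalityI subsetI)
 fix x assume "x \<in> A * N"
 then obtain a n where x: "a \<in> A" "n \<in> N" "x = a * n" by (rule in_set_timesE)
 have "x = (a * n * inverse a) * a" by (simp add: x mult.assoc)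
 then show "x \<in> N * A" using x assms nrmD(3)[OF assms(1)] by (metis set_times_intro subsetD)
next
 fix x assume "x \<in> N * A"
 then obtain a n where x: "n \<in> N" "a \<in> A" "x = n * a" by (rule in_set_timesE)
 have "x = a * (inverse a * n * a)" by (simp add: x mult.assoc)
 then show "x \<in> A * N" using x assms nrm_conj'[OF assms(1,2)] by (metis set_times_intro subsetD)
qed

lemma nrm_times_nrm:
 assumes "nrm N G" "nrm M G" "subgrp G"
 shows "nrm (N * M) G"
 unfolding nrm_def
proof (intro conjI ballI)
 show "subgrp (N * M)" using subgrp_times_nrm[OF assms(2,3)] assms(1) by (simp add: nrm_def)
 show "N * M \<subseteq> G" using set_times_subset[OF assms(3)] assms by (simp add: nrm_def)
 fix g x assume g: "g \<in> G" and "x \<in> N * M"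
 then obtain n m where x: "n \<in> N" "m \<in> M" "x = n * m" by (auto elim: in_set_timesE)
 have "g * x * inverse g = (g * n * inverse g) * (g * m * inverse g)" by (simp add: x mult.assoc)
 then show "g * x * inverse g \<in> N * M"
  using nrmD(3)[OF assms(1) g x(1)] nrmD(3)[OF assms(2) g x(2)] by (simp add: set_times_intro)
qed

lemma nrm_Int: "nrm N G ==> nrm M G ==> nrm (N \<inter> M) G"
 by (auto simp: nrm_def subgrp_Int)

lemma nrm_refl: "subgrp G ==> nrm G G"
 by (auto simp: nrm_def subgrp_mult subgrp_inverse)

lemma nrm_subset: "nrm N G ==> N \<subseteq> H ==> H \<subseteq> G ==> nrm N H"
 by (auto simp: nrm_def)

lemma mem_cnj: "x \<in> cnj g A \<longleftrightarrow> inverse g * x * g \<in> A"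
proof
 assume "inverse g * x * g \<in> A"
 moreover have "x = g * (inverse g * x * g) * inverse g" by (simp add: mult.assoc)
 ultimately show "x \<in> cnj g A" unfolding cnj_def by blast
qed (auto simp: cnj_def mult.assoc)

lemma subgrp_cnj: "subgrp A ==> subgrp (cnj g A)"
 unfolding subgrp_def mem_cnj
proof (intro conjI ballI)
 fix x y assume A: "1 \<in> A \<and> (\<forall>x\<in>A. \<forall>y\<in>A. x * y \<in> A) \<and> (\<forall>x\<in>A. inverse x \<in> A)"
 assume x: "x \<in> cnj g A" then show "inverse g * inverse x * g \<in> A"
  using A unfolding mem_cnj by (metis grp_inverse_inverse grp_inverse_mult mult.assoc)
 assume "y \<in> cnj g A"
 then have "(inverse g * x * g) * (inverse g * y * g) \<in> A" using x A unfolding mem_cnj by blast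
 then show "inverse g * (x * y) * g \<in> A" by (simp add: mult.assoc)
qed simp

lemma cnj_subset: "subgrp G ==> g \<in> G ==> A \<subseteq> G ==> cnj g A \<subseteq> G"
 by (auto simp: cnj_def intro!: subgrp_mult subgrp_inverse)

lemma card_cnj [simp]: "card (cnj g A) = card A"
 unfolding cnj_def by (rule card_image) (auto simp: inj_on_def)

lemma cnj_cnj [simp]: "cnj g (cnj h A) = cnj (g * h) A"
 by (auto simp: mem_cnj mult.assoc)

lemma cnj_1 [simp]: "cnj 1 A = A"
 by (auto simp: mem_cnj)

lemma cnj_self: "subgrp A ==> a \<in> A ==> cnj a A = A"
 by (auto simp: mem_cnj subgrp_mult_iff1 subgrp_mult_iff2 subgrp_inverse)

lemma cnj_nrm:
 assumes "nrm N G" "subgrp G" "g \<in> G"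
 shows "cnj g N = N"
proof (intro equalityI subsetI)
 fix x assume "x \<in> cnj g N" then show "x \<in> N" using nrmD(3)[OF assms(1,3)] by (auto simp: cnj_def)
next
 fix x assume "x \<in> N" then show "x \<in> cnj g N" using nrm_conj'[OF assms] by (simp add: mem_cnj)
qed

lemma cnj_Int: "cnj g (A \<inter> B) = cnj g A \<inter> cnj g B"
 by (auto simp: mem_cnj)

lemma cnj_mono: "A \<subseteq> B ==> cnj g A \<subseteq> cnj g B"
 by (auto simp: cnj_def)

subsection \<open>Counting\<close>

lemma card_fibres:
 assumes "finite Y" "\<And>y. y \<in> f ` Y ==> card {x \<in> Y. f x = y} = k"
 shows "card Y = k * card (f ` Y)"
proof -
 have "card Y = (\<Sum>x\<in>Y. 1)" by simp
 also have "\<dots> = (\<Sum>y\<in>f ` Y. \<Sum>x\<in>{x \<in> Y. f x = y}. 1)"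
  by (rule sum.image_gen[OF assms(1)])
 also have "\<dots> = (\<Sum>y\<in>f ` Y. k)" using assms(2) by simp
 finally show ?thesis by simp
qed

text \<open>All fibres of the multiplication map on pairs have the size of
  \<open>A \<inter> B\<close>: the fibre over \<open>a * b\<close> consists of the pairs
  \<open>(a * c, inverse c * b)\<close> with \<open>c\<close> in the intersection.\<close>

lemma card_set_times:
 assumes "subgrp A" "subgrp B" "finite A" "finite B"
 shows "card (A * B) * card (A \<inter> B) = card A * card B"
proof -
 let ?f = "\<lambda>(a, b). a * b"
 have "card {x \<in> A \<times> B. ?f x = y} = card (A \<inter> B)" if "y \<in> ?f ` (A \<times> B)" for y
 proof -
  from that obtain a b where ab: "a \<in> A" "b \<in> B" "y = a * b" by auto
  have "bij_betw (\<lambda>c. (a * c, inverse c * b)) (A \<inter> B) {x \<in> A \<times> B. ?f x = y}"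
  proof (rule bij_betwI')
   fix x assume "x \<in> {x \<in> A \<times> B. ?f x = y}"
   then obtain a' b' where x: "x = (a', b')" "a' \<in> A" "b' \<in> B" "a' * b' = a * b" using ab by auto
   have e: "inverse a * a' = b * inverse b'" using x(4)
    by (metis grp_left_cancel grp_right_inverse mult.assoc mult_1_right)
   have "inverse a * a' \<in> A \<inter> B"
    using assms ab x e by (metis IntI subgrp_inverse subgrp_mult)
   moreover have "x = (a * (inverse a * a'), inverse (inverse a * a') * b)"
    using x(1) by (simp add: e) (simp add: mult.assoc flip: e)
   ultimately show "\<exists>c\<in>A \<inter> B. x = (a * c, inverse c * b)" by blast
  qed (use assms ab in \<open>auto simp: subgrp_mult subgrp_inverse mult.assoc\<close>)
  then show ?thesis by (simp add: bij_betw_same_card)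
 qed
 from card_fibres[of "A \<times> B" ?f, OF _ this] have "card (A \<times> B) = card (A \<inter> B) * card (?f ` (A \<times> B))"
  using assms by simp
 moreover have "?f ` (A \<times> B) = A * B" by (auto simp: set_times_def)
 ultimately show ?thesis by (simp add: card_cartesian_product mult.commute)
qed

lemma finite_set_times': "finite A ==> finite B ==> finite (A * (B :: 'a::grp set))"
 by (simp add: finite_set_times)

section \<open>Group actions, cosets and cyclic groups\<close>

definition grp_action :: "'a::grp set \<Rightarrow> ('a \<Rightarrow> 'b \<Rightarrow> 'b) \<Rightarrow> bool" where
 "grp_action G act \<longleftrightarrow> (\<forall>x. act 1 x = x) \<and> (\<forall>g\<in>G. \<forall>h\<in>G. \<forall>x. act (g * h) x = act g (act h x))"

lemma orbit_stabilizer: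
 assumes "subgrp G" "finite G" "grp_action G act"
 shows "card G = card {g \<in> G. act g x = x} * card ((\<lambda>g. act g x) ` G)"
proof (rule card_fibres[OF assms(2)])
 fix y assume "y \<in> (\<lambda>g. act g x) ` G"
 then obtain h where h: "h \<in> G" "y = act h x" by auto
 have act: "act 1 z = z" "g \<in> G ==> g' \<in> G ==> act (g * g') z = act g (act g' z)" for g g' z
  using assms(3) by (auto simp: grp_action_def)
 have ih: "inverse h \<in> G" using h assms(1) by (simp add: subgrp_inverse)
 have "bij_betw (\<lambda>g. h * g) {g \<in> G. act g x = x} {g \<in> G. act g x = y}"
 proof (rule bij_betwI')
  fix g assume g: "g \<in> {g \<in> G. act g x = y}"
  have "act (inverse h * g) x = act (inverse h) (act h x)" using g h act(2)[OF ih, of g x] by simp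
  also have "\<dots> = x" using act(2)[OF ih h(1), of x] act(1) by simp
  finally have "inverse h * g \<in> {g \<in> G. act g x = x}" using g ih assms(1) by (simp add: subgrp_mult)
  moreover have "g = h * (inverse h * g)" by simp
  ultimately show "\<exists>g'\<in>{g \<in> G. act g x = x}. g = h * g'" by blast
 next
  fix g assume "g \<in> {g \<in> G. act g x = x}"
  then show "h * g \<in> {g \<in> G. act g x = y}" using h act(2)[OF h(1), of g x] assms(1) by (simp add: subgrp_mult)
 qed simp
 then show "card {g \<in> G. act g x = y} = card {g \<in> G. act g x = x}"
  by (simp add: bij_betw_same_card)
qed

lemma action_translation: "grp_action G (\<lambda>g Y. (\<lambda>x. g * x) ` Y)"
 unfolding grp_action_def by (simp add: image_image mult.assoc)

lemma image_mult_eq_iff: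
 assumes "subgrp H"
 shows "(\<lambda>x. g * x) ` H = (\<lambda>x. h * x) ` H \<longleftrightarrow> inverse h * g \<in> H"
proof
 assume "(\<lambda>x. g * x) ` H = (\<lambda>x. h * x) ` H"
 then have "g * 1 \<in> (\<lambda>x. h * x) ` H" using assms by (metis imageI subgrp_one)
 then show "inverse h * g \<in> H" by auto
next
 assume a: "inverse h * g \<in> H"
 show "(\<lambda>x. g * x) ` H = (\<lambda>x. h * x) ` H"
 proof (intro equalityI image_subsetI)
  fix x assume x: "x \<in> H"
  show "g * x \<in> (\<lambda>x. h * x) ` H"
   by (rule image_eqI[OF _ subgrp_mult[OF assms a x]]) (simp add: mult.assoc)
  show "h * x \<in> (\<lambda>x. g * x) ` H"
   by (rule image_eqI[OF _ subgrp_mult[OF assms subgrp_inverse[OF assms a] x]]) (simp add: mult.assoc)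
 qed
qed

lemma card_cosets:
 assumes "subgrp G" "finite G" "subgrp H" "H \<subseteq> G"
 shows "card G = card H * card ((\<lambda>g. (\<lambda>x. g * x) ` H) ` G)"
proof -
 have "{g \<in> G. (\<lambda>x. g * x) ` H = H} = H"
  using image_mult_eq_iff[OF assms(3), of _ 1] assms(4) by auto
 then show ?thesis using orbit_stabilizer[OF assms(1,2) action_translation, of H] by simp
qed

lemma card_subgrp_dvd:
 assumes "subgrp G" "finite G" "subgrp H" "H \<subseteq> G"
 shows "card H dvd card G"
 using card_cosets[OF assms] by simp

lemma card_subgrp_pos: "subgrp G ==> finite G ==> card G > 0"
 using card_gt_0_iff subgrp_one by blast

text \<open>Only powers with natural exponents are taken. The set becomes a subgroup once it is
  finite (\<open>subgrp_cyc\<close>), which always holds inside the finite groups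
  considered.\<close>

definition cyc :: "'a::grp \<Rightarrow> 'a set" where
 "cyc u = range (\<lambda>i::nat. u ^ i)"

lemma power_in_cyc [simp]: "u ^ n \<in> cyc u"
 by (simp add: cyc_def)

lemma self_in_cyc [simp]: "u \<in> cyc u"
 using power_in_cyc[of u 1] by simp

lemma grp_power_diff: "(u::'a::grp) ^ i = u ^ j ==> i \<le> j ==> u ^ (j - i) = 1"
 using power_add[of u i "j - i"] by (metis grp_mult_left_cancel le_add_diff_inverse mult_1_right)

lemma finite_order:
 assumes "finite (cyc (u::'a::grp))"
 shows "card (cyc u) > 0" "u ^ card (cyc u) = 1"
  and "\<And>e. 0 < e ==> u ^ e = 1 ==> card (cyc u) \<le> e" "cyc u = (\<lambda>i. u ^ i) ` {..<card (cyc u)}"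
proof -
 have "\<not> inj (\<lambda>i::nat. u ^ i)" using assms range_inj_infinite unfolding cyc_def by blast
 then obtain i j where ij: "i < j" "u ^ i = u ^ j" unfolding inj_def by (metis linorder_neqE_nat)
 define d where "d = (LEAST d. d > 0 \<and> u ^ d = 1)"
 have d: "d > 0 \<and> u ^ d = 1" unfolding d_def
  by (rule LeastI[of _ "j - i"]) (use ij grp_power_diff[of u i j] in auto)
 have dmin: "d \<le> e" if "e > 0" "u ^ e = 1" for e using that unfolding d_def by (simp add: Least_le)
 have "u ^ i = u ^ (i mod d)" for i
  by (metis d mod_mult_div_eq mult_1_right power_add power_mult power_one)
 then have im: "cyc u = (\<lambda>i. u ^ i) ` {..<d}" unfolding cyc_def using d
  by (auto intro!: image_eqI[of _ _ "_ mod d"])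
 have "inj_on (\<lambda>i. u ^ i) {..<d}"
 proof (rule linorder_inj_onI)
  fix x y assume xy: "x < y" "x \<in> {..<d}" "y \<in> {..<d}"
  show "u ^ x \<noteq> u ^ y"
   using grp_power_diff[of u x y] dmin[of "y - x"] xy by auto
 qed auto
 then have "card (cyc u) = d" using im by (simp add: card_image)
 then show "card (cyc u) > 0" "u ^ card (cyc u) = 1" "\<And>e. 0 < e ==> u ^ e = 1 ==> card (cyc u) \<le> e"
  "cyc u = (\<lambda>i. u ^ i) ` {..<card (cyc u)}" using d dmin im by auto
qed

lemma power_eq_1_iff:
 assumes "finite (cyc (u::'a::grp))"
 shows "u ^ n = 1 \<longleftrightarrow> card (cyc u) dvd n"
proof -
 let ?d = "card (cyc u)"
 note fo = finite_order[OF assms]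
 have "u ^ n = u ^ (n mod ?d)"
  using fo(2) by (metis mod_mult_div_eq mult_1_right power_add power_mult power_one)
 moreover have "n mod ?d < ?d" using fo(1) by simp
 ultimately have "u ^ n = 1 \<longleftrightarrow> n mod ?d = 0" using fo(3)[of "n mod ?d"] by fastforce
 then show ?thesis by (simp add: mod_eq_0_iff_dvd)
qed

lemma subgrp_cyc:
 assumes "finite (cyc (u::'a::grp))"
 shows "subgrp (cyc u)"
 unfolding subgrp_def
proof (intro conjI ballI)
 show "1 \<in> cyc u" using power_in_cyc[of u 0] by simp
 fix x assume "x \<in> cyc u"
 then obtain n where n: "x = u ^ n" by (auto simp: cyc_def)
 show "x * y \<in> cyc u" if "y \<in> cyc u" for y
  using that n power_in_cyc[of u] by (auto simp: cyc_def simp flip: power_add)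
 have "x * u ^ (card (cyc u) * n - n) = 1"
  using finite_order(1,2)[OF assms] unfolding n by (simp add: power_mult flip: power_add)
 then show "inverse x \<in> cyc u" using grp_inverse_unique power_in_cyc by metis
qed

lemma cyc_subset: "subgrp H ==> u \<in> H ==> cyc u \<subseteq> H"
 by (auto simp: cyc_def subgrp_power)

lemma cyc_commute: "x \<in> cyc u ==> y \<in> cyc u ==> x * y = y * x"
 by (auto simp: cyc_def add.commute simp flip: power_add)

lemma grp_power_card:
 assumes "subgrp G" "finite G" "u \<in> G"
 shows "u ^ card G = 1"
proof -
 have f: "finite (cyc u)" using cyc_subset[OF assms(1,3)] assms(2) finite_subset by blast
 show ?thesis using power_eq_1_iff[OF f] card_subgrp_dvd[OF assms(1,2) subgrp_cyc[OF f]]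
   cyc_subset[OF assms(1,3)] by blast
qed

text \<open>If \<open>u\<close> has order \<open>n\<close>, then \<open>(u ^ i) ^ d = 1\<close>
  forces \<open>n div gcd n d\<close> to divide \<open>i\<close>, which leaves
  \<open>gcd n d\<close> exponents below \<open>n\<close>. Cyclicity of the inertia group enters
  \<open>card_bound_subset\<close> and \<open>cyc_subgrp_unique\<close> through this bound.\<close>

lemma card_cyc_roots:
 assumes "finite (cyc (u::'a::grp))" "d > 0" "H \<subseteq> cyc u" "\<And>x. x \<in> H ==> x ^ d = 1"
 shows "card H \<le> d"
proof -
 let ?n = "card (cyc u)"
 note fo = finite_order[OF assms(1)]
 define e where "e = ?n div gcd ?n d"
 have n: "?n = e * gcd ?n d" by (simp add: e_def)
 have "e > 0" using n fo(1) by (metis gr0I mult_0)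
 have "H \<subseteq> (\<lambda>j. u ^ (e * j)) ` {..<d}"
 proof
  fix x assume x: "x \<in> H"
  then obtain i where i: "i < ?n" "x = u ^ i" using assms(3) fo(4) by auto
  have "u ^ (i * d) = 1" using assms(4)[OF x] i by (simp add: power_mult)
  then have "?n dvd i * d" using power_eq_1_iff[OF assms(1)] by blast
  then have "e dvd i * (d div gcd ?n d)"
   by (metis (no_types, lifting) assms(2) div_mult_swap dvd_div_iff_mult dvd_mult e_def gcd_dvd1 gcd_dvd2 gcd_eq_0_iff gr_implies_not0 dvd_div_mult_self)
  moreover have "coprime e (d div gcd ?n d)" unfolding e_def
   by (rule div_gcd_coprime) (use assms(2) in simp)
  ultimately have "e dvd i" by (simp add: coprime_dvd_mult_left_iff)
  then obtain j where j: "i = e * j" by blast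
  have "e * j < e * gcd ?n d" using i j n by simp
  then have "j < gcd ?n d" by simp
  also have "\<dots> \<le> d" using assms(2) gcd_le2_nat by blast
  finally show "x \<in> (\<lambda>j. u ^ (e * j)) ` {..<d}" using i j by auto
 qed
 then have "card H \<le> card ((\<lambda>j. u ^ (e * j)) ` {..<d})" by (rule card_mono[rotated]) simp
 also have "\<dots> \<le> d" using card_image_le[of "{..<d}"] by fastforce
 finally show ?thesis .
qed

lemma prime_power_proper_dvd:
 assumes "prime (p::nat)" "d dvd p ^ k" "d \<noteq> 1"
 shows "p dvd d"
 using assms by (metis divides_primepow_nat dvd_power gr0I power_0)

text \<open>An orbit with more than one point has a size that divides \<open>p ^ k\<close> and
  differs from 1, hence is divisible by \<open>p\<close>. Such orbits partition the complement of
  the fixed points.\<close>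

lemma pgroup_fixed_points:
 fixes G :: "'a::grp set" and act :: "'a \<Rightarrow> 'b \<Rightarrow> 'b"
 assumes "subgrp G" "finite G" "prime p" "card G = p ^ k" "grp_action G act"
  and "finite Y" "\<And>g x. g \<in> G ==> x \<in> Y ==> act g x \<in> Y"
 shows "p dvd card Y \<longleftrightarrow> p dvd card {x \<in> Y. \<forall>g\<in>G. act g x = x}"
proof -
 let ?F = "{x \<in> Y. \<forall>g\<in>G. act g x = x}"
 let ?orb = "\<lambda>x. (\<lambda>g. act g x) ` G"
 have act: "act 1 z = z" "g \<in> G ==> g' \<in> G ==> act (g * g') z = act g (act g' z)" for g g' z
  using assms(5) by (auto simp: grp_action_def)
 have mem: "x \<in> ?orb x" for x using act(1)[of x] assms(1) by (force intro: image_eqI[of _ _ 1])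
 have orb_eq: "?orb y = ?orb x" if yx: "y \<in> ?orb x" for x y
 proof -
  obtain h where h: "h \<in> G" "y = act h x" using yx by auto
  have ih: "inverse h \<in> G" using h assms(1) by (simp add: subgrp_inverse)
  show ?thesis
  proof (intro equalityI image_subsetI)
   fix g assume g: "g \<in> G"
   show "act g y \<in> ?orb x" using act(2)[OF g h(1), of x] g h assms(1)
    by (intro image_eqI[of _ _ "g * h"]) (auto simp: subgrp_mult)
   have "act g x = act (g * inverse h) y"
    using act(2)[OF g ih, of y] act(2)[OF ih h(1), of x] h(2) act(1) by simp
   then show "act g x \<in> ?orb y" using g ih assms(1) by (simp add: subgrp_mult)
  qed
 qed
 have "p dvd card (\<Union>(?orb ` (Y - ?F)))"
 proof (rule dvd_partition)
  have "?orb x \<subseteq> Y" if "x \<in> Y" for x using assms(7) that by auto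
  then show "finite (\<Union>(?orb ` (Y - ?F)))" using assms(6) by (meson Diff_iff UN_least finite_subset)
  show "\<forall>c\<in>?orb ` (Y - ?F). p dvd card c"
  proof
   fix c assume "c \<in> ?orb ` (Y - ?F)"
   then obtain x g where x: "x \<in> Y" "g \<in> G" "act g x \<noteq> x" "c = ?orb x" by auto
   have "card c dvd p ^ k"
    using orbit_stabilizer[OF assms(1,2,5), of x] x(4) assms(4) by simp
   moreover have "card c \<noteq> 1"
   proof
    assume "card c = 1"
    then obtain y where "c = {y}" by (rule card_1_singletonE)
    moreover have "act g x \<in> c" "x \<in> c" using x mem[of x] by auto
    ultimately show False using x(3) by auto
   qed
   ultimately show "p dvd card c" using assms(3) prime_power_proper_dvd by blast
  qed
  show "\<forall>c1\<in>?orb ` (Y - ?F). \<forall>c2\<in>?orb ` (Y - ?F). c1 \<noteq> c2 \<longrightarrow> c1 \<inter> c2 = {}"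
  proof (intro ballI impI)
   fix c1 c2 assume c: "c1 \<in> ?orb ` (Y - ?F)" "c2 \<in> ?orb ` (Y - ?F)" "c1 \<noteq> c2"
   then obtain x1 x2 where x: "c1 = ?orb x1" "c2 = ?orb x2" by blast
   then show "c1 \<inter> c2 = {}" using orb_eq[of _ x1] orb_eq[of _ x2] c(3) by blast
  qed
 qed
 moreover have "\<Union>(?orb ` (Y - ?F)) = Y - ?F"
 proof (intro equalityI subsetI)
  fix y assume "y \<in> \<Union>(?orb ` (Y - ?F))"
  then obtain x where x: "x \<in> Y - ?F" "y \<in> ?orb x" by auto
  then have "y \<in> Y" using assms(7) by auto
  moreover have False if "y \<in> ?F"
  proof -
   have "?orb x = {y}" using that orb_eq[OF x(2)] mem[of y] by auto
   then have "x = y" using mem[of x] by auto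
   then show False using x that by simp
  qed
  ultimately show "y \<in> Y - ?F" by auto
 qed (use mem in blast)
 ultimately have "p dvd card (Y - ?F)" by simp
 moreover have "card Y = card (Y - ?F) + card ?F"
  using assms(6) by (metis (no_types, lifting) card_Diff_subset card_mono finite_subset le_add_diff_inverse2 mem_Collect_eq subsetI)
 ultimately show ?thesis by (simp add: dvd_add_right_iff)
qed

text \<open>In the language of quotients: a nontrivial normal subgroup \<open>N / V\<close> of the
  \<open>p\<close>-group \<open>S / V\<close> contains a central element of order \<open>p\<close>.
  \<open>S\<close> acts by conjugation on the cosets of \<open>V\<close> in \<open>N\<close>; their
  number is divisible by \<open>p\<close> and \<open>V\<close> itself is fixed, so a second coset is
  fixed too.\<close>

lemma pgroup_central_mod:
 fixes S :: "'a::grp set"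
 assumes S: "subgrp S" "finite S" "prime p" "card S = p ^ k"
  and V: "nrm V S" and N: "nrm N S" "V \<subseteq> N" "V \<noteq> N"
 shows "\<exists>u\<in>N - V. u ^ p \<in> V \<and> (\<forall>s\<in>S. s * u * inverse s * inverse u \<in> V)"
proof -
 let ?act = "\<lambda>g Y. (\<lambda>x. g * x * inverse g) ` Y"
 let ?Y = "(\<lambda>u. (\<lambda>x. u * x) ` V) ` N"
 let ?F = "{x \<in> ?Y. \<forall>g\<in>S. ?act g x = x}"
 have sV: "subgrp V" and sN: "subgrp N" "N \<subseteq> S" using nrmD[OF V] nrmD[OF N(1)] by simp_all
 have finN: "finite N" using sN S finite_subset by blast
 have act: "?act g ((\<lambda>x. u * x) ` V) = (\<lambda>x. (g * u * inverse g) * x) ` V" if "g \<in> S" for g u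
 proof -
  have "?act g ((\<lambda>x. u * x) ` V) = (\<lambda>x. (g * u * inverse g) * x) ` cnj g V"
   by (simp add: cnj_def image_image mult.assoc)
  then show ?thesis using cnj_nrm[OF V S(1) that] by simp
 qed
 have "p dvd card ?Y"
 proof -
  have "card N = card V * card ?Y" using card_cosets[OF sN(1) finN sV] N by simp
  moreover have "card N dvd p ^ k" using card_subgrp_dvd[OF S(1,2) sN(1,2)] S by simp
  moreover have "card ?Y \<noteq> 1" using calculation N finN card_subset_eq[of N V] by auto
  ultimately show ?thesis using prime_power_proper_dvd[OF S(3)]
   by (metis dvd_mult_right)
 qed
 moreover have "p dvd card ?Y \<longleftrightarrow> p dvd card ?F"
 proof (rule pgroup_fixed_points[OF S])
  show "grp_action S ?act" unfolding grp_action_def by (simp add: image_image mult.assoc)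
  show "finite ?Y" using finN by simp
  fix g x assume gx: "g \<in> S" "x \<in> ?Y"
  then obtain u where u: "u \<in> N" "x = (\<lambda>x. u * x) ` V" by auto
  then show "?act g x \<in> ?Y" using act[OF gx(1)] nrmD(3)[OF N(1) gx(1) u(1)] by auto
 qed
 ultimately have "p dvd card ?F" by simp
 moreover have VF: "V \<in> ?F"
 proof -
  have "V = (\<lambda>x. 1 * x) ` V" by simp
  then have "V \<in> ?Y" using sN by (metis imageI subgrp_one)
  moreover have "?act g V = V" if "g \<in> S" for g using act[OF that, of 1] by simp
  ultimately show ?thesis by simp
 qed
 ultimately have "?F \<noteq> {V}" using S(3) by auto
 then obtain c where c: "c \<in> ?F" "c \<noteq> V" using VF by auto
 then obtain u where u: "u \<in> N" "c = (\<lambda>x. u * x) ` V" by auto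
 have uV: "u \<notin> V" using c u image_mult_eq_iff[OF sV, of u 1] by auto
 have comm: "s * u * inverse s * inverse u \<in> V" if s: "s \<in> S" for s
 proof -
  have "(\<lambda>x. (s * u * inverse s) * x) ` V = (\<lambda>x. u * x) ` V" using c u act[OF s, of u] s by simp
  then have "inverse u * (s * u * inverse s) \<in> V" using image_mult_eq_iff[OF sV] by blast
  then have "u * (inverse u * (s * u * inverse s)) * inverse u \<in> V" using nrmD(3)[OF V] u sN by blast
  then show ?thesis by (simp add: mult.assoc)
 qed
 have comm': "s * u ^ n * inverse s * inverse (u ^ n) \<in> V" if s: "s \<in> S" for s n
 proof (induction n)
  case (Suc n)
  have "s * u ^ Suc n * inverse s * inverse (u ^ Suc n) =
   (s * u * inverse s * inverse u) * (u * (s * u ^ n * inverse s * inverse (u ^ n)) * inverse u)"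
   by (simp add: mult.assoc)
  moreover have "u * (s * u ^ n * inverse s * inverse (u ^ n)) * inverse u \<in> V"
   using nrmD(3)[OF V] u sN Suc by blast
  ultimately show ?case using subgrp_mult[OF sV comm[OF s]] by simp
 qed (use sV in simp)
 \<comment> \<open>The representative \<open>u\<close> need not have order \<open>p\<close> modulo
   \<open>V\<close>. The last of the powers \<open>u\<close>, \<open>u ^ p\<close>,
   \<open>u ^ (p ^ 2)\<close>, ... outside \<open>V\<close> does, and it remains central modulo
   \<open>V\<close>.\<close>
 have "u ^ (p ^ k) \<in> V" using grp_power_card[OF S(1,2), of u] u sN sV S(4) by auto
 then obtain n where n: "u ^ (p ^ n) \<in> V" "\<And>m. m < n ==> u ^ (p ^ m) \<notin> V"
  using exists_least_iff[of "\<lambda>n. u ^ (p ^ n) \<in> V"] by blast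
 have "n \<noteq> 0" using n(1) uV by (cases n) auto
 then obtain m where m: "n = Suc m" by (cases n) auto
 let ?u = "u ^ (p ^ m)"
 have "?u \<in> N - V" using n(2)[of m] m u sN subgrp_power by auto
 moreover have "?u ^ p \<in> V" using n(1) m by (simp flip: power_mult add: mult.commute)
 ultimately show ?thesis using comm' by blast
qed

section \<open>Factorizations of \<open>p\<close>-groups with a cyclic factor\<close>

lemma grp_mult_eq_self [simp]: "(a::'a::grp) * b = a \<longleftrightarrow> b = 1" "b * a = a \<longleftrightarrow> b = 1"
 "a = a * b \<longleftrightarrow> b = 1" "a = b * a \<longleftrightarrow> b = 1"
 using grp_mult_left_cancel[of a b 1] grp_mult_right_cancel[of b a 1] by (auto simp del: grp_mult_left_cancel grp_mult_right_cancel)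

lemma left_commute_of: "(a::'a::grp) * b = b * a ==> a * (b * c) = b * (a * c)"
 by (simp flip: mult.assoc)

lemma commute_mult: "(a::'a::grp) * b = b * a ==> a * c = c * a ==> a * (b * c) = (b * c) * a"
 by (metis mult.assoc)

lemma commute_power: "(a::'a::grp) * b = b * a ==> a * b ^ n = b ^ n * a"
 using power_commuting_commutes[of b a n] by simp

lemma commute_inverse: "(a::'a::grp) * b = b * a ==> a * inverse b = inverse b * a"
proof -
 assume "a * b = b * a"
 then have "inverse b * (a * b) * inverse b = inverse b * (b * a) * inverse b" by simp
 then show ?thesis by (simp add: mult.assoc)
qed

lemma commute_cyc: "(a::'a::grp) * b = b * a ==> x \<in> cyc b ==> a * x = x * a"
 by (auto simp: cyc_def commute_power)

lemma power_commuting_mult: "(a::'a::grp) * b = b * a ==> (a * b) ^ n = a ^ n * b ^ n"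
proof (induction n)
 case (Suc n)
 have "(a * b) ^ n = a ^ n * b ^ n" using Suc by blast
 then have "(a * b) ^ Suc n = a * (b * a ^ n) * b ^ n" by (simp add: mult.assoc)
 also have "b * a ^ n = a ^ n * b" using commute_power[OF Suc.prems[symmetric]] .
 finally show ?case by (simp add: mult.assoc)
qed simp

text \<open>Each time a \<open>y\<close> is moved past an \<open>x\<close> one central
  \<open>c\<close> appears, and there are \<open>n choose 2\<close> crossings. For odd
  \<open>p\<close> the number \<open>p choose 2\<close> is a multiple of \<open>p\<close>, for
  \<open>p = 2\<close> it is 1; this is what separates the odd primes from 2 in the arguments that
  use it.\<close>

lemma power_central_commutator:
 fixes x y c :: "'a::grp"
 assumes yx: "y * x = x * y * c" and c: "c * x = x * c" "c * y = y * c"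
 shows "(x * y) ^ n = x ^ n * y ^ n * c ^ (n choose 2)"
proof (induction n)
 case (Suc n)
 have cx: "c ^ m * x = x * c ^ m" and cy: "c ^ m * y = y * c ^ m" for m
  using commute_power[OF c(1)[symmetric], of m] commute_power[OF c(2)[symmetric], of m] by simp_all
 have cy': "c ^ m * (y * z) = y * (c ^ m * z)" for m z
  using left_commute_of[OF cy] .
 have ynx: "y ^ m * x = x * y ^ m * c ^ m" for m
 proof (induction m)
  case (Suc m)
  have "y ^ Suc m * x = y * (y ^ m * x)" by (simp add: mult.assoc)
  also have "\<dots> = (y * x) * y ^ m * c ^ m" using Suc by (simp add: mult.assoc)
  also have "\<dots> = x * y * (c * y ^ m) * c ^ m" using yx by (simp add: mult.assoc)
  also have "c * y ^ m = y ^ m * c" using commute_power[OF c(2), of m] .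
  finally show ?case by (simp add: mult.assoc)
 qed simp
 have "(x * y) ^ Suc n = x ^ n * y ^ n * (c ^ (n choose 2) * x) * y"
  using Suc by (simp add: power_Suc2 mult.assoc del: power_Suc)
 also have "\<dots> = x ^ n * (y ^ n * x) * (c ^ (n choose 2) * y)" by (simp add: cx mult.assoc)
 also have "\<dots> = x ^ n * x * y ^ n * (c ^ n * y) * c ^ (n choose 2)" by (simp add: ynx cy cy' mult.assoc)
 also have "\<dots> = x ^ Suc n * y ^ Suc n * (c ^ n * c ^ (n choose 2))"
  by (simp add: cy' power_Suc2 mult.assoc del: power_Suc)
 also have "c ^ n * c ^ (n choose 2) = c ^ (Suc n choose 2)"
  by (simp add: numeral_2_eq_2 flip: power_add)
 finally show ?case .
qed (simp add: numeral_2_eq_2)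

lemma prime_order_subset:
 assumes "subgrp V" "finite V" "prime (card V)" "subgrp H" "v \<in> V" "v \<in> H" "v \<noteq> 1"
 shows "V \<subseteq> H"
proof -
 have "card (V \<inter> H) dvd card V"
  using card_subgrp_dvd[OF assms(1,2) subgrp_Int[OF assms(1,4)]] by simp
 moreover have "card (V \<inter> H) \<noteq> 1"
 proof
  assume "card (V \<inter> H) = 1"
  then obtain y where "V \<inter> H = {y}" by (rule card_1_singletonE)
  moreover have "1 \<in> V \<inter> H" using assms by simp
  ultimately show False using assms(5-7) by auto
 qed
 ultimately have "card (V \<inter> H) = card V" using assms(3) prime_nat_iff by blast
 then show ?thesis using card_subset_eq[of V "V \<inter> H"] assms(2) by auto
qed

subsection \<open>Cyclic supplements in $p$-groups\<close>

text \<open>The configuration induced on a Sylow \<open>p\<close>-subgroup once the normal subgroups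
  common to \<open>A\<close> and \<open>B\<close> are divided out; \<open>sylow_core\<close>
  constructs the instance. The aim is \<open>conclusion\<close>: nothing exists beyond
  \<open>V\<close> itself, unless \<open>p = 2\<close> and the cyclic group has order four.\<close>

locale pconf =
 fixes p k :: nat and S A B V :: "'a::grp set" and \<sigma> :: 'a
 assumes p: "prime p"
  and S: "subgrp S" "finite S" "card S = p ^ k"
  and A: "subgrp A" "A \<subseteq> S"
  and B: "subgrp B" "B \<subseteq> S"
  and V: "subgrp V" "V \<subseteq> S" "card V = p"
  and central: "\<And>v s. v \<in> V ==> s \<in> S ==> v * s = s * v"
  and sig: "\<sigma> \<in> S"
  and SAVB: "S = A * V * B" and AB: "A * B \<noteq> S"
  and SAI: "S = A * cyc \<sigma>" and SBI: "S = B * cyc \<sigma>"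
  and AI: "A \<inter> cyc \<sigma> = {1}" and BI: "B \<inter> cyc \<sigma> = {1}"
  and core: "\<And>N. nrm N S ==> N \<subseteq> A ==> N \<subseteq> B ==> N = {1}"
begin

lemma swap: "pconf p k S B A V \<sigma>"
proof
 have inv: "inverse ` H = H" if "subgrp H" for H :: "'a set"
  using that by (auto simp: subgrp_inverse image_iff intro!: bexI[of _ "inverse _"])
 have times: "inverse ` (H * K) = (inverse ` K) * (inverse ` H)" for H K :: "'a set"
 proof (intro equalityI subsetI)
  fix x assume "x \<in> inverse ` (H * K)"
  then obtain h k where "h \<in> H" "k \<in> K" "x = inverse k * inverse h" by (auto elim!: in_set_timesE)
  then show "x \<in> (inverse ` K) * (inverse ` H)"
   using set_times_intro[of "inverse k" "inverse ` K" "inverse h" "inverse ` H"] by simp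
 next
  fix x assume "x \<in> (inverse ` K) * (inverse ` H)"
  then obtain h k where "h \<in> H" "k \<in> K" "x = inverse (h * k)" by (auto elim!: in_set_timesE)
  then show "x \<in> inverse ` (H * K)" using set_times_intro[of h H k K] by blast
 qed
 have "S = inverse ` S" using inv[OF S(1)] by simp
 also have "\<dots> = B * V * A" unfolding SAVB times inv[OF A(1)] inv[OF V(1)] inv[OF B(1)]
  by (simp add: mult.assoc)
 finally show "S = B * V * A" .
 show "B * A \<noteq> S"
 proof
  assume "B * A = S"
  then have "inverse ` S = A * B" using times[of B A] inv[OF A(1)] inv[OF B(1)] by simp
  then show False using AB inv[OF S(1)] by simp
 qed
qed (use p S A B V central sig SAI SBI AI BI core in auto)

lemma fin: "finite A" "finite B" "finite V" "finite (cyc \<sigma>)" "subgrp (cyc \<sigma>)" "cyc \<sigma> \<subseteq> S"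
proof -
 show c: "cyc \<sigma> \<subseteq> S" using cyc_subset[OF S(1) sig] .
 show "finite A" "finite B" "finite V" "finite (cyc \<sigma>)" using finite_subset S(2) A B V c by blast+
 then show "subgrp (cyc \<sigma>)" using subgrp_cyc by blast
qed

lemma nrm_V: "nrm V S"
 unfolding nrm_def
proof (intro conjI ballI)
 fix g n assume "g \<in> S" "n \<in> V"
 then show "g * n * inverse g \<in> V" using central[of n g, symmetric] by (simp add: mult.assoc)
qed (use V in auto)

lemma Vpow: "v \<in> V ==> v ^ p = 1"
 using grp_power_card[OF V(1) fin(3)] V(3) by simp

lemma AV_trivial: "a \<in> A ==> a \<in> V ==> a = 1"
proof (rule ccontr)
 assume a: "a \<in> A" "a \<in> V" "a \<noteq> 1"
 have "V \<subseteq> A" using prime_order_subset[OF V(1) fin(3) _ A(1) a(2,1,3)] V(3) p by simp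
 then have "A * V = A" using A(1) subset_set_times1[OF V(1), of A] set_times_subset[OF A(1), of A V] by auto
 then show False using SAVB AB by simp
qed

text \<open>The factorization \<open>S = A * V * B\<close> solved for the factor in
  \<open>B\<close>, with the central factor moved to the end. Applied to an \<open>s\<close> outside
  \<open>V\<close>, it yields elements of \<open>A\<close> and \<open>B\<close> that differ by
  \<open>s\<close> modulo \<open>V\<close>.\<close>

lemma decomp:
 assumes "s \<in> S"
 obtains a b v where "a \<in> A" "b \<in> B" "v \<in> V" "b = a * (s * v)"
proof -
 have "s \<in> A * V * B" using assms SAVB by simp
 then obtain a v b where s: "a \<in> A" "v \<in> V" "b \<in> B" "s = a * v * b"
  by (auto elim!: in_set_timesE)
 have e: "b = inverse v * (inverse a * s)" by (simp add: s(4) mult.assoc)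
 have iv: "inverse v \<in> V" using s V by (simp add: subgrp_inverse)
 have "inverse a * s \<in> S" using subgrp_inverse[OF A(1) s(1)] A(2) subgrp_mult[OF S(1) _ assms] by blast
 then have "b = inverse a * s * inverse v" using e central[OF iv, of "inverse a * s"] by (simp only:)
 then have "b = inverse a * (s * inverse v)" by (simp only: mult.assoc)
 then show ?thesis by (rule that[OF subgrp_inverse[OF A(1) s(1)] s(3) iv])
qed

text \<open>The \<open>v\<close> in \<open>V\<close> for which some \<open>a * v\<close> with
  \<open>a\<close> in \<open>A\<close> lies in \<open>B\<close> form a subgroup of a group of prime
  order. If it were all of \<open>V\<close>, the middle factor of \<open>A * V * B\<close> could be
  absorbed and \<open>A * B = S\<close> would follow. Every later contradiction comes from producing
  such a \<open>v\<close>.\<close>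

lemma twist_trivial:
 assumes "a \<in> A" "b \<in> B" "v \<in> V" "b = a * v"
 shows "v = 1"
proof (rule ccontr)
 assume v1: "v \<noteq> 1"
 define H where "H = {v \<in> V. \<exists>a\<in>A. a * v \<in> B}"
 have "subgrp H" unfolding subgrp_def
 proof (intro conjI ballI)
  show "1 \<in> H" using A B V by (auto simp: H_def intro!: bexI[of _ 1])
  fix x assume "x \<in> H"
  then obtain a1 where x: "x \<in> V" "a1 \<in> A" "a1 * x \<in> B" by (auto simp: H_def)
  have "x * a1 = a1 * x" using central[of x a1] x A by auto
  then have "inverse a1 * inverse x = inverse (a1 * x)" by (simp flip: grp_inverse_mult)
  moreover have "inverse (a1 * x) \<in> B" using x B by (simp only: subgrp_inverse)
  ultimately show "inverse x \<in> H" using x A V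
   by (auto simp: H_def subgrp_inverse simp del: grp_inverse_mult intro!: bexI[of _ "inverse a1"])
  fix y assume "y \<in> H"
  then obtain a2 where y: "y \<in> V" "a2 \<in> A" "a2 * y \<in> B" by (auto simp: H_def)
  have "x * a2 = a2 * x" using central x y A by auto
  then have "(a1 * a2) * (x * y) = (a1 * x) * (a2 * y)" by (simp add: mult.assoc left_commute_of)
  then have "(a1 * a2) * (x * y) \<in> B" using x y B by (simp add: subgrp_mult)
  then show "x * y \<in> H" using x y A V by (auto simp: H_def subgrp_mult intro!: bexI[of _ "a1 * a2"])
 qed
 moreover have "v \<in> H" using assms by (auto simp: H_def)
 ultimately have VH: "V \<subseteq> H" using prime_order_subset[OF V(1) fin(3) _ _ assms(3) _ v1] V(3) p by simp
 have "S \<subseteq> A * B"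
 proof
  fix s assume "s \<in> S"
  then have "s \<in> A * V * B" using SAVB by simp
  then obtain a' v' b' where s: "a' \<in> A" "v' \<in> V" "b' \<in> B" "s = a' * v' * b'"
   by (auto elim!: in_set_timesE)
  then obtain a1 where "a1 \<in> A" "a1 * v' \<in> B" using VH by (auto simp: H_def)
  then have "a' * inverse a1 \<in> A" "a1 * v' * b' \<in> B" "s = (a' * inverse a1) * (a1 * v' * b')"
   using s A B subgrp_mult[of B "a1 * v'" b'] by (simp_all add: mult.assoc subgrp_mult subgrp_inverse)
  then show "s \<in> A * B" by (simp add: set_times_intro)
 qed
 moreover have "A * B \<subseteq> S" using set_times_subset[OF S(1)] A B by simp
 ultimately show False using AB by auto
qed

text \<open>The hypothesis together with \<open>A \<inter> cyc \<sigma> = {1}\<close> gives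
  \<open>y ^ p = 1\<close> on \<open>A * U \<inter> cyc \<sigma>\<close>, so this intersection has
  at most \<open>p\<close> elements by cyclicity. Since it is a transversal of \<open>A\<close> in
  \<open>A * U\<close>, the set \<open>A * U\<close> is no larger than its subset
  \<open>A * V\<close>.\<close>

lemma card_bound_subset:
 assumes U: "nrm U S" "V \<subseteq> U" and y: "\<And>y. y \<in> A * U ==> y \<in> cyc \<sigma> ==> y ^ p \<in> A"
 shows "U \<subseteq> A * V"
proof -
 have sAU: "subgrp (A * U)" using subgrp_times_nrm[OF U(1) S(1) A] .
 have AUS: "A * U \<subseteq> S" using set_times_subset[OF S(1)] A U by (simp add: nrm_def)
 let ?H = "A * U \<inter> cyc \<sigma>"
 have "card ?H \<le> p"
 proof (rule card_cyc_roots[OF fin(4)])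
  show "x ^ p = 1" if "x \<in> ?H" for x
   using y[of x] that AI subgrp_power[OF fin(5), of x p] by auto
 qed (use p prime_gt_0_nat in auto)
 moreover have "A * U \<subseteq> A * ?H"
 proof
  fix x assume x: "x \<in> A * U"
  then obtain a i where ai: "a \<in> A" "i \<in> cyc \<sigma>" "x = a * i" using AUS SAI by (auto elim!: in_set_timesE)
  have "a \<in> A * U" using ai(1) subset_set_times1[of U A] U by (auto simp: nrm_def)
  then have "i \<in> A * U" using x ai sAU subgrp_mult_iff1 by blast
  then show "x \<in> A * ?H" using ai by (auto intro: set_times_intro)
 qed
 moreover have "card (A * ?H) \<le> card A * card ?H"
 proof -
  have "card (A * ?H) * card (A \<inter> ?H) = card A * card ?H"
   using card_set_times[OF A(1) subgrp_Int[OF sAU fin(5)] fin(1)] fin(4) by simp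
  moreover have "card (A \<inter> ?H) > 0"
   using card_subgrp_pos[OF subgrp_Int[OF A(1) subgrp_Int[OF sAU fin(5)]]] fin by simp
  ultimately show ?thesis by (metis One_nat_def Suc_leI mult.right_neutral mult_le_mono2)
 qed
 moreover have "finite (A * ?H)" using fin by (simp add: finite_set_times)
 ultimately have "card (A * U) \<le> card A * p"
  by (meson card_mono le_trans mult_le_mono2)
 moreover have "card (A * V) = card A * p"
 proof -
  have "A \<inter> V = {1}" using AV_trivial A V by auto
  then show ?thesis using card_set_times[OF A(1) V(1) fin(1,3)] V(3) by simp
 qed
 moreover have "A * V \<subseteq> A * U" using U(2) by (auto elim!: in_set_timesE intro: set_times_intro)
 moreover have "finite (A * U)" using finite_subset[OF AUS S(2)] .
 ultimately have "A * V = A * U" using card_seteq by metis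
 then show ?thesis using subset_set_times2[OF A(1)] by auto
qed

text \<open>Elements whose image in \<open>S / V\<close> is central. The commutator stands on the
  right, in the form that \<open>power_central_commutator\<close> expects.\<close>

definition cmod :: "'a \<Rightarrow> bool" where
 "cmod u \<longleftrightarrow> u \<in> S \<and> (\<forall>s\<in>S. \<exists>c\<in>V. u * s = s * u * c)"

lemma cmodI:
 assumes "u \<in> S" "\<And>s. s \<in> S ==> s * u * inverse s * inverse u \<in> V"
 shows "cmod u"
 unfolding cmod_def
proof (intro conjI ballI)
 fix s assume s: "s \<in> S"
 let ?c = "s * u * inverse s * inverse u"
 have c: "inverse ?c \<in> V" using assms(2)[OF s] V by (simp add: subgrp_inverse del: grp_inverse_mult)
 have "u * s = inverse ?c * (s * u)" by (simp add: mult.assoc)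
 also have "\<dots> = s * u * inverse ?c" using central[OF c, of "s * u"] s assms(1) S by (simp add: subgrp_mult del: grp_inverse_mult)
 finally show "\<exists>c\<in>V. u * s = s * u * c" using c by blast
qed fact

lemma cmodE:
 assumes "cmod u" "s \<in> S"
 obtains c where "c \<in> V" "u * s = s * u * c"
 using assms unfolding cmod_def by metis

lemma cmodS: "cmod u ==> u \<in> S"
 by (simp add: cmod_def)

lemma cmod_mult:
 assumes "cmod u" "v \<in> V"
 shows "cmod (u * v)" "cmod (v * u)"
proof -
 have uv: "v * u = u * v" using central assms by (simp add: cmod_def)
 show "cmod (u * v)" unfolding cmod_def
 proof (intro conjI ballI)
  show "u * v \<in> S" using assms V S by (auto simp: cmod_def intro: subgrp_mult)
  fix s assume s: "s \<in> S"
  obtain c where c: "c \<in> V" "u * s = s * u * c" by (rule cmodE[OF assms(1) s])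
  have "u * v * s = u * s * v" using central[OF assms(2) s] by (simp add: mult.assoc)
  also have "\<dots> = s * u * (c * v)" by (simp add: c mult.assoc)
  also have "c * v = v * c" using central c assms V by auto
  finally show "\<exists>c\<in>V. u * v * s = s * (u * v) * c" using c by (auto simp: mult.assoc)
 qed
 then show "cmod (v * u)" using uv by simp
qed

lemma cmod_power:
 assumes "cmod u"
 shows "cmod (u ^ n)"
proof (induction n)
 case 0
 show ?case unfolding cmod_def using V S by (auto intro!: bexI[of _ 1])
next
 case (Suc n)
 show ?case unfolding cmod_def
 proof (intro conjI ballI)
  show "u ^ Suc n \<in> S" using assms S by (auto simp: cmod_def intro: subgrp_power simp del: power_Suc)
  fix s assume s: "s \<in> S"
  obtain c where c: "c \<in> V" "u * s = s * u * c" by (rule cmodE[OF assms s])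
  obtain d where d: "d \<in> V" "u ^ n * s = s * u ^ n * d" by (rule cmodE[OF Suc s])
  have un: "u ^ n \<in> S" using assms S by (auto simp: cmod_def subgrp_power)
  have "u ^ Suc n * s = u * s * (u ^ n * d)" by (simp add: d mult.assoc)
  also have "\<dots> = s * u * (u ^ n * c) * d" using central[OF c(1) un] by (simp add: c mult.assoc left_commute_of)
  finally show "\<exists>c\<in>V. u ^ Suc n * s = s * u ^ Suc n * c"
   using c d V by (auto simp: mult.assoc intro!: bexI[of _ "c * d"] subgrp_mult)
 qed
qed

lemma VcycE:
 assumes "x \<in> V * cyc u"
 obtains v i where "v \<in> V" "x = v * u ^ i"
 using assms by (auto simp: cyc_def elim!: in_set_timesE)

lemma nrm_Vcyc:
 assumes "cmod u"
 shows "nrm (V * cyc u) S" "V \<subseteq> V * cyc u" "u \<in> V * cyc u"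
proof -
 have uS: "u \<in> S" using assms by (simp add: cmod_def)
 have cs: "cyc u \<subseteq> S" using cyc_subset[OF S(1) uS] .
 have fc: "finite (cyc u)" using finite_subset[OF cs S(2)] .
 have sc: "subgrp (cyc u)" using subgrp_cyc[OF fc] .
 show "V \<subseteq> V * cyc u" using subset_set_times1[OF sc] .
 show "u \<in> V * cyc u" using set_times_intro[of 1 V u "cyc u"] V by simp
 show "nrm (V * cyc u) S" unfolding nrm_def
 proof (intro conjI ballI)
  show "subgrp (V * cyc u)"
   using subgrp_times_nrm[OF nrm_V S(1) sc cs] nrm_times_commute[OF nrm_V S(1) cs] by simp
  show "V * cyc u \<subseteq> S" using set_times_subset[OF S(1) V(2) cs] .
  fix s x assume s: "s \<in> S" and "x \<in> V * cyc u"
  then obtain v i where x: "v \<in> V" "x = v * u ^ i" by (auto elim: VcycE)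
  have "inverse s \<in> S" using s S by (simp add: subgrp_inverse)
  then obtain c where c: "c \<in> V" "u ^ i * inverse s = inverse s * u ^ i * c"
   by (rule cmodE[OF cmod_power[OF assms]])
  have "s * x * inverse s = v * s * (u ^ i * inverse s)" using central[OF x(1) s] by (simp add: x mult.assoc)
  also have "\<dots> = v * (u ^ i * c)" by (simp add: c mult.assoc)
  also have "u ^ i * c = c * u ^ i" using central[OF c(1), of "u ^ i"] uS S by (simp add: subgrp_power)
  finally show "s * x * inverse s \<in> V * cyc u"
   using subgrp_mult[OF V(1) x(1) c(1)] by (simp add: set_times_intro flip: mult.assoc)
 qed
qed

text \<open>Such a \<open>u\<close> equals \<open>a\<close> and \<open>b\<close> up to
  \<open>V\<close>, and \<open>twist_trivial\<close> makes \<open>a = b\<close>. The commutator of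
  \<open>a\<close> with an element of \<open>A\<close> lies in \<open>A \<inter> V\<close>, hence is
  trivial; the same holds for \<open>B\<close>, and \<open>V\<close> is central. So \<open>a\<close>
  is central in \<open>S\<close>, and \<open>cyc a\<close> is a normal subgroup inside both
  \<open>A\<close> and \<open>B\<close>, excluded by \<open>core\<close>.\<close>

lemma cmod_AV_BV:
 assumes u: "cmod u" "u \<in> A * V" "u \<in> B * V"
 shows "u \<in> V"
proof -
 obtain a v1 b v2 where 1: "a \<in> A" "v1 \<in> V" "u = a * v1" and 2: "b \<in> B" "v2 \<in> V" "u = b * v2"
  using u by (auto elim!: in_set_timesE)
 have "a * v1 = b * v2" using 1 2 by simp
 then have "a * v1 * inverse v2 = b * v2 * inverse v2" by simp
 then have b: "b = a * (v1 * inverse v2)" by (simp add: mult.assoc)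
 have "v1 * inverse v2 = 1"
  using twist_trivial[OF 1(1) 2(1) _ b] 1 2 V by (simp add: subgrp_mult subgrp_inverse)
 then have ab: "a = b" using b by simp
 have "cmod a"
 proof -
  have "a = u * inverse v1" by (simp add: 1 mult.assoc)
  then show ?thesis using cmod_mult(1)[OF u(1), of "inverse v1"] 1 V by (simp add: subgrp_inverse)
 qed
 note ca = this
 interpret sw: pconf p k S B A V \<sigma> by (rule swap)
 have comA: "a * s = s * a" if "s \<in> A" for s
 proof -
  have "s \<in> S" using that A by auto
  then obtain c where c: "c \<in> V" "a * s = s * a * c" by (rule cmodE[OF ca])
  have "c = inverse (s * a) * (a * s)" by (simp add: c(2) mult.assoc)
  then have "c \<in> A" using that 1 A by (simp add: subgrp_mult subgrp_inverse del: grp_inverse_mult)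
  then have "c = 1" using AV_trivial c(1) by blast
  then show ?thesis using c(2) by simp
 qed
 have comB: "a * s = s * a" if "s \<in> B" for s
 proof -
  have "s \<in> S" using that B by auto
  then obtain c where c: "c \<in> V" "a * s = s * a * c" by (rule cmodE[OF ca])
  have "c = inverse (s * a) * (a * s)" by (simp add: c(2) mult.assoc)
  then have "c \<in> B" using that 2 ab B by (simp add: subgrp_mult subgrp_inverse del: grp_inverse_mult)
  then have "c = 1" using sw.AV_trivial c(1) by blast
  then show ?thesis using c(2) by simp
 qed
 have com: "a * s = s * a" if "s \<in> S" for s
 proof -
  have "s \<in> A * V * B" using that SAVB by simp
  then obtain x v y where s: "x \<in> A" "v \<in> V" "y \<in> B" "s = x * v * y"
   by (auto elim!: in_set_timesE)
  have "a * v = v * a" using central[OF s(2)] 1 A by auto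
  then show ?thesis using commute_mult[OF commute_mult[OF comA[OF s(1)]] comB[OF s(3)]] s(4) by simp
 qed
 have "nrm (cyc a) S" unfolding nrm_def
 proof (intro conjI ballI)
  have "cyc a \<subseteq> S" using cyc_subset[OF S(1)] 1 A by auto
  then show "cyc a \<subseteq> S" "subgrp (cyc a)" using finite_subset[OF _ S(2)] subgrp_cyc by blast+
  fix g n assume g: "g \<in> S" and n: "n \<in> cyc a"
  have "g * n = n * g" using commute_cyc[OF com[OF g, symmetric] n] .
  then show "g * n * inverse g \<in> cyc a" using n by (simp add: mult.assoc)
 qed
 then have "cyc a = {1}" using core cyc_subset[OF A(1) 1(1)] cyc_subset[OF B(1)] 2 ab by auto
 then have "a = 1" using self_in_cyc[of a] by auto
 then show ?thesis using 1 by simp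
qed

text \<open>\<open>card_bound_subset\<close> is applied to \<open>V * cyc u\<close>. An element of
  \<open>A * (V * cyc u)\<close> is \<open>a * x\<close> with \<open>x ^ p = 1\<close> and central
  commutator \<open>c\<close>, so its \<open>p\<close>-th power is
  \<open>a ^ p * c ^ (p choose 2)\<close>, and the last factor vanishes under either alternative of
  the hypothesis.\<close>

lemma elementary_subset_AV:
 assumes u: "cmod u" "u ^ p = 1" and odd: "odd p \<or> (\<forall>s\<in>S. u * s = s * u)"
 shows "u \<in> A * V"
proof -
 have "V * cyc u \<subseteq> A * V"
 proof (rule card_bound_subset[OF nrm_Vcyc(1,2)[OF u(1)]])
  fix y assume "y \<in> A * (V * cyc u)"
  then obtain a v i where y: "a \<in> A" "v \<in> V" "y = a * (v * u ^ i)"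
   by (auto elim!: in_set_timesE VcycE)
  let ?x = "v * u ^ i"
  have uS: "u ^ i \<in> S" "a \<in> S" using cmodS[OF u(1)] S A y by (auto simp: subgrp_power)
  have xS: "?x \<in> S" using uS y V S by (auto intro: subgrp_mult)
  have xp: "?x ^ p = 1"
   using power_commuting_mult[OF central[OF y(2) uS(1)], of p] Vpow[OF y(2)] u(2)
   by (simp add: mult.commute[of i] flip: power_mult) (simp add: power_mult)
  have cx: "cmod ?x" using cmod_mult(2)[OF cmod_power[OF u(1)] y(2)] .
  obtain c where c: "c \<in> V" "?x * a = a * ?x * c" by (rule cmodE[OF cx uS(2)])
  have "c ^ (p choose 2) = 1"
  proof (cases "odd p")
   case True
   then obtain m where m: "p - 1 = 2 * m" by (metis dvd_def even_diff_nat odd_even_add odd_one even_Suc odd_Suc_minus_one oddE even_plus_one_iff)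
   then have "p choose 2 = p * m" by (simp add: choose_two)
   then show ?thesis using Vpow[OF c(1)] by (simp add: power_mult)
  next
   case False
   then have "u * a = a * u" using odd uS by simp
   then have "a * u ^ i = u ^ i * a" using commute_power[of a u i] by simp
   then have "?x * a = v * a * u ^ i" by (simp add: mult.assoc)
   then have "?x * a = a * ?x" using central[OF y(2) uS(2)] by (simp add: mult.assoc)
   then show ?thesis using c(2) by (metis grp_mult_left_cancel mult_1_right power_one)
  qed
  then have "y ^ p = a ^ p"
   using power_central_commutator[OF c(2) central[OF c(1) uS(2)] central[OF c(1) xS], of p] xp y(3)
   by simp
  then show "y ^ p \<in> A" using y A by (simp add: subgrp_power)
 qed
 then show ?thesis using nrm_Vcyc(3)[OF u(1)] by blast
qed

lemma elementary_in_V: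
 assumes "cmod u" "u ^ p = 1" "odd p \<or> (\<forall>s\<in>S. u * s = s * u)"
 shows "u \<in> V"
proof -
 interpret sw: pconf p k S B A V \<sigma> by (rule swap)
 have "sw.cmod u" using assms(1) unfolding sw.cmod_def cmod_def .
 then show ?thesis
  using cmod_AV_BV[OF assms(1) elementary_subset_AV[OF assms]] sw.elementary_subset_AV[OF _ assms(2,3)] by blast
qed

text \<open>A nontrivial normal subgroup contains a central element of order \<open>p\<close>, and
  \<open>elementary_in_V\<close> locates every such element in \<open>V\<close>. Thus
  \<open>V\<close> is the only minimal normal subgroup of \<open>S\<close>.\<close>

lemma V_least_normal:
 assumes N: "nrm N S" "N \<noteq> {1}"
 shows "V \<subseteq> N"
proof -
 have "nrm {1} S" using S(1) by (auto simp: nrm_def)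
 moreover have "{1} \<subseteq> N" "{1} \<noteq> N" using N by (auto simp: nrm_def)
 ultimately obtain u where u: "u \<in> N - {1}" "u ^ p \<in> {1}" "\<forall>s\<in>S. s * u * inverse s * inverse u \<in> {1}"
  using pgroup_central_mod[OF S(1,2) p S(3) _ N(1)] by blast
 have uS: "u \<in> S" using u N by (auto simp: nrm_def)
 have com: "u * s = s * u" if "s \<in> S" for s
 proof -
  have "s * u * inverse s * inverse u = 1" using u(3) that by simp
  then have "s * u * inverse s * inverse u * (u * s) = u * s" by simp
  then show ?thesis by (simp add: mult.assoc)
 qed
 then have "cmod u" unfolding cmod_def using uS V by (auto intro!: bexI[of _ 1])
 then have "u \<in> V" using elementary_in_V u com by auto
 then show ?thesis using prime_order_subset[OF V(1) fin(3)] V(3) p u N by (auto simp: nrm_def)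
qed

text \<open>Raising \<open>b = a * (u * v)\<close> to the power \<open>p\<close> exhibits
  \<open>b ^ p\<close> as \<open>a ^ p\<close> times an element of \<open>V\<close>, which
  \<open>twist_trivial\<close> forces to be 1.\<close>

lemma twist_commutator:
 assumes u: "cmod u" "u ^ p \<in> V" and ab: "a \<in> A" "b \<in> B" "v \<in> V" "b = a * (u * v)"
  and c: "c \<in> V" "u * a = a * u * c"
 shows "u ^ p * c ^ (p choose 2) = 1"
proof -
 have S': "u \<in> S" "a \<in> S" "u * v \<in> S" using cmodS[OF u(1)] ab A V S by (auto intro: subgrp_mult)
 have "u * v * a = u * a * v" using central[OF ab(3) S'(2)] by (simp add: mult.assoc)
 also have "\<dots> = a * (u * v) * c" using central[OF c(1), of v] ab(3) V(2) by (auto simp: c mult.assoc)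
 finally have "b ^ p = a ^ p * (u * v) ^ p * c ^ (p choose 2)"
  unfolding ab(4) using power_central_commutator central[OF c(1)] S' by blast
 moreover have "(u * v) ^ p = u ^ p"
  using power_commuting_mult[OF central[OF ab(3) S'(1), symmetric], of p] Vpow[OF ab(3)] by simp
 ultimately have "b ^ p = a ^ p * (u ^ p * c ^ (p choose 2))" by (simp add: mult.assoc)
 then show ?thesis
  using twist_trivial[OF subgrp_power[OF A(1) ab(1)] subgrp_power[OF B(1) ab(2)]]
   subgrp_mult[OF V(1) u(2) subgrp_power[OF V(1) c(1)]] by blast
qed

lemma exists_cmod:
 assumes "S \<noteq> V"
 obtains u where "cmod u" "u \<notin> V" "u ^ p \<in> V"
proof -
 obtain u where "u \<in> S - V" "u ^ p \<in> V" "\<forall>s\<in>S. s * u * inverse s * inverse u \<in> V"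
  using pgroup_central_mod[OF S(1,2) p S(3) nrm_V nrm_refl[OF S(1)] V(2)] assms by auto
 then show ?thesis using that[of u] cmodI[of u] by auto
qed

text \<open>For odd \<open>p\<close> the commutator term in \<open>twist_commutator\<close>
  disappears, so an element of order \<open>p\<close> modulo \<open>V\<close> that is central modulo
  \<open>V\<close> has order \<open>p\<close> in \<open>S\<close> as well;
  \<open>elementary_in_V\<close> then puts it in \<open>V\<close>.\<close>

lemma odd_case:
 assumes "odd p"
 shows "S = V"
proof (rule ccontr)
 assume "S \<noteq> V"
 then obtain u where u: "cmod u" "u \<notin> V" "u ^ p \<in> V" by (rule exists_cmod)
 then have uS: "u \<in> S" by (simp add: cmod_def)
 obtain a b v where ab: "a \<in> A" "b \<in> B" "v \<in> V" "b = a * (u * v)" using decomp[OF uS] .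
 have "a \<in> S" using ab A by auto
 then obtain c where c: "c \<in> V" "u * a = a * u * c" by (rule cmodE[OF u(1)])
 obtain m where m: "p - 1 = 2 * m" using assms by (metis dvd_def odd_two_times_div_two_nat even_diff_nat odd_even_add odd_one)
 then have "p choose 2 = p * m" by (simp add: choose_two)
 then have "u ^ p = 1" using twist_commutator[OF u(1,3) ab c] Vpow[OF c(1)] by (simp add: power_mult)
 then show False using elementary_in_V u assms by blast
qed

section \<open>The prime two: a cyclic factor of order four\<close>

lemma elementary_even:
 assumes p2: "p = 2" and u: "cmod u" "u ^ 2 = 1" "u \<notin> A * V"
 shows "card (cyc \<sigma>) = 4"
proof -
 let ?U = "V * cyc u"
 \<comment> \<open>Since \<open>u\<close> lies outside \<open>A * V\<close>, the bound of
   \<open>card_bound_subset\<close> must fail, which provides a \<open>y\<close> in the cyclic group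
   with \<open>y ^ 2\<close> outside \<open>A\<close>. It turns out to have order four and not to
   commute with \<open>u\<close>.\<close>
 have "\<not> (\<forall>y. y \<in> A * ?U \<longrightarrow> y \<in> cyc \<sigma> \<longrightarrow> y ^ p \<in> A)"
  using card_bound_subset[OF nrm_Vcyc(1,2)[OF u(1)]] nrm_Vcyc(3)[OF u(1)] u(3) by blast
 then obtain y where y: "y \<in> A * ?U" "y \<in> cyc \<sigma>" "y ^ 2 \<notin> A" using p2 by auto
 obtain a v i where a: "a \<in> A" "v \<in> V" "y = a * (v * u ^ i)"
  using y(1) by (auto elim!: in_set_timesE VcycE)
 let ?x = "v * u ^ i"
 have uS: "u \<in> S" "u ^ i \<in> S" "a \<in> S" using cmodS[OF u(1)] S A a by (auto simp: subgrp_power)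
 have xS: "?x \<in> S" using uS a V S by (auto intro: subgrp_mult)
 have x2: "?x ^ 2 = 1"
  using power_commuting_mult[OF central[OF a(2) uS(2)], of 2] Vpow[OF a(2)] u(2) p2
  by (simp add: mult.commute[of i] flip: power_mult) (simp add: power_mult)
 have cx: "cmod ?x" using cmod_mult(2)[OF cmod_power[OF u(1)] a(2)] .
 obtain c where c: "c \<in> V" "?x * a = a * ?x * c" by (rule cmodE[OF cx uS(3)])
 have y2: "y ^ 2 = a ^ 2 * c"
  using power_central_commutator[OF c(2) central[OF c(1) uS(3)] central[OF c(1) xS], of 2] x2 a(3)
  by simp
 then have c1: "c \<noteq> 1" using y(3) a A by (auto simp: subgrp_power)
 have "y ^ 4 = (y ^ 2) ^ 2" by (simp flip: power_mult)
 also have "\<dots> = (a ^ 2 * c) ^ 2" by (simp only: y2)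
 also have "\<dots> = a ^ 4"
  using power_commuting_mult[OF central[OF c(1), of "a ^ 2", symmetric], of 2] Vpow[OF c(1)] p2 uS S
  by (simp add: subgrp_power flip: power_mult)
 finally have "y ^ 4 \<in> A" using a A by (simp add: subgrp_power)
 then have y4: "y ^ 4 = 1" using AI subgrp_power[OF fin(5) y(2), of 4] by auto
 have y21: "y ^ 2 \<noteq> 1" using y(3) A by auto
 have yu: "y * u \<noteq> u * y"
 proof
  assume yu: "y * u = u * y"
  have xu: "u * ?x = ?x * u"
   using commute_mult[OF central[OF a(2) uS(1), symmetric] commute_power[of u u i]] by simp
  have "a = y * inverse ?x" by (simp add: a(3) mult.assoc)
  then have "u * a = a * u"
   using commute_mult[OF yu[symmetric] commute_inverse[OF xu]] by (simp only:)
  then have "u ^ i * a = a * u ^ i" using commute_power[of a u i] by simp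
  then have "?x * a = v * a * u ^ i" by (simp add: mult.assoc)
  then have "?x * a = a * ?x" using central[OF a(2) uS(3)] by (simp add: mult.assoc)
  then show False using c(2) c1 grp_mult_left_cancel[of "a * ?x" c 1] by simp
 qed
 obtain j where j: "y = \<sigma> ^ j" using y(2) by (auto simp: cyc_def)
 \<comment> \<open>The commutator of \<open>u\<close> and \<open>\<sigma>\<close> is central of
   order at most two, so \<open>\<sigma> ^ 2\<close> commutes with \<open>u\<close>. As
   \<open>y\<close> does not, it is an odd power of \<open>\<sigma>\<close>, and the order of the
   2-element \<open>\<sigma>\<close> equals that of \<open>y\<close>.\<close>
 have s2: "u * \<sigma> ^ 2 = \<sigma> ^ 2 * u"
 proof -
  obtain d where d: "d \<in> V" "u * \<sigma> = \<sigma> * u * d" by (rule cmodE[OF u(1) sig])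
  have "u * \<sigma> ^ 2 = \<sigma> * u * (d * \<sigma>)" by (simp add: power2_eq_square d flip: mult.assoc)
  also have "\<dots> = \<sigma> * (u * \<sigma>) * d" using central[OF d(1) sig] by (simp add: mult.assoc)
  also have "\<dots> = \<sigma> ^ 2 * u * d ^ 2" by (simp add: d power2_eq_square mult.assoc)
  finally show ?thesis using Vpow[OF d(1)] p2 by simp
 qed
 have "odd j"
 proof
  assume "even j"
  then obtain m where "j = 2 * m" by blast
  then have "u * y = y * u" using commute_power[OF s2, of m] j by (simp add: power_mult)
  then show False using yu by simp
 qed
 have "\<sigma> ^ (4 * j) = 1" using y4 j by (simp add: mult.commute flip: power_mult)
 then have "card (cyc \<sigma>) dvd 4 * j" using power_eq_1_iff[OF fin(4)] by simp
 moreover obtain m where m: "card (cyc \<sigma>) = 2 ^ m"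
  using card_subgrp_dvd[OF S(1,2) fin(5,6)] S(3) p2 divides_primepow_nat[of 2] by auto
 moreover have "coprime (2 ^ m) j" using \<open>odd j\<close> by simp
 ultimately have "2 ^ m dvd (4::nat)" by (simp add: coprime_dvd_mult_left_iff)
 moreover have "\<not> 2 ^ m dvd (2::nat)"
 proof
  assume "2 ^ m dvd (2::nat)"
  then have "\<sigma> ^ 2 = 1" using power_eq_1_iff[OF fin(4), of 2] m by simp
  then have "y ^ 2 = 1" using j by (metis mult.commute power_mult power_one)
  then show False using y21 by simp
 qed
 moreover have "m \<le> 2"
 proof -
  have "2 ^ m dvd (2::nat) ^ 2" using \<open>2 ^ m dvd 4\<close> by simp
  then show ?thesis by (rule power_dvd_imp_le) simp
 qed
 ultimately have "m = 2" by (cases "m = 0"; cases "m = 1") auto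
 then show ?thesis using m by simp
qed

lemma elementary_case:
 assumes "p = 2" "cmod u" "u ^ 2 = 1" "u \<notin> V"
 shows "card (cyc \<sigma>) = 4"
proof -
 interpret sw: pconf p k S B A V \<sigma> by (rule swap)
 have sw: "sw.cmod u" using assms(2) unfolding sw.cmod_def cmod_def .
 show ?thesis
 proof (cases "u \<in> A * V")
  case True
  then have "u \<notin> B * V" using cmod_AV_BV[OF assms(2)] assms(4) by blast
  then show ?thesis by (rule sw.elementary_even[OF assms(1) sw assms(3)])
 next
  case False
  then show ?thesis by (rule elementary_even[OF assms(1-3)])
 qed
qed

text \<open>Here \<open>u\<close> has order four and \<open>V\<close> is generated by
  \<open>z = u ^ 2\<close>; the argument turns on the centralizer \<open>H\<close> of
  \<open>u\<close>. If \<open>H = cyc u\<close>, then \<open>A\<close> has order two and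
  \<open>S\<close> order eight. Otherwise some \<open>x\<close> in \<open>H\<close> is of order two
  modulo \<open>cyc u\<close>: either \<open>x\<close> or \<open>x * u\<close> is an involution,
  which leads back to \<open>elementary_case\<close>, or \<open>x ^ 2\<close> generates
  \<open>cyc u\<close>, which is impossible.\<close>

lemma cyclic_case:
 assumes p2: "p = 2" and u: "cmod u" "u ^ 2 \<in> V" "u ^ 2 \<noteq> 1"
 shows "card (cyc \<sigma>) = 4"
proof -
 have uS: "u \<in> S" using u by (simp add: cmod_def)
 define z where "z = u ^ 2"
 have z: "z \<in> V" "z \<noteq> 1" "z * z = 1" using u Vpow[of "u ^ 2"] p2 by (auto simp: z_def power2_eq_square)
 have V2: "V = {1, z}"
 proof -
  have "{1, z} \<subseteq> V" using z V by simp
  moreover have "card {1, z} = card V" using z V(3) p2 by simp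
  ultimately show ?thesis by (rule card_subset_eq[OF fin(3), symmetric])
 qed
 have u2: "u ^ 2 = z" by (simp add: z_def)
 have u4: "u ^ 4 = 1" using z(3) power_add[of u 2 2] by (simp add: z_def)
 have zu: "z * s = s * z" if "s \<in> S" for s using central[OF z(1) that] .
 have z2: "z ^ 2 = 1" using z(3) by (simp add: power2_eq_square)
 have uz2: "(u * z) ^ 2 = z" using power_commuting_mult[OF zu[OF uS, symmetric], of 2] u2 z2 by simp
 have flip: "u * s = s * u \<or> u * s = s * u * z" if s: "s \<in> S" for s
 proof -
  obtain c where "c \<in> V" "u * s = s * u * c" by (rule cmodE[OF u(1) s])
  then show ?thesis unfolding V2 by auto
 qed
 have U: "cyc u = {1, u, z, u * z}"
 proof -
  have "cyc u \<subseteq> {1, u, z, u * z}" if "\<And>i. u ^ i \<in> {1, u, z, u * z}"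
   using that unfolding cyc_def by blast
  moreover have "u ^ i \<in> {1, u, z, u * z}" for i
  proof -
   have "u ^ i = u ^ (i mod 4)"
    using u4 by (metis mod_mult_div_eq mult_1_right power_add power_mult power_one)
   moreover have "i mod 4 = 0 \<or> i mod 4 = 1 \<or> i mod 4 = 2 \<or> i mod 4 = 3" by linarith
   moreover have "u ^ 3 = u * z" by (simp add: z_def eval_nat_numeral)
   ultimately show ?thesis by (auto simp: z_def)
  qed
  moreover have "1 \<in> cyc u" "z \<in> cyc u" "u * z \<in> cyc u"
   using power_in_cyc[of u 0] power_in_cyc[of u 2] power_in_cyc[of u 3] by (auto simp: z_def eval_nat_numeral)
  ultimately show ?thesis using self_in_cyc[of u] by blast
 qed
 have sq1: "w \<in> V" if w: "w \<in> cyc u" "w ^ 2 = 1" for w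
 proof -
  have "w \<noteq> u" "w \<noteq> u * z" using w(2) u2 uz2 z(2) by auto
  then show ?thesis using w(1) unfolding U V2 by blast
 qed
 have cS: "cyc u \<subseteq> S" using cyc_subset[OF S(1) uS] .
 have sU: "subgrp (cyc u)" using subgrp_cyc finite_subset[OF cS S(2)] by blast
 have uzV: "u \<notin> V" "u * z \<notin> V"
 proof -
  show "u \<notin> V" using Vpow[of u] p2 u by auto
  then show "u * z \<notin> V" using subgrp_mult_iff2[OF V(1) z(1)] by simp
 qed
 \<comment> \<open>With trivial commutator, \<open>twist_commutator\<close> would give
   \<open>u ^ 2 = 1\<close>.\<close>
 have noncomm: "u * a \<noteq> a * u" if "a \<in> A" "b \<in> B" "v \<in> V" "b = a * (u * v)" for a b v
 proof
  assume "u * a = a * u"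
  then show False using twist_commutator[OF u(1) _ that, of 1] u p2 V by simp
 qed
 obtain a b v where ab: "a \<in> A" "b \<in> B" "v \<in> V" "b = a * (u * v)" using decomp[OF uS] .
 have aS: "a \<in> S" using ab A by auto
 have ua: "u * a = a * u * z" using flip[OF aS] noncomm[OF ab] by auto
 define H where "H = {s \<in> S. u * s = s * u}"
 have sH: "subgrp H" unfolding subgrp_def
 proof (intro conjI ballI)
  show "1 \<in> H" using S by (simp add: H_def)
  fix x assume x: "x \<in> H"
  then show "inverse x \<in> H" using commute_inverse[of u x] S by (auto simp: H_def subgrp_inverse)
  fix y assume "y \<in> H"
  then show "x * y \<in> H" using x S commute_mult[of u x y] by (auto simp: H_def subgrp_mult)
 qed
 have conj_u: "\<exists>w\<in>V. inverse s * u * s = u * w" if s: "s \<in> S" for s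
 proof -
  obtain w where w: "w \<in> V" "u * s = s * u * w" by (rule cmodE[OF u(1) s])
  have "inverse s * u * s = u * w" by (simp add: w(2) mult.assoc)
  then show ?thesis using w(1) by blast
 qed
 have nH: "nrm H S" unfolding nrm_def
 proof (intro conjI ballI)
  fix s h assume s: "s \<in> S" and h: "h \<in> H"
  have hS: "h \<in> S" "u * h = h * u" using h by (auto simp: H_def)
  obtain w where w: "w \<in> V" "inverse s * u * s = u * w" using conj_u[OF s] by auto
  have uww: "u * w * h = h * (u * w)" 
   using commute_mult[OF hS(2)[symmetric] central[OF w(1) hS(1), symmetric]] by simp
  have "u * (s * h * inverse s) = s * (inverse s * u * s) * h * inverse s" by (simp add: mult.assoc)
  also have "\<dots> = s * (u * w * h) * inverse s" by (simp only: w(2)) (simp only: mult.assoc)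
  also have "\<dots> = s * h * (inverse s * u * s) * inverse s" by (simp only: uww w(2)) (simp only: mult.assoc)
  also have "\<dots> = (s * h * inverse s) * u" by (simp add: mult.assoc)
  finally show "s * h * inverse s \<in> H" using s hS S by (auto simp: H_def subgrp_mult subgrp_inverse)
 qed (use sH H_def in auto)
 have UH: "cyc u \<subseteq> H" using commute_cyc[of u u] cS by (auto simp: H_def)
 have nU: "nrm (cyc u) S"
 proof -
  have "V * cyc u = cyc u"
  proof -
   have "V \<subseteq> cyc u" using V2 U by auto
   then show ?thesis
    using set_times_subset[OF sU, of V "cyc u"] subset_set_times2[OF V(1), of "cyc u"] by blast
  qed
  then show ?thesis using nrm_Vcyc(1)[OF u(1)] by simp
 qed
 show ?thesis
 \<comment> \<open>When \<open>H = cyc u\<close>, every nontrivial element of \<open>H\<close> has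
   \<open>z\<close> among its powers, while \<open>z\<close> is not in \<open>A\<close>; so
   \<open>A\<close> meets \<open>H\<close> trivially. Two elements of \<open>A\<close> outside
   \<open>H\<close> agree modulo \<open>H\<close>, since \<open>u\<close> has only the conjugates
   \<open>u\<close> and \<open>u * z\<close>.\<close>
 proof (cases "H = cyc u")
  case True
  have "A \<inter> H \<subseteq> {1}"
  proof
   fix x assume x: "x \<in> A \<inter> H"
   have x2: "x ^ 2 \<in> A" "x \<in> A" using x A by (simp_all add: subgrp_power)
   have zA: "z \<notin> A" using AV_trivial z by blast
   have "x = 1 \<or> x = u \<or> x = z \<or> x = u * z" using x True U by blast
   then show "x \<in> {1}"
   proof (elim disjE)
    assume "x = u" then show ?thesis using x2 u2 zA by simp
   next
    assume "x = z" then show ?thesis using x2 zA by simp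
   next
    assume "x = u * z" then show ?thesis using x2 uz2 zA by simp
   qed simp
  qed
  have cA: "A \<subseteq> {1, a}"
  proof
   fix x assume x: "x \<in> A"
   show "x \<in> {1, a}"
   proof (cases "x \<in> H")
    case False
    have xS: "x \<in> S" using x A by auto
    then have ux: "u * x = x * u * z" using flip[OF xS] False by (auto simp: H_def)
    have "u * (inverse a * x) = (inverse a * x) * u"
    proof -
     have "inverse a * (u * a) * inverse a = inverse a * (a * u * z) * inverse a" by (simp add: ua)
     then have "inverse a * u = u * z * inverse a" by (simp add: mult.assoc)
     moreover have "z * inverse a = inverse a * z" using zu[of "inverse a"] aS S by (simp add: subgrp_inverse)
     ultimately have e: "inverse a * u = u * inverse a * z" by (simp add: mult.assoc)
     have "inverse a * x * u = inverse a * (x * u * z) * z" using z(3) by (simp add: mult.assoc)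
     also have "\<dots> = inverse a * u * x * z" by (simp only: ux[symmetric]) (simp only: mult.assoc)
     also have "\<dots> = u * inverse a * ((z * x) * z)" by (simp only: e) (simp only: mult.assoc)
     also have "(z * x) * z = x" by (simp only: zu[OF xS]) (simp add: z(3) mult.assoc)
     finally show ?thesis by (simp add: mult.assoc)
    qed
    then have "inverse a * x \<in> H" using x aS xS S by (auto simp: H_def subgrp_mult subgrp_inverse)
    moreover have "inverse a * x \<in> A" using x ab A by (simp add: subgrp_mult subgrp_inverse)
    ultimately have "inverse a * x = 1" using \<open>A \<inter> H \<subseteq> {1}\<close> by blast
    then have "a * (inverse a * x) = a" by simp
    then show ?thesis by simp
   qed (use x \<open>A \<inter> H \<subseteq> {1}\<close> in auto)
  qed
  have "a \<noteq> 1" using noncomm[OF ab] by auto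
  then have "A = {1, a}" using cA ab A by auto
  then have "card A = 2" using \<open>a \<noteq> 1\<close> by simp
  moreover have "card S = 8"
  proof -
   have "S = H * A"
   proof (intro equalityI subsetI)
    fix s assume s: "s \<in> S"
    show "s \<in> H * A"
    proof (cases "s \<in> H")
     case True
     then show ?thesis using subset_set_times1[OF A(1), of H] by auto
    next
     case False
     then have us: "u * s = s * u * z" using flip[OF s] s by (auto simp: H_def)
     have "u * (s * inverse a) = s * u * z * inverse a" by (simp add: us flip: mult.assoc)
     also have "\<dots> = s * (inverse a * (a * u * z)) * inverse a" by (simp add: mult.assoc)
     also have "\<dots> = s * inverse a * u" by (simp only: ua[symmetric]) (simp add: mult.assoc)
     finally have "s * inverse a \<in> H" using s aS S by (auto simp: H_def subgrp_mult subgrp_inverse)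
     then show ?thesis using set_times_intro[of "s * inverse a" H a A] ab by (simp add: mult.assoc)
    qed
   qed (use set_times_subset[OF S(1), of H A] A nH in \<open>auto simp: nrm_def\<close>)
   moreover have "card H = 4"
   proof -
    have "u \<noteq> 1" "u \<noteq> z" "u * z \<noteq> 1" "u * z \<noteq> z" "u * z \<noteq> u" using z uzV V(1) by auto
    then show ?thesis using True U z by simp
   qed
   moreover have "H \<inter> A = {1}" using \<open>A \<inter> H \<subseteq> {1}\<close> sH A by auto
   moreover have "finite H" using finite_subset[OF _ S(2)] by (auto simp: H_def)
   ultimately show ?thesis using card_set_times[OF sH A(1) _ fin(1)] \<open>card A = 2\<close> by simp
  qed
  ultimately show ?thesis using card_set_times[OF A(1) fin(5) fin(1,4)] AI SAI by simp
 next
  case False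
  obtain x where x: "x \<in> H - cyc u" "x ^ p \<in> cyc u" "\<forall>s\<in>S. s * x * inverse s * inverse x \<in> cyc u"
   using pgroup_central_mod[OF S(1,2) p S(3) nU nH UH] False by auto
  have xS: "x \<in> S" "u * x = x * u" using x by (auto simp: H_def)
  have Ux: "m * x = x * m" if "m \<in> cyc u" for m
   using commute_cyc[OF xS(2)[symmetric] that] by simp
  have elem: ?thesis if t: "t \<in> H - cyc u" "t ^ 2 = 1" and m: "\<And>s. s \<in> S ==> s * t * inverse s * inverse t \<in> cyc u" for t
  proof -
   have tS: "t \<in> S" "u * t = t * u" using t by (auto simp: H_def)
   have "cmod t"
   proof (rule cmodI[OF tS(1)])
    fix s assume s: "s \<in> S"
    let ?m = "s * t * inverse s * inverse t"
    have mt: "?m * t = t * ?m" using commute_cyc[OF tS(2)[symmetric] m[OF s]] by simp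
    have "(s * t * inverse s) ^ 2 = s * t ^ 2 * inverse s" by (simp add: power2_eq_square mult.assoc)
    also have "\<dots> = 1" using t(2) by simp
    also have "s * t * inverse s = ?m * t" by (simp add: mult.assoc)
    finally have "?m ^ 2 = 1" using power_commuting_mult[OF mt, of 2] t(2) by simp
    then show "?m \<in> V" by (rule sq1[OF m[OF s]])
   qed
   moreover have "t \<notin> V" using t U V2 by auto
   ultimately show ?thesis using elementary_case[OF p2 _ t(2)] by blast
  qed
  have x2: "x ^ 2 \<in> {1, u, z, u * z}" using x(2) p2 U by simp
  \<comment> \<open>Squaring a relation \<open>b3 = a3 * (x * m)\<close>, where \<open>a3\<close>
    commutes with \<open>u\<close>, gives \<open>b3 ^ 2 = a3 ^ 2 * (u * w)\<close> with
    \<open>w\<close> in \<open>V\<close>. By \<open>noncomm\<close> the square \<open>a3 ^ 2\<close>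
    would then fail to commute with \<open>u\<close>.\<close>
  have key: False if x2u: "x ^ 2 = u \<or> x ^ 2 = u * z"
  proof -
   have contra: False if h: "a3 \<in> A" "b3 \<in> B" "u * a3 = a3 * u" "m \<in> cyc u" "b3 = a3 * (x * m)" for a3 b3 m
   proof -
    define xm where "xm = x * m"
    have ia: "inverse a3 \<in> S" using h A S by (auto simp: subgrp_inverse)
    have ma: "a3 * m = m * a3" using commute_cyc[OF h(3)[symmetric] h(4)] .
    define k where "k = inverse a3 * x * a3 * inverse x"
    have k: "k \<in> cyc u" using x(3)[rule_format, OF ia] by (simp add: k_def)
    have kx: "k * xm = xm * k"
     unfolding xm_def by (rule commute_mult[OF Ux[OF k] cyc_commute[OF k h(4)]])
    have ka: "k * a3 = a3 * k" using commute_cyc[OF h(3)[symmetric] k] by simp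
    have xa: "xm * a3 = a3 * xm * k"
    proof -
     have "xm * a3 = x * (m * a3)" by (simp only: xm_def mult.assoc)
     also have "\<dots> = x * (a3 * m)" by (simp only: ma)
     also have "\<dots> = a3 * (k * xm)" by (simp add: k_def xm_def mult.assoc)
     also have "\<dots> = a3 * xm * k" by (simp only: kx mult.assoc)
     finally show ?thesis .
    qed
    have sq: "xm ^ 2 = x ^ 2 * m ^ 2"
     unfolding xm_def using power_commuting_mult[OF Ux[OF h(4), symmetric], of 2] .
    have usq: "w ^ 2 \<in> V" if "w \<in> cyc u" for w
     using that V2 U u2 z2 uz2 by auto
    have "k ^ 2 = 1"
    proof -
     have "xm ^ 2 \<in> cyc u"
      unfolding sq using subgrp_mult[OF sU _ subgrp_power[OF sU h(4)]] x2 U by blast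
     then have "a3 * xm ^ 2 = xm ^ 2 * a3" using commute_cyc[OF h(3)[symmetric]] by blast
     moreover have "xm ^ 2 * a3 = a3 * (xm ^ 2 * k ^ 2)"
     proof -
      have "xm ^ 2 * a3 = xm * (xm * a3)" by (simp only: power2_eq_square mult.assoc)
      also have "\<dots> = xm * (a3 * xm * k)" by (simp only: xa)
      also have "\<dots> = (xm * a3) * (xm * k)" by (simp only: mult.assoc)
      also have "\<dots> = a3 * xm * (k * xm) * k" by (simp only: xa) (simp only: mult.assoc)
      also have "\<dots> = a3 * (xm ^ 2 * k ^ 2)" by (simp only: kx) (simp only: power2_eq_square mult.assoc)
      finally show ?thesis .
     qed
     ultimately have "a3 * xm ^ 2 = a3 * (xm ^ 2 * k ^ 2)" by simp
     then have "xm ^ 2 = xm ^ 2 * k ^ 2" by (simp only: grp_mult_left_cancel)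
     then show ?thesis using grp_mult_eq_self(1)[of "xm ^ 2" "k ^ 2"] by simp
    qed
    then have kV: "k \<in> V" by (rule sq1[OF k])
    have "b3 ^ 2 = a3 ^ 2 * (xm ^ 2 * k)"
     using power_central_commutator[OF xa ka kx, of 2] h(5) by (simp add: mult.assoc xm_def)
    moreover have mk: "m ^ 2 * k \<in> V" using usq[OF h(4)] kV V by (simp add: subgrp_mult)
    obtain w where "w \<in> V" "xm ^ 2 * k = u * w"
    proof (cases "x ^ 2 = u")
     case True
     then show ?thesis using that[OF mk] by (simp add: sq mult.assoc)
    next
     case False
     then have "x ^ 2 = u * z" using x2u by blast
     then show ?thesis using that[OF subgrp_mult[OF V(1) z(1) mk]] by (simp add: sq mult.assoc)
    qed
    ultimately have "u * a3 ^ 2 \<noteq> a3 ^ 2 * u"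
     using noncomm[OF subgrp_power[OF A(1) h(1)] subgrp_power[OF B(1) h(2)], of w 2 2] by simp
    then show False using commute_power[OF h(3), of 2] by simp
   qed
   obtain a2 b2 v2 where ab2: "a2 \<in> A" "b2 \<in> B" "v2 \<in> V" "b2 = a2 * (x * v2)" using decomp[OF xS(1)] .
   have VU: "V \<subseteq> cyc u" using V2 U by auto
   have a2S: "a2 \<in> S" using ab2 A by auto
   show False
   proof (cases "u * a2 = a2 * u")
    case True
    then show False using contra[OF ab2(1,2) True _ ab2(4)] ab2(3) VU by auto
   next
    case False
    \<comment> \<open>The element \<open>a\<close> from the decomposition of \<open>u\<close> does
      not commute with \<open>u\<close> either. Both act on \<open>u\<close> by multiplication with
      \<open>z\<close>, so the product \<open>a2 * a\<close> commutes with \<open>u\<close>, and the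
      product of the two relations has the form excluded by \<open>contra\<close>.\<close>
    then have ua2: "u * a2 = a2 * u * z" using flip[OF a2S] by auto
    define k where "k = inverse a * x * a * inverse x"
    have "inverse a \<in> S" using aS S by (simp add: subgrp_inverse)
    then have k: "k \<in> cyc u" using x(3) by (force simp: k_def)
    have "u * (a2 * a) = (u * a2) * a" by (simp only: mult.assoc)
    also have "\<dots> = a2 * u * (z * a)" by (simp only: ua2) (simp only: mult.assoc)
    also have "\<dots> = a2 * (u * a) * z" by (simp only: zu[OF aS]) (simp only: mult.assoc)
    also have "\<dots> = a2 * a * u * (z * z)" by (simp only: ua) (simp only: mult.assoc)
    finally have com: "u * (a2 * a) = (a2 * a) * u" using z(3) by simp
    have "b2 * b = a2 * x * (v2 * a) * (u * v)" by (simp add: ab2 ab mult.assoc)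
    also have "\<dots> = a2 * x * (a * v2) * (u * v)" by (simp only: central[OF ab2(3) aS])
    also have "\<dots> = a2 * a * (k * x) * v2 * (u * v)" by (simp add: k_def mult.assoc)
    also have "\<dots> = a2 * a * (x * (k * v2 * (u * v)))" by (simp only: Ux[OF k]) (simp only: mult.assoc)
    finally have eq: "b2 * b = a2 * a * (x * (k * v2 * (u * v)))" .
    have "k * v2 * (u * v) \<in> cyc u"
     using k ab2(3) ab(3) VU sU by (auto intro!: subgrp_mult)
    then show False
     using contra[OF subgrp_mult[OF A(1) ab2(1) ab(1)] subgrp_mult[OF B(1) ab2(2) ab(2)] com _ eq] by blast
   qed
  qed
  consider "x ^ 2 = 1" | "x ^ 2 = z" | "x ^ 2 = u \<or> x ^ 2 = u * z" using x2 by auto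
  then show ?thesis
  proof cases
   case 1
   then show ?thesis using elem[of x] x by blast
  next
   case 2
   have xu: "x * u \<in> H - cyc u"
    using x UH self_in_cyc[of u] subgrp_mult_iff2[OF sU self_in_cyc, of x] subgrp_mult[OF sH, of x u] by blast
   have "(x * u) ^ 2 = 1" using power_commuting_mult[OF xS(2)[symmetric], of 2] 2 z(3) u2 by simp
   moreover have "s * (x * u) * inverse s * inverse (x * u) \<in> cyc u" if s: "s \<in> S" for s
   proof -
    let ?m = "s * x * inverse s * inverse x" and ?n = "s * u * inverse s"
    have n: "?n \<in> cyc u" using nrmD(3)[OF nU s] by simp
    have "s * (x * u) * inverse s * inverse (x * u) = ?m * x * ?n * inverse u * inverse x"
     by (simp add: mult.assoc)
    also have "\<dots> = ?m * (x * (?n * inverse u)) * inverse x" by (simp only: mult.assoc)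
    also have "x * (?n * inverse u) = (?n * inverse u) * x"
     using Ux[of "?n * inverse u"] n sU by (simp add: subgrp_mult subgrp_inverse)
    also have "?m * (?n * inverse u * x) * inverse x = ?m * (?n * inverse u)" by (simp add: mult.assoc)
    finally show ?thesis using x(3) s n sU by (simp add: subgrp_mult subgrp_inverse)
   qed
   ultimately show ?thesis using elem[of "x * u"] xu by blast
  next
   case 3
   then show ?thesis using key by blast
  qed
 qed
qed

theorem conclusion: "S = V \<or> p = 2 \<and> card (cyc \<sigma>) = 4"
proof (cases "odd p \<or> S = V")
 case True
 then show ?thesis using odd_case by auto
next
 case False
 then have p2: "p = 2" using p primes_dvd_imp_eq two_is_prime_nat by blast
 obtain u where "cmod u" "u \<notin> V" "u ^ p \<in> V" using exists_cmod False by blast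
 then show ?thesis using elementary_case[OF p2, of u] cyclic_case[OF p2, of u] p2 by auto
qed

end

section \<open>Quotients, Sylow subgroups and derived groups\<close>

subsection \<open>Homomorphisms and quotients\<close>

definition ghom :: "'a::grp set \<Rightarrow> ('a \<Rightarrow> 'b::grp) \<Rightarrow> bool" where
 "ghom G \<pi> \<longleftrightarrow> (\<forall>g\<in>G. \<forall>h\<in>G. \<pi> (g * h) = \<pi> g * \<pi> h)"

lemma ghom_mult: "ghom G \<pi> ==> g \<in> G ==> h \<in> G ==> \<pi> (g * h) = \<pi> g * \<pi> h"
 by (simp add: ghom_def)

lemma ghom_one: "ghom G \<pi> ==> subgrp G ==> \<pi> 1 = 1"
 using ghom_mult[of G \<pi> 1 1] by simp

lemma ghom_inverse: "ghom G \<pi> ==> subgrp G ==> g \<in> G ==> \<pi> (inverse g) = inverse (\<pi> g)"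
 using ghom_mult[of G \<pi> g "inverse g"] ghom_one[of G \<pi>] grp_inverse_unique[of "\<pi> g" "\<pi> (inverse g)"]
 by (simp add: subgrp_inverse)

lemma ghom_power: "ghom G \<pi> ==> subgrp G ==> g \<in> G ==> \<pi> (g ^ n) = \<pi> g ^ n"
 by (induction n) (simp_all add: ghom_one ghom_mult subgrp_power)

lemma ghom_subset: "ghom G \<pi> ==> H \<subseteq> G ==> ghom H \<pi>"
 by (auto simp: ghom_def)

lemma subgrp_image:
 assumes "ghom G \<pi>" "subgrp G" "subgrp H" "H \<subseteq> G"
 shows "subgrp (\<pi> ` H)"
 unfolding subgrp_def
proof (intro conjI ballI)
 show "1 \<in> \<pi> ` H" using ghom_one[OF assms(1,2)] assms(3) by (metis imageI subgrp_one)
 fix x assume "x \<in> \<pi> ` H"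
 then obtain h where h: "h \<in> H" "x = \<pi> h" by auto
 then have "inverse x = \<pi> (inverse h)" using ghom_inverse[OF assms(1,2)] assms(4) by auto
 then show "inverse x \<in> \<pi> ` H" using subgrp_inverse[OF assms(3) h(1)] by simp
 fix y assume "y \<in> \<pi> ` H"
 then obtain k where k: "k \<in> H" "y = \<pi> k" by auto
 have "h \<in> G" "k \<in> G" using h k assms(4) by auto
 then have "x * y = \<pi> (h * k)" using h k ghom_mult[OF assms(1)] by simp
 then show "x * y \<in> \<pi> ` H" using subgrp_mult[OF assms(3) h(1) k(1)] by simp
qed

lemma image_set_times:
 assumes "ghom G \<pi>" "A \<subseteq> G" "B \<subseteq> G"
 shows "\<pi> ` (A * B) = \<pi> ` A * \<pi> ` B"
proof (intro equalityI subsetI)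
 fix x assume "x \<in> \<pi> ` (A * B)"
 then obtain a b where "a \<in> A" "b \<in> B" "x = \<pi> (a * b)" by (auto elim!: in_set_timesE)
 moreover from this have "a \<in> G" "b \<in> G" using assms(2,3) by auto
 ultimately show "x \<in> \<pi> ` A * \<pi> ` B"
  using ghom_mult[OF assms(1), of a b] set_times_intro[of "\<pi> a" "\<pi> ` A" "\<pi> b" "\<pi> ` B"] by simp
next
 fix x assume "x \<in> \<pi> ` A * \<pi> ` B"
 then obtain a b where "a \<in> A" "b \<in> B" "x = \<pi> a * \<pi> b" by (auto elim!: in_set_timesE)
 moreover from this have "a \<in> G" "b \<in> G" using assms(2,3) by auto
 ultimately have "x = \<pi> (a * b)" "a * b \<in> A * B"
  using ghom_mult[OF assms(1), of a b] by (simp_all add: set_times_intro)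
 then show "x \<in> \<pi> ` (A * B)" by simp
qed

lemma nrm_image:
 assumes "ghom G \<pi>" "subgrp G" "nrm N G"
 shows "nrm (\<pi> ` N) (\<pi> ` G)"
 unfolding nrm_def
proof (intro conjI ballI)
 note N = nrmD[OF assms(3)]
 show "subgrp (\<pi> ` N)" using subgrp_image[OF assms(1,2) N(1,2)] .
 show "\<pi> ` N \<subseteq> \<pi> ` G" using N(2) by auto
 fix x n assume "x \<in> \<pi> ` G" "n \<in> \<pi> ` N"
 then obtain g k where gk: "g \<in> G" "x = \<pi> g" "k \<in> N" "n = \<pi> k" by auto
 have k: "k \<in> G" "inverse g \<in> G" "g * k \<in> G"
  using gk N(2) assms(2) by (auto intro: subgrp_mult subgrp_inverse)
 have "\<pi> (g * k * inverse g) = x * n * inverse x"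
  using gk k ghom_mult[OF assms(1)] ghom_inverse[OF assms(1,2)] by simp
 then show "x * n * inverse x \<in> \<pi> ` N" using N(3)[OF gk(1,3)] by (metis imageI)
qed

lemma subgrp_preimage:
 assumes "ghom G \<pi>" "subgrp G" "subgrp K"
 shows "subgrp {g \<in> G. \<pi> g \<in> K}"
 using assms ghom_one[OF assms(1,2)] ghom_mult[OF assms(1)] ghom_inverse[OF assms(1,2)]
 by (auto simp: subgrp_def)

lemma nrm_preimage:
 assumes "ghom G \<pi>" "subgrp G" "nrm K (\<pi> ` G)"
 shows "nrm {g \<in> G. \<pi> g \<in> K} G" "\<pi> ` {g \<in> G. \<pi> g \<in> K} = K"
proof -
 note K = nrmD[OF assms(3)]
 show "\<pi> ` {g \<in> G. \<pi> g \<in> K} = K" using K(2) by auto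
 show "nrm {g \<in> G. \<pi> g \<in> K} G" unfolding nrm_def
 proof (intro conjI ballI)
  show "subgrp {g \<in> G. \<pi> g \<in> K}" using subgrp_preimage[OF assms(1,2) K(1)] .
  fix g n assume g: "g \<in> G" and n: "n \<in> {g \<in> G. \<pi> g \<in> K}"
  have k: "n \<in> G" "inverse g \<in> G" "g * n \<in> G" "g * n * inverse g \<in> G"
   using g n assms(2) by (auto intro: subgrp_mult subgrp_inverse)
  have "\<pi> (g * n * inverse g) = \<pi> g * \<pi> n * inverse (\<pi> g)"
   using k g ghom_mult[OF assms(1)] ghom_inverse[OF assms(1,2)] by simp
  then show "g * n * inverse g \<in> {g \<in> G. \<pi> g \<in> K}" using K(3)[of "\<pi> g" "\<pi> n"] g n k by auto
 qed auto
qed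

lemma image_cyc:
 assumes "ghom G \<pi>" "subgrp G" "u \<in> G"
 shows "\<pi> ` cyc u = cyc (\<pi> u)"
 using ghom_power[OF assms] unfolding cyc_def by (auto simp: image_image)

lemma mem_of_image_mem:
 assumes "ghom G \<pi>" "subgrp G" and ker: "\<And>g. g \<in> G ==> \<pi> g = 1 ==> g \<in> N"
  and "subgrp A" "A \<subseteq> G" "N \<subseteq> A" "x \<in> G" "\<pi> x \<in> \<pi> ` A"
 shows "x \<in> A"
proof -
 obtain a where a: "a \<in> A" "\<pi> x = \<pi> a" using assms by auto
 have aG: "a \<in> G" "inverse a \<in> G" using a assms by (auto simp: subgrp_inverse)
 have "\<pi> (x * inverse a) = 1"
  using ghom_mult[OF assms(1) assms(7) aG(2)] ghom_inverse[OF assms(1,2) aG(1)] a(2) by simp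
 then have "x * inverse a \<in> A" using ker[of "x * inverse a"] assms aG by (auto intro: subgrp_mult)
 then show ?thesis using subgrp_mult_iff2[OF assms(4) subgrp_inverse[OF assms(4) a(1)]] by simp
qed

text \<open>Left translation on the cosets of \<open>N\<close>, extended by the identity on all
  other sets, is a permutation of finite support, and normality makes \<open>N\<close> the kernel.
  The quotient is the image of \<pi>, so that it is again a subset of a type in class
  \<open>grp\<close> and all preceding results apply to it.\<close>

lemma quotient_exists:
 fixes G N :: "'a::grp set"
 assumes G: "subgrp G" "finite G" and N: "nrm N G"
 shows "\<exists>\<pi> :: 'a \<Rightarrow> 'a set Perm.perm. ghom G \<pi> \<and> (\<forall>g\<in>G. \<pi> g = 1 \<longleftrightarrow> g \<in> N)"
proof -
 define C where "C = (\<lambda>g. (\<lambda>x. g * x) ` N) ` G"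
 define f where "f g = (\<lambda>Y. if Y \<in> C then (\<lambda>x. g * x) ` Y else Y)" for g
 have sN: "subgrp N" using nrmD[OF N] by simp
 have C: "(\<lambda>x. g * x) ` Y \<in> C" if "g \<in> G" "Y \<in> C" for g Y
  using that G by (auto simp: C_def image_image mult.assoc[symmetric] intro!: imageI subgrp_mult)
 have comp: "f (g * h) = f g \<circ> f h" if "g \<in> G" "h \<in> G" for g h
  using C that by (auto simp: f_def fun_eq_iff image_image mult.assoc)
 have f1: "f 1 = id" by (simp add: f_def fun_eq_iff)
 have perm: "f g \<in> {f. bij f \<and> finite {a. f a \<noteq> a}}" if g: "g \<in> G" for g
 proof -
  have ig: "inverse g \<in> G" using g G by (simp add: subgrp_inverse)
  have "f g \<circ> f (inverse g) = id" "f (inverse g) \<circ> f g = id"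
   using comp[OF g ig] comp[OF ig g] f1 by simp_all
  then have "bij (f g)" using o_bij by blast
  moreover have "{a. f g a \<noteq> a} \<subseteq> C" by (auto simp: f_def)
  moreover have "finite C" using G by (simp add: C_def)
  ultimately show ?thesis using finite_subset by blast
 qed
 define \<pi> where "\<pi> g = Perm (f g)" for g
 have ap: "apply (\<pi> g) = f g" if "g \<in> G" for g
  using Perm_inverse[OF perm[OF that]] by (simp add: \<pi>_def)
 have "ghom G \<pi>" unfolding ghom_def
 proof (intro ballI perm_eqI)
  fix g h a assume "g \<in> G" "h \<in> G"
  then show "apply (\<pi> (g * h)) a = apply (\<pi> g * \<pi> h) a"
   using ap comp G by (simp add: apply_times subgrp_mult)
 qed
 moreover have "\<pi> g = 1 \<longleftrightarrow> g \<in> N" if g: "g \<in> G" for g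
 proof
  assume "\<pi> g = 1"
  then have "f g = id" using ap[OF g] by simp
  moreover have "N \<in> C" unfolding C_def using G(1) by (intro image_eqI[of _ _ 1]) auto
  ultimately have "(\<lambda>x. g * x) ` N = N" by (metis f_def id_apply)
  then have "(\<lambda>x. g * x) ` N = (\<lambda>x. 1 * x) ` N" by simp
  then show "g \<in> N" using image_mult_eq_iff[OF sN, of g 1] by simp
 next
  assume gN: "g \<in> N"
  have "f g Y = Y" for Y
  proof (cases "Y \<in> C")
   case True
   then obtain h where h: "h \<in> G" "Y = (\<lambda>x. h * x) ` N" by (auto simp: C_def)
   have "inverse h * (g * h) \<in> N" using nrm_conj'[OF N G(1) h(1) gN] by (simp add: mult.assoc)
   then have "(\<lambda>x. (g * h) * x) ` N = Y" using image_mult_eq_iff[OF sN, of "g * h" h] h by simp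
   then show ?thesis using h True by (simp add: f_def image_image mult.assoc)
  qed (simp add: f_def)
  then show "\<pi> g = 1" using ap[OF g] by (intro perm_eqI) simp
 qed
 ultimately show ?thesis by blast
qed

subsection \<open>Sylow subgroups and derived subgroups\<close>

lemma sylow_exists:
 assumes G: "subgrp (G::'a::grp set)" "finite G" and p: "prime p" and d: "p ^ a dvd card G"
 shows "\<exists>H. subgrp H \<and> H \<subseteq> G \<and> card H = p ^ a"
proof -
 define M where "M = \<lparr>carrier = G, monoid.mult = (*), one = (1::'a)\<rparr>"
 have grp: "group M"
 proof (rule groupI)
  fix x assume "x \<in> carrier M"
  then show "\<exists>y\<in>carrier M. y \<otimes>\<^bsub>M\<^esub> x = \<one>\<^bsub>M\<^esub>"
   using G by (intro bexI[of _ "inverse x"]) (auto simp: M_def subgrp_inverse)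
 qed (use G in \<open>auto simp: M_def subgrp_mult mult.assoc\<close>)
 obtain m where "card G = p ^ a * m" using d by blast
 then have "\<exists>H. subgroup H M \<and> card H = p ^ a"
  using sylow_thm[OF p grp, of a m] G by (simp add: Coset.order_def M_def)
 then obtain H where H: "subgroup H M" "card H = p ^ a" by blast
 interpret H: subgroup H M by fact
 have HG: "H \<subseteq> G" using H.subset by (simp add: M_def)
 have "inverse x \<in> H" if "x \<in> H" for x
 proof -
  have xG: "x \<in> G" using that HG by auto
  have "inv\<^bsub>M\<^esub> x = inverse x"
   by (rule group.inv_equality[OF grp]) (use xG G in \<open>auto simp: M_def subgrp_inverse\<close>)
  then show ?thesis using H.m_inv_closed[OF that] by simp
 qed
 then have "subgrp H" using H.one_closed H.m_closed unfolding subgrp_def by (simp add: M_def)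
 then show ?thesis using HG H by blast
qed

text \<open>The number \<open>m\<close> of cosets of \<open>S\<close> is prime to \<open>p\<close>,
  so the \<open>p\<close>-group \<open>Q\<close> fixes one of them, say that of \<open>h\<close>;
  this says \<open>inverse h * q * h \<in> S\<close> for all \<open>q\<close> in
  \<open>Q\<close>.\<close>

lemma pgroup_conj_into:
 assumes G: "subgrp (G::'a::grp set)" "finite G" and p: "prime p"
  and S: "subgrp S" "S \<subseteq> G" "card G = card S * m" "\<not> p dvd m"
  and Q: "subgrp Q" "Q \<subseteq> G" "card Q = p ^ k"
 shows "\<exists>g\<in>G. cnj g Q \<subseteq> S"
proof -
 let ?C = "(\<lambda>g. (\<lambda>x. g * x) ` S) ` G"
 let ?F = "{Y \<in> ?C. \<forall>g\<in>Q. (\<lambda>x. g * x) ` Y = Y}"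
 have fQ: "finite Q" using Q G finite_subset by blast
 have "card G = card S * card ?C" using card_cosets[OF G S(1,2)] .
 moreover have "card S > 0" using card_subgrp_pos[OF S(1)] S(2) G finite_subset by blast
 ultimately have "card ?C = m" using S(3) by simp
 moreover have "p dvd card ?C \<longleftrightarrow> p dvd card ?F"
 proof (rule pgroup_fixed_points[OF Q(1) fQ p Q(3) action_translation])
  fix g Y assume "g \<in> Q" "Y \<in> ?C"
  then show "(\<lambda>x. g * x) ` Y \<in> ?C"
   using Q G by (auto simp: image_image mult.assoc[symmetric] intro!: imageI subgrp_mult)
 qed (use G in simp)
 ultimately have "\<not> p dvd card ?F" using S(4) by simp
 then have "?F \<noteq> {}" by (metis card.empty dvd_0_right)
 then obtain h where h: "h \<in> G" "\<And>g. g \<in> Q ==> (\<lambda>x. g * x) ` (\<lambda>x. h * x) ` S = (\<lambda>x. h * x) ` S" by auto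
 have "cnj (inverse h) Q \<subseteq> S"
 proof
  fix x assume "x \<in> cnj (inverse h) Q"
  then obtain q where q: "q \<in> Q" "x = inverse h * q * h" by (auto simp: cnj_def)
  have "(\<lambda>x. (q * h) * x) ` S = (\<lambda>x. h * x) ` S" using h(2)[OF q(1)] by (simp add: image_image mult.assoc)
  then show "x \<in> S" using image_mult_eq_iff[OF S(1), of "q * h" h] q by (simp add: mult.assoc)
 qed
 then show ?thesis using h G by (intro bexI[of _ "inverse h"]) (auto simp: subgrp_inverse)
qed

text \<open>A second prime divisor \<open>q\<close> would supply a subgroup of order
  \<open>q\<close>, whose nontrivial elements have order \<open>q\<close> and not a power of
  \<open>p\<close>.\<close>

lemma card_prime_power_exists:
 assumes D: "subgrp (D::'a::grp set)" "finite D" and p: "prime p"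
  and e: "\<And>x. x \<in> D ==> \<exists>k. x ^ (p ^ k) = 1"
 shows "\<exists>m. card D = p ^ m"
proof -
 have D0: "card D > 0" using card_subgrp_pos[OF D] .
 have "q = p" if q: "prime q" "q dvd card D" for q
 proof (rule ccontr)
  assume "q \<noteq> p"
  obtain H where H: "subgrp H" "H \<subseteq> D" "card H = q ^ 1"
   using sylow_exists[OF D q(1), of 1] q(2) by auto
  have "H \<noteq> {1}" using H(3) q(1) by auto
  then obtain x where x: "x \<in> H" "x \<noteq> 1" using H(1) subgrp_one by blast
  have fH: "finite H" using H(2) D finite_subset by blast
  have fc: "finite (cyc x)" using cyc_subset[OF H(1) x(1)] fH finite_subset by blast
  obtain k where k: "x ^ (p ^ k) = 1" using e x H by blast
  have "card (cyc x) dvd p ^ k" using k power_eq_1_iff[OF fc] by simp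
  moreover have "card (cyc x) dvd q" using power_eq_1_iff[OF fc] grp_power_card[OF H(1) fH x(1)] H(3) by simp
  moreover have "coprime (p ^ k) q" using primes_coprime[OF p q(1)] \<open>q \<noteq> p\<close> by simp
  ultimately have "card (cyc x) = 1" using coprime_common_divisor_nat by blast
  then have "x ^ 1 = 1" using power_eq_1_iff[OF fc, of 1] by simp
  then show False using x by simp
 qed
 then have "prime_factors (card D) \<subseteq> {p}" by auto
 then have "card D = p ^ multiplicity p (card D)"
  using D0 p by (metis card.empty empty_subsetI prime_factorization_exists_nat prod_mset_prime_factorization_nat
    image_mset_const_eq in_prime_factors_iff multiplicity_prime_power not_gr_zero subset_singletonD
    set_mset_subset_singletonD prod_mset_replicate_mset count_prime_factorization_prime
    count_replicate_mset)
 then show ?thesis by blast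
qed

section \<open>Derived subgroups, solvability and products in p-groups\<close>

definition gsp :: "'a::grp set \<Rightarrow> 'a set" where
 "gsp Y = \<Inter>{H. subgrp H \<and> Y \<subseteq> H}"

definition der :: "'a::grp set \<Rightarrow> 'a set" where
 "der D = gsp {x * y * inverse x * inverse y |x y. x \<in> D \<and> y \<in> D}"

lemma subgrp_gsp [simp]: "subgrp (gsp Y)"
 by (auto simp: gsp_def subgrp_def)

lemma gsp_least: "subgrp H ==> Y \<subseteq> H ==> gsp Y \<subseteq> H"
 by (auto simp: gsp_def)

lemma gsp_incl: "Y \<subseteq> gsp Y"
 by (auto simp: gsp_def)

lemma subgrp_der [simp]: "subgrp (der D)"
 by (simp add: der_def)

lemma commutator_in_der: "x \<in> D ==> y \<in> D ==> x * y * inverse x * inverse y \<in> der D"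
 unfolding der_def by (rule subsetD[OF gsp_incl]) blast

lemma der_least:
 assumes "subgrp H" "\<And>x y. x \<in> D ==> y \<in> D ==> x * y * inverse x * inverse y \<in> H"
 shows "der D \<subseteq> H"
 unfolding der_def by (rule gsp_least) (use assms in auto)

lemma der_subset: "subgrp D ==> der D \<subseteq> D"
 by (rule der_least) (auto intro!: subgrp_mult subgrp_inverse)

lemma der_mono: "C \<subseteq> D ==> der C \<subseteq> der D"
 by (rule der_least) (auto intro: commutator_in_der)

lemma nrm_der:
 assumes "nrm D G" "subgrp G"
 shows "nrm (der D) G"
 unfolding nrm_def
proof (intro conjI ballI)
 note D = nrmD[OF assms(1)]
 show "der D \<subseteq> G" using der_subset[OF D(1)] D(2) by blast
 fix g n assume g: "g \<in> G" and n: "n \<in> der D"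
 have ig: "inverse g \<in> G" using g assms(2) by (simp add: subgrp_inverse)
 have "der D \<subseteq> cnj (inverse g) (der D)"
 proof (rule der_least)
  show "subgrp (cnj (inverse g) (der D))" by (simp add: subgrp_cnj)
  fix x y assume xy: "x \<in> D" "y \<in> D"
  let ?x = "g * x * inverse g" and ?y = "g * y * inverse g"
  have "g * (x * y * inverse x * inverse y) * inverse g = ?x * ?y * inverse ?x * inverse ?y"
   by (simp add: mult.assoc)
  then show "x * y * inverse x * inverse y \<in> cnj (inverse g) (der D)"
   unfolding mem_cnj using commutator_in_der[OF D(3)[OF g xy(1)] D(3)[OF g xy(2)]] by simp
 qed
 then show "g * n * inverse g \<in> der D" using n by (auto simp: mem_cnj)
qed simp

lemma der_image:
 assumes "ghom G \<pi>" "subgrp G" "subgrp D" "D \<subseteq> G"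
 shows "\<pi> ` der D = der (\<pi> ` D)"
proof (intro equalityI)
 have dG: "der D \<subseteq> G" using der_subset[OF assms(3)] assms(4) by blast
 have c: "\<pi> (x * y * inverse x * inverse y) = \<pi> x * \<pi> y * inverse (\<pi> x) * inverse (\<pi> y)"
  if "x \<in> D" "y \<in> D" for x y
 proof -
  have "x \<in> G" "y \<in> G" using that assms(4) by auto
  then show ?thesis
   using ghom_mult[OF assms(1)] ghom_inverse[OF assms(1,2)] assms(2) by (simp add: subgrp_mult subgrp_inverse)
 qed
 have "der D \<subseteq> {g \<in> G. \<pi> g \<in> der (\<pi> ` D)}"
 proof (rule der_least[OF subgrp_preimage[OF assms(1,2)]])
  fix x y assume xy: "x \<in> D" "y \<in> D"
  have "x * y * inverse x * inverse y \<in> G" using xy assms by (auto intro!: subgrp_mult subgrp_inverse)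
  then show "x * y * inverse x * inverse y \<in> {g \<in> G. \<pi> g \<in> der (\<pi> ` D)}"
   using c[OF xy] commutator_in_der[of "\<pi> x" "\<pi> ` D" "\<pi> y"] xy by simp
 qed simp
 then show "\<pi> ` der D \<subseteq> der (\<pi> ` D)" by blast
 show "der (\<pi> ` D) \<subseteq> \<pi> ` der D"
 proof (rule der_least[OF subgrp_image[OF assms(1,2) _ dG]])
  fix x y assume "x \<in> \<pi> ` D" "y \<in> \<pi> ` D"
  then obtain a b where "a \<in> D" "b \<in> D" "x = \<pi> a" "y = \<pi> b" by blast
  then show "x * y * inverse x * inverse y \<in> \<pi> ` der D"
   using c[of a b] commutator_in_der[of a D b] by (metis imageI)
 qed simp
qed

lemma subgrp_der_pow: "subgrp D ==> subgrp ((der ^^ n) D)" "subgrp D ==> (der ^^ n) D \<subseteq> D"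
proof -
 show *: "subgrp D ==> subgrp ((der ^^ n) D)" for n by (induction n) auto
 show "subgrp D ==> (der ^^ n) D \<subseteq> D"
 proof (induction n)
  case (Suc n)
  then show ?case using der_subset[OF *[OF Suc.prems, of n]] by auto
 qed simp
qed

lemma der_pow_mono: "C \<subseteq> D ==> (der ^^ n) C \<subseteq> (der ^^ n) D"
 by (induction n) (auto intro!: der_mono)

lemma der_pow_image:
 assumes "ghom G \<pi>" "subgrp G" "subgrp D" "D \<subseteq> G"
 shows "\<pi> ` (der ^^ n) D = (der ^^ n) (\<pi> ` D)"
proof (induction n)
 case (Suc n)
 have "(der ^^ n) D \<subseteq> G" using subgrp_der_pow(2)[OF assms(3)] assms(4) by blast
 then show ?case using der_image[OF assms(1,2) subgrp_der_pow(1)[OF assms(3)]] Suc by simp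
qed simp

text \<open>The form in which solvability is used: no nontrivial subgroup is its own derived
  subgroup. With \<open>der_pow_image\<close> it passes to quotients and becomes the assumption
  \<open>slv\<close> of \<open>hconf\<close>.\<close>

lemma perfect_trivial:
 assumes "(der ^^ n) G = {1}" "D \<subseteq> G" "der D = D"
 shows "D \<subseteq> {1}"
proof -
 have "(der ^^ m) D = D" for m by (induction m) (auto simp: assms(3))
 then show ?thesis using der_pow_mono[OF assms(2), of n] assms(1) by simp
qed

text \<open>The index of \<open>Q \<inter> R\<close> in \<open>R\<close> is a power of
  \<open>p\<close> other than 1, so \<open>Q * R\<close> has at least \<open>p * card Q\<close>
  elements.\<close>

lemma index_prime_product:
 assumes P: "subgrp (P::'a::grp set)" "finite P" "card P = p ^ k" "prime p"
  and Q: "subgrp Q" "Q \<subseteq> P" "card P = p * card Q" and R: "subgrp R" "R \<subseteq> P" "\<not> R \<subseteq> Q"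
 shows "Q * R = P"
proof -
 have f: "finite Q" "finite R" using Q R P finite_subset by blast+
 have sI: "subgrp (Q \<inter> R)" using subgrp_Int[OF Q(1) R(1)] .
 obtain d where d: "card R = card (Q \<inter> R) * d"
  using card_subgrp_dvd[OF R(1) f(2) sI] by auto
 have pos: "card (Q \<inter> R) > 0" using card_subgrp_pos[OF sI] f by simp
 have "d \<noteq> 1"
 proof
  assume "d = 1"
  then have "Q \<inter> R = R" using d card_subset_eq[OF f(2), of "Q \<inter> R"] by simp
  then show False using R(3) by auto
 qed
 moreover have "d dvd p ^ k" using card_subgrp_dvd[OF P(1,2) R(1,2)] P(3) d by (metis dvd_mult_right)
 ultimately have pd: "p dvd d" using prime_power_proper_dvd[OF P(4)] by blast
 have "card (Q * R) * card (Q \<inter> R) = card Q * (card (Q \<inter> R) * d)" using card_set_times[OF Q(1) R(1) f] d by simp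
 then have "card (Q * R) = card Q * d" using pos by simp
 moreover have "d > 0" using d R f card_subgrp_pos by (metis gr0I mult_0_right)
 ultimately have "card P \<le> card (Q * R)" using pd Q(3) by (simp add: dvd_imp_le mult.commute)
 moreover have "Q * R \<subseteq> P" using set_times_subset[OF P(1) Q(2) R(2)] .
 ultimately show ?thesis using card_seteq[OF P(2)] by blast
qed

lemma finite_max_card:
 assumes "Z \<in> \<F>" "finite \<F>"
 obtains P where "P \<in> \<F>" "\<And>Q. Q \<in> \<F> ==> card Q \<le> card P"
proof -
 have "Max (card ` \<F>) \<in> card ` \<F>" using assms by (intro Max_in) auto
 then obtain P where "P \<in> \<F>" "card P = Max (card ` \<F>)" by auto
 then show ?thesis using that[of P] assms(2) by simp
qed

text \<open>This is the subgroup usually written \<open>O_p(G)\<close>: the product of two normal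
  \<open>p\<close>-subgroups is again one, so a normal \<open>p\<close>-subgroup of largest order
  contains all others.\<close>

lemma largest_normal_pgroup:
 assumes G: "subgrp (G::'a::grp set)" "finite G" and p: "prime p"
 obtains P where "nrm P G" "\<exists>m. card P = p ^ m" "\<And>Q m. nrm Q G ==> card Q = p ^ m ==> Q \<subseteq> P"
proof -
 let ?X = "{P. nrm P G \<and> (\<exists>m. card P = p ^ m)}"
 have "{1} \<in> ?X" using G by (auto simp: nrm_def intro: exI[of _ 0])
 moreover have "finite ?X" using finite_subset[of ?X "Pow G"] G by (auto simp: nrm_def)
 ultimately obtain P where P: "P \<in> ?X" "\<And>Q. Q \<in> ?X ==> card Q \<le> card P"
  by (rule finite_max_card) blast
 have "Q \<subseteq> P" if Q: "nrm Q G" "card Q = p ^ m" for Q m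
 proof -
  have fin: "finite P" "finite Q" using P Q G finite_subset by (auto simp: nrm_def)
  have nPQ: "nrm (P * Q) G" using nrm_times_nrm[OF _ Q(1) G(1)] P by blast
  have "card (P * Q) * card (P \<inter> Q) = card P * card Q" using card_set_times[OF _ _ fin] P Q by (auto simp: nrm_def)
  then have "card (P * Q) dvd card P * card Q" by (metis dvd_triv_left)
  moreover obtain k where "card P = p ^ k" using P by blast
  ultimately have "card (P * Q) dvd p ^ (k + m)" using Q by (simp add: power_add)
  then have "\<exists>k. card (P * Q) = p ^ k" using p divides_primepow_nat by blast
  then have "card (P * Q) \<le> card P" using P(2)[of "P * Q"] nPQ by blast
  moreover have "P \<subseteq> P * Q" using subset_set_times1[of Q P] Q by (simp add: nrm_def)
  ultimately have "P = P * Q" using card_seteq[of "P * Q" P] fin by (simp add: finite_set_times)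
  then show ?thesis using subset_set_times2[of P Q] P by (auto simp: nrm_def)
 qed
 then show ?thesis using that[of P] P by blast
qed

section \<open>Solvable groups with cyclic factorizations\<close>

text \<open>For a subgroup \<open>A\<close> of \<open>G\<close> this is the normal core, the
  intersection of all conjugates of \<open>A\<close> and the largest normal subgroup of
  \<open>G\<close> inside \<open>A\<close>.\<close>

definition corg :: "'a::grp set \<Rightarrow> 'a set \<Rightarrow> 'a set" where
 "corg G A = {x \<in> G. \<forall>g\<in>G. g * x * inverse g \<in> A}"

lemma nrm_corg:
 assumes "subgrp G" "subgrp A"
 shows "nrm (corg G A) G"
 unfolding nrm_def
proof (intro conjI ballI)
 show "subgrp (corg G A)" unfolding subgrp_def
 proof (intro conjI ballI)
  show "1 \<in> corg G A" using assms by (simp add: corg_def)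
  fix x assume x: "x \<in> corg G A"
  have "g * inverse x * inverse g \<in> A" if "g \<in> G" for g
  proof -
   have "inverse (g * x * inverse g) \<in> A" using x that assms(2) subgrp_inverse[of A] unfolding corg_def by blast
   then show ?thesis by (simp add: mult.assoc)
  qed
  then show "inverse x \<in> corg G A" using x assms by (simp add: corg_def subgrp_inverse)
  fix y assume y: "y \<in> corg G A"
  have "g * (x * y) * inverse g \<in> A" if "g \<in> G" for g
  proof -
   have "(g * x * inverse g) * (g * y * inverse g) \<in> A" using x y that assms(2) subgrp_mult[of A] unfolding corg_def by blast
   then show ?thesis by (simp add: mult.assoc)
  qed
  then show "x * y \<in> corg G A" using x y assms by (simp add: corg_def subgrp_mult)
 qed
 show "corg G A \<subseteq> G" by (auto simp: corg_def)
 fix g x assume g: "g \<in> G" and x: "x \<in> corg G A"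
 have "h * (g * x * inverse g) * inverse h \<in> A" if h: "h \<in> G" for h
 proof -
  have "(h * g) * x * inverse (h * g) \<in> A" using x subgrp_mult[OF assms(1) h g] unfolding corg_def by blast
  then show ?thesis by (simp add: mult.assoc)
 qed
 then show "g * x * inverse g \<in> corg G A"
  using g x assms(1) by (simp add: corg_def subgrp_mult subgrp_inverse)
qed

lemma corg_subset: "subgrp G ==> corg G A \<subseteq> A"
proof
 fix x assume "subgrp G" "x \<in> corg G A"
 then have "1 * x * inverse 1 \<in> A" unfolding corg_def using subgrp_one[of G] by blast
 then show "x \<in> A" by simp
qed

lemma nrm_subset_corg: "nrm N G ==> N \<subseteq> A ==> N \<subseteq> corg G A"
 unfolding nrm_def corg_def by blast

lemma product3_flip:
 assumes "subgrp G" "subgrp A" "subgrp N" "subgrp B" "A * N * B = G" "A \<subseteq> G" "N \<subseteq> G" "B \<subseteq> G"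
 shows "B * N * A = G"
proof (intro equalityI subsetI)
 fix g assume "g \<in> G"
 then have "inverse g \<in> A * N * B" using assms by (simp add: subgrp_inverse)
 then obtain a n b where h: "a \<in> A" "n \<in> N" "b \<in> B" "inverse g = a * n * b" by (auto elim!: in_set_timesE)
 then have "g = inverse (a * n * b)" by (metis grp_inverse_inverse)
 then have "g = inverse b * inverse n * inverse a" by (simp add: mult.assoc)
 then show "g \<in> B * N * A" using h assms by (auto intro!: set_times_intro subgrp_inverse)
next
 fix g assume "g \<in> B * N * A"
 then show "g \<in> G" using assms by (auto elim!: in_set_timesE intro!: subgrp_mult)
qed

lemma product2_flip:
 assumes "subgrp G" "subgrp A" "subgrp B" "A * B = G"
 shows "B * A = G"
proof -
 have "A * {1} * B = G" using assms(4) by (simp add: set_times_def)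
 moreover have "A \<subseteq> G" "B \<subseteq> G" "{1} \<subseteq> G"
  using assms subset_set_times1[of B A] subset_set_times2[of A B] by auto
 ultimately have "B * {1} * A = G" using product3_flip[of G A "{1}" B] assms by simp
 then show ?thesis by (simp add: set_times_def)
qed

lemma subgrp_of_cyc:
 assumes "finite (cyc (u::'a::grp))" "subgrp H" "H \<subseteq> cyc u"
 obtains y where "H = cyc y"
proof -
 define d where "d = (LEAST d. d > 0 \<and> u ^ d \<in> H)"
 have d: "d > 0 \<and> u ^ d \<in> H" unfolding d_def
  by (rule LeastI[of _ "card (cyc u)"]) (use finite_order(1,2)[OF assms(1)] assms(2) in simp)
 have dmin: "d \<le> e" if "e > 0" "u ^ e \<in> H" for e using that unfolding d_def by (simp add: Least_le)
 have "H \<subseteq> cyc (u ^ d)"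
 proof
  fix x assume x: "x \<in> H"
  then obtain i where i: "x = u ^ i" using assms(3) by (auto simp: cyc_def)
  have e: "u ^ i = (u ^ d) ^ (i div d) * u ^ (i mod d)"
   by (simp flip: power_mult power_add)
  have "(u ^ d) ^ (i div d) \<in> H" using d assms(2) by (simp add: subgrp_power)
  then have "u ^ (i mod d) \<in> H" using e x i subgrp_mult_iff1[OF assms(2)] by metis
  then have "i mod d = 0" using dmin[of "i mod d"] d by (metis gr0I leD mod_less_divisor)
  then show "x \<in> cyc (u ^ d)" using e i by simp
 qed
 moreover have "cyc (u ^ d) \<subseteq> H" using d cyc_subset[OF assms(2)] by blast
 ultimately show ?thesis using that by blast
qed

lemma coprime_powers_trivial:
 assumes "(c::'a::grp) ^ a = 1" "c ^ b = 1" "coprime a b" "finite (cyc c)"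
 shows "c = 1"
proof -
 have "card (cyc c) dvd a" "card (cyc c) dvd b" using assms power_eq_1_iff[OF assms(4)] by blast+
 then have "card (cyc c) = 1" using assms(3) coprime_common_divisor_nat by blast
 then have "c ^ 1 = 1" using power_eq_1_iff[OF assms(4), of 1] by simp
 then show ?thesis by simp
qed

subsection \<open>Two subgroups with a common cyclic supplement\<close>

text \<open>The situation after division by a maximal \<open>N\<close> with
  \<open>A * N * B \<noteq> G\<close>: \<open>norm\<close> records that maximality,
  \<open>gen\<close> says that \<open>f\<close> and \<open>g\<close> have no common left factor, and
  \<open>slv\<close> is solvability. The order of \<open>\<sigma>\<close> is then the index of
  \<open>A\<close> and of \<open>B\<close>, and \<open>order_four\<close> shows that it is
  four.\<close>

locale hconf =
 fixes G A B :: "'a::grp set" and \<sigma> :: 'a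
 assumes G: "subgrp G" "finite G"
  and A: "subgrp A" "A \<subseteq> G"
  and B: "subgrp B" "B \<subseteq> G"
  and sig: "\<sigma> \<in> G"
  and GAI: "A * cyc \<sigma> = G" and GBI: "B * cyc \<sigma> = G"
  and AB: "A * B \<noteq> G"
  and norm: "\<And>N. nrm N G ==> N \<noteq> {1} ==> A * N * B = G"
  and gen: "\<And>D g h. subgrp D ==> D \<subseteq> G ==> g \<in> G ==> h \<in> G ==> cnj g A \<subseteq> D ==> cnj h B \<subseteq> D ==> D = G"
  and slv: "\<And>D. subgrp D ==> D \<subseteq> G ==> der D = D ==> D = {1}"
begin

lemma swap: "hconf G B A \<sigma>"
proof
 show "B * A \<noteq> G" using product2_flip[OF G(1) B(1) A(1)] AB by blast
 fix N assume "nrm N G" "N \<noteq> {1}"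
 then show "B * N * A = G" using product3_flip[OF G(1) A(1) _ B(1) norm] A B by (auto simp: nrm_def)
qed (use G A B sig GAI GBI gen slv in auto)

lemma fin: "finite A" "finite B" "finite (cyc \<sigma>)" "subgrp (cyc \<sigma>)" "cyc \<sigma> \<subseteq> G"
proof -
 show c: "cyc \<sigma> \<subseteq> G" using cyc_subset[OF G(1) sig] .
 show "finite A" "finite B" "finite (cyc \<sigma>)" using finite_subset G(2) A B c by blast+
 then show "subgrp (cyc \<sigma>)" using subgrp_cyc by blast
qed

lemma finN: "nrm N G ==> finite N"
 using finite_subset G(2) by (auto simp: nrm_def)

lemma core:
 assumes "nrm N G" "N \<subseteq> A"
 shows "N = {1}"
proof (rule ccontr)
 assume "N \<noteq> {1}"
 then have "A * N * B = G" using norm assms by blast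
 moreover have "A * N = A"
  using set_times_subset[OF A(1), of A N] subset_set_times1[of N A] assms by (auto simp: nrm_def)
 ultimately show False using AB by simp
qed

lemma core_mem:
 assumes "x \<in> G" "\<And>g. g \<in> G ==> g * x * inverse g \<in> A"
 shows "x = 1"
proof -
 have "corg G A = {1}" using core[OF nrm_corg[OF G(1) A(1)] corg_subset[OF G(1)]] .
 moreover have "x \<in> corg G A" using assms by (simp add: corg_def)
 ultimately show ?thesis by simp
qed

text \<open>Writing \<open>g = a * i\<close> with \<open>i\<close> in the abelian group
  \<open>cyc \<sigma>\<close>, the conjugate of \<open>x\<close> by \<open>g\<close> is its
  conjugate by \<open>a\<close>. Hence all conjugates of such an \<open>x\<close> stay in
  \<open>A\<close>, and the core of \<open>A\<close> is trivial.\<close>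

lemma AI: "A \<inter> cyc \<sigma> = {1}"
proof (intro equalityI subsetI)
 fix x assume x: "x \<in> A \<inter> cyc \<sigma>"
 have "g * x * inverse g \<in> A" if gG: "g \<in> G" for g
 proof -
  have "g \<in> A * cyc \<sigma>" using gG GAI by simp
  then obtain a i where g: "a \<in> A" "i \<in> cyc \<sigma>" "g = a * i" by (rule in_set_timesE)
  have "i * x = x * i" using cyc_commute[OF g(2), of x] x by simp
  then have "i * x * inverse i = x" by (simp add: mult.assoc)
  then have "g * x * inverse g = a * x * inverse a" unfolding g(3) by (simp add: mult.assoc) (simp add: mult.assoc[symmetric])
  then show ?thesis using g x A by (simp add: subgrp_mult subgrp_inverse)
 qed
 then show "x \<in> {1}" using core_mem x A by blast
qed (use A fin in auto)

lemma card_GA: "card G = card A * card (cyc \<sigma>)"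
 using card_set_times[OF A(1) fin(4,1,3)] AI GAI by simp

lemma cnj_A_cyc:
 assumes "g \<in> G"
 obtains i where "i \<in> cyc \<sigma>" "cnj g A = cnj i A"
proof -
 have "cyc \<sigma> * A = G" using product2_flip[OF G(1) A(1) fin(4) GAI] .
 then obtain i a where g: "i \<in> cyc \<sigma>" "a \<in> A" "g = i * a" using assms by (auto elim!: in_set_timesE)
 then have "cnj g A = cnj i (cnj a A)" by simp
 then show ?thesis using that g cnj_self[OF A(1) g(2)] by simp
qed

text \<open>If the product were \<open>G\<close>, so would be the double coset of
  \<open>inverse g * h\<close>. It would contain 1, so \<open>inverse g * h\<close> would lie in
  \<open>A * B\<close>, and the double coset would be \<open>A * B\<close> itself.\<close>

lemma AB_cnj:
 assumes "g \<in> G" "h \<in> G"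
 shows "cnj g A * cnj h B \<noteq> G"
proof
 assume eq: "cnj g A * cnj h B = G"
 have fact: "\<exists>a\<in>A. \<exists>b\<in>B. x = a * (inverse g * h) * b" if "x \<in> G" for x
 proof -
  have "g * x * inverse h \<in> G" using that assms G by (auto intro!: subgrp_mult subgrp_inverse)
  then obtain a b where ab: "a \<in> A" "b \<in> B" "g * x * inverse h = (g * a * inverse g) * (h * b * inverse h)"
   unfolding eq[symmetric] by (auto simp: cnj_def elim!: in_set_timesE)
  have "x = inverse g * (g * x * inverse h) * h" by (simp add: mult.assoc)
  also have "\<dots> = a * (inverse g * h) * b" unfolding ab(3) by (simp add: mult.assoc)
  finally show ?thesis using ab by blast
 qed
 obtain a0 b0 where 0: "a0 \<in> A" "b0 \<in> B" "1 = a0 * (inverse g * h) * b0" using fact[OF subgrp_one[OF G(1)]] by blast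
 have k: "inverse g * h = inverse a0 * inverse b0"
 proof -
  have "inverse g * h = inverse a0 * (a0 * (inverse g * h) * b0) * inverse b0" by (simp add: mult.assoc)
  then show ?thesis unfolding 0(3)[symmetric] by simp
 qed
 have "G \<subseteq> A * B"
 proof
  fix x assume "x \<in> G"
  then obtain a b where ab: "a \<in> A" "b \<in> B" "x = a * (inverse g * h) * b" using fact by blast
  then have "x = (a * inverse a0) * (inverse b0 * b)" unfolding k by (simp add: mult.assoc)
  then show "x \<in> A * B" using ab 0 A B by (auto intro!: set_times_intro subgrp_mult subgrp_inverse)
 qed
 then show False using AB set_times_subset[OF G(1) A(2) B(2)] by blast
qed

lemma norm_cnj:
 assumes N: "nrm N G" "N \<noteq> {1}" and gh: "g \<in> G" "h \<in> G"
 shows "cnj g A * N * cnj h B = G"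
proof (intro equalityI subsetI)
 note n = nrmD[OF N(1)]
 fix x assume "x \<in> cnj g A * N * cnj h B"
 moreover have "cnj g A \<subseteq> G" "cnj h B \<subseteq> G" using cnj_subset[OF G(1)] A B gh by auto
 ultimately show "x \<in> G" using n(2) G by (auto elim!: in_set_timesE intro!: subgrp_mult)
next
 note n = nrmD[OF N(1)]
 fix x assume x: "x \<in> G"
 have "inverse g * h \<in> A * N * B" using gh G norm[OF N] by (auto intro!: subgrp_mult subgrp_inverse)
 then obtain a0 n0 b0 where 0: "a0 \<in> A" "n0 \<in> N" "b0 \<in> B" "inverse g * h = a0 * n0 * b0"
  by (auto elim!: in_set_timesE)
 have "inverse g * x * h \<in> A * N * B" using x gh G norm[OF N] by (auto intro!: subgrp_mult subgrp_inverse)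
 then obtain a1 n1 b1 where 1: "a1 \<in> A" "n1 \<in> N" "b1 \<in> B" "inverse g * x * h = a1 * n1 * b1"
  by (auto elim!: in_set_timesE)
 define m where "m = a0 * (n1 * inverse n0) * inverse a0"
 have m: "m \<in> N" unfolding m_def using n 0 1 A by (blast intro: subgrp_mult subgrp_inverse)
 have gm: "g * m * inverse g \<in> N" using n(3) gh m by blast
 have "x = g * (inverse g * x * h) * inverse h" by (simp add: mult.assoc)
 also have "\<dots> = g * (a1 * inverse a0) * m * (a0 * n0 * b0) * (inverse b0 * b1) * inverse h"
  unfolding 1(4) m_def by (simp add: mult.assoc)
 also have "\<dots> = (g * (a1 * inverse a0) * inverse g) * (g * m * inverse g) * (h * (inverse b0 * b1) * inverse h)"
  unfolding 0(4)[symmetric] by (simp add: mult.assoc)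
 finally have xe: "x = (g * (a1 * inverse a0) * inverse g) * (g * m * inverse g) * (h * (inverse b0 * b1) * inverse h)" .
 have "a1 * inverse a0 \<in> A" "inverse b0 * b1 \<in> B" using 0 1 A B by (auto intro!: subgrp_mult subgrp_inverse)
 then show "x \<in> cnj g A * N * cnj h B"
  unfolding xe cnj_def using gm by (intro set_times_intro imageI)
qed

text \<open>All assumptions survive independent conjugation of \<open>A\<close> and
  \<open>B\<close>. This freedom is used in \<open>order_four_prime\<close> to put both subgroups in
  good position relative to one Sylow subgroup.\<close>

lemma conj:
 assumes gh: "g \<in> G" "h \<in> G"
 shows "hconf G (cnj g A) (cnj h B) \<sigma>"
proof
 have cov: "cnj k C * cyc \<sigma> = G" if C: "subgrp C" "C \<subseteq> G" "C * cyc \<sigma> = G" and k: "k \<in> G" for C k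
 proof (intro equalityI subsetI)
  fix x assume x: "x \<in> G"
  have "cyc \<sigma> * C = G" using product2_flip[OF G(1) C(1) fin(4) C(3)] .
  then obtain i c where k': "i \<in> cyc \<sigma>" "c \<in> C" "k = i * c" using k by (auto elim!: in_set_timesE)
  then have kC: "cnj k C = cnj i C" using cnj_self[OF C(1) k'(2)] cnj_cnj[of i c C] by simp
  have "inverse i * x \<in> C * cyc \<sigma>" using k' x fin(5) G C(3) by (auto intro!: subgrp_mult subgrp_inverse)
  then obtain c j where c: "c \<in> C" "j \<in> cyc \<sigma>" "inverse i * x = c * j" by (auto elim!: in_set_timesE)
  have "x = i * (inverse i * x)" by simp
  also have "\<dots> = (i * c * inverse i) * (i * j)" unfolding c(3) by (simp add: mult.assoc)
  finally have xe: "x = (i * c * inverse i) * (i * j)" .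
  have "i * c * inverse i \<in> cnj i C" using c(1) by (simp add: cnj_def)
  then show "x \<in> cnj k C * cyc \<sigma>" unfolding kC xe
   using subgrp_mult[OF fin(4) k'(1) c(2)] by (rule set_times_intro)
 next
  fix x assume "x \<in> cnj k C * cyc \<sigma>"
  then show "x \<in> G" using cnj_subset[OF G(1) k C(2)] fin(5) G by (auto elim!: in_set_timesE intro!: subgrp_mult)
 qed
 show "cnj g A * cyc \<sigma> = G" "cnj h B * cyc \<sigma> = G" using cov A B GAI GBI gh by auto
 show "subgrp (cnj g A)" "cnj g A \<subseteq> G" "subgrp (cnj h B)" "cnj h B \<subseteq> G"
  using A B gh G by (simp_all add: subgrp_cnj cnj_subset)
 show "cnj g A * cnj h B \<noteq> G" using AB_cnj[OF gh] .
 show "cnj g A * N * cnj h B = G" if "nrm N G" "N \<noteq> {1}" for N using norm_cnj[OF that gh] .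
 fix D g' h' assume "subgrp D" "D \<subseteq> G" "g' \<in> G" "h' \<in> G" "cnj g' (cnj g A) \<subseteq> D" "cnj h' (cnj h B) \<subseteq> D"
 then show "D = G" using gen[of D "g' * g" "h' * h"] gh G by (simp add: subgrp_mult)
qed (use G sig slv in auto)

text \<open>The basic obstruction: if a nontrivial normal \<open>N\<close> were inside a product of
  conjugates, the middle factor in \<open>norm_cnj\<close> could be absorbed.\<close>

lemma no_product:
 assumes "nrm N G" "N \<noteq> {1}" "g \<in> G" "h \<in> G"
 shows "\<not> N \<subseteq> cnj g A * cnj h B"
proof
 assume N: "N \<subseteq> cnj g A * cnj h B"
 have s: "subgrp (cnj g A)" "subgrp (cnj h B)" using A B by (auto simp: subgrp_cnj)
 have "G \<subseteq> cnj g A * cnj h B"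
 proof
  fix x assume "x \<in> G"
  then have "x \<in> cnj g A * N * cnj h B" using norm_cnj[OF assms] by simp
  then obtain a n b where x: "a \<in> cnj g A" "n \<in> N" "b \<in> cnj h B" "x = a * n * b" by (auto elim!: in_set_timesE)
  then obtain a' b' where "a' \<in> cnj g A" "b' \<in> cnj h B" "n = a' * b'" using N by (blast elim!: in_set_timesE)
  then have "x = (a * a') * (b' * b)" "a * a' \<in> cnj g A" "b' * b \<in> cnj h B"
   using x s by (simp_all add: mult.assoc subgrp_mult)
  then show "x \<in> cnj g A * cnj h B" by (simp add: set_times_intro)
 qed
 moreover have "cnj g A * cnj h B \<subseteq> G" using set_times_subset[OF G(1)] cnj_subset[OF G(1)] A B assms by simp
 ultimately show False using AB_cnj[OF assms(3,4)] by blast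
qed

text \<open>As \<open>G = A * cyc \<sigma>\<close> with trivial intersection, every group between
  \<open>A\<close> and \<open>G\<close> is \<open>A\<close> times its part of the cyclic group. Thus
  the index of \<open>A \<inter> N\<close> in \<open>N\<close> is the order of a subgroup of a
  cyclic group.\<close>

lemma index_I:
 assumes "nrm N G"
 shows "A * N = A * (A * N \<inter> cyc \<sigma>)" "card (A * N) = card A * card (A * N \<inter> cyc \<sigma>)"
  "card N = card (A * N \<inter> cyc \<sigma>) * card (A \<inter> N)" "subgrp (A * N)" "A * N \<subseteq> G" "finite (A * N)"
proof -
 note n = nrmD[OF assms]
 show s: "subgrp (A * N)" using subgrp_times_nrm[OF assms G(1) A] .
 show AG: "A * N \<subseteq> G" using set_times_subset[OF G(1) A(2) n(2)] .
 show "finite (A * N)" using finite_subset[OF AG G(2)] .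
 have AA: "A \<subseteq> A * N" using subset_set_times1[OF n(1)] .
 show e: "A * N = A * (A * N \<inter> cyc \<sigma>)"
 proof (intro equalityI subsetI)
  fix x assume x: "x \<in> A * N"
  then have "x \<in> A * cyc \<sigma>" using AG GAI by auto
  then obtain a i where ai: "a \<in> A" "i \<in> cyc \<sigma>" "x = a * i" by (rule in_set_timesE)
  then have "i \<in> A * N" using x AA subgrp_mult_iff1[OF s, of a i] by auto
  then show "x \<in> A * (A * N \<inter> cyc \<sigma>)" using ai by (auto intro: set_times_intro)
 next
  fix x assume "x \<in> A * (A * N \<inter> cyc \<sigma>)"
  then obtain a i where "a \<in> A" "i \<in> A * N \<inter> cyc \<sigma>" "x = a * i" by (rule in_set_timesE)
  then show "x \<in> A * N" using AA s by (auto intro: subgrp_mult)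
 qed
 have "A \<inter> (A * N \<inter> cyc \<sigma>) = {1}" using AI AA A by auto
 then show c: "card (A * N) = card A * card (A * N \<inter> cyc \<sigma>)"
  using card_set_times[OF A(1) subgrp_Int[OF s fin(4)] fin(1)] fin(3) e by simp
 have "card (A * N) * card (A \<inter> N) = card A * card N" using card_set_times[OF A(1) n(1) fin(1) finN[OF assms]] .
 then show "card N = card (A * N \<inter> cyc \<sigma>) * card (A \<inter> N)"
  using c card_subgrp_pos[OF A(1) fin(1)] by simp
qed

text \<open>Suppose both were nontrivial. For each of them the number of elements of
  \<open>A * N' * B = G\<close> relates \<open>card (A * N' \<inter> cyc \<sigma>)\<close> to the
  growth from \<open>A \<inter> B\<close> to \<open>A * N' \<inter> B\<close>. The two cyclic orders
  are coprime, so that of \<open>V\<close> divides the corresponding growth \<open>cV\<close>; this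
  makes \<open>A * B\<close> as large as \<open>G\<close>.\<close>

lemma normal_coprime_trivial:
 assumes V: "nrm V G" "V \<noteq> {1}" "prime p" "card V = p ^ m" and N: "nrm N G" "\<not> p dvd card N"
 shows "N = {1}"
proof (rule ccontr)
 assume N1: "N \<noteq> {1}"
 have main: "card G * card (A * N' \<inter> B) = card (A * N' \<inter> cyc \<sigma>) * (card A * card B) \<and> card (A \<inter> B) dvd card (A * N' \<inter> B)"
  if N': "nrm N' G" "N' \<noteq> {1}" for N'
 proof -
  note i = index_I[OF N'(1)]
  have "card (A * N' * B) * card (A * N' \<inter> B) = card (A * N') * card B"
   using card_set_times[OF i(4) B(1) i(6) fin(2)] .
  moreover have "card (A \<inter> B) dvd card (A * N' \<inter> B)"
  proof (rule card_subgrp_dvd)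
   show "A \<inter> B \<subseteq> A * N' \<inter> B" using subset_set_times1[of N' A] N' by (auto simp: nrm_def)
  qed (use i fin subgrp_Int A B in auto)
  ultimately show ?thesis using norm[OF N'] i(2) by simp
 qed
 let ?iV = "card (A * V \<inter> cyc \<sigma>)" and ?iN = "card (A * N \<inter> cyc \<sigma>)"
 have AB0: "card (A \<inter> B) > 0" using card_subgrp_pos[OF subgrp_Int[OF A(1) B(1)]] fin by simp
 obtain cV cN where c: "card (A * V \<inter> B) = card (A \<inter> B) * cV" "card (A * N \<inter> B) = card (A \<inter> B) * cN"
  using main[OF V(1,2)] main[OF N(1) N1] by (auto elim!: dvdE)
 have m: "card G * (card (A \<inter> B) * cV) = ?iV * (card A * card B)"
  "card G * (card (A \<inter> B) * cN) = ?iN * (card A * card B)"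
  using main[OF V(1,2)] main[OF N(1) N1] unfolding c by auto
 have "(card G * card (A \<inter> B)) * (?iN * cV) = ?iN * (card G * (card (A \<inter> B) * cV))" by simp
 also have "\<dots> = ?iV * (card G * (card (A \<inter> B) * cN))" unfolding m by simp
 also have "\<dots> = (card G * card (A \<inter> B)) * (?iV * cN)" by simp
 finally have e: "?iN * cV = ?iV * cN" using AB0 card_subgrp_pos[OF G] by simp
 have "coprime ?iV ?iN"
 proof -
  have "?iV dvd p ^ m" "?iN dvd card N" using index_I(3)[OF V(1)] index_I(3)[OF N(1)] V(4) by (metis dvd_triv_left)+
  moreover have "coprime (p ^ m) (card N)" using N(2) V(3) by (simp add: prime_imp_coprime)
  ultimately show ?thesis by (meson coprime_divisors)
 qed
 then have "?iV dvd cV" using e by (metis coprime_dvd_mult_right_iff dvd_triv_left)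
 moreover have "cV > 0"
 proof -
  have "card (A * V \<inter> B) > 0"
   using card_subgrp_pos[OF subgrp_Int[OF index_I(4)[OF V(1)] B(1)]] fin by simp
  then show ?thesis using c by (metis gr0I mult_0_right)
 qed
 ultimately have "?iV \<le> cV" by (simp add: dvd_imp_le)
 then have "card G * (card (A \<inter> B) * ?iV) \<le> card G * (card (A \<inter> B) * cV)" by simp
 also have "\<dots> = ?iV * (card A * card B)" using main[OF V(1,2)] c by simp
 also have "card A * card B = card (A * B) * card (A \<inter> B)" using card_set_times[OF A(1) B(1) fin(1,2)] by simp
 finally have "(card (A \<inter> B) * ?iV) * card G \<le> (card (A \<inter> B) * ?iV) * card (A * B)" by (simp add: algebra_simps)
 moreover have "?iV > 0" using card_subgrp_pos[OF subgrp_Int[OF index_I(4)[OF V(1)] fin(4)]] fin by simp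
 ultimately have "card G \<le> card (A * B)" using AB0 by simp
 moreover have "A * B \<subseteq> G" using set_times_subset[OF G(1) A(2) B(2)] .
 ultimately show False using AB card_seteq[OF G(2)] by blast
qed

lemma G_nontrivial: "G \<noteq> {1}"
proof
 assume "G = {1}"
 then have "A = {1}" "B = {1}" using A B subgrp_one by blast+
 then show False using AB \<open>G = {1}\<close> by (simp add: set_times_def)
qed

lemma der_proper:
 assumes "nrm D G" "D \<noteq> {1}"
 shows "nrm (der D) G" "der D \<subseteq> D" "der D \<noteq> D"
 using nrm_der[OF assms(1) G(1)] der_subset slv[of D] assms by (auto simp: nrm_def)

text \<open>A nontrivial normal subgroup of least order is elementary abelian: its derived subgroup
  is a proper normal subgroup, hence trivial, and its elements of exponent \<open>p\<close> form a
  nontrivial normal subgroup, hence everything.\<close>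

lemma minimal_normal:
 obtains V p m where "nrm V G" "V \<noteq> {1}" "prime p" "card V = p ^ m"
  "\<And>x y. x \<in> V ==> y \<in> V ==> x * y = y * x" "\<And>x. x \<in> V ==> x ^ p = 1"
  "\<And>N. nrm N G ==> N \<subseteq> V ==> N \<noteq> {1} ==> N = V"
proof -
 define \<F> where "\<F> = {N. nrm N G \<and> N \<noteq> {1}}"
 have "G \<in> \<F>" using nrm_refl[OF G(1)] G_nontrivial by (simp add: \<F>_def)
 then obtain V where V: "V \<in> \<F>" "\<And>N. N \<in> \<F> ==> card V \<le> card N"
  using ex_has_least_nat[of "\<lambda>N. N \<in> \<F>" G card] by blast
 have nV: "nrm V G" "V \<noteq> {1}" using V by (auto simp: \<F>_def)
 note v = nrmD[OF nV(1)]
 have min: "N = V" if "nrm N G" "N \<subseteq> V" "N \<noteq> {1}" for N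
  using V(2)[of N] that card_seteq[OF finN[OF nV(1)] that(2)] by (simp add: \<F>_def)
 have der1: "der V = {1}" using der_proper[OF nV] min by blast
 have comm: "x * y = y * x" if "x \<in> V" "y \<in> V" for x y
 proof -
  have "x * y * inverse x * inverse y = 1" using commutator_in_der[OF that] der1 by simp
  then have "x * y * inverse x * inverse y * (y * x) = y * x" by simp
  then show ?thesis by (simp add: mult.assoc)
 qed
 have "card V \<noteq> 1" using nV subgrp_one[OF v(1)] by (auto simp: card_1_singleton_iff)
 then obtain p where p: "prime p" "p dvd card V" using prime_factor_nat by blast
 define W where "W = {x \<in> V. x ^ p = 1}"
 have "nrm W G" unfolding nrm_def
 proof (intro conjI ballI)
  show "subgrp W" unfolding subgrp_def
  proof (intro conjI ballI)
   show "1 \<in> W" using v by (simp add: W_def)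
   fix x assume x: "x \<in> W"
   have "inverse x ^ p * x ^ p = (inverse x * x) ^ p"
    by (rule power_commuting_mult[symmetric]) simp
   then have "inverse x ^ p = 1" using x by (simp add: W_def)
   then show "inverse x \<in> W" using x v by (simp add: W_def subgrp_inverse)
   fix y assume "y \<in> W"
   then show "x * y \<in> W" using x v power_commuting_mult[OF comm, of x y p] by (simp add: W_def subgrp_mult)
  qed
  show "W \<subseteq> G" using v by (auto simp: W_def)
  fix g n assume g: "g \<in> G" "n \<in> W"
  have "(g * n * inverse g) ^ k = g * n ^ k * inverse g" for k
   by (induction k) (simp_all add: mult.assoc)
  then show "g * n * inverse g \<in> W" using g v(3) by (simp add: W_def)
 qed
 moreover have "W \<noteq> {1}"
 proof -
  obtain H where H: "subgrp H" "H \<subseteq> V" "card H = p ^ 1"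
   using sylow_exists[OF v(1) finN[OF nV(1)] p(1), of 1] p(2) by auto
  have HW: "H \<subseteq> W"
  proof
   fix x assume x: "x \<in> H"
   have "x ^ card H = 1" using grp_power_card[OF H(1) finite_subset[OF H(2) finN[OF nV(1)]] x] .
   then show "x \<in> W" using x H(2,3) by (auto simp: W_def)
  qed
  show ?thesis
  proof
   assume "W = {1}"
   then have "H = {1}" using HW subgrp_one[OF H(1)] by blast
   then show False using H(3) prime_gt_1_nat[OF p(1)] by simp
  qed
 qed
 ultimately have "W = V" using min by (auto simp: W_def)
 then have exp: "x ^ p = 1" if "x \<in> V" for x using that by (auto simp: W_def)
 obtain m where "card V = p ^ m"
  using card_prime_power_exists[OF v(1) finN[OF nV(1)] p(1)] exp by (metis power_one_right)
 then show ?thesis using that[OF nV p(1) _ comm exp min] by blast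
qed

text \<open>Normal subgroups of order prime to \<open>p\<close> are trivial, so \<open>P\<close>,
  the largest normal \<open>p\<close>-subgroup, contains its own centralizer \<open>K\<close>.
  Otherwise take a smallest normal \<open>D\<close> inside \<open>K\<close> but not inside
  \<open>P\<close>. Its derived subgroup lies in \<open>P\<close> and is centralized by
  \<open>D\<close>, so the elements of \<open>D\<close> of order prime to \<open>p\<close> form a
  normal subgroup. This is trivial, \<open>D\<close> is a \<open>p\<close>-group, and
  \<open>D\<close> lies in \<open>P\<close> after all.\<close>

lemma centralizer_in_P:
 assumes p: "prime p" and V: "nrm V G" "V \<noteq> {1}" "card V = p ^ m"
  and P: "nrm P G" "card P = p ^ l" "\<And>Q k. nrm Q G ==> card Q = p ^ k ==> Q \<subseteq> P"
  and x: "x \<in> G" "\<And>y. y \<in> P ==> x * y = y * x"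
 shows "x \<in> P"
proof (rule ccontr)
 assume xP: "x \<notin> P"
 define K where "K = {x \<in> G. \<forall>y\<in>P. x * y = y * x}"
 have nK: "nrm K G" unfolding nrm_def
 proof (intro conjI ballI)
  show "subgrp K" unfolding subgrp_def
  proof (intro conjI ballI)
   show "1 \<in> K" using G by (simp add: K_def)
   fix u assume u: "u \<in> K"
   then show "inverse u \<in> K" using G commute_inverse[of _ u] by (auto simp: K_def subgrp_inverse)
   fix v assume v: "v \<in> K"
   have "y * (u * v) = (u * v) * y" if "y \<in> P" for y
    by (rule commute_mult) (use u v that in \<open>auto simp: K_def\<close>)
   then show "u * v \<in> K" using u v G by (auto simp: K_def subgrp_mult)
  qed
  fix g n assume g: "g \<in> G" and n: "n \<in> K"
  have "(g * n * inverse g) * y = y * (g * n * inverse g)" if y: "y \<in> P" for y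
  proof -
   have "inverse g * y * g \<in> P" using nrm_conj'[OF P(1) G(1) g y] .
   then have c: "n * (inverse g * y * g) = (inverse g * y * g) * n" using n by (simp add: K_def)
   have "(g * n * inverse g) * y = g * (n * (inverse g * y * g)) * inverse g" by (simp add: mult.assoc)
   also have "\<dots> = y * (g * n * inverse g)" unfolding c by (simp add: mult.assoc)
   finally show ?thesis .
  qed
  then show "g * n * inverse g \<in> K" using g n G by (auto simp: K_def intro!: subgrp_mult subgrp_inverse)
 qed (auto simp: K_def)
 define \<F> where "\<F> = {D. nrm D G \<and> D \<subseteq> K \<and> \<not> D \<subseteq> P}"
 have "K \<in> \<F>" using nK x xP by (auto simp: \<F>_def K_def)
 then obtain D where D: "D \<in> \<F>" "\<And>N. N \<in> \<F> ==> card D \<le> card N"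
  using ex_has_least_nat[of "\<lambda>N. N \<in> \<F>" K card] by blast
 have nD: "nrm D G" "D \<subseteq> K" "\<not> D \<subseteq> P" using D by (auto simp: \<F>_def)
 note d = nrmD[OF nD(1)]
 have fD: "finite D" using finN[OF nD(1)] .
 have "D \<noteq> {1}" using nD(3) P by (auto simp: nrm_def)
 note dd = der_proper[OF nD(1) this]
 have "der D \<subseteq> P"
 proof (rule ccontr)
  assume "\<not> der D \<subseteq> P"
  then have "der D \<in> \<F>" using dd nD by (auto simp: \<F>_def)
  then show False using D(2)[of "der D"] card_seteq[OF fD dd(2)] dd(3) by simp
 qed
 have fc: "finite (cyc u)" if "u \<in> G" for u using cyc_subset[OF G(1) that] G(2) finite_subset by blast
 \<comment> \<open>The commutator lies in \<open>P\<close> and commutes with \<open>u\<close>, so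
   its order divides both \<open>n\<close> and a power of \<open>p\<close>.\<close>
 have central: "u * v = v * u" if uv: "u \<in> D" "v \<in> D" and n: "u ^ n = 1" "\<not> p dvd n" for u v n
 proof -
  define c where "c = u * v * inverse u * inverse v"
  have cP: "c \<in> P" using commutator_in_der[OF uv] \<open>der D \<subseteq> P\<close> by (auto simp: c_def)
  have cG: "c \<in> G" using cP P by (auto simp: nrm_def)
  have "u * c = c * u" "v * c = c * v" using uv nD(2) cP by (auto simp: K_def)
  have "u * v = c * v * u" by (simp add: c_def mult.assoc)
  then have e: "inverse c * u = v * u * inverse v"
  proof -
   have "c * (v * u * inverse v) = u" by (simp add: c_def mult.assoc)
   then have "inverse c * (c * (v * u * inverse v)) = inverse c * u" by simp
   then show ?thesis by simp
  qed
  have "(v * u * inverse v) ^ k = v * u ^ k * inverse v" for k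
   by (induction k) (simp_all add: mult.assoc)
  then have "(inverse c * u) ^ n = 1" using e n by simp
  moreover have "(inverse c * u) ^ n = inverse c ^ n * u ^ n"
   by (rule power_commuting_mult) (use commute_inverse[OF \<open>u * c = c * u\<close>] in simp)
  ultimately have "inverse c ^ n = 1" using n by simp
  moreover have "inverse c ^ (p ^ l) = 1"
   using grp_power_card[OF nrmD(1)[OF P(1)] finN[OF P(1)] subgrp_inverse[OF nrmD(1)[OF P(1)] cP]] P(2) by simp
  moreover have "coprime n (p ^ l)" using n(2) p prime_imp_coprime coprime_commute by (metis coprime_power_right_iff)
  ultimately have "inverse c = 1" using coprime_powers_trivial fc[of "inverse c"] cG G by (blast intro: subgrp_inverse)
  then have "c = 1" by simp
  then show ?thesis using \<open>u * v = c * v * u\<close> by simp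
 qed
 define E where "E = {u \<in> D. \<exists>n. u ^ n = 1 \<and> \<not> p dvd n}"
 have nE: "nrm E G" unfolding nrm_def
 proof (intro conjI ballI)
  show "subgrp E" unfolding subgrp_def
  proof (intro conjI ballI)
   show "1 \<in> E" using d p by (auto simp: E_def intro!: exI[of _ 1])
   fix u assume "u \<in> E"
   then obtain n where u: "u \<in> D" "u ^ n = 1" "\<not> p dvd n" by (auto simp: E_def)
   have "inverse u ^ n * u ^ n = (inverse u * u) ^ n" by (rule power_commuting_mult[symmetric]) simp
   then have "inverse u ^ n = 1" using u by simp
   then show "inverse u \<in> E" using u d by (auto simp: E_def subgrp_inverse)
   fix v assume "v \<in> E"
   then obtain k where v: "v \<in> D" "v ^ k = 1" "\<not> p dvd k" by (auto simp: E_def)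
   have "(u * v) ^ (n * k) = (u ^ n) ^ k * (v ^ k) ^ n"
    using power_commuting_mult[OF central[OF u(1) v(1) u(2,3)], of "n * k"]
    by (simp add: power_mult[symmetric] mult.commute[of k n])
   then have "(u * v) ^ (n * k) = 1" using u v by simp
   moreover have "\<not> p dvd n * k" using u v p prime_dvd_mult_iff by blast
   ultimately show "u * v \<in> E" using u v d by (auto simp: E_def subgrp_mult)
  qed
  show "E \<subseteq> G" using d by (auto simp: E_def)
  fix g u assume g: "g \<in> G" and "u \<in> E"
  then obtain n where u: "u \<in> D" "u ^ n = 1" "\<not> p dvd n" by (auto simp: E_def)
  have "(g * u * inverse g) ^ k = g * u ^ k * inverse g" for k
   by (induction k) (simp_all add: mult.assoc)
  then have "(g * u * inverse g) ^ n = 1" using u by simp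
  then show "g * u * inverse g \<in> E" using d(3)[OF g u(1)] u by (auto simp: E_def)
 qed
 have "\<not> p dvd card E"
 proof
  assume "p dvd card E"
  then obtain H where H: "subgrp H" "H \<subseteq> E" "card H = p ^ 1"
   using sylow_exists[OF nrmD(1)[OF nE] finN[OF nE] p, of 1] by auto
  have "H \<noteq> {1}" using H p by auto
  then obtain u where u: "u \<in> H" "u \<noteq> 1" using H(1) subgrp_one by blast
  then obtain n where n: "u ^ n = 1" "\<not> p dvd n" using H by (auto simp: E_def)
  have "u ^ p = 1" using grp_power_card[OF H(1) finite_subset[OF H(2) finN[OF nE]] u(1)] H(3) by simp
  moreover have "coprime n p" using n(2) p prime_imp_coprime coprime_commute by blast
  moreover have "u \<in> G" using u H nrmD(2)[OF nE] by blast
  ultimately show False using coprime_powers_trivial[OF n(1)] fc u by blast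
 qed
 then have E1: "E = {1}" using normal_coprime_trivial[OF V(1,2) p V(3) nE] by blast
 have "\<exists>k. u ^ (p ^ k) = 1" if u: "u \<in> D" for u
 proof -
  let ?o = "card (cyc u)"
  have uG: "u \<in> G" using u d by auto
  have o: "?o > 0" "u ^ ?o = 1" using finite_order(1,2)[OF fc[OF uG]] by auto
  obtain r where r: "?o = p ^ multiplicity p ?o * r" "\<not> p dvd r"
   using multiplicity_decompose'[of ?o p] o p by (metis not_prime_unit gr_implies_not0)
  then have "(u ^ (p ^ multiplicity p ?o)) ^ r = 1" using o(2) by (metis power_mult)
  then have "u ^ (p ^ multiplicity p ?o) \<in> E" using r u d by (auto simp: E_def subgrp_power)
  then show ?thesis using E1 by blast
 qed
 then obtain k where "card D = p ^ k" using card_prime_power_exists[OF d(1) fD p] by blast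
 then show False using P(3) nD by blast
qed

end

lemma conj_trivial: "a * b = b * a ==> a * b * inverse a = (b::'a::grp)"
 by (simp add: mult.assoc)

context hconf
begin

text \<open>A cyclic group cannot act regularly by affine maps on an elementary abelian \<open>p\<close>-group of rank
 two, unless \<open>p = 2\<close>, nor on one of rank three.\<close>

lemma affine_bound:
 assumes V: "nrm V G" "V \<noteq> {1}" "prime p" "card V = p ^ m"
  and comm: "\<And>x y. x \<in> V ==> y \<in> V ==> x * y = y * x" and exp: "\<And>x. x \<in> V ==> x ^ p = 1"
 shows "card V \<le> (if p = 2 then 4 else p) * card (A \<inter> V)"
proof -
 note v = nrmD[OF V(1)]
 have fV: "finite V" using finN[OF V(1)] .
 note iI = index_I[OF V(1)]
 define VA where "VA = A \<inter> V"
 have sVA: "subgrp VA" "VA \<subseteq> V" using subgrp_Int A v by (auto simp: VA_def)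
 \<comment> \<open>By \<open>index_I\<close>, \<open>cyc y\<close> is a transversal of
   \<open>A\<close> in \<open>A * V\<close>; through \<open>y = \<alpha> * w\<close> it acts by
   affine maps, with a regular orbit, on \<open>V / (A \<inter> V)\<close>.\<close>
 obtain y where y: "A * V \<inter> cyc \<sigma> = cyc y"
  using subgrp_of_cyc[OF fin(3) subgrp_Int[OF iI(4) fin(4)]] by blast
 have yAV: "y \<in> A * V" "y \<in> G" using y self_in_cyc[of y] fin(5) by auto
 obtain \<alpha> w where aw: "\<alpha> \<in> A" "w \<in> V" "y = \<alpha> * w" using yAV(1) by (rule in_set_timesE)
 have aG: "\<alpha> \<in> G" "w \<in> G" using aw A v by auto
 \<comment> \<open>The linear part of the affine action is \<open>act\<close>; in additive notation
   \<open>\<delta>\<close> is \<open>act\<close> minus the identity, a nilpotent operator because a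
   \<open>p\<close>-group acts.\<close>
 define act where "act x = inverse \<alpha> * x * \<alpha>" for x
 define \<delta> where "\<delta> x = inverse x * act x" for x
 have actV: "act x \<in> V" if "x \<in> V" for x unfolding act_def using nrm_conj'[OF V(1) G(1) aG(1) that] .
 have dV: "\<delta> x \<in> V" if "x \<in> V" for x unfolding \<delta>_def using actV[OF that] that v(1) by (simp add: subgrp_mult subgrp_inverse)
 have act_mult: "act (x * x') = act x * act x'" for x x' by (simp add: act_def mult.assoc)
 have act_inv: "act (inverse x) = inverse (act x)" for x by (simp add: act_def mult.assoc)
 have actd: "act x = x * \<delta> x" for x by (simp add: \<delta>_def)
 have d_mult: "\<delta> (x * x') = \<delta> x * \<delta> x'" if "x \<in> V" "x' \<in> V" for x x'
 proof -
  have "\<delta> (x * x') = inverse x' * (inverse x * act x) * act x'" by (simp add: \<delta>_def act_mult mult.assoc)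
  also have "inverse x' * (inverse x * act x) = (inverse x * act x) * inverse x'"
   using comm[of "inverse x'" "inverse x * act x"] that v(1) actV by (simp add: subgrp_mult subgrp_inverse)
  finally show ?thesis by (simp add: \<delta>_def mult.assoc)
 qed
 have d_act: "\<delta> (act x) = act (\<delta> x)" for x by (simp add: \<delta>_def act_mult act_inv)
 \<comment> \<open>These are the invariant subspaces of \<open>V\<close> above \<open>VA\<close>,
   and \<open>D\<close> applies \<open>\<delta>\<close> modulo \<open>VA\<close>. Iterating
   \<open>D\<close> gives the descending filtration by powers of the nilpotent operator.\<close>
 define Wok where "Wok W \<longleftrightarrow> subgrp W \<and> VA \<subseteq> W \<and> W \<subseteq> V \<and> (\<forall>x\<in>W. act x \<in> W)" for W
 define D where "D W = VA * \<delta> ` W" for W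
 have VA_act: "act x \<in> VA" if "x \<in> VA" for x
  using that actV A aw by (auto simp: VA_def act_def subgrp_mult subgrp_inverse)
 have WokVA: "Wok VA" using sVA VA_act by (simp add: Wok_def)
 have WokV: "Wok V" using sVA v actV by (simp add: Wok_def)
 have dW: "\<delta> x \<in> W" if "Wok W" "x \<in> W" for x W
  using that by (auto simp: Wok_def \<delta>_def subgrp_mult subgrp_inverse)
 have WokD: "Wok (D W)" "D W \<subseteq> W" if W: "Wok W" for W
 proof -
  have s: "subgrp (\<delta> ` W)" unfolding subgrp_def
  proof (intro conjI ballI)
   have W1: "1 \<in> W" using W by (simp add: Wok_def)
   have "\<delta> 1 = 1" by (simp add: \<delta>_def act_def)
   then show "1 \<in> \<delta> ` W" using W1 by (metis imageI)
   fix a assume "a \<in> \<delta> ` W"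
   then obtain x where x: "x \<in> W" "a = \<delta> x" by blast
   have xV: "x \<in> V" "inverse x \<in> V" "inverse x \<in> W" using x W by (auto simp: Wok_def v subgrp_inverse)
   have "\<delta> x * \<delta> (inverse x) = 1" using d_mult[OF xV(1,2)] \<open>\<delta> 1 = 1\<close> by simp
   then have "inverse a = \<delta> (inverse x)" using x grp_inverse_unique by blast
   then show "inverse a \<in> \<delta> ` W" using xV(3) by simp
   fix b assume "b \<in> \<delta> ` W"
   then obtain x' where x': "x' \<in> W" "b = \<delta> x'" by blast
   have "x \<in> V" "x' \<in> V" using x x' W by (auto simp: Wok_def)
   then have "a * b = \<delta> (x * x')" using d_mult[of x x'] x x' by simp
   moreover have "x * x' \<in> W" using x x' W by (auto simp: Wok_def subgrp_mult)
   ultimately show "a * b \<in> \<delta> ` W" by simp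
  qed
  have sub: "\<delta> ` W \<subseteq> V" using W dV by (auto simp: Wok_def)
  have nVA: "nrm VA V" unfolding nrm_def
  proof (intro conjI ballI)
   fix g n assume "g \<in> V" "n \<in> VA"
   then have "g * n = n * g" using comm sVA by auto
   then show "g * n * inverse g \<in> VA" using \<open>n \<in> VA\<close> conj_trivial[of g n] by simp
  qed (use sVA in auto)
  have sD: "subgrp (D W)"
   unfolding D_def using subgrp_times_nrm[OF nVA v(1) s sub] nrm_times_commute[OF nVA v(1) sub] by simp
  have "VA \<subseteq> D W" unfolding D_def using subset_set_times1[OF s] .
  moreover show DW: "D W \<subseteq> W"
   unfolding D_def by (rule set_times_subset) (use W dW in \<open>auto simp: Wok_def\<close>)
  moreover have "act x \<in> D W" if "x \<in> D W" for x
  proof -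
   have "x \<in> VA * \<delta> ` W" using that by (simp add: D_def)
   then obtain a b where ab: "a \<in> VA" "b \<in> W" "x = a * \<delta> b" by (auto elim!: in_set_timesE)
   then have "act x = act a * \<delta> (act b)" by (simp add: act_mult d_act)
   moreover have "act b \<in> W" using W ab by (simp add: Wok_def)
   ultimately show ?thesis unfolding D_def using VA_act[OF ab(1)] by (simp add: set_times_intro)
  qed
  ultimately show "Wok (D W)" using sD W by (auto simp: Wok_def)
 qed
 define S where "S = cyc y * V"
 have fcy: "finite (cyc y)" "subgrp (cyc y)" "cyc y \<subseteq> G"
  using y fin iI(4) subgrp_Int by (metis finite_Int, metis, metis inf.coboundedI2)
 have S: "subgrp S" "S \<subseteq> G" "finite S" "V \<subseteq> S" "y \<in> S" "\<alpha> \<in> S"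
 proof -
  show s: "subgrp S" unfolding S_def using subgrp_times_nrm[OF V(1) G(1) fcy(2,3)] .
  show "S \<subseteq> G" unfolding S_def using set_times_subset[OF G(1) fcy(3) v(2)] .
  then show "finite S" using finite_subset G(2) by blast
  show VS: "V \<subseteq> S" unfolding S_def using subset_set_times2[OF fcy(2)] .
  show yS: "y \<in> S" unfolding S_def using subset_set_times1[OF v(1), of "cyc y"] self_in_cyc[of y] by blast
  have "\<alpha> = y * inverse w" by (simp add: aw mult.assoc)
  then show "\<alpha> \<in> S" using subgrp_mult[OF s yS] VS subgrp_inverse[OF v(1) aw(2)] by auto
 qed
 have SE: "\<exists>i. \<exists>x\<in>V. s = y ^ i * x" if "s \<in> S" for s using that by (auto simp: S_def cyc_def elim!: in_set_timesE)
 have nW: "nrm W S" if W: "Wok W" for W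
 proof -
  have sW: "subgrp W" "W \<subseteq> V" using W by (auto simp: Wok_def)
  have cV: "x * u * inverse x = u" if "x \<in> V" "u \<in> W" for x u
   using conj_trivial[OF comm[of x u]] that sW by auto
  have "act ` W = W"
  proof (rule card_subset_eq)
   show "finite W" using finite_subset[OF sW(2) fV] .
   show "act ` W \<subseteq> W" using W by (auto simp: Wok_def)
   show "card (act ` W) = card W" by (rule card_image) (auto simp: inj_on_def act_def)
  qed
  have yW: "y * u * inverse y \<in> W" if u: "u \<in> W" for u
  proof -
   have "y * u * inverse y = \<alpha> * (w * u * inverse w) * inverse \<alpha>" by (simp add: aw mult.assoc)
   then have e: "y * u * inverse y = \<alpha> * u * inverse \<alpha>" by (simp only: cV[OF aw(2) u])
   have "u \<in> act ` W" using \<open>act ` W = W\<close> u by simp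
   then obtain u' where u': "u' \<in> W" "u = act u'" by (rule imageE)
   have "\<alpha> * u * inverse \<alpha> = u'" unfolding u'(2) act_def by (simp add: mult.assoc)
   then show ?thesis unfolding e using u'(1) by simp
  qed
  have yiW: "y ^ i * u * inverse (y ^ i) \<in> W" if "u \<in> W" for u i
  proof (induction i)
   case (Suc i)
   have "y ^ Suc i * u * inverse (y ^ Suc i) = y * (y ^ i * u * inverse (y ^ i)) * inverse y" by (simp add: mult.assoc)
   then show ?case using yW[OF Suc] by simp
  qed (use that in simp)
  show ?thesis unfolding nrm_def
  proof (intro conjI ballI)
   show "W \<subseteq> S" using sW(2) S(4) by blast
   fix s u assume s: "s \<in> S" and u: "u \<in> W"
   obtain i x where ix: "x \<in> V" "s = y ^ i * x" using SE[OF s] by blast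
   have "s * u * inverse s = y ^ i * (x * u * inverse x) * inverse (y ^ i)" by (simp add: ix mult.assoc)
   also have "\<dots> = y ^ i * u * inverse (y ^ i)" by (simp only: cV[OF ix(1) u])
   finally show "s * u * inverse s \<in> W" using yiW[OF u] by simp
  qed fact
 qed
 have Spow: "\<exists>k. card S = p ^ k"
 proof -
  have "card (cyc y) dvd p ^ m" using iI(3) y V(4) by (metis dvd_triv_left)
  then obtain j where j: "card (cyc y) = p ^ j" using V(3) divides_primepow_nat by blast
  have "card S * card (cyc y \<inter> V) = card (cyc y) * card V" unfolding S_def using card_set_times[OF fcy(2) v(1) fcy(1) fV] .
  then have "card S dvd p ^ (j + m)" using j V(4) by (metis dvd_triv_left power_add)
  then show ?thesis using V(3) divides_primepow_nat by blast
 qed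
 \<comment> \<open>Nilpotency without linear algebra: let \<open>M\<close> be maximal among the
   proper \<open>S\<close>-normal subgroups of \<open>W\<close> above \<open>VA\<close>. Some
   \<open>u\<close> outside \<open>M\<close> is central modulo \<open>M\<close>, so the elements
   sent into \<open>M\<close> by \<open>\<delta>\<close> form a larger \<open>S\<close>-normal
   subgroup, which has to be \<open>W\<close>; hence \<open>D W \<subseteq> M\<close>.\<close>
 have Dneq: "D W \<noteq> W" if W: "Wok W" "W \<noteq> VA" for W
 proof -
  define \<F> where "\<F> = {M. nrm M S \<and> VA \<subseteq> M \<and> M \<subseteq> W \<and> M \<noteq> W}"
  have sW: "subgrp W" "W \<subseteq> V" "VA \<subseteq> W" using W by (auto simp: Wok_def)
  have "VA \<in> \<F>" using nW[OF WokVA] W sW by (auto simp: \<F>_def)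
  moreover have "finite \<F>" using finite_subset[of \<F> "Pow V"] sW fV by (auto simp: \<F>_def)
  ultimately obtain M where M: "M \<in> \<F>" "\<And>Q. Q \<in> \<F> ==> card Q \<le> card M" by (rule finite_max_card) blast
  have nM: "nrm M S" "VA \<subseteq> M" "M \<subseteq> W" "M \<noteq> W" using M by (auto simp: \<F>_def)
  note mm = nrmD[OF nM(1)]
  obtain k where "card S = p ^ k" using Spow by blast
  then obtain u where u: "u \<in> W - M" "u ^ p \<in> M" "\<forall>s\<in>S. s * u * inverse s * inverse u \<in> M"
   using pgroup_central_mod[OF S(1,3) V(3) _ nM(1) nW[OF W(1)] nM(3,4)] by blast
  have uV: "u \<in> V" using u sW by auto
  define Q where "Q = {x \<in> W. \<delta> x \<in> M}"
  have du: "\<delta> u \<in> M"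
  proof -
   have "inverse \<alpha> \<in> S" using S by (simp add: subgrp_inverse)
   then have "inverse \<alpha> * u * inverse (inverse \<alpha>) * inverse u \<in> M" using u(3) by blast
   then have "act u * inverse u \<in> M" by (simp add: act_def)
   moreover have "act u * inverse u = \<delta> u"
    unfolding \<delta>_def using comm[of "act u" "inverse u"] actV[OF uV] uV v(1) by (simp add: subgrp_inverse)
   ultimately show ?thesis by simp
  qed
  have dM: "\<delta> x \<in> M" if "x \<in> M" for x
  proof -
   have "inverse \<alpha> * x * \<alpha> \<in> M" using nrm_conj'[OF nM(1) S(1,6) that] .
   then show ?thesis unfolding \<delta>_def act_def using that mm(1) by (simp add: subgrp_mult subgrp_inverse)
  qed
  have "nrm Q S" unfolding nrm_def
  proof (intro conjI ballI)
   show sQ: "subgrp Q" unfolding subgrp_def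
   proof (intro conjI ballI)
    have "\<delta> 1 = 1" by (simp add: \<delta>_def act_def)
    then show "1 \<in> Q" using sW mm by (simp add: Q_def)
    fix x assume x: "x \<in> Q"
    have xV: "x \<in> V" "inverse x \<in> V" using x sW v by (auto simp: Q_def subgrp_inverse)
    have "\<delta> x * \<delta> (inverse x) = 1" using d_mult[OF xV] \<open>\<delta> 1 = 1\<close> by simp
    then have "\<delta> (inverse x) = inverse (\<delta> x)" using grp_inverse_unique by metis
    then show "inverse x \<in> Q" using x sW mm by (simp add: Q_def subgrp_inverse)
    fix x' assume x': "x' \<in> Q"
    then have "\<delta> (x * x') = \<delta> x * \<delta> x'" using d_mult xV(1) sW by (auto simp: Q_def)
    then show "x * x' \<in> Q" using x x' sW mm by (simp add: Q_def subgrp_mult)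
   qed
   show "Q \<subseteq> S" using sW S by (auto simp: Q_def)
   fix s x assume s: "s \<in> S" and x: "x \<in> Q"
   have xW: "x \<in> W" "\<delta> x \<in> M" using x by (auto simp: Q_def)
   obtain i z where iz: "z \<in> V" "s = y ^ i * z" using SE[OF s] by blast
   have zx: "z * x * inverse z = x" using conj_trivial[OF comm[of z x]] iz xW sW by auto
   have "y ^ i * x * inverse (y ^ i) \<in> Q"
   proof (induction i)
    case (Suc i)
    let ?t = "y ^ i * x * inverse (y ^ i)"
    have t: "?t \<in> W" "\<delta> ?t \<in> M" "?t \<in> V" using Suc sW by (auto simp: Q_def)
    have tw: "w * ?t * inverse w = ?t" using conj_trivial[OF comm[OF aw(2) t(3)]] .
    have "y ^ Suc i * x * inverse (y ^ Suc i) = \<alpha> * (w * ?t * inverse w) * inverse \<alpha>" by (simp add: aw(3) mult.assoc)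
    then have e: "y ^ Suc i * x * inverse (y ^ Suc i) = \<alpha> * ?t * inverse \<alpha>" by (simp only: tw)
    have "\<alpha> * ?t * inverse \<alpha> \<in> W" using nrmD(3)[OF nW[OF W(1)] S(6) t(1)] .
    moreover have "\<delta> (\<alpha> * ?t * inverse \<alpha>) = \<alpha> * \<delta> ?t * inverse \<alpha>" by (simp add: \<delta>_def act_def mult.assoc)
    moreover have "\<alpha> * \<delta> ?t * inverse \<alpha> \<in> M" using mm(3)[OF S(6) t(2)] .
    ultimately show ?case unfolding e by (simp add: Q_def)
   qed (use x in simp)
   moreover have "s * x * inverse s = y ^ i * (z * x * inverse z) * inverse (y ^ i)" by (simp add: iz mult.assoc)
   ultimately show "s * x * inverse s \<in> Q" using zx by simp
  qed
  moreover have "M \<subseteq> Q" using nM(3) dM by (auto simp: Q_def)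
  moreover have "u \<in> Q" using u du by (auto simp: Q_def)
  moreover have "Q \<subseteq> W" by (auto simp: Q_def)
  ultimately have "Q = W"
  proof -
   have "\<not> Q \<in> \<F>"
   proof
    assume "Q \<in> \<F>"
    then have "card Q \<le> card M" using M(2) by blast
    moreover have "finite Q" using finite_subset[OF \<open>Q \<subseteq> W\<close>] finite_subset[OF sW(2) fV] by blast
    ultimately have "M = Q" using card_seteq[OF _ \<open>M \<subseteq> Q\<close>] by blast
    then show False using u \<open>u \<in> Q\<close> by blast
   qed
   then show ?thesis using \<open>nrm Q S\<close> \<open>M \<subseteq> Q\<close> \<open>Q \<subseteq> W\<close> nM(2) by (auto simp: \<F>_def)
  qed
  then have "\<delta> ` W \<subseteq> M" by (auto simp: Q_def)
  then have "D W \<subseteq> M" unfolding D_def using set_times_subset[OF mm(1) nM(2)] by blast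
  then show ?thesis using nM(3,4) by blast
 qed
 have Dcard: "p * card (D W) \<le> card W" if W: "Wok W" "W \<noteq> VA" for W
 proof -
  have s: "subgrp W" "finite W" "subgrp (D W)" "D W \<subseteq> W"
   using W WokD[OF W(1)] finite_subset[OF _ fV] by (auto simp: Wok_def)
  obtain d where d: "card W = card (D W) * d" using card_subgrp_dvd[OF s] by blast
  have "d \<noteq> 1" using d card_subset_eq[OF s(2,4)] Dneq[OF W] by auto
  moreover have "card W dvd p ^ m" using card_subgrp_dvd[OF v(1) fV s(1)] W V(4) by (simp add: Wok_def)
  ultimately have "p dvd d" using prime_power_proper_dvd[OF V(3)] d by (metis dvd_mult_right)
  moreover have "d > 0" using d card_subgrp_pos[OF s(1,2)] by (metis gr0I mult_0_right)
  ultimately have "p \<le> d" by (simp add: dvd_imp_le)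
  then show ?thesis using d by simp
 qed
 have DVA: "D VA = VA"
 proof -
  have "\<delta> ` VA \<subseteq> VA" using dW[OF WokVA] by blast
  then have "D VA \<subseteq> VA" unfolding D_def using set_times_subset[OF sVA(1) subset_refl] by blast
  then show ?thesis using WokD(1)[OF WokVA] by (auto simp: Wok_def)
 qed
 \<comment> \<open>If \<open>y ^ e\<close> falls into the subgroup
   \<open>(A \<inter> S) * W\<close>, then its translates by the first \<open>e\<close> powers of
   \<open>y\<close> cover \<open>S\<close>; its index in \<open>S\<close> equals the index of
   \<open>W\<close> in \<open>V\<close>.\<close>
 have bound: "card V \<le> e * card W" if W: "Wok W" and e: "y ^ e \<in> (A \<inter> S) * W" "e > 0" for W e
 proof -
  define T where "T = (A \<inter> S) * W"
  have sAS: "subgrp (A \<inter> S)" "A \<inter> S \<subseteq> S" using subgrp_Int[OF A(1) S(1)] by auto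
  have sT: "subgrp T" "T \<subseteq> S"
   unfolding T_def using subgrp_times_nrm[OF nW[OF W] S(1) sAS] set_times_subset[OF S(1) sAS(2)] nW[OF W] by (auto simp: nrm_def)
  have fin': "finite (A \<inter> S)" "finite W" "finite T" using finite_subset S(3) sT sAS W fV by (auto simp: Wok_def)
  have "S \<subseteq> (\<Union>k<e. (\<lambda>t. t * y ^ k) ` T)"
  proof
   fix s assume s: "s \<in> S"
   have "S \<subseteq> A * V"
   proof
    fix s assume "s \<in> S"
    then obtain i x where "x \<in> V" "s = y ^ i * x" using SE by blast
    moreover have "y ^ i \<in> A * V" using yAV(1) iI(4) by (simp add: subgrp_power)
    moreover have "V \<subseteq> A * V" using subset_set_times2[OF A(1)] .
    ultimately show "s \<in> A * V" using iI(4) by (auto intro: subgrp_mult)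
   qed
   then have "s \<in> A * cyc y" using s iI(1) y by auto
   then obtain a i where ai: "a \<in> A" "s = a * y ^ i" by (auto simp: cyc_def elim!: in_set_timesE)
   have "a = s * inverse (y ^ i)" by (simp add: ai mult.assoc)
   then have "a \<in> S" using s S by (simp add: subgrp_mult subgrp_inverse subgrp_power)
   then have "a \<in> T" unfolding T_def using ai subset_set_times1[of W "A \<inter> S"] W by (auto simp: Wok_def)
   moreover have "(y ^ e) ^ (i div e) \<in> T" using e sT by (simp add: T_def subgrp_power)
   moreover have "s = (a * (y ^ e) ^ (i div e)) * y ^ (i mod e)"
    unfolding ai by (simp add: mult.assoc flip: power_mult power_add)
   ultimately show "s \<in> (\<Union>k<e. (\<lambda>t. t * y ^ k) ` T)"
    using sT(1) e(2) by (auto intro!: bexI[of _ "i mod e"] image_eqI[of _ _ "a * (y ^ e) ^ (i div e)"] subgrp_mult)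
  qed
  then have "card S \<le> card (\<Union>k<e. (\<lambda>t. t * y ^ k) ` T)" using fin' by (intro card_mono) auto
  also have "\<dots> \<le> (\<Sum>k<e. card ((\<lambda>t. t * y ^ k) ` T))" by (rule card_UN_le) simp
  also have "\<dots> \<le> (\<Sum>k<e. card T)" by (intro sum_mono card_image_le fin')
  finally have ST: "card S \<le> e * card T" by simp
  have "card T * card (A \<inter> S \<inter> W) = card (A \<inter> S) * card W"
   unfolding T_def using card_set_times[OF sAS(1) _ fin'(1,2)] W by (simp add: Wok_def)
  moreover have "A \<inter> S \<inter> W = VA" using W S(4) by (auto simp: VA_def Wok_def)
  moreover have "card S * card VA = card (A \<inter> S) * card V"
  proof -
   have "(A \<inter> S) * V = S"
   proof (intro equalityI subsetI)
    fix s assume s: "s \<in> S"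
    obtain i x where ix: "x \<in> V" "s = y ^ i * x" using SE[OF s] by blast
    have "y \<in> (A \<inter> S) * V" using aw S(6) by (auto intro: set_times_intro)
    moreover have sub: "subgrp ((A \<inter> S) * V)"
     using subgrp_times_nrm[OF V(1) G(1) sAS(1)] S(2) by blast
    moreover have "V \<subseteq> (A \<inter> S) * V" using subset_set_times2[OF sAS(1)] .
    ultimately show "s \<in> (A \<inter> S) * V" using ix by (auto intro!: subgrp_mult subgrp_power)
   qed (use set_times_subset[OF S(1) sAS(2) S(4)] in auto)
   moreover have "A \<inter> S \<inter> V = VA" using S(4) by (auto simp: VA_def)
   ultimately show ?thesis using card_set_times[OF sAS(1) v(1) fin'(1) fV] by simp
  qed
  ultimately have eqs: "card T * card VA = card (A \<inter> S) * card W" "card S * card VA = card (A \<inter> S) * card V" by auto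
  have "card (A \<inter> S) * card V \<le> (e * card T) * card VA" using ST eqs(2) by (metis mult_le_mono1)
  also have "\<dots> = card (A \<inter> S) * (e * card W)" using eqs(1) by (simp add: mult.assoc mult.left_commute)
  finally show ?thesis using card_subgrp_pos[OF sAS(1) fin'(1)] by simp
 qed
 have W1: "Wok (D V)" "Wok (D (D V))" "Wok (D (D (D V)))" using WokD(1) WokV by auto
 have d2: "\<delta> (\<delta> x) \<in> D (D V)" if "x \<in> V" for x
 proof -
  have inc: "\<delta> u \<in> D W" if "u \<in> W" for u W
   unfolding D_def using set_times_intro[of 1 VA "\<delta> u" "\<delta> ` W"] sVA that by simp
  show ?thesis using inc inc that by blast
 qed
 show ?thesis
 proof (cases "p = 2")
  case False
  then have "odd p" using V(3) primes_dvd_imp_eq two_is_prime_nat by blast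
  \<comment> \<open>Modulo \<open>D (D V)\<close> the commutator \<open>\<delta> w\<close> of
    \<open>w\<close> and \<open>\<alpha>\<close> is central, so \<open>(\<alpha> * w) ^ p\<close> is
    \<open>\<alpha> ^ p * w ^ p * \<delta> w ^ (p choose 2)\<close>. The last two factors vanish for
    odd \<open>p\<close>. Two proper steps of the filtration would then contradict
    \<open>bound\<close>.\<close>
  have ye: "y ^ p \<in> (A \<inter> S) * D (D V)"
  proof -
   obtain \<pi> :: "'a \<Rightarrow> 'a set Perm.perm" where pi: "ghom S \<pi>" "\<And>g. g \<in> S ==> \<pi> g = 1 \<longleftrightarrow> g \<in> D (D V)"
    using quotient_exists[OF S(1,3) nW[OF W1(2)]] by blast
   have wS: "w \<in> S" "\<delta> w \<in> S" using aw S(4) dV by auto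
   have e1: "w * \<alpha> = \<alpha> * w * \<delta> w" by (simp add: \<delta>_def act_def mult.assoc)
   have e2: "\<delta> w * \<alpha> = \<alpha> * \<delta> w * \<delta> (\<delta> w)" by (simp add: \<delta>_def act_def mult.assoc)
   have d2w: "\<delta> (\<delta> w) \<in> D (D V)" "\<delta> (\<delta> w) \<in> S" using d2[OF aw(2)] dV[OF dV[OF aw(2)]] S(4) by auto
   have p1: "\<pi> w * \<pi> \<alpha> = \<pi> \<alpha> * \<pi> w * \<pi> (\<delta> w)"
    using arg_cong[OF e1, of \<pi>] ghom_mult[OF pi(1)] wS S by (simp add: subgrp_mult)
   have p2: "\<pi> (\<delta> w) * \<pi> \<alpha> = \<pi> \<alpha> * \<pi> (\<delta> w)"
    using arg_cong[OF e2, of \<pi>] ghom_mult[OF pi(1)] wS S d2w pi(2)[OF d2w(2)] by (simp add: subgrp_mult)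
   have p3: "\<pi> (\<delta> w) * \<pi> w = \<pi> w * \<pi> (\<delta> w)"
    using arg_cong[OF comm[OF dV[OF aw(2)] aw(2)], of \<pi>] ghom_mult[OF pi(1)] wS by simp
   have one: "x \<in> V ==> \<pi> x ^ p = 1" for x
    using ghom_power[OF pi(1) S(1), of x p] ghom_one[OF pi(1) S(1)] exp S(4) by auto
   obtain n where n: "p - 1 = 2 * n" using \<open>odd p\<close> by (metis dvd_def odd_two_times_div_two_nat even_diff_nat odd_even_add odd_one)
   then have "p choose 2 = p * n" by (simp add: choose_two)
   then have "(\<pi> \<alpha> * \<pi> w) ^ p = \<pi> \<alpha> ^ p"
    using power_central_commutator[OF p1 p2 p3, of p] one[OF aw(2)] one[OF dV[OF aw(2)]] by (simp add: power_mult)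
   then have "\<pi> (y ^ p) = \<pi> (\<alpha> ^ p)"
    using ghom_power[OF pi(1) S(1)] ghom_mult[OF pi(1) S(6) wS(1)] S aw by simp
   then have "\<pi> (inverse (\<alpha> ^ p) * y ^ p) = 1"
    using ghom_mult[OF pi(1)] ghom_inverse[OF pi(1) S(1)] S by (simp add: subgrp_power subgrp_inverse)
   then have r: "inverse (\<alpha> ^ p) * y ^ p \<in> D (D V)"
    using pi(2) S by (simp add: subgrp_power subgrp_inverse subgrp_mult)
   have "\<alpha> ^ p \<in> A \<inter> S" using aw S A by (simp add: subgrp_power)
   then have "\<alpha> ^ p * (inverse (\<alpha> ^ p) * y ^ p) \<in> (A \<inter> S) * D (D V)" using r by (rule set_times_intro)
   then show ?thesis by simp
  qed
  have b: "card V \<le> p * card (D (D V))" using bound[OF W1(2) ye] V(3) prime_gt_0_nat by blast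
  have "D (D V) = VA"
  proof (cases "D V = VA")
   case True
   then show ?thesis using DVA by simp
  next
   case Fa: False
   then have "V \<noteq> VA" using DVA by auto
   then have "p * (p * card (D (D V))) \<le> card V"
    using Dcard[OF W1(1) Fa] Dcard[OF WokV] by (meson le_trans mult_le_mono2)
   then have "p * (p * card (D (D V))) \<le> 1 * (p * card (D (D V)))" using le_trans[OF _ b] by (simp only: mult_1)
   moreover have "p * card (D (D V)) > 0"
    using card_subgrp_pos[of "D (D V)"] W1(2) finite_subset[OF _ fV] V(3) prime_gt_0_nat by (auto simp: Wok_def)
   ultimately have "p \<le> 1" using mult_le_cancel2[of p "p * card (D (D V))" 1] by blast
   then show ?thesis using V(3) prime_gt_1_nat[of p] by simp
  qed
  then show ?thesis using b False by (simp add: VA_def)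
 next
  case True
  have sq: "x * x = 1" if "x \<in> V" for x using exp[OF that] True by (simp add: power2_eq_square)
  \<comment> \<open>In characteristic two
    \<open>1 + \<alpha> + \<alpha>^2 + \<alpha>^3 = (\<alpha> - 1)^3\<close>, so the fourth power of
    \<open>\<alpha> * w\<close> leaves the third iterate of \<open>\<delta>\<close> at
    \<open>w\<close>. Three proper steps of the filtration are therefore impossible, while two are
    not excluded.\<close>
  have ye: "y ^ 4 \<in> (A \<inter> S) * D (D (D V))"
  proof -
   define x where "x = \<delta> w"
   have xV: "x \<in> V" "\<delta> x \<in> V" "\<delta> (\<delta> x) \<in> V" using dV aw by (auto simp: x_def)
   have "w * \<alpha> = \<alpha> * act w" by (simp add: act_def mult.assoc)
   then have y2: "y ^ 2 = \<alpha> ^ 2 * (act w * w)"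
    by (simp add: aw power2_eq_square mult.assoc) (simp flip: mult.assoc)
   also have "act w * w = w * w * x"
    using comm[OF xV(1) aw(2)] by (simp add: actd x_def mult.assoc)
   finally have y2: "y ^ 2 = \<alpha> ^ 2 * x" using sq[OF aw(2)] by simp
   have xa: "x * \<alpha> ^ 2 = \<alpha> ^ 2 * act (act x)" by (simp add: act_def power2_eq_square mult.assoc)
   have "y ^ 4 = (y ^ 2) ^ 2" by (simp flip: power_mult)
   also have "\<dots> = \<alpha> ^ 2 * (x * \<alpha> ^ 2) * x" unfolding y2 by (simp add: power2_eq_square mult.assoc)
   also have "\<dots> = \<alpha> ^ 4 * (act (act x) * x)" unfolding xa by (simp add: mult.assoc flip: power_add)
   also have "act (act x) * x = \<delta> (\<delta> x)"
   proof -
    have "act (act x) = act x * \<delta> (act x)" by (rule actd)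
    also have "\<dots> = x * \<delta> x * (\<delta> x * \<delta> (\<delta> x))"
     using d_mult[OF xV(1,2)] actd[of x] by simp
    also have "\<dots> = x * (\<delta> x * \<delta> x) * \<delta> (\<delta> x)" by (simp only: mult.assoc)
    also have "\<dots> = \<delta> (\<delta> x) * x" using sq[OF xV(2)] comm[OF xV(1,3)] by simp
    finally show ?thesis using sq[OF xV(1)] by (simp add: mult.assoc)
   qed
   finally have y4: "y ^ 4 = \<alpha> ^ 4 * \<delta> (\<delta> x)" .
   have inc: "\<delta> u \<in> D W" if "u \<in> W" for u W
    unfolding D_def using set_times_intro[of 1 VA "\<delta> u" "\<delta> ` W"] sVA that by simp
   have "\<delta> (\<delta> x) \<in> D (D (D V))" unfolding x_def using inc[OF inc[OF inc[OF aw(2)]]] .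
   moreover have "\<alpha> ^ 4 \<in> A \<inter> S" using aw S A by (simp add: subgrp_power)
   ultimately show ?thesis unfolding y4 by (intro set_times_intro)
  qed
  have b: "card V \<le> 4 * card (D (D (D V)))" using bound[OF W1(3) ye] by simp
  have "D (D (D V)) = VA"
  proof (cases "D (D V) = VA")
   case T: True
   then show ?thesis using DVA by simp
  next
   case Fa: False
   then have ne: "D V \<noteq> VA" "V \<noteq> VA" using DVA by auto
   have "2 * (2 * (2 * card (D (D (D V))))) \<le> card V"
    using Dcard[OF W1(2) Fa] Dcard[OF W1(1) ne(1)] Dcard[OF WokV ne(2)] True by (meson le_trans mult_le_mono2)
   moreover have "card (D (D (D V))) > 0"
    using card_subgrp_pos[of "D (D (D V))"] W1(3) finite_subset[OF _ fV] by (auto simp: Wok_def)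
   ultimately show ?thesis using b by simp
  qed
  then show ?thesis using b True by (simp add: VA_def)
 qed
qed

end

section \<open>Indices of A and B in a minimal normal subgroup\<close>

lemma cyc_subgrp_unique:
 assumes "finite (cyc (u::'a::grp))" "subgrp H" "H \<subseteq> cyc u" "subgrp K" "K \<subseteq> cyc u" "card H = card K"
 shows "H = K"
proof -
 let ?R = "{x \<in> cyc u. x ^ card H = 1}"
 have f: "finite H" "finite K" using assms finite_subset by blast+
 have H: "H \<subseteq> ?R" using grp_power_card[OF assms(2) f(1)] assms(3) by blast
 have K: "K \<subseteq> ?R" using grp_power_card[OF assms(4) f(2)] assms(5,6) by auto
 have "card ?R \<le> card H"
  by (rule card_cyc_roots[OF assms(1) card_subgrp_pos[OF assms(2) f(1)]]) auto
 moreover have "finite ?R" using assms(1) by simp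
 ultimately have "H = ?R" "K = ?R" using card_seteq[OF _ H] card_seteq[OF _ K] assms(6) by auto
 then show ?thesis by simp
qed

lemma index_two_quotient:
 assumes "subgrp (Q::'a::grp set)" "finite Q" "subgrp H" "H \<subseteq> Q" "card Q \<le> 2 * card H"
  and "a \<in> Q" "a \<notin> H" "b \<in> Q" "b \<notin> H"
 shows "a * inverse b \<in> H"
proof (rule ccontr)
 assume n: "a * inverse b \<notin> H"
 let ?t = "\<lambda>c. (\<lambda>h. h * c) ` H"
 have fH: "finite H" using assms finite_subset by blast
 have c: "card (?t c) = card H" for c by (rule card_image) (simp add: inj_on_def)
 have d1: "H \<inter> ?t b = {}"
 proof -
  have "h * b \<notin> H" if "h \<in> H" for h using assms(9) subgrp_mult_iff1[OF assms(3) that] by simp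
  then show ?thesis by blast
 qed
 have "a \<notin> ?t b"
 proof
  assume "a \<in> ?t b"
  then obtain h where "h \<in> H" "a = h * b" by blast
  then show False using n by (simp add: mult.assoc)
 qed
 then have "card (insert a (H \<union> ?t b)) = Suc (card H + card H)"
  using assms(7) fH d1 c by (simp add: card_Un_disjoint)
 moreover have "h * b \<in> Q" if "h \<in> H" for h using subgrp_mult[OF assms(1) _ assms(8)] assms(4) that by blast
 then have "insert a (H \<union> ?t b) \<subseteq> Q" using assms(4,6) by blast
 ultimately show False using card_mono[OF assms(2), of "insert a (H \<union> ?t b)"] assms(5) by linarith
qed

lemma card_ghom_image:
 assumes "ghom G \<pi>" "subgrp G" "finite G" "nrm N G" "\<And>g. g \<in> G ==> \<pi> g = 1 \<longleftrightarrow> g \<in> N"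
 shows "card G = card N * card (\<pi> ` G)"
proof (rule card_fibres[OF assms(3)])
 fix y assume "y \<in> \<pi> ` G"
 then obtain h where h: "h \<in> G" "y = \<pi> h" by blast
 have "{g \<in> G. \<pi> g = y} = (\<lambda>n. h * n) ` N"
 proof (intro equalityI subsetI)
  fix g assume g: "g \<in> {g \<in> G. \<pi> g = y}"
  have ig: "inverse h \<in> G" using h assms(2) by (simp add: subgrp_inverse)
  have "\<pi> (inverse h * g) = 1"
   using ghom_mult[OF assms(1) ig] ghom_inverse[OF assms(1,2) h(1)] g h by simp
  then have "inverse h * g \<in> N" using assms(5)[of "inverse h * g"] ig g assms(2) by (simp add: subgrp_mult)
  then show "g \<in> (\<lambda>n. h * n) ` N" by (intro image_eqI[of _ _ "inverse h * g"]) simp_all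
 next
  fix g assume "g \<in> (\<lambda>n. h * n) ` N"
  then obtain n where n: "n \<in> N" "g = h * n" by blast
  have nG: "n \<in> G" using n assms(4) by (auto simp: nrm_def)
  then show "g \<in> {g \<in> G. \<pi> g = y}"
   using n h ghom_mult[OF assms(1) h(1) nG] assms(5)[OF nG] assms(2) by (simp add: subgrp_mult)
 qed
 then show "card {g \<in> G. \<pi> g = y} = card N" by (simp add: card_image inj_on_def)
qed

lemma card_cyc_ghom:
 assumes "ghom G \<pi>" "subgrp G" "finite G" "u \<in> G" "\<And>x. x \<in> cyc u ==> \<pi> x = 1 ==> x = 1"
 shows "card (cyc (\<pi> u)) = card (cyc u)"
proof -
 have cu: "cyc u \<subseteq> G" using cyc_subset[OF assms(2,4)] .
 have f: "finite (cyc u)" using finite_subset[OF cu assms(3)] .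
 have s: "subgrp (cyc u)" using subgrp_cyc[OF f] .
 have "card (cyc u) = card {1::'a} * card (\<pi> ` cyc u)"
 proof (rule card_ghom_image[OF ghom_subset[OF assms(1) cu] s f])
  show "nrm {1} (cyc u)" using s by (simp add: nrm_def)
  show "\<pi> g = 1 \<longleftrightarrow> g \<in> {1}" if "g \<in> cyc u" for g using assms(5)[OF that] ghom_one[OF assms(1,2)] by auto
 qed
 then show ?thesis using image_cyc[OF assms(1,2,4)] by simp
qed

lemma prime_power_le_dvd:
 assumes "prime (p::nat)" "x dvd p ^ k" "p \<le> x" "x \<le> c" "c = p \<or> c = p\<^sup>2"
 shows "x = p \<or> x = p\<^sup>2"
proof -
 obtain j where j: "x = p ^ j" using assms(1,2) divides_primepow_nat by blast
 have p1: "p > 1" using assms(1) prime_gt_1_nat by blast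
 have "p ^ j \<le> p ^ 2" using j assms(4,5) p1 by (metis dual_order.trans less_or_eq_imp_le numeral_2_eq_2 one_le_numeral power_increasing power_one_right)
 then have "j \<le> 2" using p1 power_le_imp_le_exp by blast
 moreover have "j \<noteq> 0" using j assms(3) p1 by (cases j) auto
 ultimately have "j = 1 \<or> j = 2" by linarith
 then show ?thesis using j by auto
qed

context hconf
begin

text \<open>As \<open>B \<inter> N\<close> has index \<open>p\<close>, a conjugate of
  \<open>A\<close> whose trace on \<open>N\<close> is not inside \<open>B\<close> would give
  \<open>N\<close> as the product of the two traces, against \<open>no_product\<close>.\<close>

lemma intersection_subset_index_prime:
 assumes N: "nrm N G" "N \<noteq> {1}" "prime p" "card N = p ^ m" and i: "card N = p * card (B \<inter> N)" and g: "g \<in> G"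
 shows "cnj g A \<inter> N \<subseteq> B"
proof (rule ccontr)
 assume n: "\<not> cnj g A \<inter> N \<subseteq> B"
 note v = nrmD[OF N(1)]
 have s: "subgrp (cnj g A \<inter> N)" "subgrp (B \<inter> N)" using A B v by (auto intro!: subgrp_Int subgrp_cnj)
 have "(B \<inter> N) * (cnj g A \<inter> N) = N"
  using index_prime_product[OF v(1) finN[OF N(1)] N(4,3) s(2) _ i s(1)] n by auto
 then have "(cnj g A \<inter> N) * (B \<inter> N) = N" using product2_flip[OF v(1) s(2,1)] by blast
 moreover have "(cnj g A \<inter> N) * (B \<inter> N) \<subseteq> cnj g A * B" by (rule set_times_mono2) auto
 ultimately have "N \<subseteq> cnj g A * cnj 1 B" by simp
 then show False using no_product[OF N(1,2) g subgrp_one[OF G(1)]] by blast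
qed

text \<open>The hypothesis places every conjugate of \<open>A \<inter> N\<close> in
  \<open>B\<close>, so \<open>A \<inter> N\<close> lies in the core of \<open>B\<close>, which is
  trivial.\<close>

lemma A_Int_trivial:
 assumes N: "nrm N G" and sub: "\<And>g. g \<in> G ==> cnj g A \<inter> N \<subseteq> B"
 shows "A \<inter> N = {1}"
proof -
 interpret sw: hconf G B A \<sigma> by (rule swap)
 have "x = 1" if x: "x \<in> A \<inter> N" for x
 proof (rule sw.core_mem)
  show "x \<in> G" using x A by blast
  fix g assume g: "g \<in> G"
  have "g * x * inverse g \<in> cnj g A \<inter> N" using x nrmD(3)[OF N g] by (auto simp: cnj_def)
  then show "g * x * inverse g \<in> B" using sub[OF g] by blast
 qed
 then show ?thesis using A nrmD(1)[OF N] by auto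
qed

text \<open>Write \<open>y = a * w\<close> and test with \<open>u = inverse a * w * a\<close>: its
  commutator with \<open>y\<close> is \<open>w * inverse u\<close>, and \<open>y ^ 2\<close> is
  \<open>a ^ 2\<close> times the inverse of that commutator. Were it in \<open>A\<close>, so would
  be \<open>y ^ 2\<close>, although \<open>A\<close> meets the cyclic group trivially.\<close>

lemma not_centralizing:
 assumes V: "nrm V G" "\<And>x y. x \<in> V ==> y \<in> V ==> x * y = y * x" "\<And>x. x \<in> V ==> x ^ 2 = 1"
  and y: "y \<in> A * V" "y \<in> cyc \<sigma>" "y ^ 2 \<noteq> 1"
 shows "\<exists>v\<in>V. y * v * inverse y * inverse v \<notin> A"
proof (rule ccontr)
 assume n: "\<not> ?thesis"
 note v = nrmD[OF V(1)]
 obtain a w where aw: "a \<in> A" "w \<in> V" "y = a * w" using y(1) by (rule in_set_timesE)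
 have aG: "a \<in> G" using aw A by auto
 define u where "u = inverse a * w * a"
 have u: "u \<in> V" unfolding u_def using nrm_conj'[OF V(1) G(1) aG aw(2)] .
 have "y * u * inverse y * inverse u = a * (w * u * inverse w) * inverse a * inverse u" by (simp add: aw mult.assoc)
 also have "w * u * inverse w = u" using conj_trivial[OF V(2)[OF aw(2) u]] .
 also have "a * u * inverse a = w" by (simp add: u_def mult.assoc)
 finally have "w * inverse u \<in> A" using n u by auto
 then have iA: "inverse (w * inverse u) \<in> A" using A by (simp only: subgrp_inverse)
 have "y ^ 2 = a ^ 2 * (u * w)" by (simp add: aw power2_eq_square u_def mult.assoc)
 also have "u * w = inverse (w * inverse u) * (w * w)" by (simp add: mult.assoc)
 also have "w * w = 1" using V(3)[OF aw(2)] by (simp add: power2_eq_square)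
 finally have "y ^ 2 \<in> A" using iA aw A by (simp add: subgrp_mult subgrp_power)
 then show False using AI y(3) subgrp_power[OF fin(4) y(2), of 2] by blast
qed

text \<open>The points of the four-group \<open>V\<close> fixed by \<open>y\<close> form
  \<open>{1, v0}\<close>. All of \<open>cyc \<sigma>\<close> commutes with \<open>y\<close> and
  hence preserves this set, so each of its elements acts on \<open>V\<close> trivially or by the
  transvection that multiplies by \<open>v0\<close> outside \<open>{1, v0}\<close>. Squares act
  trivially.\<close>

lemma four_group:
 assumes V: "nrm V G" "card V = 4" "\<And>x y. x \<in> V ==> y \<in> V ==> x * y = y * x" "\<And>x. x \<in> V ==> x ^ 2 = 1"
  and y: "y \<in> cyc \<sigma>" "card (cyc y) = 4" "\<exists>v\<in>V. y * v \<noteq> v * y"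
 obtains v0 where "v0 \<in> V" "v0 \<noteq> 1" "\<sigma> * v0 = v0 * \<sigma>"
  "\<And>v i. v \<in> V ==> v \<noteq> v0 ==> v \<noteq> 1 ==> i \<in> cyc \<sigma> ==> i * v * inverse i = v \<or> i * v * inverse i = v0 * v"
  "\<And>v. v \<in> V ==> \<sigma> ^ 2 * v = v * \<sigma> ^ 2"
proof -
 note v = nrmD[OF V(1)]
 have fV: "finite V" using finN[OF V(1)] .
 have yG: "y \<in> G" using y fin(5) by auto
 have cyG: "cyc y \<subseteq> G" using cyc_subset[OF G(1) yG] .
 have fy: "finite (cyc y)" "subgrp (cyc y)" using finite_subset[OF cyG G(2)] subgrp_cyc by auto
 let ?F = "{x \<in> V. \<forall>g\<in>cyc y. g * x * inverse g = x}"
 have "2 dvd card V \<longleftrightarrow> 2 dvd card ?F"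
 proof (rule pgroup_fixed_points[OF fy(2,1) two_is_prime_nat])
  show "card (cyc y) = 2 ^ 2" using y by simp
  show "grp_action (cyc y) (\<lambda>g x. g * x * inverse g)" unfolding grp_action_def by (simp add: mult.assoc)
  show "g * x * inverse g \<in> V" if "g \<in> cyc y" "x \<in> V" for g x using v(3) cyG that by blast
 qed (use fV in simp)
 then have "2 dvd card ?F" using V(2) by simp
 moreover have "1 \<in> ?F" using v by simp
 ultimately have "?F \<noteq> {1}" by auto
 then obtain v0 where v0: "v0 \<in> ?F" "v0 \<noteq> 1" using \<open>1 \<in> ?F\<close> by blast
 have v0V: "v0 \<in> V" using v0 by simp
 have sq: "x * x = 1" if "x \<in> V" for x using V(4)[OF that] by (simp add: power2_eq_square)
 define C where "C = {x \<in> V. y * x = x * y}"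
 have v0C: "v0 \<in> C" using v0 self_in_cyc[of y] conj_trivial unfolding C_def
 proof -
  have "y * v0 * inverse y = v0" using v0 self_in_cyc[of y] by blast
  then have "y * v0 * inverse y * y = v0 * y" by simp
  then show "v0 \<in> {x \<in> V. y * x = x * y}" using v0V by (simp add: mult.assoc)
 qed
 have sC: "subgrp C" unfolding subgrp_def
 proof (intro conjI ballI)
  show "1 \<in> C" using v by (simp add: C_def)
  fix a assume a: "a \<in> C"
  then show "inverse a \<in> C" using commute_inverse[of y a] v by (simp add: C_def subgrp_inverse)
  fix b assume "b \<in> C"
  then show "a * b \<in> C" using a commute_mult[of y a b] v by (simp add: C_def subgrp_mult)
 qed
 have CV: "C \<subseteq> V" "C \<noteq> V" using y(3) by (auto simp: C_def)
 have "card C dvd 4" using card_subgrp_dvd[OF v(1) fV sC CV(1)] V(2) by simp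
 moreover have "card C \<noteq> 4" using card_subset_eq[OF fV CV(1)] CV(2) V(2) by auto
 ultimately have "card C \<le> 2" using dvd_imp_le[of "card C" 4] by (cases "card C = 3") auto
 moreover have "{1, v0} \<subseteq> C" using v0C sC by simp
 moreover have "card {1, v0} = 2" using v0 by simp
 ultimately have C: "C = {1, v0}" using card_seteq[of C "{1, v0}"] finite_subset[OF CV(1) fV] by auto
 have fixed: "i * v0 * inverse i = v0" if i: "i \<in> cyc \<sigma>" for i
 proof -
  have iG: "i \<in> G" using i fin(5) by auto
  have yi: "y * i = i * y" using cyc_commute[OF y(1) i] .
  have yii: "y * inverse i = inverse i * y" using commute_inverse[OF yi] .
  have yv: "y * v0 = v0 * y" using v0C by (simp add: C_def)
  have "y * (i * v0 * inverse i) = (i * v0 * inverse i) * y"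
   using commute_mult[OF commute_mult[OF yi yv] yii] by simp
  then have "i * v0 * inverse i \<in> C" using v(3)[OF iG v0V] by (simp add: C_def)
  moreover have "i * v0 * inverse i \<noteq> 1"
  proof
   assume e: "i * v0 * inverse i = 1"
   have "v0 = inverse i * (i * v0 * inverse i) * i" by (simp add: mult.assoc)
   then show False using e v0(2) by simp
  qed
  ultimately show ?thesis using C by blast
 qed
 have s0: "\<sigma> * v0 = v0 * \<sigma>"
 proof -
  have "\<sigma> * v0 * inverse \<sigma> * \<sigma> = v0 * \<sigma>" using fixed[OF self_in_cyc] by simp
  then show ?thesis by (simp add: mult.assoc)
 qed
 have V4: "V = {1, v0, x, v0 * x}" if x: "x \<in> V" "x \<noteq> 1" "x \<noteq> v0" for x
 proof -
  have "v0 * x \<noteq> 1" using x sq[OF v0V] by (metis grp_left_cancel grp_inverse_unique mult_1_right)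
  then have "card {1, v0, x, v0 * x} = 4" using x v0(2) by auto
  moreover have "{1, v0, x, v0 * x} \<subseteq> V" using x v0V v by (simp add: subgrp_mult)
  ultimately show ?thesis using card_subset_eq[OF fV, of "{1, v0, x, v0 * x}"] V(2) by simp
 qed
 have shift: "i * x * inverse i = x \<or> i * x * inverse i = v0 * x"
  if x: "x \<in> V" "x \<noteq> v0" "x \<noteq> 1" and i: "i \<in> cyc \<sigma>" for x i
 proof -
  have iG: "i \<in> G" using i fin(5) by auto
  have m: "i * x * inverse i \<in> {1, v0, x, v0 * x}" using v(3)[OF iG x(1)] V4[OF x(1,3,2)] by simp
  have bk: "x = inverse i * (i * x * inverse i) * i" by (simp add: mult.assoc)
  have "i * x * inverse i \<noteq> 1" 
  proof
   assume e: "i * x * inverse i = 1"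
   show False using bk x(3) unfolding e by simp
  qed
  moreover have "i * x * inverse i \<noteq> v0"
  proof
   assume e: "i * x * inverse i = v0"
   have "inverse i \<in> cyc \<sigma>" using i fin(4) by (simp add: subgrp_inverse)
   from fixed[OF this] have "inverse i * v0 * i = v0" by simp
   then show False 
    using bk x(2) \<open>inverse i * v0 * i = v0\<close> unfolding e by simp
  qed
  ultimately show ?thesis using m by blast
 qed
 have "\<sigma> ^ 2 * x = x * \<sigma> ^ 2" if x: "x \<in> V" for x
 proof (cases "x = 1 \<or> x = v0")
  case True
  then show ?thesis using commute_power[OF s0[symmetric], of 2] by auto
 next
  case False
  have e2: "\<sigma> ^ 2 * x * inverse (\<sigma> ^ 2) = \<sigma> * (\<sigma> * x * inverse \<sigma>) * inverse \<sigma>" by (simp add: power2_eq_square mult.assoc)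
  have "\<sigma> ^ 2 * x * inverse (\<sigma> ^ 2) = x"
  proof (cases "\<sigma> * x * inverse \<sigma> = x")
   case True
   then show ?thesis unfolding e2 by simp
  next
   case F: False
   then have sx: "\<sigma> * x * inverse \<sigma> = v0 * x" using shift[OF x _ _ self_in_cyc] False by blast
   have "\<sigma> * (v0 * x) * inverse \<sigma> = (\<sigma> * v0 * inverse \<sigma>) * (\<sigma> * x * inverse \<sigma>)" by (simp add: mult.assoc)
   also have "\<dots> = v0 * (v0 * x)" using fixed[OF self_in_cyc] sx by simp
   also have "\<dots> = x" using sq[OF v0V] by (simp flip: mult.assoc)
   finally show ?thesis unfolding e2 sx .
  qed
  then have "\<sigma> ^ 2 * x * inverse (\<sigma> ^ 2) * \<sigma> ^ 2 = x * \<sigma> ^ 2" by simp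
  then show ?thesis by (simp add: mult.assoc)
 qed
 then show ?thesis using that[OF v0V v0(2) s0 shift] by blast
qed

text \<open>The indices force \<open>A \<inter> V = {1}\<close>, \<open>card V = 4\<close> and
  \<open>B \<inter> V = {1, v1}\<close>. Since \<open>G = cyc \<sigma> * B\<close> and
  \<open>B\<close> fixes \<open>v1\<close>, the conjugates of \<open>v1\<close> under
  \<open>G\<close> are those under the cyclic group: only \<open>v1\<close>, or \<open>v1\<close>
  and \<open>v0 * v1\<close>. In the first case \<open>v1\<close>, in the second \<open>v0\<close>
  as quotient of two conjugates, is fixed by \<open>G\<close>, against minimality of
  \<open>V\<close>.\<close>

lemma index_two_four_impossible:
 assumes V: "nrm V G" "V \<noteq> {1}" "card V = 2 ^ m" "\<And>x y. x \<in> V ==> y \<in> V ==> x * y = y * x" "\<And>x. x \<in> V ==> x ^ 2 = 1"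
  "\<And>N. nrm N G ==> N \<subseteq> V ==> N \<noteq> {1} ==> N = V"
  and i: "card V = 4 * card (A \<inter> V)" "card V = 2 * card (B \<inter> V)"
 shows False
proof -
 interpret sw: hconf G B A \<sigma> by (rule swap)
 note v = nrmD[OF V(1)]
 have AV: "A \<inter> V = {1}"
  using A_Int_trivial[OF V(1)] intersection_subset_index_prime[OF V(1,2) two_is_prime_nat V(3) i(2)] by blast
 then have cV: "card V = 4" "card (B \<inter> V) = 2" using i by auto
 have J4: "card (A * V \<inter> cyc \<sigma>) = 4" using index_I(3)[OF V(1)] AV cV by simp
 obtain y where y: "A * V \<inter> cyc \<sigma> = cyc y"
  using subgrp_of_cyc[OF fin(3) subgrp_Int[OF index_I(4)[OF V(1)] fin(4)]] by blast
 have yy: "y \<in> A * V" "y \<in> cyc \<sigma>" using y self_in_cyc[of y] by blast+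
 have fy: "finite (cyc y)" using y fin(3) by (metis finite_Int)
 have y2: "y ^ 2 \<noteq> 1" using power_eq_1_iff[OF fy, of 2] J4 y by (auto dest: dvd_imp_le)
 have ex: "\<exists>w\<in>V. y * w \<noteq> w * y"
 proof -
  obtain w where w: "w \<in> V" "y * w * inverse y * inverse w \<notin> A"
   using not_centralizing[OF V(1,4,5) yy y2] by blast
  have "y * w \<noteq> w * y"
  proof
   assume "y * w = w * y"
   then have "y * w * inverse y * inverse w = 1" by (simp add: mult.assoc)
   then show False using w(2) A by simp
  qed
  then show ?thesis using w(1) by blast
 qed
 have c4: "card (cyc y) = 4" using J4 y by simp
 obtain v0 where v0: "v0 \<in> V" "v0 \<noteq> 1" "\<sigma> * v0 = v0 * \<sigma>"
  "\<And>v i. v \<in> V ==> v \<noteq> v0 ==> v \<noteq> 1 ==> i \<in> cyc \<sigma> ==> i * v * inverse i = v \<or> i * v * inverse i = v0 * v"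
  using four_group[OF V(1) cV(1) V(4,5) yy(2) c4 ex] by metis
 have sB: "subgrp (B \<inter> V)" using subgrp_Int[OF B(1) v(1)] .
 have "B \<inter> V \<noteq> {1}" using cV(2) by auto
 then obtain v1 where v1: "v1 \<in> B \<inter> V" "v1 \<noteq> 1" using sB subgrp_one by blast
 have BV: "B \<inter> V = {1, v1}"
 proof -
  have "{1, v1} \<subseteq> B \<inter> V" using v1 subgrp_one[OF sB] by blast
  moreover have "card {1, v1} = card (B \<inter> V)" using v1(2) cV(2) by simp
  ultimately show ?thesis using card_subset_eq[of "B \<inter> V" "{1, v1}"] fin(2) by simp
 qed
 have gv: "\<exists>i\<in>cyc \<sigma>. g * v1 * inverse g = i * v1 * inverse i" if g: "g \<in> G" for g
 proof -
  have "g \<in> cyc \<sigma> * B" using product2_flip[OF G(1) B(1) fin(4) GBI] g by simp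
  then obtain i b where ib: "i \<in> cyc \<sigma>" "b \<in> B" "g = i * b" by (rule in_set_timesE)
  have bG: "b \<in> G" using ib B by auto
  have "b * v1 * inverse b \<in> B \<inter> V"
   using v1 ib B v(3)[OF bG, of v1] by (auto intro!: subgrp_mult subgrp_inverse)
  moreover have "b * v1 * inverse b \<noteq> 1"
  proof
   assume e: "b * v1 * inverse b = 1"
   have "v1 = inverse b * (b * v1 * inverse b) * b" by (simp add: mult.assoc)
   then show False using e v1(2) by simp
  qed
  ultimately have "b * v1 * inverse b = v1" using BV by blast
  moreover have "g * v1 * inverse g = i * (b * v1 * inverse b) * inverse i" by (simp add: ib mult.assoc)
  ultimately show ?thesis using ib by auto
 qed
 have no_fix: False if w: "w \<in> V" "w \<noteq> 1" "\<And>g. g \<in> G ==> g * w * inverse g = w" for w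
 proof -
  have "w * w = 1" using V(5)[OF w(1)] by (simp add: power2_eq_square)
  then have "inverse w = w" using grp_inverse_unique by blast
  then have "nrm {1, w} G" using w v \<open>w * w = 1\<close> G unfolding nrm_def subgrp_def by auto
  then have "{1, w} = V" using V(6)[of "{1, w}"] w v by auto
  then have "card V \<le> 2" using card_insert_le_m1[of 2 "{w}" 1] by auto
  then show False using cV by simp
 qed
 show False
 proof (cases "v1 = v0")
  case True
  have "i * v0 * inverse i = v0" if "i \<in> cyc \<sigma>" for i
   using conj_trivial[of i v0] commute_cyc[OF v0(3)[symmetric] that] by simp
  then have "g * v0 * inverse g = v0" if "g \<in> G" for g using gv[OF that] True by auto
  then show False using no_fix[OF v0(1,2)] by blast
 next
  case False
  have orb: "g * v1 * inverse g = v1 \<or> g * v1 * inverse g = v0 * v1" if gG: "g \<in> G" for g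
  proof -
   obtain i where i: "i \<in> cyc \<sigma>" "g * v1 * inverse g = i * v1 * inverse i" using gv[OF gG] by blast
   show ?thesis unfolding i(2) using v0(4)[of v1 i] False v1 i(1) by blast
  qed
  obtain h where h: "h \<in> G" "h * v1 * inverse h = v0 * v1"
   using no_fix[of v1] v1 orb by blast
  have "g * v0 * inverse g = v0" if g: "g \<in> G" for g
  proof -
   have v0e: "v0 = (h * v1 * inverse h) * inverse v1" unfolding h(2) by (simp add: mult.assoc)
   have ghG: "g * h \<in> G" using g h G by (simp add: subgrp_mult)
   have "g * v0 * inverse g = ((g * h) * v1 * inverse (g * h)) * inverse (g * v1 * inverse g)"
    unfolding v0e by (simp add: mult.assoc)
   moreover have "v0 * inverse v0 = 1" "v0 * v0 = 1" "v1 * inverse v1 = 1" using V(5)[OF v0(1)] by (auto simp: power2_eq_square)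
   moreover have iv: "inverse (v0 * v1) = v0 * inverse v1"
   proof -
    have "inverse v0 = v0" using grp_inverse_unique \<open>v0 * v0 = 1\<close> by blast
    moreover have "inverse v1 * v0 = v0 * inverse v1" using V(4)[of "inverse v1" v0] v1 v0 v by (simp add: subgrp_inverse)
    ultimately show ?thesis by simp
   qed
   ultimately have "g * v0 * inverse g \<in> {1, v0}"
   proof -
    have c: "v1 * (v0 * inverse v1) = v0" using V(4)[of v1 "v0"] v1 v0 by (simp add: mult.assoc[symmetric]) (simp add: mult.assoc)
    have E: "g * v0 * inverse g = ((g * h) * v1 * inverse (g * h)) * inverse (g * v1 * inverse g)" by fact
    have r: "v1 * inverse v1 = 1" "v1 * (v0 * inverse v1) = v0" "(v0 * v1) * inverse v1 = v0" "(v0 * v1) * (v0 * inverse v1) = 1"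
     using c \<open>v0 * v0 = 1\<close> by (simp_all add: mult.assoc)
    have c1: "(g * h) * v1 * inverse (g * h) \<in> {v1, v0 * v1}" using orb[OF ghG] by blast
    have c2: "inverse (g * v1 * inverse g) \<in> {inverse v1, v0 * inverse v1}"
     using orb[OF g] iv by (elim disjE) (simp_all only: insert_iff simp_thms)
    show ?thesis unfolding E using c1 c2 r by (elim insertE emptyE) (simp_all only: insert_iff simp_thms)
   qed
   moreover have "g * v0 * inverse g \<noteq> 1"
   proof
    assume e: "g * v0 * inverse g = 1"
    have "v0 = inverse g * (g * v0 * inverse g) * g" by (simp add: mult.assoc)
    then show False using e v0(2) by simp
   qed
   ultimately show ?thesis by blast
  qed
  then show False using no_fix[OF v0(1,2)] by blast
 qed
qed

text \<open>All conjugates of \<open>A \<inter> N\<close> are shown to lie in a subgroup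
  \<open>T\<close> that does not contain \<open>V\<close>. The largest normal subgroup
  \<open>M\<close> of \<open>G\<close> inside \<open>T\<close> then contains
  \<open>A \<inter> N\<close> but meets the minimal \<open>V\<close> trivially; since
  \<open>N = (A \<inter> N) * V\<close>, it lies in \<open>A\<close> and is trivial. The lemma is
  applied first to \<open>N = V\<close> and then to the largest normal 2-subgroup.\<close>

lemma index_four_step:
 assumes V: "nrm V G" "V \<noteq> {1}" "\<And>x y. x \<in> V ==> y \<in> V ==> x * y = y * x" "\<And>x. x \<in> V ==> x ^ 2 = 1"
  "\<And>N. nrm N G ==> N \<subseteq> V ==> N \<noteq> {1} ==> N = V"
  and N: "nrm N G" "V \<subseteq> N" "\<And>x y. x \<in> V ==> y \<in> N ==> x * y = y * x"
  and NA: "N \<subseteq> (A \<inter> N) * V" and NB: "N \<subseteq> (B \<inter> N) * V" and c4: "card N = 4 * card (B \<inter> N)" "card N = 2 ^ k"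
  and y: "y \<in> A * V" "y \<in> B * V" "y \<in> cyc \<sigma>" "y ^ 2 \<noteq> 1"
 shows "A \<inter> N = {1}"
proof -
 interpret sw: hconf G B A \<sigma> by (rule swap)
 note n = nrmD[OF N(1)] and v = nrmD[OF V(1)]
 have fN: "finite N" using finN[OF N(1)] .
 have yG: "y \<in> G" using y fin by auto
 have inv_N: "nrm (C \<inter> N) N" if C: "subgrp C" "N \<subseteq> (C \<inter> N) * V" for C
  unfolding nrm_def
 proof (intro conjI ballI)
  show "subgrp (C \<inter> N)" using subgrp_Int[OF C(1) n(1)] .
  fix g x assume g: "g \<in> N" and x: "x \<in> C \<inter> N"
  have "g \<in> (C \<inter> N) * V" using g C(2) by blast
  then obtain c w where cw: "c \<in> C \<inter> N" "w \<in> V" "g = c * w" by (rule in_set_timesE)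
  have "g * x * inverse g = c * (w * x * inverse w) * inverse c" by (simp add: cw mult.assoc)
  also have "w * x * inverse w = x" using conj_trivial[OF N(3)[OF cw(2)]] x by blast
  finally show "g * x * inverse g \<in> C \<inter> N" using subgrp_Int[OF C(1) n(1)] cw x by (simp only: subgrp_mult subgrp_inverse)
 qed auto
 have yC: "y * x * inverse y \<in> C \<inter> N" if C: "subgrp C" "C \<subseteq> G" "y \<in> C * V" and x: "x \<in> C \<inter> N" for C x
 proof -
  obtain c w where cw: "c \<in> C" "w \<in> V" "y = c * w" using C(3) by (rule in_set_timesE)
  have "y * x * inverse y = c * (w * x * inverse w) * inverse c" by (simp add: cw mult.assoc)
  also have "w * x * inverse w = x" using conj_trivial[OF N(3)[OF cw(2)]] x by blast
  finally have e: "y * x * inverse y = c * x * inverse c" .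
  have "c * x * inverse c \<in> C" using subgrp_mult[OF C(1) subgrp_mult[OF C(1) cw(1)] subgrp_inverse[OF C(1) cw(1)]] x by blast
  moreover have "c * x * inverse c \<in> N" using n(3)[of c x] C(2) cw(1) x by blast
  ultimately show ?thesis unfolding e by blast
 qed
 \<comment> \<open>\<open>y\<close> acts by conjugation on \<open>N / (B \<inter> N)\<close>, and
   \<open>T\<close> is the set of elements of \<open>N\<close> whose class is fixed.\<close>
 define T where "T = {x \<in> N. y * x * inverse y * inverse x \<in> B \<inter> N}"
 have sub: "cnj g A \<inter> N \<subseteq> T" if g: "g \<in> G" for g
 proof -
  obtain i where i: "i \<in> cyc \<sigma>" "cnj g A = cnj i A" using cnj_A_cyc[OF g] .
  have iG: "i \<in> G" using i fin(5) by auto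
  have sA: "subgrp (cnj g A \<inter> N)" "subgrp (B \<inter> N)" using A B n by (auto intro!: subgrp_Int subgrp_cnj)
  have yA: "y * x * inverse y \<in> cnj g A \<inter> N" if x: "x \<in> cnj g A \<inter> N" for x
  proof -
   have xa: "inverse i * x * i \<in> A \<inter> N" using x i(2) nrm_conj'[OF N(1) G(1) iG] by (auto simp: mem_cnj)
   have yi: "y * i = i * y" using cyc_commute[OF y(3) i(1)] .
   have e: "inverse i * (y * x * inverse y) * i = y * (inverse i * x * i) * inverse y"
   proof -
    have "inverse i * y = y * inverse i" using commute_inverse[OF yi] by simp
    moreover have "inverse y * i = i * inverse y" using commute_inverse[OF yi[symmetric]] by simp
    moreover have "inverse i * (y * x * inverse y) * i = (inverse i * y) * x * (inverse y * i)" by (simp only: mult.assoc)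
    ultimately show ?thesis by (simp only: mult.assoc)
   qed
   have "y * (inverse i * x * i) * inverse y \<in> A \<inter> N" using yC[OF A y(1) xa] .
   then show ?thesis using i(2) e n(3)[OF yG] x by (auto simp: mem_cnj)
  qed
  \<comment> \<open>By \<open>no_product\<close>, \<open>Q\<close> is a proper subgroup of
    \<open>N\<close>, so \<open>B \<inter> N\<close>, of index four in \<open>N\<close>, has index
    at most two in \<open>Q\<close>. Conjugation by \<open>y\<close> preserves both factors, since
    \<open>cnj g A\<close> is a conjugate of \<open>A\<close> by an element commuting with
    \<open>y\<close>; on a quotient of order at most two it acts trivially.\<close>
  define Q where "Q = (cnj g A \<inter> N) * (B \<inter> N)"
  have nB: "nrm (B \<inter> N) N" using inv_N[OF B(1) NB] .
  have sQ: "subgrp Q" unfolding Q_def using subgrp_times_nrm[OF nB n(1) sA(1)] by blast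
  have QN: "Q \<subseteq> N" unfolding Q_def by (rule set_times_subset[OF n(1)]) auto
  have BQ: "B \<inter> N \<subseteq> Q" unfolding Q_def using subset_set_times2[OF sA(1)] .
  have AQ: "cnj g A \<inter> N \<subseteq> Q" unfolding Q_def using subset_set_times1[OF sA(2)] .
  have "Q \<noteq> N"
  proof
   assume "Q = N"
   moreover have "Q \<subseteq> cnj g A * B" unfolding Q_def by (rule set_times_mono2) auto
   ultimately have "N \<subseteq> cnj g A * cnj 1 B" by simp
   moreover have "N \<noteq> {1}" using N(2) V(2) v(1) subgrp_one by blast
   ultimately show False using no_product[OF N(1) _ g subgrp_one[OF G(1)]] by blast
  qed
  have fQ: "finite Q" using finite_subset[OF QN fN] .
  have "card Q \<le> 2 * card (B \<inter> N)"
  proof -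
   obtain d where d: "card N = card Q * d" using card_subgrp_dvd[OF n(1) fN sQ QN] by blast
   have "d \<noteq> 1" using d card_subset_eq[OF fN QN] \<open>Q \<noteq> N\<close> by auto
   moreover have "d \<noteq> 0" using d card_subgrp_pos[OF n(1) fN] by auto
   ultimately have "2 \<le> d" by simp
   then have "card Q * 2 \<le> card N" using d by simp
   then show ?thesis using c4 by simp
  qed
  note q2 = index_two_quotient[OF sQ fQ sA(2) BQ this]
  show ?thesis
  proof
   fix x assume x: "x \<in> cnj g A \<inter> N"
   have yx: "y * x * inverse y \<in> cnj g A \<inter> N" using yA[OF x] .
   show "x \<in> T"
   proof (cases "x \<in> B \<inter> N")
    case True
    then have "y * x * inverse y \<in> B \<inter> N" using yC[OF B y(2)] by blast
    then have "y * x * inverse y * inverse x \<in> B \<inter> N" by (rule subgrp_mult[OF sA(2)]) (rule subgrp_inverse[OF sA(2) True])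
    then show ?thesis using x by (simp add: T_def)
   next
    case F: False
    have "y * x * inverse y \<notin> B \<inter> N"
    proof
     assume a: "y * x * inverse y \<in> B \<inter> N"
     have "(\<lambda>z. y * z * inverse y) ` (B \<inter> N) = B \<inter> N"
     proof (rule card_subset_eq)
      show "(\<lambda>z. y * z * inverse y) ` (B \<inter> N) \<subseteq> B \<inter> N" using yC[OF B y(2)] by blast
      show "card ((\<lambda>z. y * z * inverse y) ` (B \<inter> N)) = card (B \<inter> N)" by (rule card_image) (simp add: inj_on_def)
     qed (use fin in simp)
     then have "y * x * inverse y \<in> (\<lambda>z. y * z * inverse y) ` (B \<inter> N)" using a by simp
     then show False using F by auto
    qed
    then have "(y * x * inverse y) * inverse x \<in> B \<inter> N" using q2 yx x AQ F by blast
    then show ?thesis using x by (simp add: T_def)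
   qed
  qed
 qed
 have VT: "\<not> V \<subseteq> T"
  using sw.not_centralizing[OF V(1,3,4) y(2,3,4)] by (auto simp: T_def)
 have "x = 1" if x: "x \<in> A \<inter> N" for x
 proof -
  define M where "M = {x \<in> N. \<forall>g\<in>G. g * x * inverse g \<in> T}"
  have sT: "subgrp T"
  proof -
   have nB: "nrm (B \<inter> N) N" using inv_N[OF B(1) NB] .
   have sBN: "subgrp (B \<inter> N)" using nB by (simp add: nrm_def)
   show ?thesis unfolding subgrp_def
   proof (intro conjI ballI)
    show "1 \<in> T" using n subgrp_one[OF sBN] by (simp add: T_def)
    fix a assume a: "a \<in> T"
    then have aN: "a \<in> N" "inverse a \<in> N" using n by (auto simp: T_def subgrp_inverse)
    have "inverse a * inverse (y * a * inverse y * inverse a) * a \<in> B \<inter> N"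
     using a nrm_conj'[OF nB n(1) aN(1)] subgrp_inverse[OF sBN] unfolding T_def by blast
    then have "y * inverse a * inverse y * inverse (inverse a) \<in> B \<inter> N" by (simp add: mult.assoc)
    then show "inverse a \<in> T" using aN by (simp add: T_def)
    fix b assume b: "b \<in> T"
    then have bN: "b \<in> N" by (simp add: T_def)
    have "(y * a * inverse y * inverse a) * (a * (y * b * inverse y * inverse b) * inverse a) \<in> B \<inter> N"
     using a b nrmD(3)[OF nB aN(1)] subgrp_mult[OF sBN] unfolding T_def by blast
    then have "y * (a * b) * inverse y * inverse (a * b) \<in> B \<inter> N" by (simp add: mult.assoc)
    then show "a * b \<in> T" using aN bN n by (simp add: T_def subgrp_mult)
   qed
  qed
  have "M = corg G T \<inter> N" using n by (auto simp: M_def corg_def)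
  then have nM: "nrm M G" using nrm_Int[OF nrm_corg[OF G(1) sT] N(1)] by simp
  have AM: "A \<inter> N \<subseteq> M"
  proof
   fix z assume z: "z \<in> A \<inter> N"
   have "g * z * inverse g \<in> T" if "g \<in> G" for g
    using sub[OF that] z n(3)[OF that] by (auto simp: cnj_def)
   then show "z \<in> M" using z by (simp add: M_def)
  qed
  have "M \<inter> V \<noteq> V"
  proof
   assume a: "M \<inter> V = V"
   have "M \<subseteq> T" using corg_subset[OF G(1), of T] \<open>M = corg G T \<inter> N\<close> by blast
   then show False using a VT by blast
  qed
  then have MV: "M \<inter> V = {1}" using V(5)[OF nrm_Int[OF nM V(1)]] by blast
  have "M \<subseteq> A"
  proof
   fix z assume z: "z \<in> M"
   then have "z \<in> (A \<inter> N) * V" using NA by (auto simp: M_def)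
   then obtain a w where aw: "a \<in> A \<inter> N" "w \<in> V" "z = a * w" by (rule in_set_timesE)
   have "a \<in> M" using aw AM by blast
   then have "w \<in> M" using z aw subgrp_mult_iff1[OF nrmD(1)[OF nM]] by blast
   then have "w = 1" using MV aw by blast
   then show "z \<in> A" using aw by simp
  qed
  then have "M = {1}" using core[OF nM] by blast
  then show ?thesis using AM x by blast
 qed
 then show ?thesis using A n by auto
qed

end

section \<open>Fixed points, centralizers and index four on both sides\<close>

lemma commute_iff_conj: "(g::'a::grp) * x * inverse g = x \<longleftrightarrow> g * x = x * g"
proof
 assume "g * x * inverse g = x"
 then have "g * x * inverse g * g = x * g" by simp
 then show "g * x = x * g" by (simp add: mult.assoc)
qed (rule conj_trivial)

lemma conj_eq_one_iff: "(g::'a::grp) * x * inverse g = 1 \<longleftrightarrow> x = 1"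
proof
 assume e: "g * x * inverse g = 1"
 have "x = inverse g * (g * x * inverse g) * g" by (simp add: mult.assoc)
 then show "x = 1" unfolding e by simp
qed simp

lemma pgroup_fixed_nontrivial:
 fixes S V :: "'a::grp set"
 assumes S: "subgrp S" "finite S" "prime p" "card S = p ^ k"
  and V: "subgrp V" "finite V" "V \<noteq> {1}" "card V = p ^ m" "\<And>s v. s \<in> S ==> v \<in> V ==> s * v * inverse s \<in> V"
 obtains v where "v \<in> V" "v \<noteq> 1" "\<And>s. s \<in> S ==> s * v = v * s"
proof -
 let ?F = "{x \<in> V. \<forall>g\<in>S. g * x * inverse g = x}"
 have "m \<noteq> 0"
 proof
  assume "m = 0"
  then have "card V = 1" using V(4) by simp
  then obtain z where "V = {z}" by (auto simp: card_1_singleton_iff)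
  then show False using V(1,3) subgrp_one[OF V(1)] by simp
 qed
 then have "p dvd card V" using V(4) by simp
 moreover have "p dvd card V \<longleftrightarrow> p dvd card ?F"
 proof (rule pgroup_fixed_points[OF S])
  show "grp_action S (\<lambda>g x. g * x * inverse g)" unfolding grp_action_def by (simp add: mult.assoc)
 qed (use V in auto)
 ultimately have "p dvd card ?F" by blast
 moreover have "1 \<in> ?F" using V by simp
 ultimately have "?F \<noteq> {1}" using S(3) by (metis One_nat_def card.empty card.insert finite.emptyI empty_iff not_prime_1 nat_dvd_1_iff_1)
 then obtain v0 where v0: "v0 \<in> ?F" "v0 \<noteq> 1" using \<open>1 \<in> ?F\<close> by blast
 then show ?thesis using that[of v0] commute_iff_conj by blast
qed

lemma subgrp_centralizer: "subgrp G ==> subgrp {g \<in> G. \<forall>y\<in>Y. g * y = y * (g::'a::grp)}"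
 unfolding subgrp_def
proof (intro conjI ballI)
 assume G: "1 \<in> G \<and> (\<forall>x\<in>G. \<forall>y\<in>G. x * y \<in> G) \<and> (\<forall>x\<in>G. inverse x \<in> G)"
 let ?C = "{g \<in> G. \<forall>y\<in>Y. g * y = y * g}"
 show "1 \<in> ?C" using G by simp
 fix a assume a: "a \<in> ?C"
 show "inverse a \<in> ?C" using a G commute_inverse[of _ a] by (auto dest: sym)
 fix b assume b: "b \<in> ?C"
 have "a * b * y = y * (a * b)" if "y \<in> Y" for y
  using commute_mult[of y a b] a b that by simp
 then show "a * b \<in> ?C" using a b G by simp
qed

context hconf
begin

text \<open>The \<open>p\<close>-group \<open>P\<close> fixes a nontrivial element of
  \<open>V\<close>, so the elements of \<open>V\<close> that it centralizes form a nontrivial normal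
  subgroup of \<open>G\<close>, which minimality makes equal to \<open>V\<close>.\<close>

lemma commute_minimal:
 assumes V: "nrm V G" "V \<noteq> {1}" "prime p" "card V = p ^ m"
  "\<And>N. nrm N G ==> N \<subseteq> V ==> N \<noteq> {1} ==> N = V"
  and P: "nrm P G" "card P = p ^ l" and xy: "x \<in> V" "y \<in> P"
 shows "x * y = y * x"
proof -
 note v = nrmD[OF V(1)] and w = nrmD[OF P(1)]
 let ?Z = "{g \<in> V. \<forall>y\<in>P. g * y = y * g}"
 have "nrm ?Z G" unfolding nrm_def
 proof (intro conjI ballI)
  show "subgrp ?Z" by (rule subgrp_centralizer[OF v(1)])
  fix g z assume g: "g \<in> G" and z: "z \<in> ?Z"
  have "(g * z * inverse g) * y = y * (g * z * inverse g)" if y: "y \<in> P" for y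
  proof -
   have "inverse g * y * g \<in> P" using nrm_conj'[OF P(1) G(1) g y] .
   then have e: "z * (inverse g * y * g) = (inverse g * y * g) * z" using z by blast
   have "(g * z * inverse g) * y = g * (z * (inverse g * y * g)) * inverse g" by (simp add: mult.assoc)
   also have "\<dots> = y * (g * z * inverse g)" unfolding e by (simp add: mult.assoc)
   finally show ?thesis .
  qed
  then show "g * z * inverse g \<in> ?Z" using v(3)[OF g] z by simp
 qed (use v(2) in auto)
 moreover obtain z where "z \<in> V" "z \<noteq> 1" "\<And>s. s \<in> P ==> s * z = z * s"
  using pgroup_fixed_nontrivial[OF w(1) finN[OF P(1)] V(3) P(2) v(1) finN[OF V(1)] V(2,4)] v(3) w(2) by blast
 then have "z \<in> ?Z" "z \<noteq> 1" by auto
 then have "?Z \<noteq> {1}" by blast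
 ultimately have "?Z = V" using V(5)[of ?Z] by blast
 then show ?thesis using xy by blast
qed

text \<open>The order of \<open>A * P \<inter> cyc \<sigma>\<close> is a power of two dividing
  \<open>4 * j\<close> with \<open>j\<close> odd, hence at most four, and the intersection contains
  the subgroup of order four coming from \<open>V\<close>. So the index does not grow from
  \<open>V\<close> to \<open>P\<close>.\<close>

lemma index_four_extend:
 assumes V: "nrm V G" "card V = 4" "A \<inter> V = {1}" "card (A * V \<inter> cyc \<sigma>) = 4"
  and P: "nrm P G" "V \<subseteq> P" "card P = 2 ^ l" and j: "odd j" "\<sigma> ^ (4 * j) = 1"
 shows "card P = 4 * card (A \<inter> P)" "P \<subseteq> (A \<inter> P) * V"
proof -
 note v = nrmD[OF V(1)] and w = nrmD[OF P(1)]
 let ?J = "A * P \<inter> cyc \<sigma>"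
 have s: "subgrp ?J" using subgrp_Int[OF index_I(4)[OF P(1)] fin(4)] .
 have f: "finite ?J" using fin(3) by simp
 have "card ?J dvd card P" using index_I(3)[OF P(1)] by simp
 then obtain e where e: "card ?J = 2 ^ e" using P(3) divides_primepow_nat[OF two_is_prime_nat, of "card ?J" l] by auto
 have "card ?J dvd card (cyc \<sigma>)" using card_subgrp_dvd[OF fin(4,3) s] by blast
 also have "card (cyc \<sigma>) dvd 4 * j" using j(2) power_eq_1_iff[OF fin(3)] by blast
 finally have "2 ^ e dvd 4 * j" using e by simp
 moreover have "coprime (2 ^ e) j" using j(1) by simp
 ultimately have "2 ^ e dvd (4::nat)" using coprime_dvd_mult_left_iff by blast
 then have le: "card ?J \<le> 4" using e dvd_imp_le[of "2 ^ e" 4] by simp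
 have "A * V \<inter> cyc \<sigma> \<subseteq> ?J" using set_times_mono2[OF subset_refl[of A] P(2)] by blast
 then have "card ?J \<ge> 4" using card_mono[OF f, of "A * V \<inter> cyc \<sigma>"] V(4) by simp
 then have "card ?J = 4" using le by simp
 then show c: "card P = 4 * card (A \<inter> P)" using index_I(3)[OF P(1)] by simp
 have sAP: "subgrp (A \<inter> P)" using subgrp_Int[OF A(1) w(1)] .
 have fAP: "finite (A \<inter> P)" using fin(1) by simp
 have "A \<inter> P \<inter> V = {1}" using V(3) P(2) by blast
 then have "card ((A \<inter> P) * V) = card P"
  using card_set_times[OF sAP v(1) fAP finN[OF V(1)]] V(2) c by simp
 moreover have "(A \<inter> P) * V \<subseteq> P" by (rule set_times_subset[OF w(1) _ P(2)]) auto
 ultimately show "P \<subseteq> (A \<inter> P) * V" using card_subset_eq[OF finN[OF P(1)]] by blast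
qed

text \<open>The subgroups of order four cut out by \<open>A * V\<close> and \<open>B * V\<close>
  agree by cyclicity; let \<open>y\<close> generate them. Two applications of
  \<open>index_four_step\<close> give \<open>card V = 4\<close> and then \<open>P = V\<close> for
  the largest normal 2-subgroup \<open>P\<close>. Since \<open>\<sigma> ^ 2\<close> centralizes
  \<open>V\<close> and \<open>P\<close> contains its centralizer, \<open>\<sigma> ^ 2\<close> lies
  in \<open>V\<close> and \<open>\<sigma> ^ 4 = 1\<close>.\<close>

lemma index_four_four:
 assumes V: "nrm V G" "V \<noteq> {1}" "card V = 2 ^ m" "\<And>x y. x \<in> V ==> y \<in> V ==> x * y = y * x" "\<And>x. x \<in> V ==> x ^ 2 = 1"
  "\<And>N. nrm N G ==> N \<subseteq> V ==> N \<noteq> {1} ==> N = V"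
  and i: "card V = 4 * card (A \<inter> V)" "card V = 4 * card (B \<inter> V)"
 shows "card (cyc \<sigma>) = 4"
proof -
 interpret sw: hconf G B A \<sigma> by (rule swap)
 note v = nrmD[OF V(1)]
 have sAV: "subgrp (A \<inter> V)" "subgrp (B \<inter> V)" using subgrp_Int A B v by blast+
 have "card (A \<inter> V) > 0" "card (B \<inter> V) > 0" using sAV fin card_subgrp_pos by blast+
 then have J: "card (A * V \<inter> cyc \<sigma>) = 4" "card (B * V \<inter> cyc \<sigma>) = 4"
  using index_I(3)[OF V(1)] sw.index_I(3)[OF V(1)] i by auto
 have sJ: "subgrp (A * V \<inter> cyc \<sigma>)" "subgrp (B * V \<inter> cyc \<sigma>)"
  using subgrp_Int index_I(4)[OF V(1)] sw.index_I(4)[OF V(1)] fin(4) by blast+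
 have eq: "A * V \<inter> cyc \<sigma> = B * V \<inter> cyc \<sigma>"
  using cyc_subgrp_unique[OF fin(3) sJ(1) _ sJ(2)] J by simp
 obtain y where y: "A * V \<inter> cyc \<sigma> = cyc y" using subgrp_of_cyc[OF fin(3) sJ(1)] by blast
 have yy: "y \<in> A * V" "y \<in> B * V" "y \<in> cyc \<sigma>" using y eq self_in_cyc[of y] by blast+
 have c4: "card (cyc y) = 4" using J y by simp
 have fy: "finite (cyc y)" using c4 by (intro card_ge_0_finite) simp
 have y2: "y ^ 2 \<noteq> 1" using power_eq_1_iff[OF fy, of 2] c4 by (auto dest: dvd_imp_le)
 have AV: "A \<inter> V = {1}"
  by (rule index_four_step[OF V(1,2,4,5,6) V(1) subset_refl V(4) subset_set_times2[OF sAV(1)] subset_set_times2[OF sAV(2)] i(2) V(3) yy y2])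
 have BV: "B \<inter> V = {1}"
  by (rule sw.index_four_step[OF V(1,2,4,5,6) V(1) subset_refl V(4) subset_set_times2[OF sAV(2)] subset_set_times2[OF sAV(1)] i(1) V(3) yy(2,1,3) y2])
 have cV: "card V = 4" using i AV by simp
 have ex: "\<exists>w\<in>V. y * w \<noteq> w * y"
 proof -
  obtain w where w: "w \<in> V" "y * w * inverse y * inverse w \<notin> A"
   using not_centralizing[OF V(1,4,5) yy(1,3) y2] by blast
  have "y * w \<noteq> w * y"
  proof
   assume "y * w = w * y"
   then have "y * w * inverse y * inverse w = 1" by (simp add: mult.assoc)
   then show False using w(2) A by simp
  qed
  then show ?thesis using w(1) by blast
 qed
 obtain s2: "\<And>v. v \<in> V ==> \<sigma> ^ 2 * v = v * \<sigma> ^ 2"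
  using four_group[OF V(1) cV V(4,5) yy(3) c4 ex] by metis
 obtain j where j: "y = \<sigma> ^ j" using yy(3) by (auto simp: cyc_def)
 have oj: "odd j"
 proof
  assume "even j"
  then obtain k where "j = 2 * k" by blast
  then have yk: "y = (\<sigma> ^ 2) ^ k" using j by (simp add: power_mult)
  obtain w where w: "w \<in> V" "y * w \<noteq> w * y" using ex by blast
  have "w * y = y * w" unfolding yk by (rule commute_power) (rule s2[OF w(1), symmetric])
  then show False using w(2) by simp
 qed
 have "y ^ 4 = 1" using finite_order(2)[OF fy] c4 by simp
 then have s4: "\<sigma> ^ (4 * j) = 1" using j by (simp add: power_mult[symmetric] mult.commute)
 obtain P l where P: "nrm P G" "card P = 2 ^ l" "\<And>Q m. nrm Q G ==> card Q = 2 ^ m ==> Q \<subseteq> P"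
  using largest_normal_pgroup[OF G two_is_prime_nat] by metis
 have VP: "V \<subseteq> P" using P(3)[OF V(1,3)] .
 have pA: "card P = 4 * card (A \<inter> P)" "P \<subseteq> (A \<inter> P) * V"
  using index_four_extend[OF V(1) cV AV J(1) P(1) VP P(2) oj s4] by blast+
 have pB: "card P = 4 * card (B \<inter> P)" "P \<subseteq> (B \<inter> P) * V"
  using sw.index_four_extend[OF V(1) cV BV J(2) P(1) VP P(2) oj s4] by blast+
 have "A \<inter> P = {1}"
  by (rule index_four_step[OF V(1,2,4,5,6) P(1) VP commute_minimal[OF V(1,2) two_is_prime_nat V(3,6) P(1,2)] pA(2) pB(2,1) P(2) yy y2])
 then have "card P = card V" using pA cV by simp
 then have PV: "P = V" using card_subset_eq[OF finN[OF P(1)] VP] by simp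
 have s2G: "\<sigma> ^ 2 \<in> G" using subgrp_power[OF G(1) sig] .
 have "\<sigma> ^ 2 \<in> P" by (rule centralizer_in_P[OF two_is_prime_nat V(1,2,3) P s2G]) (simp_all only: PV s2)
 then have "(\<sigma> ^ 2) ^ 2 = 1" using V(5) PV by blast
 then have "\<sigma> ^ 4 = 1" by (simp flip: power_mult)
 then have "card (cyc \<sigma>) \<le> 4" using finite_order(3)[OF fin(3), of 4] by simp
 moreover have "card (cyc y) \<le> card (cyc \<sigma>)" by (rule card_mono[OF fin(3)]) (use y in blast)
 ultimately show ?thesis using c4 by simp
qed

text \<open>Coprime action: \<open>\<sigma> ^ 4\<close> has odd order and acts trivially on
  \<open>Q\<close> and on the quotient of order two, hence trivially on \<open>P\<close>. It then
  lies in \<open>P\<close> by \<open>centralizer_in_P\<close>, a 2-group without elements of odd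
  order other than 1.\<close>

lemma odd_part_trivial:
 assumes V: "nrm V G" "V \<noteq> {1}" "card V = 2 ^ m"
  and P: "nrm P G" "card P = 2 ^ l" "\<And>Q m. nrm Q G ==> card Q = 2 ^ m ==> Q \<subseteq> P"
  and Q: "subgrp Q" "Q \<subseteq> P" "card P = 2 * card Q" "\<And>q. q \<in> Q ==> \<sigma> * q = q * \<sigma>"
  and r: "\<sigma> ^ (4 * r) = 1" "odd r"
 shows "\<sigma> ^ 4 = 1"
proof -
 let ?\<rho> = "\<sigma> ^ 4"
 note w = nrmD[OF P(1)]
 have rG: "?\<rho> \<in> G" using subgrp_power[OF G(1) sig] .
 have rr: "?\<rho> ^ r = 1" using r(1) by (simp add: power_mult)
 have cq: "?\<rho> * q = q * ?\<rho>" if "q \<in> Q" for q using commute_power[OF Q(4)[OF that, symmetric], of 4] by simp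
 have fP: "finite P" using finN[OF P(1)] .
 have "?\<rho> * x = x * ?\<rho>" if x: "x \<in> P" for x
 proof (cases "x \<in> Q")
  case False
  let ?q = "?\<rho> * x * inverse ?\<rho> * inverse x"
  have n: "?\<rho> * x * inverse ?\<rho> \<notin> Q"
  proof
   assume a: "?\<rho> * x * inverse ?\<rho> \<in> Q"
   have "?\<rho> * (?\<rho> * x * inverse ?\<rho>) = (?\<rho> * x * inverse ?\<rho>) * ?\<rho>" by (rule cq[OF a])
   then have "?\<rho> * (?\<rho> * x * inverse ?\<rho>) = ?\<rho> * x" by (simp add: mult.assoc)
   then have "?\<rho> * x * inverse ?\<rho> = x" by (rule iffD1[OF grp_mult_left_cancel])
   then show False using a False by simp
  qed
  have qQ: "?q \<in> Q"
   using index_two_quotient[OF w(1) fP Q(1,2) _ w(3)[OF rG x] n x False] Q(3) by simp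
  have e: "?\<rho> ^ k * x = ?q ^ k * x * ?\<rho> ^ k" for k
  proof (induction k)
   case (Suc k)
   have "?\<rho> ^ Suc k * x = ?\<rho> * (?\<rho> ^ k * x)" by (simp add: mult.assoc)
   also have "\<dots> = (?\<rho> * ?q ^ k) * x * ?\<rho> ^ k" unfolding Suc.IH by (simp only: mult.assoc)
   also have "?\<rho> * ?q ^ k = ?q ^ k * ?\<rho>" by (rule commute_power[OF cq[OF qQ]])
   also have "?q ^ k * ?\<rho> * x * ?\<rho> ^ k = ?q ^ k * (?q * x * ?\<rho>) * ?\<rho> ^ k" by (simp add: mult.assoc)
   also have "\<dots> = ?q ^ Suc k * x * ?\<rho> ^ Suc k"
    using power_Suc2[of ?q k] by (simp only: mult.assoc power_Suc[of "\<sigma> ^ 4"])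
   finally show ?case .
  qed simp
  have "?q ^ r * x * 1 = 1 * x" using e[of r] unfolding rr by simp
  then have "?q ^ r = 1" by simp
  moreover have "?q ^ card P = 1" using grp_power_card[OF w(1) fP] qQ Q(2) by blast
  moreover have "coprime r (card P)" using r(2) P(2) by simp
  moreover have "finite (cyc ?q)" using finite_subset[OF cyc_subset[OF Q(1) qQ]] finite_subset[OF Q(2) fP] by blast
  ultimately have "?q = 1" by (rule coprime_powers_trivial)
  then have "?\<rho> ^ 1 * x = x * ?\<rho> ^ 1" using e[of 1] by simp
  then show ?thesis by simp
 qed (rule cq)
 then have "?\<rho> \<in> P"
  by (intro centralizer_in_P[OF two_is_prime_nat V P(1,2) _ rG]) (use P(3) in blast)+
 then have "?\<rho> ^ card P = 1" using grp_power_card[OF w(1) fP] by blast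
 moreover have "coprime r (card P)" using r(2) P(2) by simp
 moreover have "finite (cyc ?\<rho>)" using finite_subset[OF cyc_subset[OF G(1) rG] G(2)] .
 ultimately show ?thesis using coprime_powers_trivial[OF rr] by blast
qed

text \<open>In this affine-type group \<open>A\<close> and \<open>B\<close> are complements of
  \<open>V\<close>. A nontrivial \<open>a\<close> in \<open>A\<close> fixes only 1 in
  \<open>V\<close>, so \<open>w \<mapsto> w * a * inverse w * inverse a\<close> is onto
  \<open>V\<close> and \<open>a\<close> is conjugate to an element \<open>b\<close> of
  \<open>B\<close>. Both \<open>B\<close> and the conjugate of \<open>A\<close> through
  \<open>b\<close> embed in the abelian quotient by \<open>V\<close>, so both centralize
  \<open>b\<close>; by \<open>gen\<close> the whole group does, and \<open>b\<close> lies in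
  \<open>V\<close>.\<close>

lemma self_centralizing_prime_impossible:
 assumes V: "nrm V G" "prime p" "card V = p" "\<And>x. x \<in> G ==> (\<And>y. y \<in> V ==> x * y = y * x) ==> x \<in> V"
  and I: "cyc \<sigma> \<subseteq> V" and AV: "A \<inter> V = {1}" and BV: "B \<inter> V = {1}"
 shows False
proof -
 interpret sw: hconf G B A \<sigma> by (rule swap)
 note v = nrmD[OF V(1)]
 have fV: "finite V" using finN[OF V(1)] .
 have GV: "A * V = G" "B * V = G"
  using set_times_mono2[OF subset_refl I, of A] set_times_mono2[OF subset_refl I, of B] GAI GBI
   set_times_subset[OF G(1) A(2) v(2)] set_times_subset[OF G(1) B(2) v(2)] by blast+
 have "A \<noteq> {1}"
 proof
  assume a: "A = {1}"
  have "card (cyc \<sigma>) > 0" using card_subgrp_pos[OF fin(4,3)] .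
  then have "card B = 1" using card_GA sw.card_GA a by simp
  then have "B = {1}" using B(1) by (metis card_1_singletonE singletonD subgrp_one)
  then have "{1} = G" using gen[of "{1}" 1 1] a subgrp_one[OF G(1)] by simp
  then show False using G_nontrivial by simp
 qed
 then obtain a where a: "a \<in> A" "a \<noteq> 1" using subgrp_one[OF A(1)] by blast
 have aG: "a \<in> G" using a A by blast
 have fpf: "w = 1" if w: "w \<in> V" "a * w = w * a" for w
 proof (rule ccontr)
  assume w1: "w \<noteq> 1"
  let ?C = "{g \<in> G. \<forall>y\<in>{a}. g * y = y * g}"
  have "V \<subseteq> ?C"
   using prime_order_subset[OF v(1) fV _ subgrp_centralizer[OF G(1)] w(1) _ w1, of "{a}"] V(2,3) w v(2) by auto
  then have "a * y = y * a" if "y \<in> V" for y using that by auto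
  then have "a \<in> V" by (rule V(4)[OF aG])
  then show False using a AV by blast
 qed
 have "a \<in> B * V" using GV aG by simp
 then obtain b u where b: "b \<in> B" "u \<in> V" "a = b * u" by (rule in_set_timesE)
 have bG: "b \<in> G" using b B by blast
 let ?f = "\<lambda>w. w * a * inverse w * inverse a"
 have "inj_on ?f V"
 proof (rule inj_onI)
  fix w z assume wz: "w \<in> V" "z \<in> V" and e: "?f w = ?f z"
  have "inverse z * (?f w * a) * w = inverse z * (?f z * a) * w" unfolding e ..
  then have "(inverse z * w) * a = a * (inverse z * w)" by (simp add: mult.assoc)
  then have "inverse z * w = 1" using fpf[of "inverse z * w"] v wz by (simp add: subgrp_mult subgrp_inverse)
  then have "z * (inverse z * w) = z * 1" by (rule arg_cong)
  then show "w = z" by simp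
 qed
 moreover have "?f ` V \<subseteq> V"
 proof
  fix z assume "z \<in> ?f ` V"
  then obtain w where w: "w \<in> V" "z = ?f w" by blast
  have "z = w * (a * inverse w * inverse a)" unfolding w(2) by (simp only: mult.assoc)
  then show "z \<in> V" using subgrp_mult[OF v(1) w(1) v(3)[OF aG subgrp_inverse[OF v(1) w(1)]]] by simp
 qed
 ultimately have "?f ` V = V" using endo_inj_surj[OF fV] by blast
 moreover have "a * inverse u * inverse a \<in> V" using v(3)[OF aG subgrp_inverse[OF v(1) b(2)]] .
 ultimately obtain w where w: "w \<in> V" "?f w = a * inverse u * inverse a" by (metis (no_types, lifting) imageE)
 have wG: "w \<in> G" using w v by blast
 have "?f w * a = a * inverse u * inverse a * a" unfolding w(2) ..
 then have wb: "w * a * inverse w = a * inverse u" by (simp add: mult.assoc)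
 also have "\<dots> = b" unfolding b(3) by (simp add: mult.assoc)
 finally have wb: "w * a * inverse w = b" .
 have b1: "b \<noteq> 1" using wb a(2) conj_eq_one_iff by blast
 obtain v0 where v0: "v0 \<in> V" "v0 \<noteq> 1"
 proof -
  have "V \<noteq> {1}" using V(2,3) by auto
  then show ?thesis using that subgrp_one[OF v(1)] by blast
 qed
 have fv0: "finite (cyc v0)" using finite_subset[OF cyc_subset[OF v(1) v0(1)] fV] .
 have Vc: "V = cyc v0"
  using prime_order_subset[OF v(1) fV _ subgrp_cyc[OF fv0] v0(1) self_in_cyc v0(2)] V(2,3) cyc_subset[OF v(1) v0(1)] by auto
 have conjp: "g * x ^ i * inverse g = (g * x * inverse g) ^ i" for g x :: 'a and i
 proof (induction i)
  case (Suc i)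
  have "g * x ^ Suc i * inverse g = (g * x * inverse g) * (g * x ^ i * inverse g)" by (simp add: mult.assoc)
  then show ?case unfolding Suc.IH by simp
 qed simp
 \<comment> \<open>Conjugation raises the generator \<open>v0\<close> of \<open>V\<close> to a
   power, and such maps commute with each other. So a commutator centralizes \<open>V\<close> and
   therefore belongs to it.\<close>
 have comm: "g * h * inverse g * inverse h \<in> V" if gh: "g \<in> G" "h \<in> G" for g h
 proof -
  have "g * v0 * inverse g \<in> cyc v0" "h * v0 * inverse h \<in> cyc v0" using v(3) gh v0 Vc by blast+
  then obtain i j where ij: "g * v0 * inverse g = v0 ^ i" "h * v0 * inverse h = v0 ^ j" by (auto simp: cyc_def)
  have "(g * h) * v0 * inverse (g * h) = g * (h * v0 * inverse h) * inverse g" by (simp add: mult.assoc)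
  also have "\<dots> = v0 ^ (i * j)" unfolding ij(2) conjp ij(1) by (simp add: power_mult)
  finally have e1: "(g * h) * v0 * inverse (g * h) = v0 ^ (i * j)" .
  have "(h * g) * v0 * inverse (h * g) = h * (g * v0 * inverse g) * inverse h" by (simp add: mult.assoc)
  also have "\<dots> = v0 ^ (j * i)" unfolding ij(1) conjp ij(2) by (simp add: power_mult)
  finally have e2: "(h * g) * v0 * inverse (h * g) = v0 ^ (i * j)" by (simp add: mult.commute)
  let ?c = "inverse (h * g) * (g * h)"
  have "?c * v0 * inverse ?c = inverse (h * g) * ((g * h) * v0 * inverse (g * h)) * (h * g)" by (simp add: mult.assoc)
  also have "\<dots> = inverse (h * g) * ((h * g) * v0 * inverse (h * g)) * (h * g)" unfolding e1 e2 ..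
  also have "\<dots> = v0" by (simp add: mult.assoc)
  finally have c: "?c * v0 = v0 * ?c" by (simp only: commute_iff_conj)
  have cV: "?c \<in> V"
  proof (rule V(4))
   show "?c \<in> G" using gh G by (simp add: subgrp_mult subgrp_inverse)
   fix y assume "y \<in> V"
   then show "?c * y = y * ?c" by (intro commute_cyc[OF c]) (simp only: Vc[symmetric])
  qed
  have hgG: "h * g \<in> G" using gh G by (simp add: subgrp_mult)
  have "g * h * inverse g * inverse h = (h * g) * ?c * inverse (h * g)" by (simp add: mult.assoc)
  then show ?thesis using v(3)[OF hgG cV] by simp
 qed
 let ?D = "{g \<in> G. \<forall>y\<in>{b}. g * y = y * g}"
 have key: "x * b = b * x" if x: "x \<in> C" "subgrp C" "C \<subseteq> G" "C \<inter> V = {1}" "b \<in> C" for x C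
 proof -
  have "x * b * inverse x * inverse b \<in> C \<inter> V"
   using comm[of x b] x bG by (auto intro!: subgrp_mult subgrp_inverse)
  then have "x * b * inverse x * inverse b = 1" using x(4) by blast
  then have "x * b * inverse x * inverse b * b * x = 1 * b * x" by simp
  then show ?thesis by (simp add: mult.assoc)
 qed
 have "cnj w A \<inter> V = {1}" using cnj_Int[of w A V] AV cnj_nrm[OF V(1) G(1) wG] by (auto simp: cnj_def)
 moreover have "b \<in> cnj w A" using wb a(1) unfolding cnj_def by blast
 ultimately have "x * b = b * x" "x \<in> G" if "x \<in> cnj w A" for x
  using key[OF that subgrp_cnj[OF A(1)] cnj_subset[OF G(1) wG A(2)]] that cnj_subset[OF G(1) wG A(2)] by blast+
 then have "cnj w A \<subseteq> ?D" by blast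
 moreover have "x * b = b * x" "x \<in> G" if "x \<in> cnj 1 B" for x
  using key[of x B] that B BV b(1) by (simp_all only: cnj_1 subsetD)
 then have "cnj 1 B \<subseteq> ?D" by blast
 ultimately have "?D = G" using gen[OF subgrp_centralizer[OF G(1)] _ wG subgrp_one[OF G(1)]] by blast
 then have "y * b = b * y" if "y \<in> V" for y using that v(2) by blast
 then have "b \<in> V" by (intro V(4)[OF bG]) (rule sym)
 then show False using b(1) BV b1 by blast
qed

end

section \<open>A minimal normal subgroup of prime order and a Sylow subgroup\<close>

lemma subgrp_normalizer:
 assumes "subgrp (G::'a::grp set)"
 shows "subgrp {g \<in> G. cnj g M = M}"
 unfolding subgrp_def
proof (intro conjI ballI)
 let ?N = "{g \<in> G. cnj g M = M}"
 show "1 \<in> ?N" using assms by simp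
 fix g assume g: "g \<in> ?N"
 have "cnj (inverse g) (cnj g M) = M" by (simp only: cnj_cnj grp_left_inverse cnj_1)
 then have "cnj (inverse g) M = M" using g by (simp only: mem_Collect_eq)
 then show "inverse g \<in> ?N" using g subgrp_inverse[OF assms] by blast
 fix h assume h: "h \<in> ?N"
 have "cnj (g * h) M = cnj g (cnj h M)" by (simp only: cnj_cnj)
 then have "cnj (g * h) M = M" using g h by (simp only: mem_Collect_eq)
 then show "g * h \<in> ?N" using g h subgrp_mult[OF assms] by blast
qed

lemma cnj_eqI:
 assumes "finite M" "\<And>x. x \<in> M ==> g * x * inverse g \<in> M"
 shows "cnj g M = M"
proof (rule card_subset_eq[OF assms(1)])
 show "cnj g M \<subseteq> M" unfolding cnj_def using assms(2) by blast
qed simp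

lemma nrm_of_cnj: "subgrp M ==> M \<subseteq> G ==> (\<And>g. g \<in> G ==> cnj g M = M) ==> nrm M G"
 unfolding nrm_def cnj_def by blast

lemma power_of_order:
 assumes f: "finite (cyc (u::'a::grp))" and n: "card (cyc u) = q * r" "r > 0"
 shows "card (cyc (u ^ r)) = q"
proof -
 have s: "cyc (u ^ r) \<subseteq> cyc u" by (auto simp: cyc_def simp flip: power_mult)
 have f': "finite (cyc (u ^ r))" using finite_subset[OF s f] .
 have "(u ^ r) ^ q = 1" using finite_order(2)[OF f] n by (simp flip: power_mult add: mult.commute)
 then have 1: "card (cyc (u ^ r)) dvd q" using power_eq_1_iff[OF f'] by blast
 have "u ^ (r * card (cyc (u ^ r))) = 1" using finite_order(2)[OF f'] by (simp add: power_mult)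
 then have "r * q dvd r * card (cyc (u ^ r))" using power_eq_1_iff[OF f] n by (simp add: mult.commute)
 then have "q dvd card (cyc (u ^ r))" using n(2) by simp
 then show ?thesis using 1 by (rule dvd_antisym[rotated])
qed

text \<open>The Sylow subgroup \<open>S\<close> is in general position: it contains the
  \<open>p\<close>-part \<open>\<tau>\<close> of \<open>\<sigma>\<close>, and
  \<open>A \<inter> S\<close> and \<open>B \<inter> S\<close> are Sylow in \<open>A\<close> and
  \<open>B\<close>. The natural numbers \<open>c\<close>, \<open>ca\<close>, \<open>cb\<close> and
  \<open>r\<close> are the cofactors prime to \<open>p\<close>.\<close>

locale hsyl = hconf G A B \<sigma> for G A B :: "'a::grp set" and \<sigma> :: 'a +
 fixes p k r c ca cb :: nat and V S :: "'a set" and \<tau> :: 'a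
 assumes p: "prime p"
  and V: "nrm V G" "card V = p" "A \<inter> V = {1}" "B \<inter> V = {1}"
  and S: "subgrp S" "S \<subseteq> G" "card S = p ^ k" "card G = card S * c" "\<not> p dvd c"
  and cA: "card A = card (A \<inter> S) * ca" "\<not> p dvd ca"
  and cB: "card B = card (B \<inter> S) * cb" "\<not> p dvd cb"
  and tau: "\<tau> = \<sigma> ^ r" "\<tau> \<in> S" "card (cyc \<sigma>) = card (cyc \<tau>) * r" "\<not> p dvd r"
begin

lemma syl_swap: "hsyl G B A \<sigma> p k r c cb ca V S \<tau>"
 by (intro hsyl.intro hsyl_axioms.intro swap) (rule p V S cA cB tau)+

lemma finS: "finite S" using finite_subset[OF S(2) G(2)] .

lemma ftau: "cyc \<tau> \<subseteq> S" "finite (cyc \<tau>)" "subgrp (cyc \<tau>)" "cyc \<tau> \<subseteq> cyc \<sigma>"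
proof -
 show 1: "cyc \<tau> \<subseteq> S" using cyc_subset[OF S(1) tau(2)] .
 show 2: "finite (cyc \<tau>)" using finite_subset[OF 1 finS] .
 show "subgrp (cyc \<tau>)" using subgrp_cyc[OF 2] .
 show "cyc \<tau> \<subseteq> cyc \<sigma>" using cyc_subset[OF fin(4)] tau(1) by simp
qed

lemma prime_power_subgrp:
 assumes "subgrp H" "H \<subseteq> S"
 obtains e where "card H = p ^ e"
proof -
 have "card H dvd p ^ k" using card_subgrp_dvd[OF S(1) finS assms] S(3) by simp
 then show ?thesis using that divides_primepow_nat[OF p] by blast
qed

lemma AS: "subgrp (A \<inter> S)" "finite (A \<inter> S)" "subgrp (B \<inter> S)" "finite (B \<inter> S)"
 using subgrp_Int A(1) B(1) S(1) fin by auto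

text \<open>The \<open>p\<close>-part of
  \<open>card G = card A * card (cyc \<sigma>)\<close>.\<close>

lemma card_S: "card S = card (A \<inter> S) * card (cyc \<tau>)"
proof -
 obtain e where e: "card (cyc \<tau>) = p ^ e" using prime_power_subgrp[OF ftau(3,1)] .
 obtain f where f: "card (A \<inter> S) = p ^ f" using prime_power_subgrp[OF AS(1)] by blast
 have "c * p ^ k = (ca * r) * p ^ (f + e)"
  using card_GA S(3,4) cA(1) tau(3) e f by (simp add: power_add mult_ac)
 moreover have "\<not> p dvd ca * r" using prime_dvd_mult_iff[OF p] cA(2) tau(4) by blast
 ultimately have "k = f + e" using prime_power_cancel[OF p] S(5) by blast
 then show ?thesis using S(3) e f by (simp add: power_add)
qed

lemma S_AI: "S = (A \<inter> S) * cyc \<tau>" "A \<inter> S \<inter> cyc \<tau> = {1}"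
proof -
 show i: "A \<inter> S \<inter> cyc \<tau> = {1}" using AI ftau subgrp_one[OF AS(1)] subgrp_one[OF ftau(3)] by blast
 then have "card ((A \<inter> S) * cyc \<tau>) = card S"
  using card_set_times[OF AS(1) ftau(3) AS(2) ftau(2)] card_S by simp
 moreover have "(A \<inter> S) * cyc \<tau> \<subseteq> S" by (rule set_times_subset[OF S(1) _ ftau(1)]) auto
 ultimately show "S = (A \<inter> S) * cyc \<tau>" using card_subset_eq[OF finS] by blast
qed

lemma normal_pgroup_subset:
 assumes N: "nrm N G" "card N = p ^ m"
 shows "N \<subseteq> S"
proof -
 obtain g where g: "g \<in> G" "cnj g N \<subseteq> S"
  using pgroup_conj_into[OF G p S(1,2,4,5) nrmD(1,2)[OF N(1)] N(2)] by blast
 then show ?thesis using cnj_nrm[OF N(1) G(1) g(1)] by simp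
qed

lemma V_facts: "subgrp V" "finite V" "V \<subseteq> S" "V \<noteq> {1}" "prime (card V)" "nrm V S"
proof -
 show "subgrp V" "finite V" using nrmD(1)[OF V(1)] finN[OF V(1)] .
 show 1: "V \<subseteq> S" using normal_pgroup_subset[OF V(1), of 1] V(2) by simp
 show "V \<noteq> {1}" using V(2) p by auto
 show "prime (card V)" using V(2) p by simp
 show "nrm V S" using nrm_subset[OF V(1) 1 S(2)] .
qed

lemma central:
 assumes "v \<in> V" "s \<in> S"
 shows "v * s = s * v"
proof -
 have cV: "card V = p ^ 1" using V(2) by simp
 obtain v0 where v0: "v0 \<in> V" "v0 \<noteq> 1" "\<And>s. s \<in> S ==> s * v0 = v0 * s"
  using pgroup_fixed_nontrivial[OF S(1) finS p S(3) V_facts(1,2,4) cV] nrmD(3)[OF V_facts(6)] by blast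
 let ?C = "{g \<in> G. \<forall>y\<in>S. g * y = y * g}"
 have "v0 \<in> ?C" using v0 V_facts(3) S(2) by auto
 then have "V \<subseteq> ?C" using prime_order_subset[OF V_facts(1,2,5) subgrp_centralizer[OF G(1)] v0(1) _ v0(2)] by blast
 then show ?thesis using assms by blast
qed

text \<open>Again a comparison of \<open>p\<close>-parts, now in the count of
  \<open>A * V * B = G\<close>. The overlap of \<open>(A \<inter> S) * V\<close> with
  \<open>B \<inter> S\<close> is a subgroup of the overlap of \<open>A * V\<close> with
  \<open>B\<close>, so its order divides the larger one; this is enough to make the product inside
  \<open>S\<close> as large as \<open>S\<close>.\<close>

lemma S_AVB: "S = (A \<inter> S) * V * (B \<inter> S)"
proof -
 let ?A = "A \<inter> S" and ?B = "B \<inter> S"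
 have i: "?A \<inter> V = {1}" using V(3) V_facts(3) by blast
 have c1: "card (A * V) = card A * p" using card_set_times[OF A(1) V_facts(1) fin(1) V_facts(2)] V(2,3) by simp
 have c2: "card (?A * V) = card ?A * p" using card_set_times[OF AS(1) V_facts(1) AS(2) V_facts(2)] V(2) i by simp
 have s1: "subgrp (A * V)" using subgrp_times_nrm[OF V(1) G(1) A] .
 have s2: "subgrp (?A * V)" using subgrp_times_nrm[OF V_facts(6) S(1) AS(1)] by blast
 have AVS: "?A * V \<subseteq> S" by (rule set_times_subset[OF S(1) _ V_facts(3)]) auto
 have f1: "finite (A * V)" "finite (?A * V)" using finite_set_times' fin AS V_facts by blast+
 let ?R = "A * V \<inter> B" and ?Q = "?A * V \<inter> ?B"
 have e1: "card G * card ?R = card A * p * card B"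
  using card_set_times[OF s1 B(1) f1(1) fin(2)] norm[OF V(1) V_facts(4)] c1 by simp
 have e2: "card (?A * V * ?B) * card ?Q = card ?A * p * card ?B"
  using card_set_times[OF s2 AS(3) f1(2) AS(4)] c2 by simp
 have sQ: "subgrp ?Q" "subgrp ?R" using subgrp_Int s1 s2 AS(3) B(1) by blast+
 have "?Q \<subseteq> ?R" using set_times_mono2[of ?A A V V] by blast
 then have "card ?Q dvd card ?R" using card_subgrp_dvd[OF sQ(2) _ sQ(1)] f1 by simp
 then obtain y where y: "card ?R = card ?Q * y" by blast
 obtain x where x: "card ?Q = p ^ x" using prime_power_subgrp[OF sQ(1)] by blast
 obtain a where a: "card ?A = p ^ a" using prime_power_subgrp[OF AS(1)] by blast
 obtain b where b: "card ?B = p ^ b" using prime_power_subgrp[OF AS(3)] by blast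
 have "p ^ (k + x) * (c * y) = p ^ (a + 1 + b) * (ca * cb)"
  using e1 unfolding S(4) y cA(1) cB(1) S(3) x a b by (simp add: power_add mult_ac)
 then have "p ^ (k + x) dvd p ^ (a + 1 + b) * (ca * cb)" by (metis dvd_triv_left)
 moreover have "\<not> p dvd ca * cb" using prime_dvd_mult_iff[OF p] cA(2) cB(2) by blast
 then have "coprime (p ^ (k + x)) (ca * cb)" using prime_imp_coprime[OF p] coprime_power_left_iff by blast
 ultimately have "p ^ (k + x) dvd p ^ (a + 1 + b)" using coprime_dvd_mult_left_iff by blast
 then have "p ^ (k + x) \<le> p ^ (a + 1 + b)" using p by (intro dvd_imp_le) (simp_all add: prime_gt_0_nat)
 then have "card S * card ?Q \<le> card (?A * V * ?B) * card ?Q" using e2 S(3) x a b by (simp add: power_add mult_ac)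
 moreover have "card ?Q > 0" using card_subgrp_pos[OF sQ(1)] f1 by simp
 ultimately have "card S \<le> card (?A * V * ?B)" by simp
 moreover have sub: "?A * V * ?B \<subseteq> S" by (rule set_times_subset[OF S(1) AVS]) auto
 ultimately show ?thesis using card_seteq[OF finS sub] by simp
qed

lemma S_AB: "(A \<inter> S) * (B \<inter> S) \<noteq> S"
proof
 assume e: "(A \<inter> S) * (B \<inter> S) = S"
 have "(A \<inter> S) * (B \<inter> S) \<subseteq> A * B" by (rule set_times_mono2) auto
 then have "V \<subseteq> cnj 1 A * cnj 1 B" using V_facts(3) e by simp
 then show False using no_product[OF V(1) V_facts(4)] subgrp_one[OF G(1)] by blast
qed

lemma p_dvd_index:
 assumes P: "nrm P G" "V \<subseteq> P" "card P = p ^ l"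
 shows "p dvd card (A * P \<inter> cyc \<sigma>)" "card (A * P \<inter> cyc \<sigma>) dvd card (cyc \<tau>)"
proof -
 have s: "subgrp (A * N \<inter> cyc \<sigma>)" if "nrm N G" for N using subgrp_Int[OF index_I(4)[OF that] fin(4)] .
 have "card (A * V \<inter> cyc \<sigma>) = p" using index_I(3)[OF V(1)] V by simp
 moreover have "A * V \<inter> cyc \<sigma> \<subseteq> A * P \<inter> cyc \<sigma>" using set_times_mono2[OF subset_refl P(2)] by blast
 ultimately show "p dvd card (A * P \<inter> cyc \<sigma>)"
  using card_subgrp_dvd[OF s[OF P(1)] _ s[OF V(1)]] fin(3) by simp
 have "card (A * P \<inter> cyc \<sigma>) dvd p ^ l" using index_I(3)[OF P(1)] P(3) by (metis dvd_triv_left)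
 then obtain e where e: "card (A * P \<inter> cyc \<sigma>) = p ^ e" using divides_primepow_nat[OF p] by blast
 have "card (A * P \<inter> cyc \<sigma>) dvd card (cyc \<tau>) * r"
  using card_subgrp_dvd[OF fin(4,3) s[OF P(1)]] tau(3) by simp
 moreover have "coprime (p ^ e) r" using p tau(4) by (simp add: prime_imp_coprime)
 ultimately show "card (A * P \<inter> cyc \<sigma>) dvd card (cyc \<tau>)" unfolding e using coprime_dvd_mult_left_iff by blast
qed

text \<open>Modulo the largest normal subgroup of \<open>S\<close> inside
  \<open>A \<inter> B\<close>, the Sylow subgroup satisfies \<open>pconf\<close>. The order of
  \<open>\<tau>\<close> comes from \<open>conclusion\<close>. A normal subgroup of \<open>S\<close>
  inside \<open>A\<close> with nontrivial image would contain the image of \<open>V\<close> by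
  \<open>V_least_normal\<close>, which would put \<open>V\<close> into \<open>A\<close>; hence it
  lies in the kernel and thus in \<open>B\<close>.\<close>

lemma sylow_core:
 shows "\<And>N. nrm N S ==> N \<subseteq> A ==> N \<subseteq> B" and "card (cyc \<tau>) = p \<or> p = 2 \<and> card (cyc \<tau>) = 4"
proof -
 interpret sw: hsyl G B A \<sigma> p k r c cb ca V S \<tau> by (rule syl_swap)
 let ?A = "A \<inter> S" and ?B = "B \<inter> S"
 define N0 where "N0 = corg S (?A \<inter> ?B)"
 have n0: "nrm N0 S" unfolding N0_def by (rule nrm_corg[OF S(1) subgrp_Int[OF AS(1,3)]])
 have n0A: "N0 \<subseteq> ?A" "N0 \<subseteq> ?B" using corg_subset[OF S(1)] unfolding N0_def by blast+
 obtain \<pi> :: "'a \<Rightarrow> 'a set Perm.perm" where pi: "ghom S \<pi>" and ker: "\<And>g. g \<in> S ==> \<pi> g = 1 \<longleftrightarrow> g \<in> N0"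
  using quotient_exists[OF S(1) finS n0] by blast
 have memA: "x \<in> ?A" if "x \<in> S" "\<pi> x \<in> \<pi> ` ?A" for x
  by (rule mem_of_image_mem[OF pi S(1) _ AS(1) _ n0A(1) that]) (use ker in auto)
 have memB: "x \<in> ?B" if "x \<in> S" "\<pi> x \<in> \<pi> ` ?B" for x
  by (rule mem_of_image_mem[OF pi S(1) _ AS(3) _ n0A(2) that]) (use ker in auto)
 have cyct: "cyc (\<pi> \<tau>) = \<pi> ` cyc \<tau>" using image_cyc[OF pi S(1) tau(2)] by simp
 have inA: "\<pi> ` ?A \<inter> cyc (\<pi> \<tau>) = {1}"
 proof -
  have "y = 1" if y: "y \<in> \<pi> ` ?A" "y \<in> \<pi> ` cyc \<tau>" for y
  proof -
   obtain x where x: "x \<in> cyc \<tau>" "y = \<pi> x" using y(2) by blast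
   have xS: "x \<in> S" using x ftau(1) by blast
   have "x \<in> ?A" using memA[OF xS] y(1) unfolding x(2) .
   then have "x = 1" using S_AI(2) x(1) by blast
   then show ?thesis using x(2) ghom_one[OF pi S(1)] by simp
  qed
  moreover have "1 \<in> \<pi> ` ?A" "1 \<in> \<pi> ` cyc \<tau>"
   using ghom_one[OF pi S(1)] subgrp_one[OF AS(1)] subgrp_one[OF ftau(3)] by force+
  ultimately show ?thesis unfolding cyct by blast
 qed
 have inB: "\<pi> ` ?B \<inter> cyc (\<pi> \<tau>) = {1}"
 proof -
  have "y = 1" if y: "y \<in> \<pi> ` ?B" "y \<in> \<pi> ` cyc \<tau>" for y
  proof -
   obtain x where x: "x \<in> cyc \<tau>" "y = \<pi> x" using y(2) by blast
   have xS: "x \<in> S" using x ftau(1) by blast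
   have "x \<in> ?B" using memB[OF xS] y(1) unfolding x(2) .
   then have "x = 1" using sw.S_AI(2) x(1) by blast
   then show ?thesis using x(2) ghom_one[OF pi S(1)] by simp
  qed
  moreover have "1 \<in> \<pi> ` ?B" "1 \<in> \<pi> ` cyc \<tau>"
   using ghom_one[OF pi S(1)] subgrp_one[OF AS(3)] subgrp_one[OF ftau(3)] by force+
  ultimately show ?thesis unfolding cyct by blast
 qed
 have VN: "V \<inter> N0 = {1}" using V(3) n0A(1) V_facts(1) nrmD(1)[OF n0] subgrp_one by blast
 have cV: "card (\<pi> ` V) = p"
 proof -
  have "nrm {1} V" using V_facts(1) by (auto simp: nrm_def)
  moreover have "\<pi> g = 1 \<longleftrightarrow> g \<in> {1}" if "g \<in> V" for g using ker[of g] that V_facts(3) VN by blast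
  ultimately have "card V = card {1::'a} * card (\<pi> ` V)"
   by (intro card_ghom_image[OF ghom_subset[OF pi V_facts(3)] V_facts(1,2)])
  then show ?thesis using V(2) by simp
 qed
 have "card S = card N0 * card (\<pi> ` S)" by (rule card_ghom_image[OF pi S(1) finS n0 ker])
 then have "card (\<pi> ` S) dvd p ^ k" using S(3) by (metis dvd_triv_right)
 then obtain k' where k': "card (\<pi> ` S) = p ^ k'" using divides_primepow_nat[OF p] by blast
 have AVS: "?A * V \<subseteq> S" by (rule set_times_subset[OF S(1) _ V_facts(3)]) auto
 interpret q: pconf p k' "\<pi> ` S" "\<pi> ` ?A" "\<pi> ` ?B" "\<pi> ` V" "\<pi> \<tau>"
 proof
  show "prime p" by (rule p)
  show "subgrp (\<pi> ` S)" "subgrp (\<pi> ` ?A)" "subgrp (\<pi> ` ?B)" "subgrp (\<pi> ` V)"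
   using subgrp_image[OF pi S(1)] S(1) AS V_facts by blast+
  show "finite (\<pi> ` S)" using finS by simp
  show "card (\<pi> ` S) = p ^ k'" by (rule k')
  show "\<pi> ` ?A \<subseteq> \<pi> ` S" "\<pi> ` ?B \<subseteq> \<pi> ` S" "\<pi> ` V \<subseteq> \<pi> ` S" using V_facts(3) by blast+
  show "card (\<pi> ` V) = p" by (rule cV)
  show "\<pi> \<tau> \<in> \<pi> ` S" using tau(2) by blast
  show "v * s = s * v" if vs: "v \<in> \<pi> ` V" "s \<in> \<pi> ` S" for v s
  proof -
   obtain x y where xy: "x \<in> V" "y \<in> S" "v = \<pi> x" "s = \<pi> y" using vs by blast
   have xS: "x \<in> S" using xy V_facts by blast
   have "\<pi> (x * y) = \<pi> (y * x)" using central[OF xy(1,2)] by simp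
   then show ?thesis using ghom_mult[OF pi xS xy(2)] ghom_mult[OF pi xy(2) xS] xy(3,4) by simp
  qed
  have "\<pi> ` (?A * V * ?B) = \<pi> ` (?A * V) * \<pi> ` ?B" by (rule image_set_times[OF pi AVS]) auto
  also have "\<pi> ` (?A * V) = \<pi> ` ?A * \<pi> ` V" by (rule image_set_times[OF pi _ V_facts(3)]) auto
  finally show "\<pi> ` S = \<pi> ` ?A * \<pi> ` V * \<pi> ` ?B" using S_AVB by simp
  show "\<pi> ` ?A * \<pi> ` ?B \<noteq> \<pi> ` S"
  proof
   assume e: "\<pi> ` ?A * \<pi> ` ?B = \<pi> ` S"
   have "S \<subseteq> ?A * ?B"
   proof
    fix x assume x: "x \<in> S"
    then have "\<pi> x \<in> \<pi> ` ?A * \<pi> ` ?B" using e by blast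
    then obtain u w where uw: "u \<in> \<pi> ` ?A" "w \<in> \<pi> ` ?B" "\<pi> x = u * w" by (rule in_set_timesE)
    then obtain a b where ab: "a \<in> ?A" "b \<in> ?B" "u = \<pi> a" "w = \<pi> b" by blast
    have aS: "a \<in> S" "inverse a \<in> S" using ab subgrp_inverse[OF S(1)] by blast+
    have "\<pi> (inverse a * x) = inverse (\<pi> a) * \<pi> x" using ghom_mult[OF pi aS(2) x] ghom_inverse[OF pi S(1) aS(1)] by simp
    also have "\<dots> = \<pi> b" unfolding uw(3) ab(3,4) by simp
    finally have "\<pi> (inverse a * x) \<in> \<pi> ` ?B" using ab(2) by simp
    then have "inverse a * x \<in> ?B" using memB[OF subgrp_mult[OF S(1) aS(2) x]] by blast
    then have "a * (inverse a * x) \<in> ?A * ?B" by (rule set_times_intro[OF ab(1)])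
    then show "x \<in> ?A * ?B" by simp
   qed
   moreover have "?A * ?B \<subseteq> S" by (rule set_times_subset[OF S(1)]) auto
   ultimately show False using S_AB by blast
  qed
  show "\<pi> ` S = \<pi> ` ?A * cyc (\<pi> \<tau>)"
   using image_set_times[OF pi _ ftau(1), of ?A] S_AI(1) cyct by auto
  show "\<pi> ` S = \<pi> ` ?B * cyc (\<pi> \<tau>)"
   using image_set_times[OF pi _ ftau(1), of ?B] sw.S_AI(1) cyct by auto
  show "\<pi> ` ?A \<inter> cyc (\<pi> \<tau>) = {1}" "\<pi> ` ?B \<inter> cyc (\<pi> \<tau>) = {1}" using inA inB .
  fix N assume N: "nrm N (\<pi> ` S)" "N \<subseteq> \<pi> ` ?A" "N \<subseteq> \<pi> ` ?B"
  let ?M = "{g \<in> S. \<pi> g \<in> N}"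
  have "?M \<subseteq> ?A \<inter> ?B" using memA memB N(2,3) by blast
  then have "?M \<subseteq> N0" unfolding N0_def by (rule nrm_subset_corg[OF nrm_preimage(1)[OF pi S(1) N(1)]])
  then have "\<pi> ` ?M \<subseteq> {1}" using ker by blast
  then show "N = {1}" using nrm_preimage(2)[OF pi S(1) N(1)] nrmD(1)[OF N(1)] subgrp_one by blast
 qed
 show "N \<subseteq> B" if N: "nrm N S" "N \<subseteq> A" for N
 proof -
  have "\<pi> ` N = {1}"
  proof (rule ccontr)
   assume "\<pi> ` N \<noteq> {1}"
   then have "\<pi> ` V \<subseteq> \<pi> ` N" using q.V_least_normal[OF nrm_image[OF pi S(1) N(1)]] by blast
   also have "\<dots> \<subseteq> \<pi> ` ?A" using N(2) nrmD(2)[OF N(1)] by blast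
   finally have "V \<subseteq> ?A" using memA V_facts(3) by blast
   then show False using V(3) V_facts(4) by blast
  qed
  then have "N \<subseteq> N0" using ker nrmD(2)[OF N(1)] by blast
  then show ?thesis using n0A by blast
 qed
 have ct: "card (cyc (\<pi> \<tau>)) = card (cyc \<tau>)"
 proof (rule card_cyc_ghom[OF pi S(1) finS tau(2)])
  fix x assume x: "x \<in> cyc \<tau>" "\<pi> x = 1"
  then have "x \<in> ?A" using ker[of x] ftau(1) n0A(1) by blast
  then show "x = 1" using S_AI(2) x(1) by blast
 qed
 have pt: "p dvd card (cyc \<tau>)"
  using p_dvd_index[OF V(1) subset_refl, of 1] V(2) dvd_trans by simp
 show "card (cyc \<tau>) = p \<or> p = 2 \<and> card (cyc \<tau>) = 4"
 proof (cases "p = 2 \<and> card (cyc (\<pi> \<tau>)) = 4")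
  case False
  then have "\<pi> ` S = \<pi> ` V" using q.conclusion by blast
  then have "card (cyc (\<pi> \<tau>)) \<le> p" using card_mono[of "\<pi> ` V" "cyc (\<pi> \<tau>)"] cV cyct ftau(1) V_facts(2) by (metis finite_imageI image_mono)
  then show ?thesis using ct pt dvd_imp_le[OF pt] card_subgrp_pos[OF ftau(3,2)] by simp
 qed (use ct in simp)
qed

text \<open>The assumption on \<open>\<tau>\<close> gives \<open>S \<subseteq> A * P\<close>. So
  conjugating by \<open>s\<close> after \<open>a\<close> amounts to conjugating by an element of
  \<open>P\<close>, which keeps \<open>x\<close> in \<open>A\<close>, followed by an element of
  \<open>A\<close>.\<close>

lemma core_normalized:
 assumes P: "nrm P G" "P \<subseteq> S" "cyc \<tau> \<subseteq> A * P" and a: "a \<in> A" and x: "x \<in> corg S (A \<inter> S) \<inter> P"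
 shows "a * x * inverse a \<in> corg S (A \<inter> S) \<inter> P"
proof -
 have aG: "a \<in> G" using a A by blast
 have q: "a * x * inverse a \<in> P" using nrmD(3)[OF P(1) aG] x by blast
 have "s * (a * x * inverse a) * inverse s \<in> A \<inter> S" if s: "s \<in> S" for s
 proof
  have "S \<subseteq> A * (A * P)" unfolding S_AI(1)[THEN sym] using S_AI(1) set_times_mono2[of "A \<inter> S" A, OF _ P(3)] by blast
  also have "\<dots> = A * P" using subgrp_times_self[OF A(1)] by (simp add: mult.assoc[symmetric])
  finally have "s \<in> A * P" using s by blast
  then obtain a1 u where au: "a1 \<in> A" "u \<in> P" "s = a1 * u" by (rule in_set_timesE)
  let ?u = "inverse a * u * a"
  have "?u \<in> S" using nrm_conj'[OF P(1) G(1) aG au(2)] P(2) by blast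
  then have "?u * x * inverse ?u \<in> A" using x by (auto simp: corg_def)
  moreover have "a1 * a \<in> A" using au a A by (simp add: subgrp_mult)
  ultimately have "(a1 * a) * (?u * x * inverse ?u) * inverse (a1 * a) \<in> A" using A(1) by (simp only: subgrp_mult subgrp_inverse)
  moreover have "s * (a * x * inverse a) * inverse s = (a1 * a) * (?u * x * inverse ?u) * inverse (a1 * a)"
   unfolding au(3) by (simp add: mult.assoc)
  ultimately show "s * (a * x * inverse a) * inverse s \<in> A" by simp
  show "s * (a * x * inverse a) * inverse s \<in> S"
   using s q P(2) S(1) by (meson subgrp_inverse subgrp_mult subsetD)
 qed
 then show ?thesis using q P(2) by (auto simp: corg_def)
qed

text \<open>By \<open>sylow_core\<close> the cores of \<open>A \<inter> S\<close> and
  \<open>B \<inter> S\<close> in \<open>S\<close> coincide, so their intersection with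
  \<open>P\<close> is normalized by both \<open>A\<close> and \<open>B\<close>. By
  \<open>gen\<close> it is normal in \<open>G\<close>, hence trivial. Then \<open>N\<close> meets
  \<open>P\<close> trivially and commutes with it, so \<open>N \<subseteq> P\<close> by
  \<open>centralizer_in_P\<close>.\<close>

lemma normal_in_S_trivial:
 assumes P: "nrm P G" "P \<subseteq> S" "card P = p ^ l" "\<And>Q m. nrm Q G ==> card Q = p ^ m ==> Q \<subseteq> P"
  and t: "cyc \<tau> \<subseteq> A * P" "cyc \<tau> \<subseteq> B * P" and N: "nrm N S" "N \<subseteq> A"
 shows "N = {1}"
proof -
 interpret sw: hsyl G B A \<sigma> p k r c cb ca V S \<tau> by (rule syl_swap)
 note w = nrmD[OF P(1)]
 define M where "M = corg S (A \<inter> S) \<inter> P"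
 have PS: "nrm P S" using nrm_subset[OF P(1,2) S(2)] .
 have nA: "nrm (corg S (A \<inter> S)) S" "nrm (corg S (B \<inter> S)) S" using nrm_corg[OF S(1)] AS by blast+
 have cs: "corg S (A \<inter> S) \<subseteq> A" "corg S (B \<inter> S) \<subseteq> B" using corg_subset[OF S(1)] by blast+
 have cB: "corg S (A \<inter> S) \<subseteq> corg S (B \<inter> S)" "corg S (B \<inter> S) \<subseteq> corg S (A \<inter> S)"
  by (rule nrm_subset_corg[OF nA(1) Int_greatest[OF sylow_core(1)[OF nA(1) cs(1)] nrmD(2)[OF nA(1)]]],
    rule nrm_subset_corg[OF nA(2) Int_greatest[OF sw.sylow_core(1)[OF nA(2) cs(2)] nrmD(2)[OF nA(2)]]])
 have MB: "M = corg S (B \<inter> S) \<inter> P" using cB unfolding M_def by blast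
 have nM: "nrm M S" unfolding M_def using nrm_Int[OF nA(1) PS] .
 have fM: "finite M" using finN[OF P(1)] unfolding M_def by simp
 have "cnj 1 A \<subseteq> {g \<in> G. cnj g M = M}"
 proof
  fix a assume "a \<in> cnj 1 A"
  then have a: "a \<in> A" by simp
  have "cnj a M = M" by (rule cnj_eqI[OF fM]) (unfold M_def, rule core_normalized[OF P(1,2) t(1) a])
  then show "a \<in> {g \<in> G. cnj g M = M}" using a A(2) by blast
 qed
 moreover have "cnj 1 B \<subseteq> {g \<in> G. cnj g M = M}"
 proof
  fix a assume "a \<in> cnj 1 B"
  then have a: "a \<in> B" by simp
  have "cnj a M = M" by (rule cnj_eqI[OF fM]) (unfold MB, rule sw.core_normalized[OF P(1,2) t(2) a])
  then show "a \<in> {g \<in> G. cnj g M = M}" using a B(2) by blast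
 qed
 ultimately have "{g \<in> G. cnj g M = M} = G"
  using gen[OF subgrp_normalizer[OF G(1)]] subgrp_one[OF G(1)] by blast
 then have "nrm M G" using nrm_of_cnj[OF nrmD(1)[OF nM], of G] nrmD(2)[OF nM] S(2) by blast
 then have M1: "M = {1}" using core cs(1) unfolding M_def by blast
 have "N \<subseteq> corg S (A \<inter> S)" using nrm_subset_corg[OF N(1)] N nrmD(2)[OF N(1)] by blast
 then have NP: "N \<inter> P \<subseteq> {1}" using M1 unfolding M_def by blast
 have "x \<in> P" if x: "x \<in> N" for x
 proof (rule centralizer_in_P[OF p V(1) V_facts(4) _ P(1,3)])
  show "card V = p ^ 1" using V(2) by simp
  show "Q \<subseteq> P" if "nrm Q G" "card Q = p ^ k" for Q k using P(4)[OF that] .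
  have xS: "x \<in> S" using x nrmD(2)[OF N(1)] by blast
  then show "x \<in> G" using S(2) by blast
  fix y assume y: "y \<in> P"
  have yS: "y \<in> S" using y P(2) by blast
  let ?c = "x * y * inverse x * inverse y"
  have "?c = x * (y * inverse x * inverse y)" by (simp only: mult.assoc)
  then have "?c \<in> N" using subgrp_mult[OF nrmD(1)[OF N(1)] x nrmD(3)[OF N(1) yS subgrp_inverse[OF nrmD(1)[OF N(1)] x]]] by simp
  moreover have "?c \<in> P" using subgrp_mult[OF w(1) nrmD(3)[OF PS xS y] subgrp_inverse[OF w(1) y]] .
  ultimately have "?c = 1" using NP by blast
  then have "?c * y * x = y * x" by simp
  then show "x * y = y * x" by (simp add: mult.assoc)
 qed
 then show ?thesis using NP subgrp_one[OF nrmD(1)[OF N(1)]] by blast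
qed

text \<open>\<open>W = (A \<inter> S) * V\<close> has index two in \<open>S\<close>, so conjugation
  by \<open>\<tau>\<close> interchanges \<open>A \<inter> S\<close> with another subgroup
  \<open>A2\<close> of \<open>W\<close>. Their intersection is normal in \<open>S\<close> and lies
  in \<open>A\<close>, hence is trivial; so the square of \<open>card (A \<inter> S)\<close> is at
  most \<open>card W\<close>, that is, twice \<open>card (A \<inter> S)\<close>.\<close>

lemma card_AS_le_two:
 assumes p2: "p = 2" "card (cyc \<tau>) = 4" and triv: "\<And>N. nrm N S ==> N \<subseteq> A ==> N = {1}"
 shows "card (A \<inter> S) \<le> 2"
proof -
 let ?A = "A \<inter> S"
 define W where "W = ?A * V"
 have sW: "subgrp W" unfolding W_def using subgrp_times_nrm[OF V_facts(6) S(1) AS(1)] by blast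
 have WS: "W \<subseteq> S" unfolding W_def by (rule set_times_subset[OF S(1) _ V_facts(3)]) auto
 have AW: "?A \<subseteq> W" unfolding W_def using subset_set_times1[OF V_facts(1)] .
 have "?A \<inter> V = {1}" using V(3) V_facts(3) by blast
 then have cW: "card W = card ?A * 2" unfolding W_def using card_set_times[OF AS(1) V_facts(1) AS(2) V_facts(2)] V(2) p2 by simp
 have iW: "card S \<le> 2 * card W" using card_S cW p2 by simp
 note quo = index_two_quotient[OF S(1) finS sW WS iW]
 have nW: "s * w * inverse s \<in> W" if sw: "s \<in> S" "w \<in> W" for s w
 proof (cases "s \<in> W")
  case True
  then show ?thesis using subgrp_mult[OF sW subgrp_mult[OF sW True sw(2)] subgrp_inverse[OF sW True]] by blast
 next
  case False
  have "s * w \<notin> W" using False subgrp_mult_iff2[OF sW sw(2)] by blast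
  moreover have "s * w \<in> S" using subgrp_mult[OF S(1) sw(1)] sw(2) WS by blast
  ultimately show ?thesis using quo[OF _ _ sw(1) False] by blast
 qed
 have t2: "\<tau> * \<tau> \<in> W"
 proof (cases "\<tau> \<in> W")
  case True
  then show ?thesis using subgrp_mult[OF sW] by blast
 next
  case False
  have "inverse \<tau> \<notin> W" using False subgrp_inverse_iff[OF sW] by blast
  then have "\<tau> * inverse (inverse \<tau>) \<in> W" using quo[OF tau(2) False subgrp_inverse[OF S(1) tau(2)]] by blast
  then show ?thesis by simp
 qed
 have cV: "cnj v C = C" if v: "v \<in> V" and C: "C \<subseteq> S" for v C
 proof -
  have "v * c * inverse v = c" if "c \<in> C" for c using conj_trivial[OF central[OF v]] that C by blast
  then show ?thesis by (simp add: cnj_def)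
 qed
 define A2 where "A2 = cnj \<tau> ?A"
 have A2: "subgrp A2" "A2 \<subseteq> W" "finite A2" "card A2 = card ?A"
 proof -
  show "subgrp A2" unfolding A2_def by (rule subgrp_cnj[OF AS(1)])
  show "A2 \<subseteq> W" unfolding A2_def cnj_def using nW[OF tau(2)] AW by blast
  show "finite A2" unfolding A2_def cnj_def using AS(2) by blast
  show "card A2 = card ?A" unfolding A2_def by simp
 qed
 have tA2: "cnj \<tau> A2 = ?A"
 proof -
  obtain a v where av: "a \<in> ?A" "v \<in> V" "\<tau> * \<tau> = a * v" using t2 unfolding W_def by (rule in_set_timesE)
  have "cnj \<tau> A2 = cnj a (cnj v ?A)" unfolding A2_def cnj_cnj av(3) ..
  then show ?thesis using cV[OF av(2), of ?A] cnj_self[OF AS(1) av(1)] by simp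
 qed
 define D where "D = ?A \<inter> A2"
 have norm_A2: "cnj a A2 = A2" if a: "a \<in> ?A" for a
 proof -
  have "inverse \<tau> * a * \<tau> \<in> W" using nW[OF subgrp_inverse[OF S(1) tau(2)]] a AW by force
  then obtain b v where bv: "b \<in> ?A" "v \<in> V" "inverse \<tau> * a * \<tau> = b * v" unfolding W_def by (rule in_set_timesE)
  have e: "a * \<tau> = \<tau> * (b * v)" unfolding bv(3)[symmetric] by (simp add: mult.assoc)
  have "cnj a A2 = cnj \<tau> (cnj b (cnj v ?A))" unfolding A2_def cnj_cnj e by (simp add: mult.assoc)
  then show ?thesis using cV[OF bv(2), of ?A] cnj_self[OF AS(1) bv(1)] unfolding A2_def by simp
 qed
 let ?H = "{g \<in> S. cnj g D = D}"
 have sH: "subgrp ?H" by (rule subgrp_normalizer[OF S(1)])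
 have "?A \<subseteq> ?H" using norm_A2 cnj_self[OF AS(1)] unfolding D_def cnj_Int by auto
 moreover have "cnj \<tau> D = D" 
  unfolding D_def using cnj_Int[of \<tau> ?A A2] tA2 A2_def by blast
 then have "cyc \<tau> \<subseteq> ?H" using cyc_subset[OF sH, of \<tau>] tau(2) by blast
 ultimately have "S \<subseteq> ?H" using set_times_subset[OF sH] S_AI(1) by blast
 then have "nrm D S" using nrm_of_cnj[OF subgrp_Int[OF AS(1) A2(1)], of S] unfolding D_def by blast
 then have "?A \<inter> A2 = {1}" using triv[of D] unfolding D_def by blast
 then have "card (?A * A2) = card ?A * card ?A" using card_set_times[OF AS(1) A2(1) AS(2) A2(3)] A2(4) by simp
 moreover have "?A * A2 \<subseteq> W" by (rule set_times_subset[OF sW AW A2(2)])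
 then have "card (?A * A2) \<le> card W" using card_mono finite_subset[OF WS finS] by blast
 ultimately have "card ?A * card ?A \<le> card ?A * 2" using cW by simp
 moreover have "card ?A > 0" using card_subgrp_pos[OF AS(1,2)] .
 ultimately show ?thesis by simp
qed

lemma index_prime_trivial:
 assumes P: "nrm P G" "V \<subseteq> P" "card P = p ^ l" and i: "card (B * P \<inter> cyc \<sigma>) = p"
 shows "A \<inter> P = {1}" "card P = card (A * P \<inter> cyc \<sigma>)"
proof -
 interpret sw: hconf G B A \<sigma> by (rule swap)
 have "P \<noteq> {1}" using P(2) V_facts(1,4) subgrp_one by blast
 moreover have "card P = p * card (B \<inter> P)" using sw.index_I(3)[OF P(1)] i by simp
 ultimately show 1: "A \<inter> P = {1}"
  using A_Int_trivial[OF P(1)] intersection_subset_index_prime[OF P(1) _ p P(3)] by blast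
 show "card P = card (A * P \<inter> cyc \<sigma>)" using index_I(3)[OF P(1)] 1 by simp
qed

text \<open>Let \<open>iA\<close> and \<open>iB\<close> be the indices of \<open>A\<close> and
  \<open>B\<close> in the largest normal \<open>p\<close>-subgroup \<open>P\<close>. They divide the
  order of \<open>\<tau>\<close> and are not both \<open>p\<close>, so \<open>p = 2\<close> and
  \<open>\<tau>\<close> has order four. If one index is two, then \<open>P\<close> has order four.
  If both are four, \<open>P\<close> has order four, or order eight and equals \<open>S\<close>. In
  each case \<open>\<sigma>\<close> centralizes a subgroup of index two in \<open>P\<close>, namely
  \<open>V\<close> or \<open>cyc \<tau>\<close>, and \<open>odd_part_trivial\<close>
  applies.\<close>

theorem order_four_of_prime: "card (cyc \<sigma>) = 4"
proof -
 interpret sw: hsyl G B A \<sigma> p k r c cb ca V S \<tau> by (rule syl_swap)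
 obtain P l where P: "nrm P G" "card P = p ^ l" "\<And>Q m. nrm Q G ==> card Q = p ^ m ==> Q \<subseteq> P"
  using largest_normal_pgroup[OF G p] by metis
 have V1: "card V = p ^ 1" using V(2) by simp
 have VP: "V \<subseteq> P" using P(3)[OF V(1) V1] .
 have PS: "P \<subseteq> S" using normal_pgroup_subset[OF P(1,2)] .
 have fP: "finite P" using finN[OF P(1)] .
 define iA iB where "iA = card (A * P \<inter> cyc \<sigma>)" and "iB = card (B * P \<inter> cyc \<sigma>)"
 have dA: "p dvd iA" "iA dvd card (cyc \<tau>)" using p_dvd_index[OF P(1) VP P(2)] unfolding iA_def by blast+
 have dB: "p dvd iB" "iB dvd card (cyc \<tau>)" using sw.p_dvd_index[OF P(1) VP P(2)] unfolding iB_def by blast+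
 have centr: "x \<in> P" if "x \<in> G" "\<And>y. y \<in> P ==> x * y = y * x" for x
  by (rule centralizer_in_P[OF p V(1) V_facts(4) V1 P(1,2) _ that]) (rule P(3))
 \<comment> \<open>Two indices \<open>p\<close> force \<open>P = V\<close>. As \<open>V\<close> is
   central in \<open>S\<close> and contains its centralizer, \<open>\<tau>\<close> generates
   \<open>V\<close>; then \<open>\<sigma>\<close> centralizes \<open>V\<close> and lies in it, the
   configuration of \<open>self_centralizing_prime_impossible\<close>.\<close>
 have not_pp: False if pp: "iA = p" "iB = p"
 proof -
  have "card P = p" using index_prime_trivial(2)[OF P(1) VP P(2)] pp unfolding iA_def iB_def by simp
  then have PV: "P = V" using card_subset_eq[OF fP VP] V(2) by simp
  have "\<tau> \<in> P" by (rule centr) (use tau(2) S(2) central PV in \<open>auto dest: sym\<close>)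
  then have tV: "\<tau> \<in> V" using PV by simp
  have "\<tau> \<noteq> 1"
  proof
   assume "\<tau> = 1"
   then have "card (cyc \<tau>) = 1" by (simp add: cyc_def)
   then show False using dA p dvd_trans[OF dA] by auto
  qed
  then have Vt: "V \<subseteq> cyc \<tau>" using prime_order_subset[OF V_facts(1,2,5) ftau(3) tV self_in_cyc] by blast
  have "\<sigma> \<in> P"
  proof (rule centr[OF sig])
   fix y assume "y \<in> P"
   then have "y \<in> cyc \<sigma>" using PV Vt ftau(4) by blast
   then show "\<sigma> * y = y * \<sigma>" using cyc_commute[OF self_in_cyc] by blast
  qed
  then have "cyc \<sigma> \<subseteq> V" using cyc_subset[OF V_facts(1)] PV by blast
  then show False using self_centralizing_prime_impossible[OF V(1) p V(2) _ _ V(3,4)] centr PV by blast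
 qed
 have p2: "p = 2 \<and> card (cyc \<tau>) = 4"
 proof (rule ccontr)
  assume "\<not> ?thesis"
  then have "card (cyc \<tau>) = p" using sylow_core(2) by blast
  then show False using dA dB not_pp dvd_antisym by metis
 qed
 have idx: "x = 2 \<or> x = 4" if "2 dvd x" "x dvd 4" for x :: nat
 proof -
  have "x \<le> 4" using that(2) dvd_imp_le by simp
  then have "x \<in> {0, 1, 2, 3, 4}" by auto
  then show ?thesis using that by auto
 qed
 have iA: "iA = 2 \<or> iA = 4" and iB: "iB = 2 \<or> iB = 4" using idx dA dB p2 by auto
 have r: "\<sigma> ^ (4 * r) = 1" "odd r" using finite_order(2)[OF fin(3)] tau(3,4) p2 by auto
 have V2: "card V = 2 ^ 1" "card P = 2 ^ l" using V1 P(2) p2 by auto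
 have P2: "Q \<subseteq> P" if "nrm Q G" "card Q = 2 ^ m" for Q m using P(3)[of Q m] that p2 by simp
 have sV: "\<sigma> * v = v * \<sigma>" if v: "v \<in> V" for v
 proof (cases "v = 1")
  case False
  have "{1, v} = V" by (rule card_subset_eq[OF V_facts(2)]) (use v False V(2) p2 subgrp_one[OF V_facts(1)] in auto)
  moreover have "\<sigma> * v * inverse \<sigma> \<in> V" using nrmD(3)[OF V(1) sig v] .
  moreover have "\<sigma> * v * inverse \<sigma> \<noteq> 1" using False conj_eq_one_iff by blast
  ultimately have "\<sigma> * v * inverse \<sigma> = v" by blast
  then show ?thesis by (simp only: commute_iff_conj)
 qed simp
 have s4V: "\<sigma> ^ 4 = 1" if "card P = 4"
  by (rule odd_part_trivial[OF V(1) V_facts(4) V2(1) P(1) V2(2) _ V_facts(1) VP _ sV r]) (use P2 that V2 in auto)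
 have "\<sigma> ^ 4 = 1"
 proof (cases "iA = 4 \<and> iB = 4")
  case False
  then consider "iA = 4" "iB = 2" | "iA = 2" "iB = 4" using iA iB not_pp p2 by auto
  then have "card P = 4"
  proof cases
   case 1
   then show ?thesis using index_prime_trivial(2)[OF P(1) VP P(2)] p2 unfolding iA_def iB_def by simp
  next
   case 2
   then show ?thesis using sw.index_prime_trivial(2)[OF P(1) VP P(2)] p2 unfolding iA_def iB_def by simp
  qed
  then show ?thesis by (rule s4V)
 next
  case True
  have sJ: "subgrp (A * P \<inter> cyc \<sigma>)" "subgrp (B * P \<inter> cyc \<sigma>)"
   using subgrp_Int index_I(4)[OF P(1)] sw.index_I(4)[OF P(1)] fin(4) by blast+
  have t: "cyc \<tau> \<subseteq> A * P" "cyc \<tau> \<subseteq> B * P"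
   using cyc_subgrp_unique[OF fin(3) ftau(3,4) sJ(1)] cyc_subgrp_unique[OF fin(3) ftau(3,4) sJ(2)] True p2
   unfolding iA_def iB_def by auto
  have "card (A \<inter> S) \<le> 2"
   by (rule card_AS_le_two) (use p2 normal_in_S_trivial[OF P(1) PS P(2,3) t] in auto)
  moreover have "card (A \<inter> P) \<le> card (A \<inter> S)" by (rule card_mono[OF AS(2)]) (use PS in auto)
  moreover have "card (A \<inter> P) > 0" using card_subgrp_pos[OF subgrp_Int[OF A(1) nrmD(1)[OF P(1)]]] fin(1) by simp
  moreover have cP: "card P = 4 * card (A \<inter> P)" using index_I(3)[OF P(1)] True unfolding iA_def by simp
  ultimately consider "card P = 4" | "card P = 8" "card (A \<inter> S) = 2"
   by (cases "card (A \<inter> P) = 1") auto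
  then show ?thesis
  proof cases
   case 1
   then show ?thesis by (rule s4V)
  next
   case 2
   then have "P = S" using card_subset_eq[OF finS PS] card_S p2 by simp
   then have tP: "cyc \<tau> \<subseteq> P" using ftau(1) by simp
   have c: "\<sigma> * q = q * \<sigma>" if "q \<in> cyc \<tau>" for q using cyc_commute[OF self_in_cyc] that ftau(4) by blast
   show ?thesis
    by (rule odd_part_trivial[OF V(1) V_facts(4) V2(1) P(1) V2(2) _ ftau(3) tP _ c r]) (use P2 2 p2 in auto)
  qed
 qed
 then have "card (cyc \<sigma>) \<le> 4" using finite_order(3)[OF fin(3), of 4] by simp
 moreover have "card (cyc \<sigma>) = 4 * r" using tau(3) p2 by simp
 moreover have "r \<noteq> 0" using r(2) by (metis even_zero)
 ultimately show ?thesis by simp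
qed

end

section \<open>Choice of the Sylow subgroup and the index-four theorem\<close>

lemma prime_part_exists:
 assumes "prime (p::nat)" "n > 0"
 obtains k c where "n = p ^ k * c" "\<not> p dvd c"
 using prime_power_canonical[OF assms] that by (metis mult.commute)

context hconf
begin

lemma conj_sylow_part:
 assumes p: "prime p" and S: "subgrp S" "S \<subseteq> G" "card S = p ^ k" "card G = card S * c" "\<not> p dvd c"
 obtains g ca where "g \<in> G" "card (cnj g A) = card (cnj g A \<inter> S) * ca" "\<not> p dvd ca"
proof -
 obtain a ca where a: "card A = p ^ a * ca" "\<not> p dvd ca" using prime_part_exists[OF p card_subgrp_pos[OF A(1) fin(1)]] .
 obtain A0 where A0: "subgrp A0" "A0 \<subseteq> A" "card A0 = p ^ a" using sylow_exists[OF A(1) fin(1) p, of a] a by auto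
 obtain g where g: "g \<in> G" "cnj g A0 \<subseteq> S" using pgroup_conj_into[OF G p S(1,2,4,5) A0(1) _ A0(3)] A0(2) A(2) by blast
 let ?Q = "cnj g A \<inter> S"
 have sA: "subgrp (cnj g A)" using subgrp_cnj[OF A(1)] .
 have fA: "finite (cnj g A)" using finite_subset[OF cnj_subset[OF G(1) g(1) A(2)] G(2)] .
 have sQ: "subgrp ?Q" using subgrp_Int[OF sA S(1)] .
 have fS: "finite S" using finite_subset[OF S(2) G(2)] .
 have "card ?Q dvd p ^ k" using card_subgrp_dvd[OF S(1) fS sQ] S(3) by simp
 then obtain e where e: "card ?Q = p ^ e" using divides_primepow_nat[OF p] by blast
 have "card ?Q dvd card (cnj g A)" using card_subgrp_dvd[OF sA fA sQ] by blast
 then have "p ^ e dvd p ^ a * ca" using e a(1) by simp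
 moreover have "coprime (p ^ e) ca" using prime_imp_coprime[OF p a(2)] coprime_power_left_iff by blast
 ultimately have "card ?Q dvd p ^ a" using e coprime_dvd_mult_left_iff by metis
 moreover have "cnj g A0 \<subseteq> ?Q" using cnj_mono[OF A0(2)] g(2) by blast
 then have "p ^ a dvd card ?Q" using card_subgrp_dvd[OF sQ _ subgrp_cnj[OF A0(1)]] fA A0(3) by (metis card_cnj finite_Int)
 ultimately have "card ?Q = p ^ a" by (rule dvd_antisym)
 then show ?thesis using that[OF g(1), of ca] a by simp
qed

text \<open>The Sylow subgroup is chosen around the \<open>p\<close>-part of
  \<open>\<sigma>\<close>; afterwards \<open>A\<close> and \<open>B\<close> are conjugated
  separately so that each meets it in a Sylow subgroup. Being normal, \<open>V\<close> still meets
  the conjugates trivially.\<close>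

lemma order_four_prime:
 assumes p: "prime p" and V: "nrm V G" "card V = p" "A \<inter> V = {1}" "B \<inter> V = {1}"
 shows "card (cyc \<sigma>) = 4"
proof -
 interpret sw: hconf G B A \<sigma> by (rule swap)
 obtain k c where k: "card G = p ^ k * c" "\<not> p dvd c" using prime_part_exists[OF p card_subgrp_pos[OF G]] .
 obtain e r where e: "card (cyc \<sigma>) = p ^ e * r" "\<not> p dvd r" using prime_part_exists[OF p card_subgrp_pos[OF fin(4,3)]] .
 define \<tau> where "\<tau> = \<sigma> ^ r"
 have r0: "r > 0" using e(2) by (metis dvd_0_right gr0I)
 have ct: "card (cyc \<tau>) = p ^ e" unfolding \<tau>_def by (rule power_of_order[OF fin(3) e(1) r0])
 have tG: "\<tau> \<in> G" unfolding \<tau>_def using subgrp_power[OF G(1) sig] .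
 have tc: "cyc \<tau> \<subseteq> G" using cyc_subset[OF G(1) tG] .
 have st: "subgrp (cyc \<tau>)" using subgrp_cyc[OF finite_subset[OF tc G(2)]] .
 obtain S0 where S0: "subgrp S0" "S0 \<subseteq> G" "card S0 = p ^ k" using sylow_exists[OF G p, of k] k by auto
 obtain g where g: "g \<in> G" "cnj g (cyc \<tau>) \<subseteq> S0" using pgroup_conj_into[OF G p S0(1,2) _ k(2) st tc ct] k(1) S0(3) by auto
 define S where "S = cnj (inverse g) S0"
 have S: "subgrp S" "S \<subseteq> G" "card S = p ^ k" "card G = card S * c"
  unfolding S_def using subgrp_cnj[OF S0(1)] cnj_subset[OF G(1) subgrp_inverse[OF G(1) g(1)] S0(2)] S0(3) k(1) by simp_all
 have tS: "\<tau> \<in> S" unfolding S_def mem_cnj using g(2) self_in_cyc[of \<tau>] by (auto simp: cnj_def)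
 obtain g1 ca where g1: "g1 \<in> G" "card (cnj g1 A) = card (cnj g1 A \<inter> S) * ca" "\<not> p dvd ca"
  using conj_sylow_part[OF p S k(2)] .
 obtain g2 cb where g2: "g2 \<in> G" "card (cnj g2 B) = card (cnj g2 B \<inter> S) * cb" "\<not> p dvd cb"
  using sw.conj_sylow_part[OF p S k(2)] .
 have "cnj g1 A \<inter> V = cnj g1 (A \<inter> V)" using cnj_Int[of g1 A V] cnj_nrm[OF V(1) G(1) g1(1)] by simp
 then have V1: "cnj g1 A \<inter> V = {1}" unfolding V(3) by (simp add: cnj_def)
 have "cnj g2 B \<inter> V = cnj g2 (B \<inter> V)" using cnj_Int[of g2 B V] cnj_nrm[OF V(1) G(1) g2(1)] by simp
 then have V2: "cnj g2 B \<inter> V = {1}" unfolding V(4) by (simp add: cnj_def)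
 have cr: "card (cyc \<sigma>) = card (cyc \<tau>) * r" using e(1) ct by simp
 have "hsyl G (cnj g1 A) (cnj g2 B) \<sigma> p k r c ca cb V S \<tau>"
  by (intro hsyl.intro hsyl_axioms.intro conj[OF g1(1) g2(1)])
   (rule p V(1,2) V1 V2 S k(2) g1(2,3) g2(2,3) \<tau>_def tS cr e(2))+
 then show ?thesis by (rule hsyl.order_four_of_prime)
qed

text \<open>The index is a power of \<open>p\<close>, is not 1 because the core of \<open>A\<close>
  is trivial, and is bounded by \<open>affine_bound\<close>.\<close>

lemma index_minimal:
 assumes V: "nrm V G" "V \<noteq> {1}" "prime p" "card V = p ^ m"
  "\<And>x y. x \<in> V ==> y \<in> V ==> x * y = y * x" "\<And>x. x \<in> V ==> x ^ p = 1"
 shows "card V = p * card (A \<inter> V) \<or> p = 2 \<and> card V = 4 * card (A \<inter> V)"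
proof -
 let ?i = "card (A * V \<inter> cyc \<sigma>)"
 have c: "card V = ?i * card (A \<inter> V)" by (rule index_I(3)[OF V(1)])
 have "card (A \<inter> V) > 0" using card_subgrp_pos[OF subgrp_Int[OF A(1) nrmD(1)[OF V(1)]]] fin(1) by simp
 then have le: "?i \<le> (if p = 2 then 4 else p)" using affine_bound[OF V] c by (metis mult_le_cancel2)
 have d: "?i dvd p ^ m" using c V(4) by (metis dvd_triv_left)
 have "?i \<noteq> 1"
 proof
  assume "?i = 1"
  then have "card (A \<inter> V) = card V" using c by simp
  then have "V \<subseteq> A" using card_subset_eq[OF finN[OF V(1)], of "A \<inter> V"] by blast
  then show False using core[OF V(1)] V(2) by blast
 qed
 then have pd: "p dvd ?i" using prime_power_proper_dvd[OF V(3) d] by blast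
 then have "p \<le> ?i" using dvd_imp_le[OF pd] c card_subgrp_pos[OF nrmD(1)[OF V(1)] finN[OF V(1)]] by (metis gr0I mult_0 less_irrefl)
 moreover have "(if p = 2 then 4 else p) = p \<or> (if p = 2 then 4 else p) = p\<^sup>2" by simp
 ultimately have "?i = p \<or> ?i = p\<^sup>2" using prime_power_le_dvd[OF V(3) d _ le] by blast
 then show ?thesis
 proof
  assume "?i = p\<^sup>2"
  moreover have "p\<^sup>2 > p" using prime_gt_1_nat[OF V(3)] by (simp add: power2_eq_square)
  ultimately have "p = 2" using le by (auto split: if_splits)
  then show ?thesis using c \<open>?i = p\<^sup>2\<close> by simp
 qed (use c in simp)
qed

theorem order_four: "card (cyc \<sigma>) = 4"
proof -
 interpret sw: hconf G B A \<sigma> by (rule swap)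
 obtain V p m where V: "nrm V G" "V \<noteq> {1}" "prime p" "card V = p ^ m"
  "\<And>x y. x \<in> V ==> y \<in> V ==> x * y = y * x" "\<And>x. x \<in> V ==> x ^ p = 1"
  "\<And>N. nrm N G ==> N \<subseteq> V ==> N \<noteq> {1} ==> N = V" by (rule minimal_normal) blast
 have iA: "card V = p * card (A \<inter> V) \<or> p = 2 \<and> card V = 4 * card (A \<inter> V)" by (rule index_minimal[OF V(1-6)])
 have iB: "card V = p * card (B \<inter> V) \<or> p = 2 \<and> card V = 4 * card (B \<inter> V)" by (rule sw.index_minimal[OF V(1-6)])
 show ?thesis
 proof (cases "card V = p * card (A \<inter> V) \<and> card V = p * card (B \<inter> V)")
  case True
  have AV: "A \<inter> V = {1}"
   by (rule A_Int_trivial[OF V(1)], rule intersection_subset_index_prime[OF V(1-4)]) (use True in blast)+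
  have BV: "B \<inter> V = {1}"
   by (rule sw.A_Int_trivial[OF V(1)], rule sw.intersection_subset_index_prime[OF V(1-4)]) (use True in blast)+
  show ?thesis using order_four_prime[OF V(3,1) _ AV BV] True AV by simp
 next
  case False
  then have p: "p = 2" using iA iB by blast
  note W = V(1,2) V(4)[unfolded p] V(5) V(6)[unfolded p] V(7)
  consider "card V = 4 * card (A \<inter> V)" "card V = 4 * card (B \<inter> V)" | "card V = 4 * card (A \<inter> V)" "card V = 2 * card (B \<inter> V)"
   | "card V = 2 * card (A \<inter> V)" "card V = 4 * card (B \<inter> V)" using False iA iB p by auto
  then show ?thesis
  proof cases
   case 1
   show ?thesis by (rule index_four_four[OF W 1])
  next
   case 2
   have False by (rule index_two_four_impossible[OF W 2])
   then show ?thesis ..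
  next
   case 3
   have False by (rule sw.index_two_four_impossible[OF W 3(2,1)])
   then show ?thesis ..
  qed
 qed
qed

end

text \<open>\<open>A'\<close> is \<open>A * N\<close> for a normal \<open>N\<close> of largest order
  with \<open>A * N * B \<noteq> G\<close>. Its index is that of the image of \<open>A\<close> in
  the quotient, where \<open>order_four\<close> applies.\<close>

theorem cyclic_factorization_index_four:
 fixes G A B :: "'a::grp set"
 assumes G: "subgrp G" "finite G" and slv: "(der ^^ n) G = {1}"
  and A: "subgrp A" "A \<subseteq> G" and B: "subgrp B" "B \<subseteq> G" and sig: "\<sigma> \<in> G"
  and GAI: "A * cyc \<sigma> = G" and GBI: "B * cyc \<sigma> = G" and AB: "A * B \<noteq> G"
  and gen: "\<And>D g h. subgrp D ==> D \<subseteq> G ==> g \<in> G ==> h \<in> G ==> cnj g A \<subseteq> D ==> cnj h B \<subseteq> D ==> D = G"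
 obtains A' where "subgrp A'" "A \<subseteq> A'" "A' \<subseteq> G" "card G = 4 * card A'" "A' * B \<noteq> G"
proof -
 let ?F = "{N. nrm N G \<and> A * N * B \<noteq> G}"
 have "A * {1} = A" by (auto simp: set_times_def)
 moreover have "nrm {1} G" using G(1) by (auto simp: nrm_def)
 ultimately have "{1} \<in> ?F" using AB by simp
 moreover have "finite ?F" by (rule finite_subset[of _ "Pow G"]) (use G nrmD(2) in auto)
 ultimately obtain N where N: "N \<in> ?F" "\<And>Q. Q \<in> ?F ==> card Q \<le> card N" by (rule finite_max_card) blast
 have nN: "nrm N G" and ANB: "A * N * B \<noteq> G" using N(1) by auto
 obtain \<pi> :: "'a \<Rightarrow> 'a set Perm.perm" where pi: "ghom G \<pi>" and ker: "\<And>g. g \<in> G ==> \<pi> g = 1 \<longleftrightarrow> g \<in> N"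
  using quotient_exists[OF G nN] by blast
 note n = nrmD[OF nN]
 have sAN: "subgrp (A * N)" using subgrp_times_nrm[OF nN G(1) A] .
 have ANG: "A * N \<subseteq> G" using set_times_subset[OF G(1) A(2) n(2)] .
 have NA: "N \<subseteq> A * N" using subset_set_times2[OF A(1)] .
 have piN: "\<pi> ` N = {1}" using ker n(1,2) ghom_one[OF pi G(1)] subgrp_one[OF n(1)] by force
 have piAN: "\<pi> ` (A * N) = \<pi> ` A" using image_set_times[OF pi A(2) n(2)] unfolding piN by (auto simp: set_times_def)
 have cycs: "cyc (\<pi> \<sigma>) = \<pi> ` cyc \<sigma>" using image_cyc[OF pi G(1) sig] by simp
 have cs: "cyc \<sigma> \<subseteq> G" using cyc_subset[OF G(1) sig] .
 have cnjp: "cnj (\<pi> g) (\<pi> ` C) = \<pi> ` cnj g C" if "g \<in> G" "C \<subseteq> G" for g C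
 proof -
  have "\<pi> g * \<pi> x * inverse (\<pi> g) = \<pi> (g * x * inverse g)" if "x \<in> C" for x
   using that \<open>g \<in> G\<close> \<open>C \<subseteq> G\<close> G(1) by (simp add: subsetD subgrp_mult subgrp_inverse ghom_mult[OF pi] ghom_inverse[OF pi G(1)])
  then show ?thesis unfolding cnj_def image_image by (rule image_cong[OF refl])
 qed
 have "hconf (\<pi> ` G) (\<pi> ` A) (\<pi> ` B) (\<pi> \<sigma>)"
 proof
  show "subgrp (\<pi> ` G)" "subgrp (\<pi> ` A)" "subgrp (\<pi> ` B)" using subgrp_image[OF pi G(1)] G(1) A B by blast+
  show "finite (\<pi> ` G)" using G(2) by simp
  show "\<pi> ` A \<subseteq> \<pi> ` G" "\<pi> ` B \<subseteq> \<pi> ` G" "\<pi> \<sigma> \<in> \<pi> ` G" using A B sig by blast+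
  show "\<pi> ` A * cyc (\<pi> \<sigma>) = \<pi> ` G" using image_set_times[OF pi A(2) cs] GAI cycs by simp
  show "\<pi> ` B * cyc (\<pi> \<sigma>) = \<pi> ` G" using image_set_times[OF pi B(2) cs] GBI cycs by simp
  show "\<pi> ` A * \<pi> ` B \<noteq> \<pi> ` G"
  proof
   assume e: "\<pi> ` A * \<pi> ` B = \<pi> ` G"
   have sBN: "subgrp (B * N)" using subgrp_times_nrm[OF nN G(1) B] .
   have BNG: "B * N \<subseteq> G" using set_times_subset[OF G(1) B(2) n(2)] .
   have "G \<subseteq> A * (B * N)"
   proof
    fix x assume x: "x \<in> G"
    then have "\<pi> x \<in> \<pi> ` A * \<pi> ` B" using e by blast
    then obtain u w where uw: "u \<in> \<pi> ` A" "w \<in> \<pi> ` B" "\<pi> x = u * w" by (rule in_set_timesE)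
    then obtain a b where ab: "a \<in> A" "b \<in> B" "u = \<pi> a" "w = \<pi> b" by blast
    have aG: "a \<in> G" "inverse a \<in> G" using ab A subgrp_inverse[OF G(1)] by blast+
    have "\<pi> (inverse a * x) = inverse (\<pi> a) * \<pi> x" using ghom_mult[OF pi aG(2) x] ghom_inverse[OF pi G(1) aG(1)] by simp
    also have "\<dots> = \<pi> b" unfolding uw(3) ab(3,4) by simp
    finally have q: "\<pi> (inverse a * x) \<in> \<pi> ` (B * N)" using ab(2) subset_set_times1[OF n(1), of B] by auto
    have "inverse a * x \<in> B * N"
     by (rule mem_of_image_mem[OF pi G(1) _ sBN BNG subset_set_times2[OF B(1)] subgrp_mult[OF G(1) aG(2) x] q])
      (use ker in blast)
    then have "a * (inverse a * x) \<in> A * (B * N)" by (rule set_times_intro[OF ab(1)])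
    then show "x \<in> A * (B * N)" by simp
   qed
   moreover have "A * (B * N) = A * N * B" using nrm_times_commute[OF nN G(1) B(2)] by (simp add: mult.assoc)
   moreover have "A * N * B \<subseteq> G" by (rule set_times_subset[OF G(1) ANG B(2)])
   ultimately show False using ANB by blast
  qed
  show "\<pi> ` A * K * \<pi> ` B = \<pi> ` G" if K: "nrm K (\<pi> ` G)" "K \<noteq> {1}" for K
  proof -
   let ?M = "{g \<in> G. \<pi> g \<in> K}"
   have M: "nrm ?M G" "\<pi> ` ?M = K" using nrm_preimage[OF pi G(1) K(1)] .
   have NM: "N \<subseteq> ?M" 
   proof
    fix x assume x: "x \<in> N"
    then have "\<pi> x = 1" using ker n(2) by blast
    then show "x \<in> ?M" using x n(2) subgrp_one[OF nrmD(1)[OF K(1)]] by auto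
   qed
   have "?M \<noteq> N" using M(2) piN K(2) by metis
   then have "card N < card ?M" using psubset_card_mono[of ?M N] NM G(2) by auto
   then have AMB: "A * ?M * B = G" using N(2)[of ?M] M(1) by fastforce
   have "\<pi> ` (A * ?M * B) = \<pi> ` A * K * \<pi> ` B"
    using image_set_times[OF pi _ B(2), of "A * ?M"] image_set_times[OF pi A(2), of ?M] M(2)
     set_times_subset[OF G(1) A(2), of ?M] by auto
   then show ?thesis using AMB by simp
  qed
  show "D = \<pi> ` G" if D: "subgrp D" "D \<subseteq> \<pi> ` G" and gh: "g \<in> \<pi> ` G" "h \<in> \<pi> ` G" and sub: "cnj g (\<pi> ` A) \<subseteq> D" "cnj h (\<pi> ` B) \<subseteq> D" for D g h
  proof -
   obtain g' h' where g': "g' \<in> G" "g = \<pi> g'" "h' \<in> G" "h = \<pi> h'" using gh by blast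
   let ?D = "{x \<in> G. \<pi> x \<in> D}"
   have "\<pi> ` cnj g' A \<subseteq> D" "\<pi> ` cnj h' B \<subseteq> D" using sub cnjp[OF g'(1) A(2)] cnjp[OF g'(3) B(2)] g' by auto
   then have "cnj g' A \<subseteq> ?D" "cnj h' B \<subseteq> ?D" using cnj_subset[OF G(1) g'(1) A(2)] cnj_subset[OF G(1) g'(3) B(2)] by blast+
   then have "?D = G" using gen[OF subgrp_preimage[OF pi G(1) D(1)] _ g'(1,3)] by blast
   then show ?thesis using D(2) by blast
  qed
  show "D = {1}" if D: "subgrp D" "D \<subseteq> \<pi> ` G" "der D = D" for D
  proof -
   have "(der ^^ n) (\<pi> ` G) = {1}" using der_pow_image[OF pi G(1) G(1) subset_refl, of n] slv ghom_one[OF pi G(1)] by simp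
   then have "D \<subseteq> {1}" using perfect_trivial D(2,3) by blast
   then show ?thesis using subgrp_one[OF D(1)] by blast
  qed
 qed
 then interpret h: hconf "\<pi> ` G" "\<pi> ` A" "\<pi> ` B" "\<pi> \<sigma>" .
 have c: "card (\<pi> ` G) = 4 * card (\<pi> ` A)" using h.card_GA h.order_four by simp
 have "card G = card N * card (\<pi> ` G)" by (rule card_ghom_image[OF pi G nN ker])
 moreover have "card (A * N) = card N * card (\<pi> ` (A * N))"
  by (rule card_ghom_image[OF ghom_subset[OF pi ANG] sAN finite_subset[OF ANG G(2)] nrm_subset[OF nN NA ANG]])
   (use ker ANG in blast)
 ultimately have "card G = 4 * card (A * N)" using c piAN by simp
 then show ?thesis using that[OF sAN subset_set_times1[OF n(1)] ANG] ANB by blast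
qed

section \<open>Automorphisms of an algebraic closure\<close>

hide_const (open) up_ring.coeff up_ring.monom UnivPoly.deg Polynomials.degree Polynomials.lead_coeff Coset.order module.smult

section \<open>Ring homomorphisms between types and their action on polynomials\<close>

definition rhom :: "('a::comm_ring_1 \<Rightarrow> 'b::comm_ring_1) \<Rightarrow> bool" where
 "rhom \<phi> \<longleftrightarrow> \<phi> 1 = 1 \<and> (\<forall>x y. \<phi> (x + y) = \<phi> x + \<phi> y) \<and> (\<forall>x y. \<phi> (x * y) = \<phi> x * \<phi> y)"

lemma rhomI: "\<phi> 1 = 1 ==> (\<And>x y. \<phi> (x + y) = \<phi> x + \<phi> y) ==> (\<And>x y. \<phi> (x * y) = \<phi> x * \<phi> y) ==> rhom \<phi>"
 by (simp add: rhom_def)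

context
 fixes \<phi> :: "'a::comm_ring_1 \<Rightarrow> 'b::comm_ring_1"
 assumes h: "rhom \<phi>"
begin

lemma rhom_1: "\<phi> 1 = 1" and rhom_add: "\<phi> (x + y) = \<phi> x + \<phi> y" and rhom_mult: "\<phi> (x * y) = \<phi> x * \<phi> y"
 using h by (simp_all add: rhom_def)

lemma rhom_0: "\<phi> 0 = 0" using rhom_add[of 0 0] by simp
lemma rhom_minus: "\<phi> (- x) = - \<phi> x" using rhom_add[of x "- x"] rhom_0 by (simp add: eq_neg_iff_add_eq_0 add.commute)
lemma rhom_diff: "\<phi> (x - y) = \<phi> x - \<phi> y" using rhom_add[of x "- y"] rhom_minus by simp
lemma rhom_power: "\<phi> (x ^ n) = \<phi> x ^ n" by (induction n) (simp_all add: rhom_1 rhom_mult)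
lemma rhom_sum: "\<phi> (sum u Y) = (\<Sum>i\<in>Y. \<phi> (u i))" by (induction Y rule: infinite_finite_induct) (simp_all add: rhom_0 rhom_add)
lemma rhom_prod: "\<phi> (prod u Y) = (\<Prod>i\<in>Y. \<phi> (u i))" by (induction Y rule: infinite_finite_induct) (simp_all add: rhom_1 rhom_mult)

lemma rhom_coeff: "coeff (map_poly \<phi> p) i = \<phi> (coeff p i)"
 by (simp add: coeff_map_poly rhom_0)

lemma rhom_map_pCons: "map_poly \<phi> (pCons c p) = pCons (\<phi> c) (map_poly \<phi> p)"
 by (rule poly_eqI) (simp add: rhom_coeff coeff_pCons split: nat.split)

lemma rhom_map_poly: "rhom (map_poly \<phi>)"
 by (rule rhomI; rule poly_eqI) (simp_all add: rhom_coeff rhom_add coeff_mult rhom_sum rhom_mult rhom_1 rhom_0 coeff_1)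

lemma rhom_map_smult: "map_poly \<phi> (smult c p) = smult (\<phi> c) (map_poly \<phi> p)"
 by (rule poly_eqI) (simp add: rhom_coeff rhom_mult)

lemma rhom_poly: "\<phi> (poly p x) = poly (map_poly \<phi> p) (\<phi> x)"
 by (induction p) (simp_all add: rhom_map_pCons rhom_add rhom_mult rhom_0)

end

lemma rhom_map_pcompose:
 assumes "rhom \<phi>"
 shows "map_poly \<phi> (pcompose p q) = pcompose (map_poly \<phi> p) (map_poly \<phi> q)"
proof (induction p)
 case (pCons a p)
 then show ?case
  by (simp add: pcompose_pCons rhom_map_pCons[OF assms] rhom_add[OF rhom_map_poly[OF assms]] rhom_mult[OF rhom_map_poly[OF assms]] rhom_0[OF assms])
qed simp

lemma rhom_comp: "rhom \<phi> ==> rhom \<psi> ==> rhom (\<lambda>x. \<phi> (\<psi> x))"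
 by (simp add: rhom_def)

lemma rhom_const_poly: "rhom (\<lambda>c. [:c:])"
 by (rule rhomI) (simp_all add: one_pCons)

lemma map_poly_comp_rhom: "rhom \<phi> ==> rhom \<psi> ==> map_poly \<phi> (map_poly \<psi> p) = map_poly (\<lambda>x. \<phi> (\<psi> x)) p"
 by (rule poly_eqI) (simp add: rhom_coeff rhom_comp)

lemma rhom_to_ac: "rhom to_ac"
 by (rule rhomI) simp_all

context
 fixes \<phi> :: "'a::field \<Rightarrow> 'b::field"
 assumes h: "rhom \<phi>"
begin

lemma rhom_eq_0_iff: "\<phi> x = 0 \<longleftrightarrow> x = 0"
proof
 assume "\<phi> x = 0"
 then have "\<phi> (x * inverse x) = 0" by (simp add: rhom_mult[OF h])
 then show "x = 0" using rhom_1[OF h] by (cases "x = 0") auto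
qed (simp add: rhom_0[OF h])

lemma rhom_eq_iff: "\<phi> x = \<phi> y \<longleftrightarrow> x = y"
 using rhom_eq_0_iff[of "x - y"] by (simp add: rhom_diff[OF h])

lemma rhom_inverse: "\<phi> (inverse x) = inverse (\<phi> x)"
proof (cases "x = 0")
 case False
 then have "\<phi> x * \<phi> (inverse x) = 1" using rhom_mult[OF h, of x "inverse x"] rhom_1[OF h] by simp
 then show ?thesis by (metis inverse_unique)
qed (simp add: rhom_0[OF h])

lemma rhom_divide: "\<phi> (x / y) = \<phi> x / \<phi> y"
 by (simp add: divide_inverse rhom_mult[OF h] rhom_inverse)

lemma rhom_degree: "degree (map_poly \<phi> p) = degree p"
 by (rule degree_map_poly) (simp add: rhom_eq_0_iff)

lemma rhom_map_poly_eq_iff: "map_poly \<phi> p = map_poly \<phi> q \<longleftrightarrow> p = q"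
 by (metis poly_eqI rhom_coeff[OF h] rhom_eq_iff)

lemma rhom_map_poly_eq_0_iff: "map_poly \<phi> p = 0 \<longleftrightarrow> p = 0"
 using rhom_map_poly_eq_iff[of p 0] by simp

end

text \<open>The graph of a partial ring homomorphism defined on a subring. The condition at 0 is
  single-valuedness, since differences stay in the graph, and extension of homomorphisms becomes
  inclusion of sets.\<close>

definition rgraph :: "('a::field \<times> 'b::field) set \<Rightarrow> bool" where
 "rgraph \<Gamma> \<longleftrightarrow> (1, 1) \<in> \<Gamma> \<and>
   (\<forall>a b c d. (a, b) \<in> \<Gamma> \<longrightarrow> (c, d) \<in> \<Gamma> \<longrightarrow> (a - c, b - d) \<in> \<Gamma> \<and> (a * c, b * d) \<in> \<Gamma>) \<and>
   (\<forall>b. (0, b) \<in> \<Gamma> \<longrightarrow> b = 0)"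

definition gpoly :: "('a::field \<times> 'b::field) set \<Rightarrow> 'a poly \<Rightarrow> 'b poly \<Rightarrow> bool" where
 "gpoly \<Gamma> p q \<longleftrightarrow> (\<forall>i. (coeff p i, coeff q i) \<in> \<Gamma>)"

context
 fixes \<Gamma> :: "('a::field \<times> 'b::field) set"
 assumes \<Gamma>: "rgraph \<Gamma>"
begin

lemma rgraph_1: "(1, 1) \<in> \<Gamma>"
 and rgraph_diff: "(a, b) \<in> \<Gamma> ==> (c, d) \<in> \<Gamma> ==> (a - c, b - d) \<in> \<Gamma>"
 and rgraph_mult: "(a, b) \<in> \<Gamma> ==> (c, d) \<in> \<Gamma> ==> (a * c, b * d) \<in> \<Gamma>"
 and rgraph_zero: "(0, b) \<in> \<Gamma> ==> b = 0"
 using \<Gamma> unfolding rgraph_def by blast+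

lemma rgraph_0: "(0, 0) \<in> \<Gamma>" using rgraph_diff[OF rgraph_1 rgraph_1] by simp
lemma rgraph_add: "(a, b) \<in> \<Gamma> ==> (c, d) \<in> \<Gamma> ==> (a + c, b + d) \<in> \<Gamma>"
 using rgraph_diff[of a b "- c" "- d"] rgraph_diff[OF rgraph_0, of c d] by simp
lemma rgraph_unique: "(a, b) \<in> \<Gamma> ==> (a, c) \<in> \<Gamma> ==> b = c"
 using rgraph_diff[of a b a c] rgraph_zero[of "b - c"] by simp
lemma rgraph_sum: "(\<And>i. i \<in> Y ==> (u i, w i) \<in> \<Gamma>) ==> (sum u Y, sum w Y) \<in> \<Gamma>"
 by (induction Y rule: infinite_finite_induct) (simp_all add: rgraph_0 rgraph_add)

lemma gpoly_diff: "gpoly \<Gamma> p q ==> gpoly \<Gamma> r s ==> gpoly \<Gamma> (p - r) (q - s)"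
 by (simp add: gpoly_def rgraph_diff)
lemma gpoly_mult: "gpoly \<Gamma> p q ==> gpoly \<Gamma> r s ==> gpoly \<Gamma> (p * r) (q * s)"
 by (simp add: gpoly_def coeff_mult rgraph_sum rgraph_mult)
lemma gpoly_monom: "(a, b) \<in> \<Gamma> ==> gpoly \<Gamma> (Polynomial.monom a n) (Polynomial.monom b n)"
 by (simp add: gpoly_def rgraph_0)
lemma gpoly_zero: "gpoly \<Gamma> 0 q ==> q = 0"
 by (rule poly_eqI) (simp add: gpoly_def rgraph_zero)

text \<open>The usual extension to a simple algebraic extension: a monic polynomial of least degree
  over the domain with root \<open>\<alpha>\<close> is carried to a polynomial over the target, and
  \<open>\<alpha>\<close> is sent to one of its roots. The hypothesis \<open>inv\<close> serves to
  make that polynomial monic.\<close>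

lemma rgraph_adjoin:
 assumes alg: "\<exists>p q. gpoly \<Gamma> p q \<and> p \<noteq> 0 \<and> poly p \<alpha> = 0"
  and inv: "\<And>a b. (a, b) \<in> \<Gamma> ==> a \<noteq> 0 ==> \<exists>c. (inverse a, c) \<in> \<Gamma>"
  and root: "\<And>q :: 'b poly. degree q > 0 ==> \<exists>y. poly q y = 0"
 shows "\<exists>\<Gamma>' \<beta>. rgraph \<Gamma>' \<and> \<Gamma> \<subseteq> \<Gamma>' \<and> (\<alpha>, \<beta>) \<in> \<Gamma>'"
proof -
 define Q where "Q p \<longleftrightarrow> (\<exists>q. gpoly \<Gamma> p q) \<and> p \<noteq> 0 \<and> poly p \<alpha> = 0" for p
 have "\<exists>p. Q p" using alg by (auto simp: Q_def)
 then obtain p0 where p0: "Q p0" and "\<forall>p. Q p \<longrightarrow> degree p0 \<le> degree p"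
  using ex_has_least_nat[of Q _ degree] by blast
 then have min: "degree p0 \<le> degree p" if "Q p" for p using that by blast
 obtain q0 where q0: "gpoly \<Gamma> p0 q0" using p0 by (auto simp: Q_def)
 obtain c where c: "(inverse (lead_coeff p0), c) \<in> \<Gamma>"
  using inv[of "lead_coeff p0" "coeff q0 (degree p0)"] q0 p0 by (auto simp: gpoly_def Q_def)
 define p where "p = Polynomial.monom (inverse (lead_coeff p0)) 0 * p0"
 define q where "q = Polynomial.monom c 0 * q0"
 have pq: "gpoly \<Gamma> p q" unfolding p_def q_def by (rule gpoly_mult[OF gpoly_monom[OF c] q0])
 define d where "d = degree p"
 have p0': "p0 \<noteq> 0" using p0 by (simp add: Q_def)
 have p: "lead_coeff p = 1" "poly p \<alpha> = 0" "d = degree p0"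
  using p0 by (simp_all add: p_def d_def Q_def monom_0)
 have d0: "d > 0"
 proof (rule ccontr)
  assume "\<not> d > 0"
  then have "degree p = 0" by (simp add: d_def)
  then obtain a where "p = [:a:]" by (rule degree_eq_zeroE)
  then show False using p(1,2) by simp
 qed
 have q1: "coeff q d = 1"
  using pq p(1) rgraph_unique[OF _ rgraph_1] unfolding gpoly_def d_def by metis
 have "coeff q i = 0" if "i > d" for i
  using pq that rgraph_zero[of "coeff q i"] unfolding gpoly_def d_def by (metis coeff_eq_0)
 then have "degree q \<le> d" by (simp add: degree_le)
 moreover have "d \<le> degree q" using q1 by (intro le_degree) simp
 ultimately have dq: "degree q = d" by simp
 then obtain \<beta> where \<beta>: "poly q \<beta> = 0" using root d0 by metis
 \<comment> \<open>Well-definedness, by division with remainder carried out in both fields at once: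
   subtracting a multiple of \<open>p\<close> from \<open>r\<close> and the corresponding multiple
   of \<open>q\<close> from \<open>s\<close> lowers the degree of \<open>r\<close> and changes
   neither value.\<close>
 have zero: "poly s \<beta> = 0" if "gpoly \<Gamma> r s" "poly r \<alpha> = 0" for r s
  using that
 proof (induction "degree r" arbitrary: r s rule: less_induct)
  case less
  show ?case
  proof (cases "r = 0")
   case True
   then have "s = 0" using gpoly_zero less.prems(1) by blast
   then show ?thesis by simp
  next
   case False
   then have le: "d \<le> degree r" using min[of r] less.prems p(3) by (auto simp: Q_def)
   let ?e = "degree r - d"
   let ?r = "r - Polynomial.monom (lead_coeff r) ?e * p"
   let ?s = "s - Polynomial.monom (coeff s (degree r)) ?e * q"
   have g: "gpoly \<Gamma> ?r ?s"
    by (intro gpoly_diff gpoly_mult gpoly_monom pq less.prems(1)) (use less.prems(1) in \<open>simp add: gpoly_def\<close>)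
   have z: "poly ?r \<alpha> = 0" using less.prems(2) p(2) by simp
   have "degree ?r < degree r"
   proof (rule degree_lessI)
    show "?r \<noteq> 0 \<or> degree r > 0" using le d0 by simp
    have dm: "degree (Polynomial.monom (lead_coeff r) ?e * p) = degree r"
     using False p(1) d_def le by (subst Polynomial.degree_mult_eq) (auto simp: Polynomial.degree_monom_eq monom_eq_0_iff)
    have "coeff (Polynomial.monom (lead_coeff r) ?e * p) (degree r) = lead_coeff r"
     using lead_coeff_mult[of "Polynomial.monom (lead_coeff r) ?e" p] p(1) dm False
     by (simp add: Polynomial.degree_monom_eq)
    then show "\<forall>k\<ge>degree r. coeff ?r k = 0"
     using dm by (auto simp: coeff_eq_0 le_less)
   qed
   then have "poly ?s \<beta> = 0" using less.hyps g z by blast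
   then show ?thesis using \<beta> by simp
  qed
 qed
 define \<Gamma>' where "\<Gamma>' = {(poly r \<alpha>, poly s \<beta>) |r s. gpoly \<Gamma> r s}"
 have const: "(a, b) \<in> \<Gamma>'" if "(a, b) \<in> \<Gamma>" for a b
  unfolding \<Gamma>'_def using gpoly_monom[OF that, of 0] by (force simp: monom_0)
 have "rgraph \<Gamma>'" unfolding rgraph_def
 proof (intro conjI allI impI)
  show "(1, 1) \<in> \<Gamma>'" using const rgraph_1 .
  fix a b c d assume "(a, b) \<in> \<Gamma>'" "(c, d) \<in> \<Gamma>'"
  then obtain r s r' s' where rs: "gpoly \<Gamma> r s" "a = poly r \<alpha>" "b = poly s \<beta>" "gpoly \<Gamma> r' s'" "c = poly r' \<alpha>" "d = poly s' \<beta>"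
   unfolding \<Gamma>'_def by blast
  have "(poly (r - r') \<alpha>, poly (s - s') \<beta>) \<in> \<Gamma>'" "(poly (r * r') \<alpha>, poly (s * s') \<beta>) \<in> \<Gamma>'"
   unfolding \<Gamma>'_def using gpoly_diff[OF rs(1,4)] gpoly_mult[OF rs(1,4)] by blast+
  then show "(a - c, b - d) \<in> \<Gamma>'" "(a * c, b * d) \<in> \<Gamma>'" using rs by simp_all
 next
  fix b assume "(0, b) \<in> \<Gamma>'"
  then obtain r s where rs: "gpoly \<Gamma> r s" "0 = poly r \<alpha>" "b = poly s \<beta>" unfolding \<Gamma>'_def by blast
  show "b = 0" using zero[OF rs(1)] rs(2,3) by simp
 qed
 moreover have "\<Gamma> \<subseteq> \<Gamma>'" using const by auto
 moreover have "(poly (Polynomial.monom 1 1) \<alpha>, poly (Polynomial.monom 1 1) \<beta>) \<in> \<Gamma>'"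
  unfolding \<Gamma>'_def using gpoly_monom[OF rgraph_1, of 1] by blast
 then have "(\<alpha>, \<beta>) \<in> \<Gamma>'" by (simp add: poly_monom)
 ultimately show ?thesis by blast
qed

end

text \<open>Solving an algebraic equation for its lowest nonzero coefficient expresses the inverse
  as a polynomial. Hence a subring between the base field and its closure is a field, which supplies
  the hypothesis \<open>inv\<close> of \<open>rgraph_adjoin\<close>.\<close>

lemma alg_closure_inverse_poly:
 fixes a :: "'f::field alg_closure"
 assumes "a \<noteq> 0"
 obtains r where "inverse a = poly (map_poly to_ac r) a"
proof -
 have "\<exists>r. a * poly (map_poly to_ac r) a = 1" if "p \<noteq> 0" "poly (map_poly to_ac p) a = 0" for p :: "'f poly"
  using that
 proof (induction p)
  case (pCons c p)
  have e: "to_ac c + a * poly (map_poly to_ac p) a = 0" using pCons.prems by (simp add: rhom_map_pCons[OF rhom_to_ac])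
  show ?case
  proof (cases "c = 0")
   case True
   then have "p \<noteq> 0" "poly (map_poly to_ac p) a = 0" using pCons.prems e assms by auto
   then show ?thesis by (rule pCons.IH)
  next
   case False
   have "a * poly (map_poly to_ac p) a = - to_ac c" using e by (simp add: eq_neg_iff_add_eq_0 add.commute)
   then have "a * poly (map_poly to_ac (smult (- inverse c) p)) a = to_ac (- inverse c) * (- to_ac c)"
    unfolding rhom_map_smult[OF rhom_to_ac] poly_smult by (metis mult.left_commute)
   also have "\<dots> = 1" using False by simp
   finally show ?thesis by blast
  qed
 qed simp
 then obtain r where "a * poly (map_poly to_ac r) a = 1" using alg_closure_algebraic by metis
 then show ?thesis using that by (metis inverse_unique)
qed

text \<open>Ring homomorphisms from an algebraic closure are obtained from Zorn's lemma, applied to their graphs.\<close>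

theorem rgraph_extend_alg_closure:
 fixes \<Gamma> :: "('f::field alg_closure \<times> 'c::alg_closed_field) set"
 assumes \<Gamma>: "rgraph \<Gamma>" and \<iota>: "rhom \<iota>" "\<And>c. (to_ac c, \<iota> c) \<in> \<Gamma>"
 shows "\<exists>\<Phi>. rhom \<Phi> \<and> (\<forall>a b. (a, b) \<in> \<Gamma> \<longrightarrow> \<Phi> a = b)"
proof -
 let ?F = "{\<Gamma>'. rgraph \<Gamma>' \<and> \<Gamma> \<subseteq> \<Gamma>'}"
 have "\<exists>Z\<in>?F. \<forall>Y\<in>?F. Z \<subseteq> Y \<longrightarrow> Y = Z"
 proof (rule subset_Zorn_nonempty)
  show "?F \<noteq> {}" using \<Gamma> by blast
  fix C assume C: "C \<noteq> {}" "subset.chain ?F C"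
  have sub: "C \<subseteq> ?F" and lin: "\<And>Y Z. Y \<in> C ==> Z \<in> C ==> Y \<subseteq> Z \<or> Z \<subseteq> Y"
   using C(2) by (auto simp: subset_chain_def)
  have "rgraph (\<Union>C)" unfolding rgraph_def
  proof (intro conjI allI impI)
   show "(1, 1) \<in> \<Union>C" using C(1) sub rgraph_1 by blast
   fix a b c d assume "(a, b) \<in> \<Union>C" "(c, d) \<in> \<Union>C"
   then obtain Y Z where "Y \<in> C" "Z \<in> C" "(a, b) \<in> Y" "(c, d) \<in> Z" by blast
   then obtain W where W: "W \<in> C" "(a, b) \<in> W" "(c, d) \<in> W" using lin[of Y Z] by blast
   then have "rgraph W" using sub by blast
   then show "(a - c, b - d) \<in> \<Union>C" "(a * c, b * d) \<in> \<Union>C"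
    using rgraph_diff[OF _ W(2,3)] rgraph_mult[OF _ W(2,3)] W(1) by blast+
  next
   fix b assume "(0, b) \<in> \<Union>C"
   then show "b = 0" using sub rgraph_zero by blast
  qed
  note un = this
  obtain Y where Y: "Y \<in> C" using C(1) by blast
  have "\<Gamma> \<subseteq> Y" using subsetD[OF sub Y] by simp
  then have "\<Gamma> \<subseteq> \<Union>C" using Union_upper[OF Y] by (rule order_trans)
  then show "\<Union>C \<in> ?F" using un by (simp only: mem_Collect_eq simp_thms)
 qed
 then obtain Z where ZF: "Z \<in> ?F" and mx: "\<forall>Y\<in>?F. Z \<subseteq> Y \<longrightarrow> Y = Z" by (elim bexE)
 have Z: "rgraph Z" "\<Gamma> \<subseteq> Z" using ZF by simp_all
 have Z3: "Y = Z" if "rgraph Y" "Z \<subseteq> Y" for Y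
  using mx that order_trans[OF Z(2) that(2)] by (simp only: mem_Collect_eq)
 have pol: "(poly (map_poly to_ac r) a, poly (map_poly \<iota> r) b) \<in> Z" if ab: "(a, b) \<in> Z" for a b r
 proof (induction r)
  case 0
  show ?case using rgraph_0[OF Z(1)] by simp
 next
  case (pCons c r)
  have "(to_ac c, \<iota> c) \<in> Z" using \<iota>(2) Z(2) by blast
  then show ?case using rgraph_add[OF Z(1) _ rgraph_mult[OF Z(1) ab pCons.IH]]
   by (simp add: rhom_map_pCons[OF rhom_to_ac] rhom_map_pCons[OF \<iota>(1)])
 qed
 have total: "\<exists>b. (a, b) \<in> Z" for a
 proof -
  have inv: "\<exists>c. (inverse a, c) \<in> Z" if "(a, b) \<in> Z" "a \<noteq> 0" for a b
   using pol[OF that(1)] alg_closure_inverse_poly[OF that(2)] by metis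
  obtain p where p: "p \<noteq> 0" "poly (map_poly to_ac p) a = 0" by (rule alg_closure_algebraic)
  have "gpoly Z (map_poly to_ac p) (map_poly \<iota> p)"
   using \<iota>(2) Z(2) by (auto simp: gpoly_def rhom_coeff[OF \<iota>(1)] rhom_coeff[OF rhom_to_ac])
  moreover have "map_poly to_ac p \<noteq> 0" using p(1) rhom_map_poly_eq_0_iff[OF rhom_to_ac] by blast
  ultimately have alg: "\<exists>p q. gpoly Z p q \<and> p \<noteq> 0 \<and> poly p a = 0" using p(2) by blast
  have "\<exists>Y b. rgraph Y \<and> Z \<subseteq> Y \<and> (a, b) \<in> Y"
   by (rule rgraph_adjoin[OF Z(1) alg inv alg_closed_imp_poly_has_root])
  then show ?thesis using Z3 by metis
 qed
 define \<Phi> where "\<Phi> a = (SOME b. (a, b) \<in> Z)" for a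
 have \<Phi>: "(a, \<Phi> a) \<in> Z" for a unfolding \<Phi>_def using total by (rule someI_ex)
 have uni: "\<Phi> a = b" if "(a, b) \<in> Z" for a b using rgraph_unique[OF Z(1) \<Phi> that] .
 have "rhom \<Phi>"
  by (intro rhomI uni) (simp_all add: rgraph_1[OF Z(1)] rgraph_add[OF Z(1)] rgraph_mult[OF Z(1)] \<Phi>)
 then show ?thesis using uni Z(2) by blast
qed

corollary rhom_extend_alg_closure:
 fixes \<iota> :: "'f::field \<Rightarrow> 'c::alg_closed_field"
 assumes "rhom \<iota>"
 obtains \<Phi> :: "'f alg_closure \<Rightarrow> 'c" where "rhom \<Phi>" "\<And>c. \<Phi> (to_ac c) = \<iota> c"
proof -
 let ?\<Gamma> = "range (\<lambda>c. (to_ac c, \<iota> c))"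
 have "rgraph ?\<Gamma>" unfolding rgraph_def
 proof (intro conjI allI impI)
  show "(1, 1) \<in> ?\<Gamma>" using rhom_1[OF assms] by (intro image_eqI[of _ _ 1]) simp_all
  fix a b c d assume "(a, b) \<in> ?\<Gamma>" "(c, d) \<in> ?\<Gamma>"
  then obtain u v where "a = to_ac u" "b = \<iota> u" "c = to_ac v" "d = \<iota> v" by blast
  then show "(a - c, b - d) \<in> ?\<Gamma>" "(a * c, b * d) \<in> ?\<Gamma>"
   using image_eqI[of _ "\<lambda>c. (to_ac c, \<iota> c)" "u - v" UNIV] image_eqI[of _ "\<lambda>c. (to_ac c, \<iota> c)" "u * v" UNIV]
   by (simp_all add: rhom_diff[OF assms] rhom_mult[OF assms])
 qed (use rhom_0[OF assms] in auto)
 then show ?thesis using rgraph_extend_alg_closure[OF _ assms, of ?\<Gamma>] that by blast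
qed

text \<open>Only endomorphisms over the base field are demanded. They are bijective because they
  permute the finite root set of each polynomial over the base field
  (\<open>ac_aut_bij\<close>).\<close>

definition ac_aut :: "('f::field alg_closure \<Rightarrow> 'f alg_closure) set" where
 "ac_aut = {\<phi>. rhom \<phi> \<and> (\<forall>c. \<phi> (to_ac c) = to_ac c)}"

lemma ac_autD: "\<phi> \<in> ac_aut ==> rhom \<phi>" "\<phi> \<in> ac_aut ==> \<phi> (to_ac c) = to_ac c"
 by (simp_all add: ac_aut_def)

lemma ac_aut_map_poly: "\<phi> \<in> ac_aut ==> map_poly \<phi> (map_poly to_ac p) = map_poly to_ac p"
 by (simp add: map_poly_comp_rhom[OF _ rhom_to_ac] ac_autD)

lemma ac_aut_poly: "\<phi> \<in> ac_aut ==> \<phi> (poly (map_poly to_ac p) x) = poly (map_poly to_ac p) (\<phi> x)"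
 by (simp add: rhom_poly[OF ac_autD(1)] ac_aut_map_poly)

lemma ac_aut_root: "\<phi> \<in> ac_aut ==> poly (map_poly to_ac p) x = 0 ==> poly (map_poly to_ac p) (\<phi> x) = 0"
 using ac_aut_poly[of \<phi> p x] by (simp add: rhom_0[OF ac_autD(1)])

lemma ac_aut_bij:
 fixes \<phi> :: "'f::field alg_closure \<Rightarrow> 'f alg_closure"
 assumes "\<phi> \<in> ac_aut"
 shows "bij \<phi>"
proof -
 have inj: "inj \<phi>" using rhom_eq_iff[OF ac_autD(1)[OF assms]] by (auto intro: injI)
 have "a \<in> range \<phi>" for a
 proof -
  obtain p where p: "p \<noteq> 0" "poly (map_poly to_ac p) a = 0" by (rule alg_closure_algebraic)
  let ?R = "{x. poly (map_poly to_ac p) x = 0}"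
  have "finite ?R" using p(1) by (intro poly_roots_finite) (simp add: rhom_map_poly_eq_0_iff[OF rhom_to_ac])
  moreover have "\<phi> ` ?R \<subseteq> ?R" using ac_aut_root[OF assms] by blast
  ultimately have "\<phi> ` ?R = ?R" using inj_on_subset[OF inj subset_UNIV] by (rule endo_inj_surj)
  then have "a \<in> \<phi> ` ?R" using p(2) by simp
  then show ?thesis by (rule rev_subsetD) (rule image_mono[OF subset_UNIV])
 qed
 then show ?thesis using inj by (auto simp: bij_def)
qed

lemma ac_aut_id: "(\<lambda>x. x) \<in> ac_aut" by (simp add: ac_aut_def rhom_def)
lemma ac_aut_comp: "\<phi> \<in> ac_aut ==> \<psi> \<in> ac_aut ==> (\<lambda>x. \<phi> (\<psi> x)) \<in> ac_aut"
 by (simp add: ac_aut_def rhom_comp)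
lemma ac_aut_inv:
 assumes "\<phi> \<in> ac_aut"
 shows "(inv_into UNIV \<phi>) \<in> ac_aut" "\<phi> ((inv_into UNIV \<phi>) x) = x" "(inv_into UNIV \<phi>) (\<phi> x) = x"
proof -
 have b: "inj \<phi>" "surj \<phi>" using ac_aut_bij[OF assms] by (auto simp: bij_def)
 show 1: "\<phi> ((inv_into UNIV \<phi>) x) = x" "(inv_into UNIV \<phi>) (\<phi> x) = x" for x
  by (rule surj_f_inv_f[OF b(2)], rule inv_f_f[OF b(1)])
 note r = ac_autD(1)[OF assms]
 have "rhom ((inv_into UNIV \<phi>))"
  by (rule rhomI; rule injD[OF b(1)]) (simp_all only: 1 rhom_1[OF r] rhom_add[OF r] rhom_mult[OF r])
 moreover have "(inv_into UNIV \<phi>) (to_ac c) = to_ac c" for c using 1(2)[of "to_ac c"] ac_autD(2)[OF assms] by simp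
 ultimately show "(inv_into UNIV \<phi>) \<in> ac_aut" by (simp add: ac_aut_def)
qed
lemma ac_aut_funpow: "\<phi> \<in> ac_aut ==> \<phi> ^^ n \<in> ac_aut"
proof (induction n)
 case 0
 show ?case using ac_aut_id by (simp add: id_def)
next
 case (Suc n)
 then show ?case using ac_aut_comp[of \<phi> "\<phi> ^^ n"] by (simp add: o_def)
qed

text \<open>The hypothesis says that sending the value of \<open>q\<close> at \<open>x\<close> to
  its value at \<open>y\<close> is well defined; this graph is then extended to the whole
  closure.\<close>

lemma ac_aut_extend:
 fixes x y :: "'f::field alg_closure"
 assumes "\<And>q. poly (map_poly to_ac q) x = 0 ==> poly (map_poly to_ac q) y = 0"
 obtains \<phi> where "\<phi> \<in> ac_aut" "\<phi> x = y"
proof -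
 let ?e = "\<lambda>q. (poly (map_poly to_ac q) x, poly (map_poly to_ac q) y)"
 let ?\<Gamma> = "range ?e"
 note m = rhom_map_poly[OF rhom_to_ac]
 have "rgraph ?\<Gamma>" unfolding rgraph_def
 proof (intro conjI allI impI)
  show "(1, 1) \<in> ?\<Gamma>" by (rule image_eqI[of _ _ 1]) (simp_all add: rhom_1[OF m])
  fix a b c d assume "(a, b) \<in> ?\<Gamma>" "(c, d) \<in> ?\<Gamma>"
  then obtain u v where "(a, b) = ?e u" "(c, d) = ?e v" by blast
  then show "(a - c, b - d) \<in> ?\<Gamma>" "(a * c, b * d) \<in> ?\<Gamma>"
   using rangeI[of ?e "u - v"] rangeI[of ?e "u * v"] by (simp_all add: rhom_diff[OF m] rhom_mult[OF m])
 next
  fix b assume "(0, b) \<in> ?\<Gamma>"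
  then show "b = 0" using assms by auto
 qed
 moreover have "(to_ac c, to_ac c) \<in> ?\<Gamma>" for c by (rule image_eqI[of _ _ "[:c:]"]) (simp_all add: rhom_map_pCons[OF rhom_to_ac])
 ultimately obtain \<Phi> where \<Phi>: "rhom \<Phi>" "\<And>a b. (a, b) \<in> ?\<Gamma> ==> \<Phi> a = b"
  using rgraph_extend_alg_closure[OF _ rhom_to_ac, of ?\<Gamma>] by blast
 have "(x, y) \<in> ?\<Gamma>" by (rule image_eqI[of _ _ "[:0, 1:]"]) (simp_all add: rhom_map_pCons[OF rhom_to_ac])
 then show ?thesis using that[of \<Phi>] \<Phi> \<open>\<And>c. (to_ac c, to_ac c) \<in> ?\<Gamma>\<close> by (auto simp: ac_aut_def)
qed

lemma alg_closure_minimal_polynomial: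
 fixes e :: "'f::field alg_closure"
 obtains p where "p \<noteq> 0" "degree p > 0" "\<And>q. poly (map_poly to_ac q) e = 0 \<longleftrightarrow> p dvd q"
proof -
 note m = rhom_map_poly[OF rhom_to_ac]
 define Q where "Q p \<longleftrightarrow> p \<noteq> 0 \<and> poly (map_poly to_ac p) e = 0" for p
 obtain p1 where "Q p1" unfolding Q_def using alg_closure_algebraic by metis
 then obtain p where p: "Q p" and min: "\<forall>q. Q q \<longrightarrow> degree p \<le> degree q"
  using ex_has_least_nat[of Q _ degree] by blast
 have dvd: "p dvd q" if "poly (map_poly to_ac q) e = 0" for q
 proof (rule ccontr)
  assume n: "\<not> p dvd q"
  then have r0: "q mod p \<noteq> 0" by (simp add: mod_eq_0_iff_dvd)
  have "map_poly to_ac q = map_poly to_ac (q div p) * map_poly to_ac p + map_poly to_ac (q mod p)"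
   by (simp flip: rhom_mult[OF m] rhom_add[OF m])
  then have "Q (q mod p)" using that p r0 by (simp add: Q_def)
  then have "degree p \<le> degree (q mod p)" using min by blast
  moreover have "degree (q mod p) < degree p" using degree_mod_less[of p q] p r0 by (auto simp: Q_def)
  ultimately show False by simp
 qed
 have "degree p \<noteq> 0"
 proof
  assume "degree p = 0"
  then obtain a where "p = [:a:]" by (rule degree_eq_zeroE)
  then show False using p by (simp add: Q_def rhom_map_pCons[OF rhom_to_ac])
 qed
 moreover have "poly (map_poly to_ac q) e = 0" if dv: "p dvd q" for q
 proof -
  obtain u where "q = p * u" using dv by (rule dvdE)
  then show ?thesis using p by (simp add: Q_def rhom_mult[OF m])
 qed
 ultimately show ?thesis using p dvd by (intro that[of p]) (auto simp only: Q_def)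
qed

text \<open>In characteristic zero the minimal polynomial of \<open>e\<close> does not divide its
  derivative, so \<open>e\<close> is a simple root. If the degree exceeded one there would be
  another root \<open>y\<close>, and some automorphism would carry \<open>e\<close> to it.\<close>

lemma ac_aut_fixed:
 fixes e :: "'f::field_char_0 alg_closure"
 assumes "\<And>\<phi>. \<phi> \<in> ac_aut ==> \<phi> e = e"
 shows "e \<in> range to_ac"
proof -
 obtain p where p: "p \<noteq> 0" "degree p > 0" "\<And>q. poly (map_poly to_ac q) e = 0 \<longleftrightarrow> p dvd q"
  by (rule alg_closure_minimal_polynomial) blast
 have pe: "poly (map_poly to_ac p) e = 0" using p(3) by simp
 show ?thesis
 proof (cases "degree p = 1")
  case True
  obtain a b where ab: "p = [:a, b:]" "b \<noteq> 0" using True by (metis degree1_coeffs)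
  have "to_ac a + e * to_ac b = 0" using pe ab by (simp add: rhom_map_pCons[OF rhom_to_ac])
  then have "e = to_ac (- a / b)" using ab(2) by (simp add: field_simps eq_neg_iff_add_eq_0)
  then show ?thesis by blast
 next
  case False
  let ?p = "map_poly to_ac p"
  have "[:- e, 1:] dvd ?p" using pe by (simp add: poly_eq_0_iff_dvd)
  then obtain r where r: "?p = [:- e, 1:] * r" by blast
  have pd: "pderiv ?p = map_poly to_ac (pderiv p)"
   by (rule poly_eqI) (simp add: coeff_pderiv rhom_coeff[OF rhom_to_ac])
  have "poly (pderiv ?p) e = poly r e" unfolding r pderiv_mult by (simp add: pderiv_pCons)
  moreover have "\<not> p dvd pderiv p" using dvd_imp_degree_le[of p "pderiv p"] p(2) by (auto simp: degree_pderiv pderiv_eq_0_iff)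
  then have "poly (pderiv ?p) e \<noteq> 0" unfolding pd using p(3) by blast
  ultimately have re: "poly r e \<noteq> 0" by simp
  have "r \<noteq> 0" using re by auto
  then have "degree ?p = 1 + degree r" unfolding r by (subst Polynomial.degree_mult_eq) auto
  then have "degree r > 0" using False p(2) rhom_degree[OF rhom_to_ac, of p] by simp
  then obtain y where y: "poly r y = 0" using alg_closed_imp_poly_has_root by blast
  have py: "poly ?p y = 0" unfolding r using y by simp
  have "poly (map_poly to_ac q) y = 0" if q: "poly (map_poly to_ac q) e = 0" for q
  proof -
   obtain u where "q = p * u" using p(3)[of q] q by blast
   then show ?thesis using py by (simp add: rhom_mult[OF rhom_map_poly[OF rhom_to_ac]])
  qed
  then obtain \<phi> where "\<phi> \<in> ac_aut" "\<phi> e = y" by (rule ac_aut_extend)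
  then have "y = e" using assms by auto
  then show ?thesis using y re by simp
 qed
qed

lemma ac_aut_fixed_poly:
 fixes P :: "'f::field_char_0 alg_closure poly"
 assumes "\<And>\<phi>. \<phi> \<in> ac_aut ==> map_poly \<phi> P = P"
 obtains p where "P = map_poly to_ac p"
proof -
 have "coeff P i \<in> range to_ac" for i
 proof (rule ac_aut_fixed)
  fix \<phi> :: "'f alg_closure \<Rightarrow> 'f alg_closure" assume "\<phi> \<in> ac_aut"
  then show "\<phi> (coeff P i) = coeff P i"
   using assms rhom_coeff[OF ac_autD(1), of \<phi> P i] by simp
 qed
 then have "P = map_poly to_ac (map_poly of_ac P)"
  by (intro poly_eqI) (simp add: rhom_coeff[OF rhom_to_ac] coeff_map_poly to_ac_of_ac)
 then show ?thesis by (rule that)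
qed

text \<open>Lagrange interpolation along the orbit of \<open>y\<close>, with denominators cleared.\<close>

lemma ac_aut_stabilizer_fixed:
 fixes e y :: "'f::field_char_0 alg_closure"
 assumes inv: "\<And>\<phi>. \<phi> \<in> ac_aut ==> \<phi> y = y ==> \<phi> e = e"
 obtains a b where "poly (map_poly to_ac b) y \<noteq> 0" "e * poly (map_poly to_ac b) y = poly (map_poly to_ac a) y"
proof -
 define Orb where "Orb = (\<lambda>\<phi>. \<phi> y) ` ac_aut"
 obtain p where p: "p \<noteq> 0" "poly (map_poly to_ac p) y = 0" by (rule alg_closure_algebraic)
 have "Orb \<subseteq> {x. poly (map_poly to_ac p) x = 0}" unfolding Orb_def using ac_aut_root p(2) by blast
 then have fO: "finite Orb" using finite_subset[OF _ poly_roots_finite] p(1) rhom_map_poly_eq_0_iff[OF rhom_to_ac] by blast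
 have yO: "y \<in> Orb" unfolding Orb_def by (rule image_eqI[OF _ ac_aut_id]) simp
 have bO: "bij_betw \<phi> Orb Orb" if "\<phi> \<in> ac_aut" for \<phi>
 proof -
  have "\<phi> ` Orb \<subseteq> Orb" unfolding Orb_def using ac_aut_comp[OF that] by auto
  then show ?thesis using endo_inj_surj[OF fO] ac_aut_bij[OF that] unfolding bij_betw_def bij_def by (meson inj_on_subset subset_UNIV)
 qed
 define W where "W z = (\<Prod>z'\<in>Orb - {z}. [:- z', 1:])" for z
 \<comment> \<open>\<open>W z\<close> is the Lagrange numerator at \<open>z\<close>; without
   dividing by its value, \<open>L u\<close> takes the value \<open>u y * poly (W y) y\<close> at
   \<open>y\<close>. Taking \<open>u\<close> constant 1 gives the denominator, so both polynomials
   have coefficients in the base field.\<close>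
 define L where "L u = (\<Sum>z\<in>Orb. smult (u z) (W z))" for u
 have Ly: "poly (L u) y = u y * poly (W y) y" for u
 proof -
  have "poly (W z) y = 0" if "z \<in> Orb - {y}" for z
   unfolding W_def poly_prod using fO yO that by (intro prod_zero) auto
  then have "(\<Sum>z\<in>Orb - {y}. u z * poly (W z) y) = 0" by (intro sum.neutral) simp
  then show ?thesis unfolding L_def poly_sum by (simp add: sum.remove[OF fO yO])
 qed
 have Wy: "poly (W y) y \<noteq> 0" unfolding W_def poly_prod using fO by simp
 have Wm: "map_poly \<phi> (W z) = W (\<phi> z)" if \<phi>: "\<phi> \<in> ac_aut" "z \<in> Orb" for \<phi> z
 proof -
  have bj: "bij_betw \<phi> (Orb - {z}) (Orb - {\<phi> z})" using bij_betw_DiffI[OF bO[OF \<phi>(1)], of "{z}" "{\<phi> z}"]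
    bij_betwE[OF bO[OF \<phi>(1)]] \<phi>(2) by (auto simp: bij_betw_def)
  have "map_poly \<phi> (W z) = (\<Prod>z'\<in>Orb - {z}. [:- \<phi> z', 1:])"
   unfolding W_def rhom_prod[OF rhom_map_poly[OF ac_autD(1)[OF \<phi>(1)]]]
   by (simp add: rhom_map_pCons[OF ac_autD(1)[OF \<phi>(1)]] rhom_1[OF ac_autD(1)[OF \<phi>(1)]] rhom_minus[OF ac_autD(1)[OF \<phi>(1)]])
  also have "\<dots> = W (\<phi> z)" unfolding W_def by (rule prod.reindex_bij_betw[OF bj])
  finally show ?thesis .
 qed
 have Lf: "map_poly \<phi> (L u) = L u" if \<phi>: "\<phi> \<in> ac_aut" and u: "\<And>z. z \<in> Orb ==> \<phi> (u z) = u (\<phi> z)" for \<phi> u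
 proof -
  have "map_poly \<phi> (L u) = (\<Sum>z\<in>Orb. smult (u (\<phi> z)) (W (\<phi> z)))"
   unfolding L_def rhom_sum[OF rhom_map_poly[OF ac_autD(1)[OF \<phi>]]]
   by (intro sum.cong refl) (simp add: rhom_map_smult[OF ac_autD(1)[OF \<phi>]] Wm[OF \<phi>] u)
  also have "\<dots> = L u" unfolding L_def by (rule sum.reindex_bij_betw[OF bO[OF \<phi>]])
  finally show ?thesis .
 qed
 \<comment> \<open>\<open>u\<close> transports \<open>e\<close> along the orbit of \<open>y\<close>,
   that is \<open>u (\<phi> y) = \<phi> e\<close>; independence of the chosen automorphism is the
   assumption on the stabilizer of \<open>y\<close>.\<close>
 define u where "u z = (SOME \<phi>. \<phi> \<in> ac_aut \<and> \<phi> y = z) e" for z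
 have u: "u (\<phi> y) = \<phi> e" if \<phi>: "\<phi> \<in> ac_aut" for \<phi>
 proof -
  define \<psi> where "\<psi> = (SOME \<psi>. \<psi> \<in> ac_aut \<and> \<psi> y = \<phi> y)"
  have \<psi>: "\<psi> \<in> ac_aut \<and> \<psi> y = \<phi> y" unfolding \<psi>_def
   by (rule someI[of "\<lambda>\<psi>. \<psi> \<in> ac_aut \<and> \<psi> y = \<phi> y" \<phi>]) (use \<phi> in simp)
  have "(inv_into UNIV \<phi>) (\<psi> y) = y" using \<psi> ac_aut_inv(3)[OF \<phi>] by simp
  then have "(inv_into UNIV \<phi>) (\<psi> e) = e" using inv[OF ac_aut_comp[OF ac_aut_inv(1)[OF \<phi>]]] \<psi> by blast
  then have "\<psi> e = \<phi> e" using ac_aut_inv(2)[OF \<phi>] by metis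
  then show ?thesis unfolding u_def \<psi>_def .
 qed
 have "map_poly \<phi> (L u) = L u" if \<phi>: "\<phi> \<in> ac_aut" for \<phi>
 proof (rule Lf[OF \<phi>])
  fix z assume "z \<in> Orb"
  then obtain \<psi> where \<psi>: "\<psi> \<in> ac_aut" "z = \<psi> y" unfolding Orb_def by blast
  show "\<phi> (u z) = u (\<phi> z)" unfolding \<psi>(2) u[OF \<psi>(1)] using u[OF ac_aut_comp[OF \<phi> \<psi>(1)]] by simp
 qed
 then obtain a where a: "L u = map_poly to_ac a" by (rule ac_aut_fixed_poly)
 have "map_poly \<phi> (L (\<lambda>_. 1)) = L (\<lambda>_. 1)" if \<phi>: "\<phi> \<in> ac_aut" for \<phi> by (rule Lf[OF \<phi>]) (simp add: rhom_1[OF ac_autD(1)[OF \<phi>]])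
 then obtain b where b: "L (\<lambda>_. 1) = map_poly to_ac b" by (rule ac_aut_fixed_poly)
 have uy: "u y = e" using u[OF ac_aut_id] by simp
 show ?thesis by (rule that[of b a]) (simp_all add: a[symmetric] b[symmetric] Ly Wy uy)
qed

section \<open>Inertia at infinity\<close>

instance fract :: ("{idom, ring_char_0}") field_char_0
proof
 have "of_nat n = to_fract (of_nat n :: 'a)" for n by (induction n) simp_all
 then show "inj (of_nat :: nat \<Rightarrow> 'a fract)" by (auto intro!: injI)
qed

lemma rhom_to_fract: "rhom to_fract"
 by (rule rhomI) simp_all

lemma rhom_fract_eqI:
 fixes \<phi> \<psi> :: "'r::idom fract \<Rightarrow> 's::field"
 assumes "rhom \<phi>" "rhom \<psi>" "\<And>x. \<phi> (to_fract x) = \<psi> (to_fract x)"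
 shows "\<phi> q = \<psi> q"
proof -
 obtain a b where "q = Fract a b" by (cases q)
 then have "q = to_fract a / to_fract b" by (simp add: to_fract_def)
 then show ?thesis using assms by (simp add: rhom_divide)
qed

lemma rhom_fract_extend:
 fixes \<rho> :: "'r::idom \<Rightarrow> 's::field"
 assumes \<rho>: "rhom \<rho>" and inj: "\<And>x. \<rho> x = 0 ==> x = 0"
 obtains \<Theta> :: "'r fract \<Rightarrow> 's" where "rhom \<Theta>" "\<And>x. \<Theta> (to_fract x) = \<rho> x"
proof -
 define \<Theta> where "\<Theta> q = (SOME v. \<exists>a b. b \<noteq> 0 \<and> q = Fract a b \<and> v = \<rho> a / \<rho> b)" for q
 have val: "\<Theta> (Fract a b) = \<rho> a / \<rho> b" if b: "b \<noteq> 0" for a b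
 proof -
  have "\<exists>a' b'. b' \<noteq> 0 \<and> Fract a b = Fract a' b' \<and> \<Theta> (Fract a b) = \<rho> a' / \<rho> b'"
   unfolding \<Theta>_def by (rule someI[of _ "\<rho> a / \<rho> b"]) (use b in blast)
  then obtain a' b' where b': "b' \<noteq> 0" "Fract a b = Fract a' b'" "\<Theta> (Fract a b) = \<rho> a' / \<rho> b'" by blast
  have "a * b' = a' * b" using b'(1,2) b by (simp add: eq_fract)
  then have "\<rho> a * \<rho> b' = \<rho> a' * \<rho> b" by (metis rhom_mult[OF \<rho>])
  moreover have "\<rho> b \<noteq> 0" "\<rho> b' \<noteq> 0" using inj b b'(1) by blast+
  ultimately show ?thesis unfolding b'(3) by (simp add: field_simps)
 qed
 have "rhom \<Theta>"
 proof (rule rhomI)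
  show "\<Theta> 1 = 1" using val[of 1 1] rhom_1[OF \<rho>] by (simp add: fract_collapse)
  fix x y :: "'r fract"
  obtain a b where x: "x = Fract a b" "b \<noteq> 0" by (cases x)
  obtain c d where y: "y = Fract c d" "d \<noteq> 0" by (cases y)
  have n: "\<rho> b \<noteq> 0" "\<rho> d \<noteq> 0" using inj x y by blast+
  show "\<Theta> (x + y) = \<Theta> x + \<Theta> y" using x y n
   by (simp add: val rhom_add[OF \<rho>] rhom_mult[OF \<rho>] field_simps)
  show "\<Theta> (x * y) = \<Theta> x * \<Theta> y" using x y n
   by (simp add: val rhom_mult[OF \<rho>])
 qed
 moreover have "\<Theta> (to_fract x) = \<rho> x" for x using val[of 1 x] rhom_1[OF \<rho>] by (simp add: to_fract_def)
 ultimately show ?thesis by (rule that)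
qed

text \<open>The image of an algebraically closed field contains all roots of polynomials over it.
  This is used both for constants among Laurent series and for the image of the closure of
  \<open>k(t)\<close>.\<close>

lemma root_in_range:
 fixes \<Phi> :: "'a::alg_closed_field \<Rightarrow> 'b::field"
 assumes \<Phi>: "rhom \<Phi>" and "P \<noteq> 0" "poly (map_poly \<Phi> P) y = 0"
 shows "y \<in> range \<Phi>"
 using assms(2,3)
proof (induction "degree P" arbitrary: P rule: less_induct)
 case less
 show ?case
 proof (cases "degree P = 0")
  case True
  then obtain a where "P = [:a:]" by (rule degree_eq_zeroE)
  then show ?thesis using less.prems by (simp add: rhom_map_pCons[OF \<Phi>] rhom_eq_0_iff[OF \<Phi>])
 next
  case False
  then obtain a where "poly P a = 0" using alg_closed_imp_poly_has_root by blast
  then obtain Q where Q: "P = [:- a, 1:] * Q" by (auto simp: poly_eq_0_iff_dvd)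
  then have Q0: "Q \<noteq> 0" using less.prems by auto
  have "map_poly \<Phi> P = [:- \<Phi> a, 1:] * map_poly \<Phi> Q"
   unfolding Q rhom_mult[OF rhom_map_poly[OF \<Phi>]] by (simp add: rhom_map_pCons[OF \<Phi>] rhom_minus[OF \<Phi>] rhom_1[OF \<Phi>])
  then have "y = \<Phi> a \<or> poly (map_poly \<Phi> Q) y = 0" using less.prems by auto
  moreover have "degree Q < degree P" unfolding Q using Q0 by (subst Polynomial.degree_mult_eq) auto
  ultimately show ?thesis using less.hyps Q0 by blast
 qed
qed

text \<open>Split off a prime, \<open>N = q * M\<close>. If \<open>q\<close> divides
  \<open>M\<close>, a \<open>q\<close>-th root of a primitive \<open>M\<close>-th root of unity is
  primitive of order \<open>N\<close>; otherwise multiply by a root of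
  \<open>1 + X + ... + X^(q-1)\<close>, which differs from 1 in characteristic zero.\<close>

lemma primitive_root_exists:
 fixes N :: nat
 assumes "N > 0"
 shows "\<exists>\<zeta> :: 'k::field_char_0 alg_closure. \<forall>j. \<zeta> ^ j = 1 \<longleftrightarrow> N dvd j"
 using assms
proof (induction N rule: less_induct)
 case (less N)
 show ?case
 proof (cases "N = 1")
  case True
  then show ?thesis by (intro exI[of _ 1]) simp
 next
  case False
  then obtain q where q: "prime q" "q dvd N" using prime_factor_nat by blast
  then obtain M where M: "N = q * M" by blast
  have "M < N" "M > 0" using less.prems M prime_gt_1_nat[OF q(1)] by auto
  then obtain z :: "'k alg_closure" where z: "\<And>j. z ^ j = 1 \<longleftrightarrow> M dvd j" using less.IH by blast
  show ?thesis
  proof (cases "q dvd M")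
   case True
   obtain w where w: "w ^ q = z" using nth_root_exists[of q z] prime_gt_0_nat[OF q(1)] by blast
   have "w ^ j = 1 \<longleftrightarrow> N dvd j" for j
   proof
    assume j: "w ^ j = 1"
    have "z ^ j = (w ^ j) ^ q" unfolding w[symmetric] by (simp flip: power_mult add: mult.commute)
    then have "M dvd j" using j z by simp
    then have "q dvd j" using True by (rule dvd_trans[rotated])
    then obtain i where i: "j = q * i" by blast
    then have "z ^ i = 1" using j w by (simp add: power_mult)
    then show "N dvd j" using z i M by simp
   next
    assume "N dvd j"
    then obtain i where "j = q * M * i" using M by blast
    then have "w ^ j = (z ^ M) ^ i" using w by (simp add: power_mult)
    moreover have "z ^ M = 1" using z[of M] by simp
    ultimately show "w ^ j = 1" by simp
   qed
   then show ?thesis by blast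
  next
   case False
   have q1: "q - 1 > 0" using prime_gt_1_nat[OF q(1)] by simp
   obtain e :: "'k alg_closure" where e: "(\<Sum>k\<le>q - 1. 1 * e ^ k) = 0" using alg_closed[of "q - 1" "\<lambda>_. 1"] q1 by auto
   have s: "(\<Sum>k<q. e ^ k) = 0" using e q1 by (simp add: lessThan_Suc_atMost[symmetric])
   have e1: "e \<noteq> 1"
   proof
    assume "e = 1"
    then have "of_nat q = (0::'k alg_closure)" using s by simp
    then show False using prime_gt_0_nat[OF q(1)] by simp
   qed
   have eq: "e ^ q = 1" using power_diff_1_eq[of e q] s by simp
   have ej: "q dvd j" if j: "e ^ j = 1" for j
   proof (rule ccontr)
    assume "\<not> q dvd j"
    then obtain i l where il: "j * i = Suc (q * l)" using bezout_prime[OF q(1)] by blast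
    have "e = e ^ (j * i)" unfolding il by (simp add: power_mult eq)
    then have "e = (e ^ j) ^ i" by (simp add: power_mult)
    then show False using j e1 by simp
   qed
   have cop: "coprime M q" using prime_imp_coprime[OF q(1) False] by (simp add: coprime_commute)
   have "(z * e) ^ j = 1 \<longleftrightarrow> N dvd j" for j
   proof
    assume j: "(z * e) ^ j = 1"
    have "((z * e) ^ j) ^ q = z ^ (j * q) * (e ^ q) ^ j"
     by (simp add: power_mult_distrib flip: power_mult) (simp add: mult.commute)
    then have "z ^ (j * q) = 1" using j eq by simp
    then have "M dvd j * q" using z by blast
    then have Mj: "M dvd j" using cop coprime_dvd_mult_left_iff by blast
    have "z ^ j = 1" using z[of j] Mj by blast
    then have "e ^ j = 1" using j by (simp add: power_mult_distrib)
    then have "q dvd j" by (rule ej)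
    then show "N dvd j" unfolding M using divides_mult Mj cop by (metis mult.commute)
   next
    assume "N dvd j"
    then have "M dvd j" "q dvd j" using M dvd_mult_left dvd_mult_right by blast+
    then have "z ^ j = 1" "e ^ j = 1" using z[of j] eq by (auto simp: power_mult)
    then show "(z * e) ^ j = 1" by (simp add: power_mult_distrib)
   qed
   then show ?thesis by blast
  qed
 qed
qed

text \<open>The substitution of \<open>\<zeta> s\<close> for the variable \<open>s\<close>. For a
  primitive \<open>N\<close>-th root of unity it generates the automorphisms of the Laurent series
  in \<open>s\<close> that fix the constants and \<open>s ^ N\<close>.\<close>

definition twist :: "'a::comm_ring_1 \<Rightarrow> 'a fps \<Rightarrow> 'a fps" where
 "twist \<zeta> u = Abs_fps (\<lambda>n. \<zeta> ^ n * fps_nth u n)"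

lemma twist_nth: "fps_nth (twist \<zeta> u) n = \<zeta> ^ n * fps_nth u n"
 by (simp add: twist_def)

lemma rhom_twist: "rhom (twist \<zeta>)"
proof (rule rhomI)
 show "twist \<zeta> (x * y) = twist \<zeta> x * twist \<zeta> y" for x y
 proof (rule fps_ext)
  fix n
  have "\<zeta> ^ n * (fps_nth x i * fps_nth y (n - i)) = \<zeta> ^ i * fps_nth x i * (\<zeta> ^ (n - i) * fps_nth y (n - i))" if "i \<in> {0..n}" for i
  proof -
   have "\<zeta> ^ n = \<zeta> ^ i * \<zeta> ^ (n - i)" using that by (simp flip: power_add)
   then show ?thesis by (simp add: mult_ac)
  qed
  then show "fps_nth (twist \<zeta> (x * y)) n = fps_nth (twist \<zeta> x * twist \<zeta> y) n"
   unfolding twist_nth fps_mult_nth sum_distrib_left by (intro sum.cong refl)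
 qed
qed (auto intro!: fps_ext simp: twist_nth algebra_simps)

lemma twist_twist: "twist \<zeta> (twist \<xi> u) = twist (\<zeta> * \<xi>) u"
 by (rule fps_ext) (simp add: twist_nth power_mult_distrib mult_ac)

lemma twist_const: "twist \<zeta> (fps_const c) = fps_const c"
 by (rule fps_ext) (simp add: twist_nth)

lemma twist_X: "twist \<zeta> fps_X = fps_const \<zeta> * fps_X"
 by (rule fps_ext) (auto simp: twist_nth le_Suc_eq)

lemma twist_X_power: "\<zeta> ^ N = 1 ==> twist \<zeta> (fps_X ^ N) = fps_X ^ N"
 by (simp add: rhom_power[OF rhom_twist] twist_X power_mult_distrib fps_const_power)

lemma twist_eq_0: "(\<zeta>::'a::field) \<noteq> 0 ==> twist \<zeta> u = 0 ==> u = 0"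
 by (simp add: fps_eq_iff twist_nth)

lemma rhom_fps_const: "rhom fps_const"
 by (rule rhomI) simp_all

lemma rhom_fps_compose: "fps_nth (w::'a::idom fps) 0 = 0 ==> rhom (\<lambda>u. fps_compose u w)"
 by (rule rhomI) (simp_all add: fps_compose_add_distrib fps_compose_mult_distrib)

lemma rhom_fps_nth_0: "rhom (\<lambda>u. fps_nth u 0)"
 by (rule rhomI) simp_all

abbreviation fc :: "'k::field \<Rightarrow> 'k alg_closure fps" where "fc c \<equiv> fps_const (to_ac c)"

lemma rhom_fc: "rhom fc"
 using rhom_comp[OF rhom_fps_const rhom_to_ac] .

text \<open>If \<open>w\<close> is the compositional inverse of \<open>z / \<rho>(z) ^ (1 / n)\<close>, where \<open>\<rho>\<close> is the reversed polynomial
 of \<open>f\<close>, then \<open>f (1 / w(s)) = s ^ (- n)\<close>; the lemma states this for \<open>s ^ m\<close> in place of \<open>s\<close>.\<close>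

lemma puiseux_root_exists:
 fixes f :: "'k::field_char_0 poly"
 assumes n: "degree f = n" "n > 0" and m: "m > 0"
 obtains w where "w ^ n = fps_X ^ (n * m) * poly (map_poly fc (reflect_poly f)) w" "fps_nth w m \<noteq> 0"
proof -
 let ?P = "map_poly fc (reflect_poly f)"
 define \<rho> where "\<rho> = poly ?P fps_X"
 have "fps_nth \<rho> 0 = poly (map_poly (\<lambda>u. fps_nth u 0) ?P) 0"
  unfolding \<rho>_def rhom_poly[OF rhom_fps_nth_0] by simp
 also have "\<dots> = to_ac (lead_coeff f)"
  by (simp add: poly_0_coeff_0 rhom_coeff[OF rhom_fps_nth_0] rhom_coeff[OF rhom_fc])
 finally have r0: "fps_nth \<rho> 0 \<noteq> 0" using n by auto
 obtain k where k: "n = Suc k" using n(2) by (cases n) auto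
 obtain c where c: "c ^ n = fps_nth \<rho> 0" using nth_root_exists[OF n(2)] by blast
 then have c0: "c \<noteq> 0" using r0 zero_power[OF n(2)] by metis
 define R where "R = fps_radical (\<lambda>_ _. c) n \<rho>"
 have R: "R ^ n = \<rho>" unfolding R_def k using power_radical[OF r0, of "\<lambda>_ _. c" k] c k by simp
 have R0: "fps_nth R 0 = c" unfolding R_def using k by simp
 \<comment> \<open>\<open>Q ^ n\<close> is the expansion of \<open>1 / f (1 / z)\<close>; the
   radical exists because the constant term of \<open>\<rho>\<close> is the nonzero leading
   coefficient of \<open>f\<close>.\<close>
 define Q where "Q = fps_X * inverse R"
 have Q: "fps_nth Q 0 = 0" "fps_nth Q 1 \<noteq> 0" using R0 c0 by (simp_all add: Q_def)
 define W where "W = fps_inv Q"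
 have W0: "fps_nth W 0 = 0" by (simp add: W_def fps_inv_def)
 note hW = rhom_fps_compose[OF W0]
 have "fps_compose Q W = fps_X" unfolding W_def by (rule fps_inv_right[OF Q])
 then have "W * inverse (fps_compose R W) = fps_X"
  unfolding Q_def rhom_mult[OF hW] using W0 fps_inverse_compose[OF W0, of R] R0 c0 by simp
 then have "fps_X * fps_compose R W = W * (inverse (fps_compose R W) * fps_compose R W)" by (simp only: mult.assoc[symmetric])
 also have "inverse (fps_compose R W) * fps_compose R W = 1" by (rule inverse_mult_eq_1) (use R0 c0 in simp)
 finally have W: "W = fps_X * fps_compose R W" by simp
 \<comment> \<open>Passing from \<open>s\<close> to \<open>s ^ m\<close> allows polynomials of
   different degrees \<open>n\<close> to share one ramification index \<open>n * m\<close>.\<close>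
 define Xm :: "'k alg_closure fps" where "Xm = fps_X ^ m"
 have Xm0: "fps_nth Xm 0 = 0" using m by (simp add: Xm_def)
 note hX = rhom_fps_compose[OF Xm0]
 define w where "w = fps_compose W Xm"
 have w: "w = Xm * fps_compose (fps_compose R W) Xm"
  unfolding w_def by (subst W, subst rhom_mult[OF hX]) (use Xm0 in simp)
 have w0: "fps_nth w 0 = 0" using W0 by (simp add: w_def)
 have "fps_compose (fps_compose R W) Xm ^ n = fps_compose (fps_compose \<rho> W) Xm"
  using R rhom_power[OF hX, of "fps_compose R W" n] rhom_power[OF hW, of R n] by simp
 also have "fps_compose \<rho> W = poly (map_poly (\<lambda>u. fps_compose u W) ?P) W"
  unfolding \<rho>_def rhom_poly[OF hW] using W0 by simp
 also have "map_poly (\<lambda>u. fps_compose u W) ?P = ?P"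
  by (rule poly_eqI) (simp add: rhom_coeff[OF hW] rhom_coeff[OF rhom_fc])
 also have "fps_compose (poly ?P W) Xm = poly (map_poly (\<lambda>u. fps_compose u Xm) ?P) w"
  unfolding rhom_poly[OF hX] w_def ..
 also have "map_poly (\<lambda>u. fps_compose u Xm) ?P = ?P"
  by (rule poly_eqI) (simp add: rhom_coeff[OF hX] rhom_coeff[OF rhom_fc])
 finally have "w ^ n = Xm ^ n * poly ?P w" by (subst w) (simp add: power_mult_distrib)
 moreover have "Xm ^ n = fps_X ^ (n * m)" unfolding Xm_def by (simp flip: power_mult add: mult.commute)
 moreover have "fps_nth w m = c" unfolding w Xm_def using R0 by (simp add: fps_X_power_mult_nth)
 ultimately show ?thesis using that[of w] c0 by simp
qed

section \<open>The fibre over t in an algebraic closure of k(t)\<close>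

definition kc :: "'k::field_char_0 \<Rightarrow> 'k poly fract alg_closure" where "kc c = to_ac (rf_const c)"
definition tv :: "'k::field_char_0 poly fract alg_closure" where "tv = to_ac rf_var"
definition fibre :: "'k::field_char_0 poly \<Rightarrow> 'k poly fract alg_closure set" where
 "fibre f = {x. poly (map_poly kc f) x = tv}"

lemma rhom_rf_const: "rhom rf_const"
 by (rule rhomI) simp_all
lemma rhom_kc: "rhom kc"
 unfolding kc_def using rhom_comp[OF rhom_to_ac rhom_rf_const] .

lemma poly_rf_var: "poly (map_poly rf_const p) rf_var = to_fract p"
proof (induction p)
 case (pCons c p)
 have "to_fract (pCons c p) = to_fract ([:c:] + [:0, 1:] * p)" by simp
 also have "\<dots> = rf_const c + rf_var * to_fract p" by (simp only: to_fract_add to_fract_mult rf_const_def rf_var_def)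
 finally show ?case using pCons by (simp add: rhom_map_pCons[OF rhom_rf_const])
qed simp

lemma ac_aut_kc: "\<phi> \<in> ac_aut ==> \<phi> (kc c) = kc c" "\<phi> \<in> ac_aut ==> \<phi> tv = tv"
 by (simp_all add: kc_def tv_def ac_autD)

lemma ac_aut_map_kc: "\<phi> \<in> ac_aut ==> map_poly \<phi> (map_poly kc p) = map_poly kc p"
 by (simp add: map_poly_comp_rhom[OF _ rhom_kc] ac_autD ac_aut_kc)

lemma ac_aut_poly_kc: "\<phi> \<in> ac_aut ==> \<phi> (poly (map_poly kc p) x) = poly (map_poly kc p) (\<phi> x)"
 by (simp add: rhom_poly[OF ac_autD(1)] ac_aut_map_kc)

lemma ac_aut_fibre: "\<phi> \<in> ac_aut ==> x \<in> fibre f ==> \<phi> x \<in> fibre f"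
 using ac_aut_poly_kc[of \<phi> f x] by (simp add: fibre_def ac_aut_kc)

lemma fibre_roots: "fibre f = {x. poly (map_poly kc f - [:tv:]) x = 0}"
 by (simp add: fibre_def)

lemma fibre_poly_nonzero:
 assumes "degree f > 0"
 shows "degree (map_poly kc f - [:tv:]) = degree f" "map_poly kc f - [:tv:] \<noteq> 0"
proof -
 have "map_poly kc f - [:tv:] = map_poly kc f + (- [:tv:])" by (rule diff_conv_add_uminus)
 also have "degree \<dots> = degree (map_poly kc f)"
  by (rule degree_add_eq_left) (use assms in \<open>simp add: rhom_degree[OF rhom_kc]\<close>)
 finally show "degree (map_poly kc f - [:tv:]) = degree f" by (simp only: rhom_degree[OF rhom_kc])
 then show "map_poly kc f - [:tv:] \<noteq> 0" using assms by auto
qed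

lemma finite_fibre: "degree f > 0 ==> finite (fibre f)"
 unfolding fibre_roots by (rule poly_roots_finite[OF fibre_poly_nonzero(2)])

text \<open>\<open>t\<close> is sent to \<open>s ^ (- N)\<close> in the fraction field of the power
  series, which plays the part of the Laurent series. The map is injective on polynomials: after
  clearing the pole, the constant term is the leading coefficient.\<close>

lemma laurent_embedding:
 assumes N: "N > 0"
 obtains \<iota> :: "'k::field_char_0 poly fract \<Rightarrow> 'k alg_closure fps fract"
 where "rhom \<iota>" "\<And>c. \<iota> (rf_const c) = to_fract (fc c)" "\<iota> rf_var = inverse (to_fract (fps_X ^ N))"
proof -
 define cL :: "'k \<Rightarrow> 'k alg_closure fps fract" where "cL c = to_fract (fc c)" for c
 have cL: "rhom cL" unfolding cL_def using rhom_comp[OF rhom_to_fract rhom_fc] .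
 define sN :: "'k alg_closure fps fract" where "sN = to_fract (fps_X ^ N)"
 have sN0: "sN \<noteq> 0" by (simp add: sN_def)
 define \<rho> where "\<rho> p = poly (map_poly cL p) (inverse sN)" for p
 note m = rhom_map_poly[OF cL]
 have \<rho>: "rhom \<rho>" unfolding \<rho>_def by (rule rhomI) (simp_all add: rhom_1[OF m] rhom_add[OF m] rhom_mult[OF m])
 have "p = 0" if p: "\<rho> p = 0" for p
 proof (rule ccontr)
  assume p0: "p \<noteq> 0"
  have rf: "reflect_poly (map_poly cL p) = map_poly cL (reflect_poly p)"
   by (rule poly_eqI) (simp add: coeff_reflect_poly rhom_coeff[OF cL] rhom_degree[OF cL] rhom_0[OF cL])
  have "poly (map_poly cL (reflect_poly p)) sN = 0"
   using poly_reflect_poly_nz[OF sN0, of "map_poly cL p"] p rf by (simp add: \<rho>_def)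
  moreover have "map_poly cL (reflect_poly p) = map_poly to_fract (map_poly fc (reflect_poly p))"
   unfolding cL_def map_poly_comp_rhom[OF rhom_to_fract rhom_fc] ..
  ultimately have "to_fract (poly (map_poly fc (reflect_poly p)) (fps_X ^ N)) = 0"
   unfolding rhom_poly[OF rhom_to_fract] sN_def by simp
  then have "fps_nth (poly (map_poly fc (reflect_poly p)) (fps_X ^ N)) 0 = 0" by simp
  then have "poly (map_poly (\<lambda>u. fps_nth u 0) (map_poly fc (reflect_poly p))) 0 = 0"
   unfolding rhom_poly[OF rhom_fps_nth_0] using N by simp
  then have "to_ac (lead_coeff p) = 0"
   by (simp add: poly_0_coeff_0 rhom_coeff[OF rhom_fps_nth_0] rhom_coeff[OF rhom_fc])
  then show False using p0 by simp
 qed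
 then obtain \<iota> where \<iota>: "rhom \<iota>" "\<And>x. \<iota> (to_fract x) = \<rho> x" using rhom_fract_extend[OF \<rho>] by blast
 show ?thesis
  by (rule that[OF \<iota>(1)]) (simp_all add: rf_const_def rf_var_def \<iota>(2) \<rho>_def rhom_map_pCons[OF cL] rhom_0[OF cL] rhom_1[OF cL] cL_def sN_def)
qed

lemma laurent_embedding_ac:
 assumes "N > 0"
 obtains \<Phi> :: "'k::field_char_0 poly fract alg_closure \<Rightarrow> 'k alg_closure fps fract alg_closure" and \<iota>
 where "rhom \<Phi>" "\<And>c. \<Phi> (kc c) = to_ac (to_fract (fc c))" "\<Phi> tv = to_ac (inverse (to_fract (fps_X ^ N)))"
  "rhom \<iota>" "\<And>c. \<iota> (rf_const c) = to_fract (fc c)" "\<iota> rf_var = inverse (to_fract (fps_X ^ N))" "\<And>c. \<Phi> (to_ac c) = to_ac (\<iota> c)"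
proof -
 obtain \<iota> :: "'k poly fract \<Rightarrow> 'k alg_closure fps fract"
  where \<iota>: "rhom \<iota>" "\<And>c. \<iota> (rf_const c) = to_fract (fc c)" "\<iota> rf_var = inverse (to_fract (fps_X ^ N))"
  using laurent_embedding[OF assms] by blast
 obtain \<Phi> :: "'k poly fract alg_closure \<Rightarrow> 'k alg_closure fps fract alg_closure"
  where \<Phi>: "rhom \<Phi>" "\<And>c. \<Phi> (to_ac c) = to_ac (\<iota> c)"
  using rhom_extend_alg_closure[OF rhom_comp[OF rhom_to_ac \<iota>(1)]] by blast
 show ?thesis by (rule that[OF \<Phi>(1) _ _ \<iota> \<Phi>(2)]) (simp_all add: kc_def tv_def \<Phi>(2) \<iota>(2,3))
qed

text \<open>If \<open>x\<close> were algebraic over \<open>k\<close>, its Laurent image would be a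
  constant by \<open>root_in_range\<close>, and so would be the image of \<open>t = f(x)\<close>,
  which is the inverse of \<open>s\<close>.\<close>

lemma fibre_transcendental:
 fixes f p :: "'k::field_char_0 poly"
 assumes x: "x \<in> fibre f" and p: "poly (map_poly kc p) x = 0"
 shows "p = 0"
proof (rule ccontr)
 assume p0: "p \<noteq> 0"
 obtain \<Phi> :: "'k poly fract alg_closure \<Rightarrow> 'k alg_closure fps fract alg_closure" and \<iota>
  where \<Phi>: "rhom \<Phi>" "\<And>c. \<Phi> (kc c) = to_ac (to_fract (fc c))" "\<Phi> tv = to_ac (inverse (to_fract (fps_X ^ 1)))"
  using laurent_embedding_ac[of 1] by (metis zero_less_one)
 define \<Psi> :: "'k alg_closure \<Rightarrow> 'k alg_closure fps fract alg_closure" where "\<Psi> a = to_ac (to_fract (fps_const a))" for a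
 have \<Psi>: "rhom \<Psi>" unfolding \<Psi>_def using rhom_comp[OF rhom_to_ac rhom_comp[OF rhom_to_fract rhom_fps_const]] .
 have cmp: "map_poly \<Phi> (map_poly kc q) = map_poly \<Psi> (map_poly to_ac q)" for q
  by (rule poly_eqI) (simp add: rhom_coeff \<Phi>(1) \<Psi> rhom_kc rhom_to_ac \<Phi>(2) \<Psi>_def)
 have "poly (map_poly \<Psi> (map_poly to_ac p)) (\<Phi> x) = 0"
  using rhom_poly[OF \<Phi>(1), of "map_poly kc p" x] p rhom_0[OF \<Phi>(1)] cmp by simp
 then have "\<Phi> x \<in> range \<Psi>"
  by (intro root_in_range[OF \<Psi>]) (use p0 rhom_map_poly_eq_0_iff[OF rhom_to_ac] in blast)+
 then obtain a where a: "\<Phi> x = \<Psi> a" by blast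
 have "\<Phi> tv = poly (map_poly \<Psi> (map_poly to_ac f)) (\<Psi> a)"
  using x rhom_poly[OF \<Phi>(1), of "map_poly kc f" x] a cmp by (simp add: fibre_def)
 also have "\<dots> = \<Psi> (poly (map_poly to_ac f) a)" using rhom_poly[OF \<Psi>] by metis
 finally have "inverse (to_fract fps_X) = to_fract (fps_const (poly (map_poly to_ac f) a))" 
  unfolding \<Phi>(3) \<Psi>_def by (simp only: to_ac_eq_iff power_one_right)
 then have "to_fract fps_X * inverse (to_fract fps_X) = to_fract (fps_X * fps_const (poly (map_poly to_ac f) a))" by simp
 then have "fps_X * fps_const (poly (map_poly to_ac f) a) = 1" by (simp flip: to_fract_mult add: to_fract_1[symmetric] del: to_fract_1)
 then have "fps_nth (fps_X * fps_const (poly (map_poly to_ac f) a)) 0 = 1" by simp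
 then show False by simp
qed

text \<open>The substitution \<open>s \<mapsto> \<zeta> s\<close> fixes the image of
  \<open>k(t)\<close>, is extended to a closure of the Laurent field and is then restricted to the
  closure of \<open>k(t)\<close>. It permutes the roots \<open>1 / w(\<zeta>^i s)\<close> of
  \<open>h(X) - t\<close> cyclically. These are as many as the degree of \<open>h\<close>, which
  also shows that \<open>h(X) - t\<close> has only simple roots.\<close>

theorem inertia_generator:
 fixes f g :: "'k::field_char_0 poly"
 assumes df: "degree f > 0" and dg: "degree g > 0"
 obtains \<sigma> where "\<sigma> \<in> ac_aut"
  "\<And>h. h \<in> {f, g} ==> card (fibre h) = degree h"
  "\<And>h z z'. h \<in> {f, g} ==> z \<in> fibre h ==> z' \<in> fibre h ==> \<exists>i. (\<sigma> ^^ i) z = z'"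
proof -
 \<comment> \<open>A common multiple of the two degrees, so that the same series field contains the
   roots for both \<open>f\<close> and \<open>g\<close>.\<close>
 define N where "N = degree f * degree g"
 have N0: "N > 0" using df dg by (simp add: N_def)
 obtain \<zeta> :: "'k alg_closure" where \<zeta>: "\<And>j. \<zeta> ^ j = 1 \<longleftrightarrow> N dvd j" using primitive_root_exists[OF N0] by blast
 have \<zeta>N: "\<zeta> ^ N = 1" using \<zeta> by simp
 have \<zeta>0: "\<zeta> \<noteq> 0" using \<zeta>N N0 by (metis power_0_left not_gr0 zero_neq_one)
 obtain \<Phi> :: "'k poly fract alg_closure \<Rightarrow> 'k alg_closure fps fract alg_closure" and \<iota>
  where \<Phi>: "rhom \<Phi>" "\<And>c. \<Phi> (kc c) = to_ac (to_fract (fc c))" "\<Phi> tv = to_ac (inverse (to_fract (fps_X ^ N)))"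
   "rhom \<iota>" "\<And>c. \<iota> (rf_const c) = to_fract (fc c)" "\<iota> rf_var = inverse (to_fract (fps_X ^ N))" "\<And>c. \<Phi> (to_ac c) = to_ac (\<iota> c)"
  using laurent_embedding_ac[OF N0] by blast
 have tw: "rhom (\<lambda>u. to_fract (twist \<zeta> u))" using rhom_comp[OF rhom_to_fract rhom_twist] .
 obtain \<tau> where \<tau>: "rhom \<tau>" "\<And>u. \<tau> (to_fract u) = to_fract (twist \<zeta> u)"
  using rhom_fract_extend[OF tw] twist_eq_0[OF \<zeta>0] by (metis to_fract_eq_0_iff)
 obtain \<T> where \<T>: "rhom \<T>" "\<And>u. \<T> (to_ac u) = to_ac (\<tau> u)" using rhom_extend_alg_closure[OF rhom_comp[OF rhom_to_ac \<tau>(1)]] by blast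
 have \<tau>c: "\<tau> (to_fract (fc c)) = to_fract (fc c)" for c by (simp add: \<tau>(2) twist_const)
 have \<tau>X: "\<tau> (inverse (to_fract (fps_X ^ N))) = inverse (to_fract (fps_X ^ N))"
  by (simp add: rhom_inverse[OF \<tau>(1)] \<tau>(2) twist_X_power[OF \<zeta>N])
 have \<tau>\<iota>: "\<tau> (\<iota> q) = \<iota> q" for q
 proof (rule rhom_fract_eqI[OF rhom_comp[OF \<tau>(1) \<Phi>(4)] \<Phi>(4)])
  fix p :: "'k poly"
  have e1: "\<iota> (to_fract p) = poly (map_poly (\<lambda>c. to_fract (fc c)) p) (inverse (to_fract (fps_X ^ N)))"
   unfolding poly_rf_var[symmetric] rhom_poly[OF \<Phi>(4)] map_poly_comp_rhom[OF \<Phi>(4) rhom_rf_const] \<Phi>(5,6) ..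
  have e2: "map_poly \<tau> (map_poly (\<lambda>c. to_fract (fc c)) p) = map_poly (\<lambda>c. to_fract (fc c)) p"
   by (rule poly_eqI) (simp add: rhom_coeff \<tau>(1) rhom_comp[OF rhom_to_fract rhom_fc] \<tau>c)
  show "\<tau> (\<iota> (to_fract p)) = \<iota> (to_fract p)" unfolding e1 rhom_poly[OF \<tau>(1)] e2 \<tau>X ..
 qed
 \<comment> \<open>As \<open>\<tau>\<close> fixes the image of \<open>k(t)\<close>,
   \<open>\<T>\<close> permutes the roots of each polynomial over it; these roots all lie in the
   image of \<open>\<Phi>\<close>, so \<open>\<T>\<close> can be pulled back.\<close>
 have "\<exists>y. \<Phi> y = \<T> (\<Phi> x)" for x
 proof -
  obtain p where p: "p \<noteq> 0" "poly (map_poly to_ac p) x = 0" by (rule alg_closure_algebraic)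
  have "map_poly \<T> (map_poly \<Phi> (map_poly to_ac p)) = map_poly \<Phi> (map_poly to_ac p)"
   by (rule poly_eqI) (simp add: rhom_coeff \<T>(1) \<Phi>(1) rhom_to_ac \<Phi>(7) \<T>(2) \<tau>\<iota>)
  then have "poly (map_poly \<Phi> (map_poly to_ac p)) (\<T> (\<Phi> x)) = \<T> (\<Phi> (poly (map_poly to_ac p) x))"
   unfolding rhom_poly[OF \<Phi>(1)] rhom_poly[OF \<T>(1)] by simp
  then have "\<T> (\<Phi> x) \<in> range \<Phi>"
   by (intro root_in_range[OF \<Phi>(1), of "map_poly to_ac p"])
    (use p in \<open>simp_all add: rhom_map_poly_eq_0_iff[OF rhom_to_ac] rhom_0[OF \<Phi>(1)] rhom_0[OF \<T>(1)]\<close>)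
  then show ?thesis by (metis imageE)
 qed
 then obtain \<sigma> where \<sigma>: "\<And>x. \<Phi> (\<sigma> x) = \<T> (\<Phi> x)" by metis
 note inj = rhom_eq_iff[OF \<Phi>(1)]
 have "rhom \<sigma>"
  by (rule rhomI; rule iffD1[OF inj])
   (simp_all only: \<sigma> rhom_1[OF \<Phi>(1)] rhom_add[OF \<Phi>(1)] rhom_mult[OF \<Phi>(1)] rhom_1[OF \<T>(1)] rhom_add[OF \<T>(1)] rhom_mult[OF \<T>(1)])
 moreover have "\<sigma> (to_ac c) = to_ac c" for c by (rule iffD1[OF inj]) (simp add: \<sigma> \<Phi>(7) \<T>(2) \<tau>\<iota>)
 ultimately have \<sigma>A: "\<sigma> \<in> ac_aut" by (simp add: ac_aut_def)
 have main: "card (fibre h) = degree h \<and> (\<forall>z\<in>fibre h. \<forall>z'\<in>fibre h. \<exists>i. (\<sigma> ^^ i) z = z')"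
  if h: "degree h = n" "n > 0" "N = n * m" for h n m
 proof -
  have m0: "m > 0" using h N0 by (cases m) auto
  obtain w where w: "w ^ n = fps_X ^ (n * m) * poly (map_poly fc (reflect_poly h)) w" "fps_nth w m \<noteq> 0"
   using puiseux_root_exists[OF h(1,2) m0] by blast
  define wi where "wi i = twist (\<zeta> ^ i) w" for i
  have \<zeta>i: "(\<zeta> ^ i) ^ N = 1" for i using \<zeta>N by (metis power_commutes power_mult mult.commute power_one)
  have wi: "wi i ^ n = fps_X ^ N * poly (map_poly fc (reflect_poly h)) (wi i)" for i
  proof -
   have "map_poly (twist (\<zeta> ^ i)) (map_poly fc (reflect_poly h)) = map_poly fc (reflect_poly h)"
    by (rule poly_eqI) (simp add: rhom_coeff rhom_twist rhom_fc twist_const)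
   then show ?thesis using arg_cong[OF w(1), of "twist (\<zeta> ^ i)"]
    unfolding rhom_power[OF rhom_twist] rhom_mult[OF rhom_twist] rhom_poly[OF rhom_twist] wi_def
    using twist_X_power[OF \<zeta>i] h(3) by (simp add: rhom_power[OF rhom_twist])
  qed
  \<comment> \<open>The coefficient of index \<open>m\<close> tells the series apart for
    \<open>i < n\<close>, since \<open>\<zeta> ^ m\<close> has order \<open>n\<close>.\<close>
  have wm: "fps_nth (wi i) m = \<zeta> ^ (i * m) * fps_nth w m" for i by (simp add: wi_def twist_nth power_mult)
  have wi0: "wi i \<noteq> 0" for i using wm[of i] w(2) \<zeta>0 by auto
  define u where "u i = inverse (to_fract (wi i))" for i
  let ?c = "\<lambda>c. to_fract (fc c)"
  have rc: "rhom ?c" using rhom_comp[OF rhom_to_fract rhom_fc] .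
  have u: "poly (map_poly ?c h) (u i) = inverse (to_fract (fps_X ^ N))" for i
  proof -
   let ?x = "to_fract (wi i)"
   have x0: "?x \<noteq> 0" using wi0 by simp
   have rf: "reflect_poly (map_poly ?c h) = map_poly ?c (reflect_poly h)"
    by (rule poly_eqI) (simp add: coeff_reflect_poly rhom_coeff[OF rc] rhom_degree[OF rc])
   have "to_fract (wi i ^ n) = to_fract (fps_X ^ N) * poly (map_poly to_fract (map_poly fc (reflect_poly h))) ?x"
    unfolding wi to_fract_mult rhom_poly[OF rhom_to_fract] ..
   also have "map_poly to_fract (map_poly fc (reflect_poly h)) = reflect_poly (map_poly ?c h)"
    unfolding rf map_poly_comp_rhom[OF rhom_to_fract rhom_fc] ..
   also have "poly (reflect_poly (map_poly ?c h)) ?x = ?x ^ n * poly (map_poly ?c h) (u i)"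
    unfolding u_def poly_reflect_poly_nz[OF x0] rhom_degree[OF rc] h(1) ..
   finally have "?x ^ n * 1 = ?x ^ n * (to_fract (fps_X ^ N) * poly (map_poly ?c h) (u i))"
    by (simp add: rhom_power[OF rhom_to_fract] mult_ac)
   then have "to_fract (fps_X ^ N) * poly (map_poly ?c h) (u i) = 1" using x0 by (metis mult_cancel_left power_not_zero)
   then show ?thesis by (metis inverse_unique)
  qed
  have \<Phi>h: "map_poly \<Phi> (map_poly kc h - [:tv:]) = map_poly to_ac (map_poly ?c h) - [:to_ac (inverse (to_fract (fps_X ^ N))):]"
   by (rule poly_eqI) (auto simp: rhom_coeff \<Phi>(1) rhom_kc rhom_to_ac rc \<Phi>(2,3) rhom_diff[OF \<Phi>(1)] coeff_pCons rhom_0[OF \<Phi>(1)] split: nat.splits)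
  have dh: "degree h > 0" using h by simp
  have "\<exists>x. \<Phi> x = to_ac (u i)" for i
  proof -
   have "poly (map_poly \<Phi> (map_poly kc h - [:tv:])) (to_ac (u i)) = 0"
    unfolding \<Phi>h using rhom_poly[OF rhom_to_ac, of "map_poly ?c h" "u i"] u by simp
   then have "to_ac (u i) \<in> range \<Phi>" by (rule root_in_range[OF \<Phi>(1) fibre_poly_nonzero(2)[OF dh]])
   then show ?thesis by (metis imageE)
  qed
  then obtain x where x: "\<And>i. \<Phi> (x i) = to_ac (u i)" by metis
  have xf: "x i \<in> fibre h" for i
  proof -
   have "map_poly \<Phi> (map_poly kc h) = map_poly to_ac (map_poly ?c h)"
    by (rule poly_eqI) (simp add: rhom_coeff \<Phi>(1) rhom_kc rhom_to_ac rc \<Phi>(2))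
   then have "\<Phi> (poly (map_poly kc h) (x i)) = \<Phi> tv"
    unfolding rhom_poly[OF \<Phi>(1)] x \<Phi>(3) using rhom_poly[OF rhom_to_ac, of "map_poly ?c h" "u i"] u by simp
   then show ?thesis unfolding fibre_def inj by simp
  qed
  have xS: "\<sigma> (x i) = x (Suc i)" for i
  proof (rule iffD1[OF inj])
   have "twist \<zeta> (wi i) = wi (Suc i)" by (simp add: wi_def twist_twist)
   then have "\<tau> (u i) = u (Suc i)" by (simp add: u_def rhom_inverse[OF \<tau>(1)] \<tau>(2))
   then show "\<Phi> (\<sigma> (x i)) = \<Phi> (x (Suc i))" by (simp add: \<sigma> x \<T>(2))
  qed
  have xk: "(\<sigma> ^^ k) (x i) = x (i + k)" for i k by (induction k) (simp_all add: xS)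
  have per: "x (i + N) = x i" for i
  proof (rule iffD1[OF inj])
   have "wi (i + N) = wi i" by (simp add: wi_def power_add \<zeta>N)
   then show "\<Phi> (x (i + N)) = \<Phi> (x i)" by (simp add: x u_def)
  qed
  have "inj_on x {..<n}"
  proof (rule linorder_inj_onI)
   fix i j assume ij: "i < j" "i \<in> {..<n}" "j \<in> {..<n}"
   show "x i \<noteq> x j"
   proof
    assume "x i = x j"
    then have "to_ac (u i) = to_ac (u j)" using x by metis
    then have "wi i = wi j" by (simp add: u_def)
    then have "\<zeta> ^ (i * m) = \<zeta> ^ (j * m)" using wm[of i] wm[of j] w(2) by simp
    also have "j * m = i * m + (j - i) * m" using ij by (simp flip: distrib_right)
    finally have "\<zeta> ^ ((j - i) * m) = 1" using \<zeta>0 by (simp add: power_add)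
    then have "n * m dvd (j - i) * m" using \<zeta> h(3) by simp
    then have "n dvd j - i" using m0 by simp
    then show False using ij dvd_imp_le[of n "j - i"] by auto
   qed
  qed auto
  then have c: "card (x ` {..<n}) = n" by (simp add: card_image)
  have "card (fibre h) \<le> n"
   unfolding fibre_roots using card_poly_roots_bound[OF fibre_poly_nonzero(2)[OF dh]] fibre_poly_nonzero(1)[OF dh] h(1) by simp
  then have fx: "fibre h = x ` {..<n}"
   using card_seteq[OF finite_fibre[OF dh], of "x ` {..<n}"] xf c by auto
  have "\<exists>i. (\<sigma> ^^ i) z = z'" if z: "z \<in> fibre h" "z' \<in> fibre h" for z z'
  proof -
   obtain i j where ij: "i < n" "j < n" "z = x i" "z' = x j" using z unfolding fx by auto
   have "n \<le> N" using h m0 by simp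
   then have "(\<sigma> ^^ (j + N - i)) z = x (j + N)" unfolding ij(3) xk using ij(1) by simp
   then show ?thesis using per ij(4) by auto
  qed
  then show ?thesis using fx c h(1) by simp
 qed
 have "card (fibre h) = degree h \<and> (\<forall>z\<in>fibre h. \<forall>z'\<in>fibre h. \<exists>i. (\<sigma> ^^ i) z = z')" if "h \<in> {f, g}" for h
  using that main[OF refl df, of "degree g"] main[OF refl dg, of "degree f"] by (auto simp: N_def mult.commute)
 then show ?thesis using that[OF \<sigma>A] by blast
qed

section \<open>Factors and decompositions\<close>

lemma common_denominator:
 fixes P :: "'k::field poly fract poly"
 shows "\<exists>d A. d \<noteq> 0 \<and> smult (to_fract d) P = fract_poly A"
proof (induction P)
 case 0
 show ?case by (intro exI[of _ 1] exI[of _ 0]) simp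
next
 case (pCons c P)
 obtain d A where d: "d \<noteq> 0" "smult (to_fract d) P = fract_poly A" using pCons.IH by blast
 obtain a b where ab: "c = Fract a b" "b \<noteq> 0" by (cases c)
 have c: "to_fract b * c = to_fract a" using ab by (simp add: to_fract_def eq_fract)
 have "smult (to_fract (b * d)) (pCons c P) = pCons (to_fract (d * a)) (smult (to_fract b) (fract_poly A))"
  using c unfolding d(2)[symmetric] by (simp add: mult_ac)
 also have "\<dots> = fract_poly (pCons (d * a) (smult b A))" by (simp add: rhom_map_pCons[OF rhom_to_fract])
 finally show ?case using d(1) ab(2) by (intro exI[of _ "b * d"]) auto
qed

text \<open>Gauss's lemma: a root of a minimal denominator of \<open>P\<close> would kill all numerators of \<open>P\<close> or of \<open>Q\<close>,
 so that its minimal polynomial could be cancelled.\<close>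

lemma monic_factor_integral:
 fixes F :: "'k::field poly poly"
 assumes F: "fract_poly F = P * Q" and P: "lead_coeff P = 1" and Q: "lead_coeff Q = 1"
 obtains A where "P = fract_poly A"
proof -
 note rf = rhom_coeff[OF rhom_to_fract]
 define D where "D P d \<longleftrightarrow> d \<noteq> 0 \<and> (\<exists>A. smult (to_fract d) P = fract_poly A)" for P :: "'k poly fract poly" and d
 have ex: "\<exists>d. D P d \<and> (\<forall>e. D P e \<longrightarrow> degree d \<le> degree e)" for P
 proof -
  obtain d0 where "D P d0" unfolding D_def using common_denominator[of P] by blast
  then show ?thesis using ex_has_least_nat[of "D P" d0 degree] by blast
 qed
 \<comment> \<open>Because \<open>P\<close> is monic, the denominator \<open>d\<close> is itself one
   of the numerators. So a nonconstant common divisor \<open>p\<close> of the numerators divides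
   \<open>d\<close> as well, and \<open>d / p\<close> would be a denominator of smaller
   degree.\<close>
 have cancel: False if P: "lead_coeff P = 1" and d: "\<forall>e. D P e \<longrightarrow> degree d \<le> degree e" "d \<noteq> 0"
  and A: "smult (to_fract d) P = fract_poly A" and p: "degree p > 0" "\<And>i. p dvd coeff A i" for P d A p
 proof -
  have "[:p:] dvd A" using p(2) by (simp add: const_poly_dvd_iff)
  then obtain A' where "A = [:p:] * A'" by (rule dvdE)
  then have A': "A = smult p A'" by simp
  have "to_fract d = to_fract (coeff A (degree P))"
   using arg_cong[OF A, of "\<lambda>q. coeff q (degree P)"] P by (simp add: rf)
  then have "p dvd d" using p(2) by simp
  then obtain d' where d': "d = p * d'" by blast
  have "smult (to_fract p) (smult (to_fract d') P) = smult (to_fract p) (fract_poly A')"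
   using A unfolding A' d' by simp
  moreover have "p \<noteq> 0" "d' \<noteq> 0" using d(2) d' by auto
  ultimately have "D P d'" unfolding D_def by (metis smult_cancel to_fract_eq_0_iff)
  then have "degree d \<le> degree d'" using d(1) by blast
  then show False using \<open>p \<noteq> 0\<close> \<open>d' \<noteq> 0\<close> p(1) unfolding d' by (simp add: Polynomial.degree_mult_eq)
 qed
 obtain d where d: "D P d" "\<forall>e. D P e \<longrightarrow> degree d \<le> degree e" using ex by blast
 obtain d' where d': "D Q d'" "\<forall>e. D Q e \<longrightarrow> degree d' \<le> degree e" using ex by blast
 obtain A B where A: "smult (to_fract d) P = fract_poly A" and B: "smult (to_fract d') Q = fract_poly B"
  using d(1) d'(1) unfolding D_def by blast
 have n: "d \<noteq> 0" "d' \<noteq> 0" using d(1) d'(1) by (simp_all add: D_def)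
 have "fract_poly (A * B) = smult (to_fract (d * d')) (P * Q)" unfolding fract_poly_mult A[symmetric] B[symmetric] by (simp add: mult.commute)
 then have "fract_poly (A * B) = fract_poly (smult (d * d') F)" unfolding F[symmetric] by simp
 then have AB: "A * B = smult (d * d') F" unfolding fract_poly_eq_iff .
 have "degree d = 0"
 proof (rule ccontr)
  assume "degree d \<noteq> 0"
  then obtain \<xi> where l: "poly (map_poly to_ac d) \<xi> = 0"
   using alg_closed_imp_poly_has_root[of "map_poly to_ac d"] rhom_degree[OF rhom_to_ac, of d] by auto
  obtain p where p: "degree p > 0" "\<And>q. poly (map_poly to_ac q) \<xi> = 0 \<longleftrightarrow> p dvd q"
   using alg_closure_minimal_polynomial[of \<xi>] by metis
  define ev where "ev q = poly (map_poly to_ac q) \<xi>" for q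
  note m = rhom_map_poly[OF rhom_to_ac]
  have ev: "rhom ev" unfolding ev_def by (rule rhomI) (simp_all add: rhom_1[OF m] rhom_add[OF m] rhom_mult[OF m])
  have "map_poly ev A * map_poly ev B = 0"
   unfolding rhom_mult[OF rhom_map_poly[OF ev], symmetric] AB rhom_map_smult[OF ev] rhom_mult[OF ev] using l by (simp add: ev_def)
  moreover have "p dvd coeff C i" if "map_poly ev C = 0" for C i
   using rhom_coeff[OF ev, of C i] that p(2) by (simp add: ev_def)
  ultimately have "(\<forall>i. p dvd coeff A i) \<or> (\<forall>i. p dvd coeff B i)" by auto
  then show False using cancel[OF P d(2) n(1) A p(1)] cancel[OF Q d'(2) n(2) B p(1)] by blast
 qed
 then obtain u where u: "d = [:u:]" by (rule degree_eq_zeroE)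
 then have "u \<noteq> 0" using n by auto
 then have "P = smult (to_fract [:inverse u:] * to_fract d) P" unfolding u by (simp flip: to_fract_mult add: one_pCons[symmetric])
 also have "\<dots> = fract_poly (smult [:inverse u:] A)" unfolding fract_poly_smult A[symmetric] by simp
 finally show ?thesis by (rule that)
qed

section \<open>Stable subsets of a fibre and factors of f(X) - g(Y)\<close>

lemma prod_linear:
 fixes D :: "'a::field set"
 shows "lead_coeff (\<Prod>z\<in>D. [:- z, 1:]) = 1" "degree (\<Prod>z\<in>D. [:- z, 1:]) = card D"
  "finite D ==> poly (\<Prod>z\<in>D. [:- z, 1:]) x = 0 \<longleftrightarrow> x \<in> D"
proof -
 show "lead_coeff (\<Prod>z\<in>D. [:- z, 1:]) = 1" unfolding lead_coeff_prod by simp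
qed (simp_all add: degree_prod_sum_eq poly_prod)

lemma eq_prod_roots:
 fixes p :: "'a::field poly"
 assumes D: "finite D" "card D = degree p" "\<And>z. z \<in> D ==> poly p z = 0" and p: "p \<noteq> 0"
 shows "p = smult (lead_coeff p) (\<Prod>z\<in>D. [:- z, 1:])"
proof (rule ccontr)
 let ?q = "smult (lead_coeff p) (\<Prod>z\<in>D. [:- z, 1:])"
 assume "p \<noteq> ?q"
 then have n: "p - ?q \<noteq> 0" by simp
 have dq: "degree ?q = degree p" using p D(2) prod_linear(2)[of D] by simp
 have z: "D \<subseteq> {z. poly (p - ?q) z = 0}" using D(3) prod_linear(3)[OF D(1)] by auto
 have "card D \<le> degree (p - ?q)"
  using card_mono[OF poly_roots_finite[OF n] z] card_poly_roots_bound[OF n] by simp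
 moreover have "degree (p - ?q) < degree p"
 proof (rule degree_lessI)
  have "coeff ?q (degree p) = lead_coeff p"
   using prod_linear(1)[of D] prod_linear(2)[of D] D(2) by simp
  then show "\<forall>k\<ge>degree p. coeff (p - ?q) k = 0"
   using dq by (auto simp: coeff_eq_0 le_less simp del: coeff_smult)
  show "p - ?q \<noteq> 0 \<or> degree p > 0" using n by blast
 qed
 ultimately show False using D(2) by simp
qed

lemma fibre_prod:
 assumes "degree f > 0" "card (fibre f) = degree f"
 shows "map_poly kc f - [:tv:] = smult (kc (lead_coeff f)) (\<Prod>z\<in>fibre f. [:- z, 1:])"
proof -
 note n = fibre_poly_nonzero[OF assms(1)]
 have "lead_coeff (map_poly kc f - [:tv:]) = kc (lead_coeff f)"
  unfolding n(1) using assms(1) by (simp add: rhom_coeff[OF rhom_kc] coeff_pCons split: nat.splits)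
 then show ?thesis using eq_prod_roots[OF finite_fibre[OF assms(1)] _ _ n(2)] assms(2) n(1) by (simp add: fibre_def)
qed

lemma ac_aut_prod_linear:
 assumes "\<phi> \<in> ac_aut" "finite D" "\<phi> ` D \<subseteq> D"
 shows "map_poly \<phi> (\<Prod>z\<in>D. [:- z, 1:]) = (\<Prod>z\<in>D. [:- z, 1:])" "bij_betw \<phi> D D"
proof -
 note h = ac_autD(1)[OF assms(1)]
 have i: "inj_on \<phi> D" using ac_aut_bij[OF assms(1)] by (meson bij_def inj_on_subset subset_UNIV)
 then show b: "bij_betw \<phi> D D" using endo_inj_surj[OF assms(2,3)] by (simp add: bij_betw_def)
 have "map_poly \<phi> (\<Prod>z\<in>D. [:- z, 1:]) = (\<Prod>z\<in>D. [:- \<phi> z, 1:])"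
  unfolding rhom_prod[OF rhom_map_poly[OF h]] by (simp add: rhom_map_pCons[OF h] rhom_1[OF h] rhom_minus[OF h])
 also have "\<dots> = (\<Prod>z\<in>D. [:- z, 1:])" by (rule prod.reindex_bij_betw[OF b])
 finally show "map_poly \<phi> (\<Prod>z\<in>D. [:- z, 1:]) = (\<Prod>z\<in>D. [:- z, 1:])" .
qed

text \<open>Specialization of the inner variable at \<open>y\<close>. For \<open>y\<close> in a
  fibre it is injective by \<open>fibre_transcendental\<close>, and so extends to an isomorphism of
  \<open>k(Y)\<close> with \<open>k(y)\<close>.\<close>

definition ev :: "'k::field_char_0 poly fract alg_closure \<Rightarrow> 'k poly \<Rightarrow> 'k poly fract alg_closure" where
 "ev y p = poly (map_poly kc p) y"

lemma rhom_ev: "rhom (ev y)"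
proof -
 note m = rhom_map_poly[OF rhom_kc]
 show ?thesis by (rule rhomI) (simp_all add: ev_def rhom_1[OF m] rhom_add[OF m] rhom_mult[OF m])
qed

lemma ev_const: "ev y [:c:] = kc c"
 by (simp add: ev_def rhom_map_pCons[OF rhom_kc])

text \<open>The fixed field of the stabilizer of \<open>y\<close> is \<open>k(y)\<close>: by
  \<open>ac_aut_stabilizer_fixed\<close> a fixed element is a quotient of polynomials in
  \<open>y\<close> over \<open>k(t)\<close>, and \<open>t = g(y)\<close> lies in
  \<open>k(y)\<close>.\<close>

lemma stabilizer_fixed_rational:
 assumes y: "y \<in> fibre g" and \<theta>: "rhom \<theta>" "\<And>p. \<theta> (to_fract p) = ev y p"
  and inv: "\<And>\<phi>. \<phi> \<in> ac_aut ==> \<phi> y = y ==> \<phi> e = e"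
 shows "e \<in> range \<theta>"
proof -
 have base: "to_ac c \<in> range \<theta>" for c
 proof -
  have t: "to_ac (to_fract p) = \<theta> (to_fract (pcompose p g))" for p
  proof -
   have "to_ac (to_fract p) = poly (map_poly kc p) tv"
    unfolding poly_rf_var[symmetric] rhom_poly[OF rhom_to_ac] map_poly_comp_rhom[OF rhom_to_ac rhom_rf_const] kc_def tv_def ..
   also have "tv = poly (map_poly kc g) y" using y by (simp add: fibre_def)
   finally show ?thesis by (simp add: \<theta>(2) ev_def rhom_map_pcompose[OF rhom_kc] poly_pcompose)
  qed
  obtain a b where "c = Fract a b" by (cases c)
  then have "c = to_fract a / to_fract b" by (simp add: to_fract_def)
  then have "to_ac c = \<theta> (to_fract (pcompose a g) / to_fract (pcompose b g))" by (simp add: t rhom_divide[OF \<theta>(1)])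
  then show ?thesis by blast
 qed
 have yr: "y = \<theta> (to_fract [:0, 1:])" by (simp add: \<theta>(2) ev_def rhom_map_pCons[OF rhom_kc] rhom_0[OF rhom_kc] rhom_1[OF rhom_kc])
 have pol: "poly (map_poly to_ac a) y \<in> range \<theta>" for a
 proof (induction a)
  case 0
  show ?case using rhom_0[OF \<theta>(1)] by (metis map_poly_0 poly_0 rangeI)
 next
  case (pCons c a)
  obtain u v where "to_ac c = \<theta> u" "poly (map_poly to_ac a) y = \<theta> v" using base pCons.IH by blast
  then have "poly (map_poly to_ac (pCons c a)) y = \<theta> (u + to_fract [:0, 1:] * v)"
   by (simp add: rhom_map_pCons[OF rhom_to_ac] rhom_add[OF \<theta>(1)] rhom_mult[OF \<theta>(1)] flip: yr)
  then show ?case by blast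
 qed
 obtain a b where ab: "poly (map_poly to_ac b) y \<noteq> 0" "e * poly (map_poly to_ac b) y = poly (map_poly to_ac a) y"
  
  by (rule ac_aut_stabilizer_fixed[where y = y and e = e]) (use inv in blast)+
 obtain u v where "poly (map_poly to_ac a) y = \<theta> u" "poly (map_poly to_ac b) y = \<theta> v" using pol by blast
 then have "e = \<theta> (u / v)" using ab by (simp add: rhom_divide[OF \<theta>(1)] field_simps)
 then show ?thesis by blast
qed

text \<open>The monic polynomial with roots \<open>D\<close> has coefficients fixed by the
  stabilizer of \<open>y\<close>, hence in \<open>k(y)\<close>. Read in \<open>k(Y)\<close>, it and
  its complement are monic factors of \<open>f(X) - g(Y)\<close> up to the leading coefficient, and
  \<open>monic_factor_integral\<close> moves them to \<open>k[X, Y]\<close>.\<close>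

lemma fibre_factor:
 assumes f: "degree f > 0" "card (fibre f) = degree f" and y: "y \<in> fibre g"
  and D: "D \<subseteq> fibre f" "\<And>\<phi>. \<phi> \<in> ac_aut ==> \<phi> y = y ==> \<phi> ` D \<subseteq> D"
 obtains P Q where "lead_coeff P = 1" "lead_coeff Q = 1" "bivariate_diff f g = smult [:lead_coeff f:] (P * Q)"
  "degree P = card D" "degree Q = degree f - card D"
  "map_poly (ev y) P = (\<Prod>z\<in>D. [:- z, 1:])"
proof -
 have "p = 0" if "ev y p = 0" for p using fibre_transcendental[OF y] that by (simp add: ev_def)
 then obtain \<theta> where \<theta>: "rhom \<theta>" "\<And>p. \<theta> (to_fract p) = ev y p" using rhom_fract_extend[OF rhom_ev] by blast
 note fin = finite_fibre[OF f(1)]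
 have rat: "\<exists>P. map_poly \<theta> P = (\<Prod>z\<in>E. [:- z, 1:]) \<and> lead_coeff P = 1 \<and> degree P = card E"
  if E: "E \<subseteq> fibre f" "\<And>\<phi>. \<phi> \<in> ac_aut ==> \<phi> y = y ==> \<phi> ` E \<subseteq> E" for E
 proof -
  let ?p = "\<Prod>z\<in>E. [:- z, 1:]"
  have fE: "finite E" using finite_subset[OF E(1) fin] .
  have c: "coeff ?p i \<in> range \<theta>" for i
  proof (rule stabilizer_fixed_rational[OF y \<theta>])
   fix \<phi> assume \<phi>: "\<phi> \<in> ac_aut" "\<phi> y = y"
   show "\<phi> (coeff ?p i) = coeff ?p i"
    using ac_aut_prod_linear(1)[OF \<phi>(1) fE E(2)[OF \<phi>]] rhom_coeff[OF ac_autD(1)[OF \<phi>(1)], of ?p i] by simp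
  qed
  define \<psi> where "\<psi> = inv_into UNIV \<theta>"
  have \<psi>: "\<theta> (\<psi> a) = a" if "a \<in> range \<theta>" for a unfolding \<psi>_def using that by (rule f_inv_into_f)
  have "\<theta> (\<psi> 0) = \<theta> 0" using \<psi>[of 0] rhom_0[OF \<theta>(1)] by (metis rangeI)
  then have "\<psi> 0 = 0" using rhom_eq_iff[OF \<theta>(1)] by blast
  then have m: "map_poly \<theta> (map_poly \<psi> ?p) = ?p"
   by (intro poly_eqI) (simp only: rhom_coeff[OF \<theta>(1)] coeff_map_poly \<psi>[OF c])
  have dg: "degree (map_poly \<psi> ?p) = card E" using rhom_degree[OF \<theta>(1), of "map_poly \<psi> ?p"] m prod_linear(2)[of E] by simp
  have "\<theta> (lead_coeff (map_poly \<psi> ?p)) = \<theta> 1"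
   unfolding rhom_coeff[OF \<theta>(1), symmetric] m dg rhom_1[OF \<theta>(1)] using prod_linear(1,2)[of E] by simp
  then show ?thesis using m dg rhom_eq_iff[OF \<theta>(1)] by blast
 qed
 obtain P where P: "map_poly \<theta> P = (\<Prod>z\<in>D. [:- z, 1:])" "lead_coeff P = 1" "degree P = card D" using rat[OF D] by blast
 have "\<phi> ` (fibre f - D) \<subseteq> fibre f - D" if \<phi>: "\<phi> \<in> ac_aut" "\<phi> y = y" for \<phi>
 proof -
  have "\<phi> ` D = D" using ac_aut_prod_linear(2)[OF \<phi>(1) finite_subset[OF D(1) fin] D(2)[OF \<phi>]] by (simp add: bij_betw_def)
  moreover have "\<phi> z \<notin> \<phi> ` D" if "z \<notin> D" for z using that rhom_eq_iff[OF ac_autD(1)[OF \<phi>(1)]] by auto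
  ultimately show ?thesis using ac_aut_fibre[OF \<phi>(1)] by auto
 qed
 then obtain Q where Q: "map_poly \<theta> Q = (\<Prod>z\<in>fibre f - D. [:- z, 1:])" "lead_coeff Q = 1" "degree Q = card (fibre f - D)"
  using rat[OF Diff_subset] by blast
 let ?l = "lead_coeff f"
 have l0: "?l \<noteq> 0" using f(1) by auto
 have "map_poly \<theta> (fract_poly (bivariate_diff f g)) = map_poly (ev y) (bivariate_diff f g)"
  unfolding map_poly_comp_rhom[OF \<theta>(1) rhom_to_fract] \<theta>(2) ..
 also have "\<dots> = map_poly kc f - [:tv:]"
  unfolding bivariate_diff_def rhom_diff[OF rhom_map_poly[OF rhom_ev]] map_poly_comp_rhom[OF rhom_ev rhom_const_poly] ev_const
  using y by (simp add: rhom_map_pCons[OF rhom_ev] ev_def fibre_def)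
 also have "\<dots> = smult (kc ?l) (map_poly \<theta> P * map_poly \<theta> Q)"
  unfolding fibre_prod[OF f] P(1) Q(1) using prod.subset_diff[OF D(1) fin] by (metis mult.commute)
 finally have "map_poly \<theta> (fract_poly (bivariate_diff f g)) = map_poly \<theta> (smult (to_fract [:?l:]) (P * Q))"
  by (simp only: rhom_map_smult[OF \<theta>(1)] rhom_mult[OF rhom_map_poly[OF \<theta>(1)]] \<theta>(2) ev_const)
 then have F: "fract_poly (bivariate_diff f g) = smult (to_fract [:?l:]) (P * Q)" using rhom_map_poly_eq_iff[OF \<theta>(1)] by blast
 define F1 where "F1 = smult [:inverse ?l:] (bivariate_diff f g)"
 have u: "[:inverse ?l:] * [:?l:] = (1::'a poly)" using l0 by simp
 have "fract_poly F1 = smult (to_fract ([:inverse ?l:] * [:?l:])) (P * Q)"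
  unfolding F1_def fract_poly_smult F smult_smult to_fract_mult ..
 then have F1: "fract_poly F1 = P * Q" unfolding u by simp
 obtain A where A: "P = fract_poly A" using monic_factor_integral[OF F1 P(2) Q(2)] .
 obtain B where B: "Q = fract_poly B" using monic_factor_integral[OF _ Q(2) P(2), of F1] F1 by (metis mult.commute)
 have dgr: "degree (fract_poly C) = degree C" for C :: "'a poly poly" by (rule degree_map_poly) simp
 have "F1 = A * B" using F1 unfolding A B fract_poly_mult[symmetric] fract_poly_eq_iff .
 then have "smult [:?l:] (A * B) = smult ([:?l:] * [:inverse ?l:]) (bivariate_diff f g)" unfolding F1_def by (metis smult_smult)
 also have "\<dots> = bivariate_diff f g" using u by (simp only: mult.commute smult_1_left)
 finally have "bivariate_diff f g = smult [:?l:] (A * B)" ..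
 moreover have "lead_coeff A = 1" "lead_coeff B = 1"
  using P(2) Q(2) unfolding A B dgr rhom_coeff[OF rhom_to_fract] by (simp_all flip: to_fract_1)
 moreover have "degree A = card D" "degree B = degree f - card D"
  using P(3) Q(3) f(2) card_Diff_subset[OF finite_subset[OF D(1) fin] D(1)] unfolding A B dgr by simp_all
 moreover have "map_poly (ev y) A = (\<Prod>z\<in>D. [:- z, 1:])"
  using P(1) unfolding A map_poly_comp_rhom[OF \<theta>(1) rhom_to_fract] \<theta>(2) .
 ultimately show ?thesis using that by blast
qed

lemma linear_factor_decomposition:
 assumes "bivariate_diff f g = smult u (P * Q)" "lead_coeff P = 1" "degree P = 1"
 obtains v where "g = pcompose f v" "P = [:- v, 1:]"
proof -
 obtain a b where "P = [:a, b:]" using assms(3) by (metis degree1_coeffs)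
 then have P: "P = [:a, 1:]" using assms(2,3) by (auto split: if_splits)
 have "poly (bivariate_diff f g) (- a) = 0" unfolding assms(1) P by simp
 then have "g = pcompose f (- a)" by (simp add: bivariate_diff_def pcompose_altdef)
 then show ?thesis using that[of "- a"] P by simp
qed

text \<open>Total degrees are read off after the substitution of \<open>X Y\<close> for \<open>X\<close>.\<close>

definition hom_subst :: "'k::field poly poly \<Rightarrow> 'k poly poly" where
 "hom_subst P = poly (map_poly (map_poly (\<lambda>a. [:a:])) P) [:0, [:0, 1:]:]"

lemma rhom_hom_subst: "rhom hom_subst"
proof -
 note m = rhom_map_poly[OF rhom_map_poly[OF rhom_const_poly]]
 show ?thesis by (rule rhomI) (simp_all add: hom_subst_def rhom_1[OF m] rhom_add[OF m] rhom_mult[OF m])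
qed

lemma coeff_hom_subst:
 "coeff (coeff (hom_subst P) t) i = (if i \<le> t then coeff (coeff P i) (t - i) else 0)"
proof (induction P arbitrary: t i)
 case 0
 show ?case by (simp add: hom_subst_def)
next
 case (pCons c P)
 have "hom_subst (pCons c P) = map_poly (\<lambda>a. [:a:]) c + [:0, [:0, 1:]:] * hom_subst P"
  by (simp add: hom_subst_def rhom_map_pCons[OF rhom_map_poly[OF rhom_const_poly]])
 then show ?case using pCons.IH by (cases t; cases i) (auto simp: rhom_coeff[OF rhom_const_poly] coeff_pCons)
qed

text \<open>Total degrees add up to that of \<open>f(X) - f(Y)\<close>, which is
  \<open>degree f\<close>. A factor monic in \<open>X\<close> has total degree at least its degree
  in \<open>X\<close>, and these degrees already add up to \<open>degree f\<close>; so equality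
  holds for each factor.\<close>

lemma factor_coeff_degree:
 fixes f :: "'k::field poly"
 assumes f: "bivariate_diff f f = smult [:c:] (P * Q)" "c \<noteq> 0" and P: "lead_coeff P = 1" and Q: "lead_coeff Q = 1"
  and d: "degree P + degree Q = degree f"
 shows "degree (coeff P i) \<le> degree P"
proof -
 have low: "hom_subst R \<noteq> 0 \<and> degree R \<le> degree (hom_subst R)" if "lead_coeff R = 1" for R :: "'k poly poly"
 proof -
  have "coeff (coeff (hom_subst R) (degree R)) (degree R) = 1"
   using that by (simp add: coeff_hom_subst)
  then have "coeff (hom_subst R) (degree R) \<noteq> 0" by auto
  then show ?thesis using le_degree by auto
 qed
 have "coeff (coeff (hom_subst (bivariate_diff f f)) t) i = 0" if "t > degree f" for t i
  using that unfolding coeff_hom_subst bivariate_diff_def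
  by (auto simp: rhom_coeff[OF rhom_const_poly] coeff_pCons coeff_eq_0 split: nat.splits)
 then have "degree (hom_subst (bivariate_diff f f)) \<le> degree f" by (intro degree_le allI impI poly_eqI) simp
 moreover have "hom_subst [:[:c:]:] = [:[:c:]:]" by (simp add: hom_subst_def rhom_map_pCons rhom_map_poly rhom_const_poly)
 then have "hom_subst (bivariate_diff f f) = smult [:c:] (hom_subst P * hom_subst Q)"
  unfolding f(1) using rhom_mult[OF rhom_hom_subst, of "[:[:c:]:]" "P * Q"] rhom_mult[OF rhom_hom_subst, of P Q] by simp
 ultimately have "degree (hom_subst P) + degree (hom_subst Q) \<le> degree f"
  using low[OF P] low[OF Q] f(2) by (simp add: Polynomial.degree_mult_eq)
 then have le: "degree (hom_subst P) \<le> degree P" using low[OF Q] d by simp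
 show ?thesis
 proof (rule degree_le, intro allI impI)
  fix j assume "degree P < j"
  then have "coeff (hom_subst P) (i + j) = 0" using le by (intro coeff_eq_0) simp
  then show "coeff (coeff P i) j = 0" using coeff_hom_subst[of P "i + j" i] by simp
 qed
qed

text \<open>The expansion of \<open>f\<close> in powers of \<open>w\<close> is found by repeated
  division by \<open>w\<close> over the small field, and uniqueness of division identifies the
  coefficients of \<open>H\<close> with the remainders.\<close>

lemma pcompose_descent:
 fixes f w :: "'a::field poly" and H :: "'b::field poly"
 assumes \<kappa>: "rhom \<kappa>" and w: "degree w > 0" and "map_poly \<kappa> f = pcompose H (map_poly \<kappa> w)"
 shows "\<exists>h. H = map_poly \<kappa> h"
 using assms(3)
proof (induction H arbitrary: f)
 case 0
 show ?case by (intro exI[of _ 0]) simp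
next
 case (pCons c H)
 note m = rhom_map_poly[OF \<kappa>]
 let ?w = "map_poly \<kappa> w" and ?q = "map_poly \<kappa> (f div w)" and ?r = "map_poly \<kappa> (f mod w)"
 have "map_poly \<kappa> f = ?q * ?w + ?r" by (simp flip: rhom_mult[OF m] rhom_add[OF m])
 then have e: "(pcompose H ?w - ?q) * ?w = ?r - [:c:]" using pCons.prems by (simp add: pcompose_pCons algebra_simps)
 have "w \<noteq> 0" using w by auto
 then have "degree (f mod w) < degree w" using degree_mod_less[of w f] w by auto
 then have "degree (?r - [:c:]) < degree ?w"
  using w by (intro le_less_trans[OF degree_diff_le_max]) (simp add: rhom_degree[OF \<kappa>])
 then have z: "pcompose H ?w - ?q = 0"
  using e \<open>w \<noteq> 0\<close> by (metis (no_types, lifting) Polynomial.degree_mult_eq le_add2 linorder_not_less rhom_map_poly_eq_0_iff[OF \<kappa>])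
 then obtain h where h: "H = map_poly \<kappa> h" using pCons.IH[of "f div w"] by auto
 have "[:c:] = ?r" using e z by simp
 then have "c = \<kappa> (coeff (f mod w) 0)" using rhom_coeff[OF \<kappa>, of "f mod w" 0] by (metis coeff_pCons_0)
 then show ?case using h by (intro exI[of _ "pCons (coeff (f mod w) 0) h"]) (simp add: rhom_map_pCons[OF \<kappa>])
qed

text \<open>The right factor \<open>w\<close> is a coefficient of the factor \<open>P\<close> of
  \<open>f(X) - f(Y)\<close> belonging to the block \<open>D\<close>. Coefficients of
  \<open>P\<close> take the same value at all points of \<open>D\<close>, so a nonconstant one has
  degree at least \<open>card D\<close>, while \<open>factor_coeff_degree\<close> bounds it from
  above. Hence \<open>D\<close> and its translates are the fibres of \<open>w\<close> on the roots
  of \<open>f(X) - t\<close>.\<close>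

theorem block_decomposition:
 assumes f: "degree f > 0" "card (fibre f) = degree f" and x: "x \<in> D"
  and D: "D \<subseteq> fibre f" "\<And>\<phi>. \<phi> \<in> ac_aut ==> \<phi> x \<in> D ==> \<phi> ` D \<subseteq> D"
  and tr: "\<And>z. z \<in> fibre f ==> \<exists>\<phi>\<in>ac_aut. \<phi> x = z"
 obtains h w where "f = pcompose h w" "degree w = card D" "\<And>z. z \<in> fibre f ==> ev z w = ev x w \<longleftrightarrow> z \<in> D"
proof -
 note fin = finite_fibre[OF f(1)]
 have fD: "finite D" using finite_subset[OF D(1) fin] .
 have xf: "x \<in> fibre f" using x D by blast
 have ev\<phi>: "\<phi> (ev z p) = ev (\<phi> z) p" if "\<phi> \<in> ac_aut" for \<phi> z p using ac_aut_poly_kc[OF that] by (simp add: ev_def)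
 have c0: "card D > 0" using x fD card_gt_0_iff by blast
 have cle: "card D \<le> degree f" using card_mono[OF fin D(1)] f(2) by simp
 obtain P Q where P: "lead_coeff P = 1" "lead_coeff Q = 1" "bivariate_diff f f = smult [:lead_coeff f:] (P * Q)"
  "degree P = card D" "degree Q = degree f - card D" "map_poly (ev x) P = (\<Prod>z\<in>D. [:- z, 1:])"
 proof (rule fibre_factor[OF f xf D(1)])
  show "\<phi> ` D \<subseteq> D" if "\<phi> \<in> ac_aut" "\<phi> x = x" for \<phi> using D(2)[OF that(1)] that(2) x by simp
 qed
 have const: "ev z (coeff P i) = ev x (coeff P i)" if z: "z \<in> D" for z i
 proof -
  obtain \<phi> where \<phi>: "\<phi> \<in> ac_aut" "\<phi> x = z" using tr z D(1) by blast
  have "\<phi> (coeff (map_poly (ev x) P) i) = coeff (map_poly (ev x) P) i"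
   unfolding P(6) rhom_coeff[OF ac_autD(1)[OF \<phi>(1)], symmetric] using ac_aut_prod_linear(1)[OF \<phi>(1) fD D(2)[OF \<phi>(1)]] \<phi>(2) z by simp
  then show ?thesis unfolding rhom_coeff[OF rhom_ev] ev\<phi>[OF \<phi>(1)] \<phi>(2) .
 qed
 \<comment> \<open>If all coefficients of \<open>P\<close> were constant in \<open>Y\<close>, the
   root \<open>x\<close> would be algebraic over \<open>k\<close>.\<close>
 have "\<exists>i. degree (coeff P i) > 0"
 proof (rule ccontr)
  assume n: "\<not> ?thesis"
  have c: "coeff P i = [:coeff (coeff P i) 0:]" for i
  proof -
   have "degree (coeff P i) = 0" using n by auto
   then obtain a where "coeff P i = [:a:]" by (rule degree_eq_zeroE)
   then show ?thesis by simp
  qed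
  define q where "q = map_poly (\<lambda>c. coeff c 0) P"
  have cq: "coeff q i = coeff (coeff P i) 0" for i by (simp add: q_def coeff_map_poly)
  have "map_poly (ev x) P = map_poly kc q"
   by (rule poly_eqI) (metis c cq ev_const rhom_coeff[OF rhom_ev] rhom_coeff[OF rhom_kc])
  then have "poly (map_poly kc q) x = 0" using P(6) prod_linear(3)[OF fD] x by simp
  then have "q = 0" by (rule fibre_transcendental[OF xf])
  then show False using cq[of "degree P"] P(1) by simp
 qed
 then obtain i where i: "degree (coeff P i) > 0" by blast
 define w where "w = coeff P i"
 have wle: "degree w \<le> card D"
  unfolding w_def P(4)[symmetric] by (rule factor_coeff_degree[OF P(3) _ P(1,2)]) (use f(1) P(4,5) cle in auto)
 let ?w = "map_poly kc w"
 let ?v = "\<lambda>z. ?w - [:ev z w:]"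
 have dv: "degree (?v z) = degree w" "?v z \<noteq> 0" "lead_coeff (?v z) = kc (lead_coeff w)" for z
 proof -
  have "degree (?w + (- [:ev z w:])) = degree ?w"
   by (rule degree_add_eq_left) (use i w_def in \<open>simp add: rhom_degree[OF rhom_kc]\<close>)
  then show 1: "degree (?v z) = degree w" by (simp only: rhom_degree[OF rhom_kc] diff_conv_add_uminus)
  then show "?v z \<noteq> 0" using i w_def by auto
  show "lead_coeff (?v z) = kc (lead_coeff w)"
   unfolding 1 using i w_def by (simp add: rhom_coeff[OF rhom_kc] coeff_pCons split: nat.splits)
 qed
 have roots: "poly (?v z) z' = 0 \<longleftrightarrow> ev z' w = ev z w" for z z' by (simp add: ev_def)
 have bound: "card E \<le> degree w" if E: "\<And>z'. z' \<in> E ==> ev z' w = ev z w" for E z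
 proof -
  have "E \<subseteq> {z'. poly (?v z) z' = 0}" using E roots by blast
  then have "card E \<le> card {z'. poly (?v z) z' = 0}" by (rule card_mono[OF poly_roots_finite[OF dv(2)]])
  then show ?thesis using card_poly_roots_bound[OF dv(2), of z] dv(1)[of z] by simp
 qed
 have wD: "degree w = card D" using bound[of D x] const wle by (simp add: w_def)
 define E where "E z = {z' \<in> fibre f. ev z' w = ev z w}" for z
 have Ec: "card (E z) = card D" if z: "z \<in> fibre f" for z
 proof -
  obtain \<phi> where \<phi>: "\<phi> \<in> ac_aut" "\<phi> x = z" using tr z by blast
  have "\<phi> ` D \<subseteq> E z"
  proof
   fix z' assume "z' \<in> \<phi> ` D"
   then obtain t where t: "t \<in> D" "z' = \<phi> t" by blast
   have "ev z' w = \<phi> (ev t w)" unfolding t(2) ev\<phi>[OF \<phi>(1)] ..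
   also have "\<dots> = ev z w" using const[OF t(1), of i] ev\<phi>[OF \<phi>(1), of x w] \<phi>(2) by (simp add: w_def)
   finally show "z' \<in> E z" using ac_aut_fibre[OF \<phi>(1)] t D(1) by (auto simp: E_def)
  qed
  then have "card (\<phi> ` D) \<le> card (E z)" using fin by (intro card_mono) (simp_all add: E_def)
  moreover have "inj_on \<phi> D" using rhom_eq_iff[OF ac_autD(1)[OF \<phi>(1)]] by (simp add: inj_on_def)
  ultimately show ?thesis using bound[of "E z" z] wD by (simp add: card_image E_def)
 qed
 have "D \<subseteq> E x" using const D(1) by (auto simp: E_def w_def)
 then have ED: "E x = D" using card_subset_eq[of "E x" D] Ec[OF xf] fin by (simp add: E_def)
 let ?l = "kc (lead_coeff w)"
 have l0: "?l \<noteq> 0" using i by (auto simp: rhom_eq_0_iff[OF rhom_kc] w_def)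
 have vE: "(\<Prod>t\<in>E z. [:- t, 1:]) = pcompose [:- ev z w / ?l, inverse ?l:] ?w" if z: "z \<in> fibre f" for z
 proof -
  have "?v z = smult ?l (\<Prod>t\<in>E z. [:- t, 1:])"
   using eq_prod_roots[of "E z" "?v z"] dv Ec[OF z] wD fin roots by (simp add: E_def)
  then have "smult (inverse ?l) (?v z) = (\<Prod>t\<in>E z. [:- t, 1:])" using l0 by simp
  moreover have "pcompose [:- ev z w / ?l, inverse ?l:] ?w = smult (inverse ?l) (?v z)"
   by (rule poly_eqI) (simp add: pcompose_pCons coeff_pCons divide_inverse algebra_simps split: nat.split)
  ultimately show ?thesis by simp
 qed
 \<comment> \<open>Grouping the roots by the value \<open>v\<close> of \<open>w\<close> turns
   \<open>f(X) - t\<close> into a product of the polynomials \<open>w - v\<close>, so it is a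
   polynomial in \<open>w\<close>, first over the closure and then over \<open>k\<close> by
   \<open>pcompose_descent\<close>.\<close>
 define H where "H = smult (kc (lead_coeff f)) (\<Prod>v\<in>(\<lambda>z. ev z w) ` fibre f. [:- v / ?l, inverse ?l:]) + [:tv:]"
 have p1: "pcompose 1 ?w = 1" using pcompose_const[of 1 ?w] by (simp only: one_pCons)
 have pp: "pcompose (prod u T) ?w = (\<Prod>t\<in>T. pcompose (u t) ?w)" for u and T :: "'a poly fract alg_closure set"
  by (induction T rule: infinite_finite_induct) (simp_all add: pcompose_mult p1)
 have "(\<Prod>z\<in>fibre f. [:- z, 1:]) = (\<Prod>v\<in>(\<lambda>z. ev z w) ` fibre f. \<Prod>z\<in>{z \<in> fibre f. ev z w = v}. [:- z, 1:])"
  by (rule prod.image_gen[OF fin])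
 also have "\<dots> = (\<Prod>v\<in>(\<lambda>z. ev z w) ` fibre f. pcompose [:- v / ?l, inverse ?l:] ?w)"
  by (rule prod.cong[OF refl]) (use vE in \<open>auto simp: E_def\<close>)
 finally have fH: "map_poly kc f = pcompose H ?w"
  using fibre_prod[OF f] unfolding H_def pcompose_add pcompose_smult pp by (simp add: diff_eq_eq)
 have "degree w > 0" using i w_def by simp
 then obtain h where h: "H = map_poly kc h" using pcompose_descent[OF rhom_kc _ fH] by blast
 have "map_poly kc f = map_poly kc (pcompose h w)" using fH unfolding h rhom_map_pcompose[OF rhom_kc] .
 then have "f = pcompose h w" using rhom_map_poly_eq_iff[OF rhom_kc] by blast
 then show ?thesis using that[of h w] wD ED by (auto simp: E_def)
qed

section \<open>The Galois group on two fibres\<close>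

text \<open>The missing cubic term makes the factors \<open>X^2 + a X + q\<close> and
  \<open>X^2 - a X + q'\<close>, and the linear term gives that \<open>a (q' - q)\<close> is
  constant. If this constant is nonzero, \<open>q\<close> and hence \<open>g\<close> is constant. If
  \<open>a = 0\<close>, both \<open>f\<close> and \<open>g\<close> factor through the quadratic with
  coefficients \<open>c0\<close>, \<open>c2\<close>, \<open>l\<close>. If \<open>q' = q\<close>,
  then \<open>q\<close> is determined by \<open>a\<close> and the Dickson pair results with
  \<open>g\<^sub>1 = a\<close>, in the notation of the theorem.\<close>

lemma quartic_factorization:
 fixes f g :: "'k::field_char_0 poly"
 assumes f: "f = [:c0, c1, c2, 0, l:]" "l \<noteq> 0" and g: "degree g > 0"
  and F: "bivariate_diff f g = smult [:l:] (P * Q)"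
  and P: "lead_coeff P = 1" "degree P = 2" and Q: "lead_coeff Q = 1" "degree Q = 2"
 shows "(\<exists>h u v. degree h = 2 \<and> degree u > 0 \<and> f = pcompose h u \<and> g = pcompose h v) \<or>
  (\<exists>\<mu> \<alpha> v. degree \<mu> = 1 \<and> f = pcompose \<mu> (dickson 4 \<alpha>) \<and>
   g = pcompose (pcompose \<mu> (smult (- (1 / 4)) (dickson 4 (2 * \<alpha>)))) v)"
proof -
 obtain q a where P': "P = [:q, a, 1:]" using degree2_coeffs[OF P(2)] P by (metis coeff_pCons_0 coeff_pCons_Suc numeral_2_eq_2)
 obtain q' a' where Q': "Q = [:q', a', 1:]" using degree2_coeffs[OF Q(2)] Q by (metis coeff_pCons_0 coeff_pCons_Suc numeral_2_eq_2)
 have "bivariate_diff f g = [:[:c0:] - g, [:c1:], [:c2:], 0, [:l:]:]"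
  by (simp add: bivariate_diff_def f rhom_map_pCons[OF rhom_const_poly] one_pCons)
 moreover have "smult [:l:] (P * Q) = [:smult l (q * q'), smult l (q * a' + a * q'),
   smult l (q + a * a' + q'), smult l (a + a'), [:l:]:]"
  unfolding P' Q' by (simp add: algebra_simps smult_add_right)
 ultimately have e: "[:c0:] - g = smult l (q * q')" "[:c1:] = smult l (q * a' + a * q')"
  "[:c2:] = smult l (q + a * a' + q')" "0 = smult l (a + a')"
  using F by (simp_all del: smult_eq_0_iff smult_add_right)
 have inv: "r = smult (inverse l) p" if "p = smult l r" for p r using that f(2) by simp
 have "a + a' = 0" using e(4) f(2) by simp
 then have a': "a' = - a" by (simp add: eq_neg_iff_add_eq_0 add.commute)
 have e1: "a * (q' - q) = [:c1 / l:]" using inv[OF e(2)] a' by (simp add: algebra_simps divide_inverse)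
 have e2: "q + q' = a * a + [:c2 / l:]" using inv[OF e(3)] a' by (simp add: algebra_simps divide_inverse)
 have ge: "g = [:c0:] - smult l (q * q')" using e(1) by (simp add: algebra_simps)
 consider "c1 \<noteq> 0" | "c1 = 0" "a = 0" | "c1 = 0" "q' = q" using e1 by (cases "c1 = 0") auto
 then show ?thesis
 proof cases
  case 1
  then have n: "a * (q' - q) \<noteq> 0" unfolding e1 using f(2) by simp
  then have "degree a + degree (q' - q) = 0"
   using arg_cong[OF e1, of degree] by (subst (asm) Polynomial.degree_mult_eq) auto
  then obtain u s where us: "a = [:u:]" "q' - q = [:s:]" by (metis add_is_0 degree_eq_zeroE)
  have "q' = q + [:s:]" using us(2) by (simp add: algebra_simps)
  then have "q + q + [:s:] = [:u * u + c2 / l:]" using e2 us(1) by (simp add: algebra_simps)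
  then have "(q + q + [:s:]) - [:s:] = [:u * u + c2 / l - s:]" by simp
  moreover have "smult 2 q = (q + q + [:s:]) - [:s:]" by (rule poly_ext) simp
  ultimately have "smult 2 q = [:u * u + c2 / l - s:]" by simp
  then have "degree (smult 2 q) = 0" by simp
  then have "degree q = 0" by simp
  then obtain t where "q = [:t:]" by (rule degree_eq_zeroE)
  then have "degree g = 0" unfolding ge using \<open>q' = q + [:s:]\<close> by simp
  then show ?thesis using g by simp
 next
  case 2
  have "f = pcompose [:c0, c2, l:] [:0, 0, 1:]" unfolding f(1) 2 by (rule poly_ext) (simp add: poly_pcompose algebra_simps)
  moreover have q': "q' = [:c2 / l:] - q" using e2 2 by (simp add: algebra_simps)
  have "g = pcompose [:c0, c2, l:] (- q)" unfolding ge q' using f(2)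
   by (intro poly_ext) (simp add: poly_pcompose field_simps)
  ultimately show ?thesis using f(2) by (intro disjI1 exI[of _ "[:c0, c2, l:]"] exI[of _ "[:0, 0, 1:]"] exI[of _ "- q"]) simp
 next
  case 3
  \<comment> \<open>Forced by comparing the quadratic coefficient of \<open>f\<close> with that of
    \<open>dickson 4 \<alpha>\<close>, which is \<open>- 4 * \<alpha>\<close>; then
    \<open>2 * q = a * a - 4 * \<alpha>\<close>, whose square produces the parameter
    \<open>2 * \<alpha>\<close> and the factor \<open>- 1 / 4\<close>.\<close>
  define \<alpha> where "\<alpha> = - c2 / (4 * l)"
  have c2: "c2 = - 4 * \<alpha> * l" unfolding \<alpha>_def using f(2) by simp
  define \<mu> where "\<mu> = [:c0 - 2 * l * \<alpha>\<^sup>2, l:]"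
  have "f = pcompose \<mu> (dickson 4 \<alpha>)" unfolding f(1) \<mu>_def dickson_4 3 c2
   by (rule poly_ext) (simp add: poly_pcompose algebra_simps power2_eq_square)
  moreover have "g = pcompose (pcompose \<mu> (smult (- (1 / 4)) (dickson 4 (2 * \<alpha>)))) a"
  proof (rule poly_ext)
   fix z
   have "2 * poly q z = poly (q + q') z" using 3 by simp
   also have "\<dots> = poly a z * poly a z - 4 * \<alpha>" unfolding e2 c2 using f(2) by simp
   finally have q: "poly q z = (poly a z * poly a z - 4 * \<alpha>) / 2" by (simp add: mult.commute)
   show "poly g z = poly (pcompose (pcompose \<mu> (smult (- (1 / 4)) (dickson 4 (2 * \<alpha>)))) a) z"
    unfolding ge \<mu>_def dickson_4 3(2) by (simp add: poly_pcompose q) (simp add: field_simps power2_eq_square)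
  qed
  moreover have "degree \<mu> = 1" unfolding \<mu>_def using f(2) by simp
  ultimately show ?thesis by blast
 qed
qed

text \<open>The shift by a quarter of the normalized cubic coefficient removes the cubic term, so
  that the two quadratic factors get opposite linear coefficients.\<close>

lemma depressed_quartic:
 fixes h :: "'k::field_char_0 poly"
 assumes "degree h = 4"
 obtains s c0 c1 c2 l where "pcompose h [:- s, 1:] = [:c0, c1, c2, 0, l:]" "l \<noteq> 0"
proof -
 define l where "l = lead_coeff h"
 have "h \<noteq> 0" using assms by auto
 then have l0: "l \<noteq> 0" unfolding l_def by (metis leading_coeff_0_iff)
 define s where "s = coeff h 3 / (4 * l)"
 have h: "h = [:coeff h 0, coeff h 1, coeff h 2, coeff h 3, l:]"
  by (rule poly_eqI) (use assms in \<open>auto simp: coeff_pCons l_def numeral_eq_Suc coeff_eq_0 split: nat.splits\<close>)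
 have s: "coeff h 3 = 4 * l * s" using l0 by (simp add: s_def)
 let ?p = "pcompose h [:- s, 1:]"
 obtain b0 b1 b2 where b: "h = [:b0, b1, b2, 4 * l * s, l:]" using h unfolding s by metis
 have "?p = [:b0 - s * b1 + s ^ 2 * b2 - 3 * l * s ^ 4, b1 - 2 * s * b2 + 8 * l * s ^ 3, b2 - 6 * l * s ^ 2, 0, l:]"
  unfolding b by (rule poly_ext) (simp add: poly_pcompose, simp add: algebra_simps power2_eq_square power3_eq_cube power4_eq_xxxx)
 then show ?thesis using that l0 by blast
qed

section \<open>From automorphisms of the closure to the monodromy groups\<close>

lemma ring_of_type_algebra_inv:
 fixes a :: "'a::field"
 shows "\<ominus>\<^bsub>ring_of_type_algebra\<^esub> a = - a" "a \<noteq> 0 ==> inv\<^bsub>ring_of_type_algebra\<^esub> a = inverse a"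
proof -
 interpret R: field "ring_of_type_algebra :: 'a ring" by (rule field_from_type_algebra)
 show "\<ominus>\<^bsub>ring_of_type_algebra\<^esub> a = - a" by (rule R.minus_equality) (simp_all add: ring_of_type_algebra_def)
 show "inv\<^bsub>ring_of_type_algebra\<^esub> a = inverse a" if "a \<noteq> 0"
  by (rule R.comm_inv_char) (use that in \<open>simp_all add: ring_of_type_algebra_def\<close>)
qed

text \<open>The link to the monodromy groups of the statement: automorphisms of the closure act on
  each fibre through them, so solvability is inherited by the group they induce on both
  fibres.\<close>

lemma ac_aut_restrict_galois:
 assumes "\<phi> \<in> ac_aut"
 shows "restrict \<phi> (carrier (splitting_field p)) \<in> carrier (galois_group p)" "ac_roots p \<subseteq> carrier (splitting_field p)"
proof -
 let ?R = "ring_of_type_algebra" and ?H = "range to_ac \<union> ac_roots p"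
 let ?L = "carrier (splitting_field p)"
 have L: "?L = generate_field ?R ?H" by (simp add: splitting_field_def)
 show "ac_roots p \<subseteq> ?L" unfolding L using generate_field.incl[of _ ?H] by blast
 have K: "to_ac c \<in> ?L" for c unfolding L using generate_field.incl[of _ ?H] by blast
 have ops: "\<one>\<^bsub>?R\<^esub> = (1::'a alg_closure)" "\<zero>\<^bsub>?R\<^esub> = (0::'a alg_closure)" "\<And>a b::'a alg_closure. a \<oplus>\<^bsub>?R\<^esub> b = a + b" "\<And>a b::'a alg_closure. a \<otimes>\<^bsub>?R\<^esub> b = a * b"
  by (simp_all add: ring_of_type_algebra_def)
 have sub: "\<psi> a \<in> ?L" if \<psi>: "\<psi> \<in> ac_aut" and a: "a \<in> ?L" for \<psi> a
 proof -
  note h = ac_autD(1)[OF \<psi>]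
  show ?thesis using a unfolding L
  proof (induction rule: generate_field.induct)
   case one
   show ?case using generate_field.one[of ?R ?H] by (simp add: ops rhom_1[OF h])
  next
   case (incl x)
   then have "\<psi> x \<in> ?H" using ac_autD(2)[OF \<psi>] ac_aut_root[OF \<psi>] by (auto simp: ac_roots_def)
   then show ?case by (rule generate_field.incl)
  next
   case (a_inv x)
   then show ?case using generate_field.a_inv[of "\<psi> x" ?R ?H] by (simp add: ring_of_type_algebra_inv rhom_minus[OF h])
  next
   case (m_inv x)
   then show ?case using generate_field.m_inv[of "\<psi> x" ?R ?H]
    by (simp add: ops ring_of_type_algebra_inv rhom_inverse[OF h] rhom_eq_0_iff[OF h])
  next
   case (eng_add x y)
   then show ?case using generate_field.eng_add[of "\<psi> x" ?R ?H "\<psi> y"] by (simp add: ops rhom_add[OF h])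
  next
   case (eng_mult x y)
   then show ?case using generate_field.eng_mult[of "\<psi> x" ?R ?H "\<psi> y"] by (simp add: ops rhom_mult[OF h])
  qed
 qed
 note h = ac_autD(1)[OF assms]
 have "a \<in> \<phi> ` ?L" if "a \<in> ?L" for a using sub[OF ac_aut_inv(1)[OF assms] that] ac_aut_inv(2)[OF assms, of a] by (metis imageI)
 then have "\<phi> ` ?L = ?L" using sub[OF assms] by blast
 then have "bij_betw \<phi> ?L ?L" using rhom_eq_iff[OF h] by (auto simp: bij_betw_def inj_on_def)
 then have "restrict \<phi> ?L \<in> Bij ?L" by (simp add: Bij_def cong: bij_betw_cong)
 moreover have "x + y \<in> ?L" "x * y \<in> ?L" if "x \<in> ?L" "y \<in> ?L" for x y using generate_field_closed[of _ ?H] that unfolding L by auto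
 then have "restrict \<phi> ?L \<in> ring_hom (splitting_field p) (splitting_field p)"
  using sub[OF assms] K[of 1] by (auto simp: ring_hom_def splitting_field_ops rhom_add[OF h] rhom_mult[OF h] rhom_1[OF h])
 ultimately show "restrict \<phi> ?L \<in> carrier (galois_group p)" using K by (simp add: galois_group_def ac_autD(2)[OF assms])
qed

lemma fibre_eq_ac_roots: "fibre f = ac_roots (map_poly rf_const f - [:rf_var:])"
proof -
 have "map_poly to_ac (map_poly rf_const f - [:rf_var:]) = map_poly kc f - [:tv:]"
  unfolding rhom_diff[OF rhom_map_poly[OF rhom_to_ac]] map_poly_comp_rhom[OF rhom_to_ac rhom_rf_const]
  by (simp add: rhom_map_pCons[OF rhom_to_ac] kc_def[abs_def] tv_def)
 then show ?thesis by (simp add: fibre_roots ac_roots_def)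
qed

lemma map_ev_bivariate_diff: "y \<in> fibre g ==> map_poly (ev y) (bivariate_diff f g) = map_poly kc f - [:tv:]"
 unfolding bivariate_diff_def rhom_diff[OF rhom_map_poly[OF rhom_ev]] map_poly_comp_rhom[OF rhom_ev rhom_const_poly] ev_const
 by (simp add: rhom_map_pCons[OF rhom_ev] ev_def fibre_def)

text \<open>\<open>\<sigma>\<close> is the inertia generator of \<open>inertia_generator\<close>,
  while \<open>x\<close> and \<open>y\<close> are the roots whose stabilizers play the roles of
  \<open>A\<close> and \<open>B\<close>.\<close>

locale fibres =
 fixes f g :: "'k::field_char_0 poly" and \<sigma> and x y
 assumes df: "degree f > 0" and dg: "degree g > 0"
  and sol: "solvable (monodromy_group f)" "solvable (monodromy_group g)"
  and \<sigma>: "\<sigma> \<in> ac_aut"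
  and cf: "\<And>h. h \<in> {f, g} ==> card (fibre h) = degree h"
  and tr: "\<And>h z z'. h \<in> {f, g} ==> z \<in> fibre h ==> z' \<in> fibre h ==> \<exists>i. (\<sigma> ^^ i) z = z'"
  and x: "x \<in> fibre f" and y: "y \<in> fibre g"
begin

text \<open>\<open>G\<close> is the Galois group of the compositum of the two splitting fields,
  realized by its action on all roots at once. \<open>prm\<close> is the identity off
  \<open>R\<close>, which keeps the support finite.\<close>

definition "R = fibre f \<union> fibre g"
definition "prm \<phi> = Perm (\<lambda>z. if z \<in> R then \<phi> z else z)"
definition "G = prm ` ac_aut"
definition "stab z = {p \<in> G. apply p z = z}"

lemma finR: "finite R" using finite_fibre[OF df] finite_fibre[OF dg] by (simp add: R_def)

lemma xyR: "x \<in> R" "y \<in> R" using x y by (simp_all add: R_def)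

lemma aut_R: "\<phi> \<in> ac_aut ==> z \<in> R ==> \<phi> z \<in> R" using ac_aut_fibre by (auto simp: R_def)

lemma apply_prm:
 assumes \<phi>: "\<phi> \<in> ac_aut"
 shows "apply (prm \<phi>) = (\<lambda>z. if z \<in> R then \<phi> z else z)"
proof -
 let ?q = "\<lambda>z. if z \<in> R then \<phi> z else z"
 have b: "bij_betw \<phi> R R" using ac_aut_prod_linear(2)[OF \<phi> finR] aut_R[OF \<phi>] by blast
 have "bij_betw ?q R R" using b by (simp cong: bij_betw_cong)
 moreover have "bij_betw ?q (- R) (- R)" by (auto simp: bij_betw_def inj_on_def)
 ultimately have "bij ?q" using bij_betw_combine[of ?q R R "- R" "- R"] by simp
 moreover have "finite {a. ?q a \<noteq> a}" by (rule finite_subset[OF _ finR]) auto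
 ultimately show ?thesis unfolding prm_def by (intro Perm_inverse) simp
qed

lemma prm_mult: "\<phi> \<in> ac_aut ==> \<psi> \<in> ac_aut ==> prm \<phi> * prm \<psi> = prm (\<lambda>z. \<phi> (\<psi> z))"
 by (rule perm_eqI) (simp add: apply_times apply_prm ac_aut_comp aut_R)

lemma prm_id: "prm (\<lambda>z. z) = 1"
 by (rule perm_eqI) (simp add: apply_prm ac_aut_id)

lemma prm_inverse: "\<phi> \<in> ac_aut ==> inverse (prm \<phi>) = prm (inv_into UNIV \<phi>)"
 by (rule grp_inverse_unique) (simp add: prm_mult ac_aut_inv prm_id)

lemma subgrp_G: "subgrp G"
 unfolding subgrp_def
proof (intro conjI ballI)
 show "1 \<in> G" unfolding G_def prm_id[symmetric] using ac_aut_id by blast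
 fix p assume "p \<in> G"
 then obtain \<phi> where \<phi>: "\<phi> \<in> ac_aut" "p = prm \<phi>" by (auto simp: G_def)
 show "inverse p \<in> G" unfolding \<phi>(2) prm_inverse[OF \<phi>(1)] G_def using ac_aut_inv(1)[OF \<phi>(1)] by blast
 fix q assume "q \<in> G"
 then obtain \<psi> where \<psi>: "\<psi> \<in> ac_aut" "q = prm \<psi>" by (auto simp: G_def)
 show "p * q \<in> G" unfolding \<phi>(2) \<psi>(2) prm_mult[OF \<phi>(1) \<psi>(1)] G_def using ac_aut_comp[OF \<phi>(1) \<psi>(1)] by blast
qed

lemma G_apply:
 assumes "p \<in> G"
 shows "z \<notin> R ==> apply p z = z" "z \<in> fibre f ==> apply p z \<in> fibre f" "z \<in> fibre g ==> apply p z \<in> fibre g"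
proof -
 obtain \<phi> where \<phi>: "\<phi> \<in> ac_aut" "p = prm \<phi>" using assms by (auto simp: G_def)
 show "z \<notin> R ==> apply p z = z" "z \<in> fibre f ==> apply p z \<in> fibre f" "z \<in> fibre g ==> apply p z \<in> fibre g"
  using ac_aut_fibre[OF \<phi>(1)] by (simp_all add: \<phi>(2) apply_prm[OF \<phi>(1)])
qed

lemma fin_G: "finite G"
proof -
 have "inj_on (\<lambda>p. restrict (apply p) R) G"
 proof (rule inj_onI, rule perm_eqI)
  fix p q a assume pq: "p \<in> G" "q \<in> G" and e: "restrict (apply p) R = restrict (apply q) R"
  show "apply p a = apply q a" using fun_cong[OF e, of a] G_apply(1)[OF pq(1), of a] G_apply(1)[OF pq(2), of a] by (cases "a \<in> R") auto
 qed
 moreover have "apply p a \<in> R" if "p \<in> G" "a \<in> R" for p a using that G_apply(2,3)[OF that(1), of a] by (auto simp: R_def)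
 then have "(\<lambda>p. restrict (apply p) R) ` G \<subseteq> R \<rightarrow>\<^sub>E R" by auto
 ultimately show ?thesis using finite_imageD finite_subset finite_PiE[OF finR, of "\<lambda>_. R"] finR by blast
qed

lemma subgrp_stab: "subgrp (stab z)"
 unfolding subgrp_def stab_def
proof (intro conjI ballI)
 show "1 \<in> {p \<in> G. apply p z = z}" using subgrp_G by simp
 fix p assume p: "p \<in> {p \<in> G. apply p z = z}"
 have "apply (inverse p) (apply p z) = z" by (simp add: apply_sequence)
 then show "inverse p \<in> {p \<in> G. apply p z = z}" using p subgrp_G by (simp add: subgrp_inverse)
 fix q assume "q \<in> {p \<in> G. apply p z = z}"
 then show "p * q \<in> {p \<in> G. apply p z = z}" using p subgrp_G by (simp add: subgrp_mult apply_times)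
qed

lemma stab_cnj: "p \<in> G ==> stab (apply p z) \<subseteq> cnj p (stab z)"
proof
 fix q assume p: "p \<in> G" and q: "q \<in> stab (apply p z)"
 have "apply (inverse p * q * p) z = apply (inverse p) (apply q (apply p z))" by (simp add: apply_times)
 also have "\<dots> = z" using q by (simp add: stab_def apply_sequence)
 finally show "q \<in> cnj p (stab z)" using p q subgrp_G by (simp add: mem_cnj stab_def subgrp_mult subgrp_inverse)
qed

lemma prm_stab: "\<phi> \<in> ac_aut ==> z \<in> R ==> prm \<phi> \<in> stab z \<longleftrightarrow> \<phi> z = z"
 by (auto simp: stab_def G_def apply_prm)

lemma sig_pow: "z \<in> R ==> apply (prm \<sigma> ^ i) z = (\<sigma> ^^ i) z"
proof (induction i)
 case (Suc i)
 have "(\<sigma> ^^ i) z \<in> R" using aut_R[OF ac_aut_funpow[OF \<sigma>] Suc.prems] .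
 then show ?case using Suc by (simp add: apply_times apply_prm[OF \<sigma>])
qed simp

text \<open>\<open>\<sigma>\<close> is transitive on each fibre, so every element of
  \<open>G\<close> can be corrected by a power of it to fix \<open>z\<close>.\<close>

lemma stab_cyc:
 assumes h: "h \<in> {f, g}" "z \<in> fibre h"
 shows "stab z * cyc (prm \<sigma>) = G"
proof
 have sG: "prm \<sigma> \<in> G" using \<sigma> by (simp add: G_def)
 have sub: "stab z \<subseteq> G" by (auto simp: stab_def)
 show "stab z * cyc (prm \<sigma>) \<subseteq> G" by (rule set_times_subset[OF subgrp_G sub cyc_subset[OF subgrp_G sG]])
 show "G \<subseteq> stab z * cyc (prm \<sigma>)"
 proof
  fix p assume p: "p \<in> G"
  have ip: "inverse p \<in> G" using subgrp_inverse[OF subgrp_G p] .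
  have "apply (inverse p) z \<in> fibre h" using G_apply(2,3)[OF ip, of z] h by auto
  then obtain i where i: "(\<sigma> ^^ i) (apply (inverse p) z) = z" using tr[OF h(1) _ h(2)] by blast
  have zR: "apply (inverse p) z \<in> R" using \<open>apply (inverse p) z \<in> fibre h\<close> h(1) by (auto simp: R_def)
  let ?s = "prm \<sigma> ^ i"
  have s: "apply ?s (apply (inverse p) z) = z" using sig_pow[OF zR] i by simp
  have "apply (inverse ?s) (apply ?s (apply (inverse p) z)) = apply (inverse p) z" by (simp add: apply_sequence)
  then have "apply (inverse ?s) z = apply (inverse p) z" unfolding s .
  then have "apply (p * inverse ?s) z = z" by (simp add: apply_times) (simp add: apply_sequence)
  then have "p * inverse ?s \<in> stab z" using p subgrp_power[OF subgrp_G sG, of i] subgrp_G by (simp add: stab_def subgrp_mult subgrp_inverse)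
  then have "(p * inverse ?s) * ?s \<in> stab z * cyc (prm \<sigma>)" by (rule set_times_intro) simp
  then show "p \<in> stab z * cyc (prm \<sigma>)" by (simp add: mult.assoc)
 qed
qed

text \<open>Restriction to the fibre is a homomorphism \<open>\<rho>\<close> into the monodromy
  group; it carries each term of the derived series of \<open>G\<close> into the corresponding term
  there, which is eventually trivial.\<close>

lemma der_fixes_fibre:
 assumes h: "h \<in> {f, g}"
 obtains n where "\<And>p z. p \<in> (der ^^ n) G ==> z \<in> fibre h ==> apply p z = z"
proof -
 define M where "M = monodromy_group h"
 let ?p = "map_poly rf_const h - [:rf_var:]"
 interpret M: Group.group M unfolding M_def monodromy_group_def by (rule group_galois_perm_group)
 have "solvable M" using h sol unfolding M_def by auto
 then obtain n where n: "(derived M ^^ n) (carrier M) = {\<one>\<^bsub>M\<^esub>}" using M.solvable_iff_trivial_derived_seq by blast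
 have mult: "u \<otimes>\<^bsub>M\<^esub> v = (\<lambda>u\<in>Bij (fibre h). \<lambda>v\<in>Bij (fibre h). compose (fibre h) u v) u v" for u v
  by (simp add: M_def monodromy_group_def galois_perm_group_def BijGroup_def fibre_eq_ac_roots)
 have one: "\<one>\<^bsub>M\<^esub> = (\<lambda>z\<in>fibre h. z)" by (simp add: M_def monodromy_group_def galois_perm_group_def BijGroup_def fibre_eq_ac_roots)
 have car: "carrier M \<subseteq> Bij (fibre h)"
  using subgroup.subset[OF subgroup_galois_perm_group[of ?p]]
  by (simp add: M_def monodromy_group_def fibre_eq_ac_roots BijGroup_def)
 define \<rho> where "\<rho> p = restrict (apply p) (fibre h)" for p
 have hR: "fibre h \<subseteq> R" using h by (auto simp: R_def)
 have \<rho>c: "\<rho> p \<in> carrier M" if pG: "p \<in> G" for p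
 proof -
  obtain \<phi> where \<phi>: "\<phi> \<in> ac_aut" "p = prm \<phi>" using pG by (auto simp: G_def)
  note r = ac_aut_restrict_galois[OF \<phi>(1), of ?p]
  have "\<rho> p = restrict (restrict \<phi> (carrier (splitting_field ?p))) (ac_roots ?p)"
   unfolding \<rho>_def \<phi>(2) apply_prm[OF \<phi>(1)] fibre_eq_ac_roots[symmetric]
   using hR r(2) unfolding fibre_eq_ac_roots[symmetric] by (auto simp: fun_eq_iff)
  then have "\<rho> p \<in> (\<lambda>s. restrict s (ac_roots ?p)) ` carrier (galois_group ?p)" using r(1) by (rule image_eqI)
  then show ?thesis by (simp add: M_def monodromy_group_def galois_perm_group_def)
 qed
 have \<rho>m: "\<rho> (p * q) = \<rho> p \<otimes>\<^bsub>M\<^esub> \<rho> q" if pq: "p \<in> G" "q \<in> G" for p q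
 proof -
  have "apply q z \<in> fibre h" if "z \<in> fibre h" for z using G_apply(2,3)[OF pq(2), of z] that h by auto
  then show ?thesis unfolding mult using car \<rho>c[OF pq(1)] \<rho>c[OF pq(2)]
   by (auto simp: \<rho>_def compose_def apply_times fun_eq_iff subset_iff)
 qed
 have \<rho>1: "\<rho> 1 = \<one>\<^bsub>M\<^esub>" by (simp add: \<rho>_def one id_def)
 have \<rho>i: "\<rho> (inverse p) = inv\<^bsub>M\<^esub> \<rho> p" if p: "p \<in> G" for p
 proof -
  have i: "inverse p \<in> G" using subgrp_inverse[OF subgrp_G p] .
  show ?thesis using \<rho>m[OF i p] \<rho>1 M.inv_equality[OF _ \<rho>c[OF p] \<rho>c[OF i]] by simp
 qed
 have "(der ^^ k) G \<subseteq> G \<and> \<rho> ` (der ^^ k) G \<subseteq> (derived M ^^ k) (carrier M)" for k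
 proof (induction k)
  case 0
  show ?case using \<rho>c by auto
 next
  case (Suc k)
  let ?D = "(der ^^ k) G" and ?K = "(derived M ^^ k) (carrier M)"
  have KM: "?K \<subseteq> carrier M" by (rule M.exp_of_derived_in_carrier) simp
  interpret S: Group.subgroup "derived M ?K" M by (rule M.derived_is_subgroup[OF KM])
  let ?P = "{p \<in> G. \<rho> p \<in> derived M ?K}"
  have "subgrp ?P" unfolding subgrp_def
  proof (intro conjI ballI)
   show "1 \<in> ?P" using subgrp_G \<rho>1 S.one_closed by simp
   fix p assume p: "p \<in> ?P"
   then show "inverse p \<in> ?P" using subgrp_inverse[OF subgrp_G] \<rho>i[of p] S.m_inv_closed[of "\<rho> p"] by simp
   fix q assume "q \<in> ?P"
   then show "p * q \<in> ?P" using p subgrp_mult[OF subgrp_G] \<rho>m[of p q] S.m_closed[of "\<rho> p" "\<rho> q"] by simp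
  qed
  moreover have "p * q * inverse p * inverse q \<in> ?P" if pq: "p \<in> ?D" "q \<in> ?D" for p q
  proof -
   have G: "p \<in> G" "q \<in> G" using pq Suc by auto
   have "\<rho> (p * q * inverse p * inverse q) = \<rho> p \<otimes>\<^bsub>M\<^esub> \<rho> q \<otimes>\<^bsub>M\<^esub> inv\<^bsub>M\<^esub> \<rho> p \<otimes>\<^bsub>M\<^esub> inv\<^bsub>M\<^esub> \<rho> q"
    using G subgrp_G by (simp add: \<rho>m \<rho>i subgrp_mult subgrp_inverse)
   moreover have "\<rho> p \<in> ?K" "\<rho> q \<in> ?K" using pq Suc by auto
   ultimately have "\<rho> (p * q * inverse p * inverse q) \<in> derived_set M ?K" by (intro UN_I[of "\<rho> p"] UN_I[of "\<rho> q"]) simp_all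
   then have "\<rho> (p * q * inverse p * inverse q) \<in> derived M ?K" unfolding derived_def by (rule generate.incl)
   then show ?thesis using G subgrp_G by (simp add: subgrp_mult subgrp_inverse)
  qed
  ultimately have "der ?D \<subseteq> ?P" by (rule der_least)
  then show ?case by (auto simp only: funpow.simps o_apply)
 qed
 note sub = this
 show ?thesis
 proof (rule that)
  fix p z assume p: "p \<in> (der ^^ n) G" and z: "z \<in> fibre h"
  have "\<rho> p \<in> (derived M ^^ n) (carrier M)" using sub[of n] p by blast
  then have "\<rho> p = (\<lambda>z\<in>fibre h. z)" unfolding n one by simp
  then have "restrict (apply p) (fibre h) z = (\<lambda>z\<in>fibre h. z) z" unfolding \<rho>_def by (rule fun_cong)
  then show "apply p z = z" using z by simp
 qed
qed

text \<open>A deep enough term of the derived series fixes both fibres pointwise, and an element of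
  \<open>G\<close> is determined by its action on them.\<close>

lemma der_trivial: obtains n where "(der ^^ n) G = {1}"
proof -
 obtain n where n: "\<And>p z. p \<in> (der ^^ n) G ==> z \<in> fibre f ==> apply p z = z" using der_fixes_fibre[of f] by blast
 obtain m where m: "\<And>p z. p \<in> (der ^^ m) G ==> z \<in> fibre g ==> apply p z = z" using der_fixes_fibre[of g] by blast
 have le: "(der ^^ (i + j)) G \<subseteq> (der ^^ j) G" for i j unfolding funpow_add by (simp add: subgrp_der_pow subgrp_G)
 have "p = 1" if p: "p \<in> (der ^^ (n + m)) G" for p
 proof (rule perm_eqI)
  fix a
  have q: "p \<in> (der ^^ m) G" "p \<in> (der ^^ n) G" "p \<in> G"
   using p le[of n m] le[of m n] subgrp_der_pow(2)[OF subgrp_G, of "n + m"] by (auto simp: add.commute)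
  show "apply p a = apply 1 a" using n[OF q(2), of a] m[OF q(1), of a] G_apply(1)[OF q(3), of a] by (auto simp: R_def)
 qed
 moreover have "1 \<in> (der ^^ (n + m)) G" using subgrp_der_pow(1)[OF subgrp_G] by simp
 ultimately show ?thesis using that[of "n + m"] by blast
qed

lemma orbit_transitive:
 assumes "z \<in> fibre f" "z' \<in> fibre f"
 obtains p where "p \<in> G" "apply p z = z'"
proof -
 obtain i where "(\<sigma> ^^ i) z = z'" using tr[of f] assms by blast
 moreover have "z \<in> R" using assms by (simp add: R_def)
 moreover have "prm \<sigma> ^ i \<in> G" using subgrp_power[OF subgrp_G] \<sigma> by (simp add: G_def)
 ultimately show ?thesis using that sig_pow by metis
qed

text \<open>As \<open>D\<close> contains the stabilizer of \<open>z\<close>, the orbit of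
  \<open>z\<close> under \<open>D\<close> is a block whose setwise stabilizer is \<open>D\<close>.
  In terms of fields, the last conclusion says that \<open>D\<close> is the stabilizer of
  \<open>w(z)\<close>.\<close>

lemma intermediate_group_decomposition:
 assumes D: "subgrp D" "D \<subseteq> G" "stab z \<subseteq> D" and z: "z \<in> fibre f"
 obtains h w where "f = pcompose h w" "degree w = card ((\<lambda>p. apply p z) ` D)"
  "\<And>\<phi>. \<phi> \<in> ac_aut ==> \<phi> (ev z w) = ev z w \<longleftrightarrow> prm \<phi> \<in> D"
proof -
 let ?O = "(\<lambda>p. apply p z) ` D"
 have zR: "z \<in> R" using z by (simp add: R_def)
 have mem: "\<phi> z \<in> ?O \<longleftrightarrow> prm \<phi> \<in> D" if \<phi>: "\<phi> \<in> ac_aut" for \<phi>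
 proof
  assume "\<phi> z \<in> ?O"
  then obtain d where d: "d \<in> D" "apply (prm \<phi>) z = apply d z" using apply_prm[OF \<phi>] zR by auto
  have "apply (inverse d * prm \<phi>) z = z" using d(2) by (simp add: apply_times) (simp add: apply_sequence)
  moreover have "inverse d * prm \<phi> \<in> G" using d(1) D(2) \<phi> subgrp_G by (auto simp: G_def[symmetric] intro!: subgrp_mult subgrp_inverse) (simp add: G_def)
  ultimately have "inverse d * prm \<phi> \<in> D" using D(3) by (auto simp: stab_def)
  then show "prm \<phi> \<in> D" using subgrp_mult_iff1[OF D(1) subgrp_inverse[OF D(1) d(1)]] by blast
 next
  assume "prm \<phi> \<in> D"
  then have "apply (prm \<phi>) z \<in> ?O" by blast
  then show "\<phi> z \<in> ?O" using apply_prm[OF \<phi>] zR by simp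
 qed
 have Of: "?O \<subseteq> fibre f" using D(2) G_apply(2) z by blast
 obtain h w where hw: "f = pcompose h w" "degree w = card ?O" "\<And>t. t \<in> fibre f ==> ev t w = ev z w \<longleftrightarrow> t \<in> ?O"
 proof (rule block_decomposition[OF df cf _ Of])
  show "f \<in> {f, g}" by simp
  show "z \<in> ?O" using subgrp_one[OF D(1)] by force
  show "\<phi> ` ?O \<subseteq> ?O" if \<phi>: "\<phi> \<in> ac_aut" "\<phi> z \<in> ?O" for \<phi>
  proof
   fix t assume "t \<in> \<phi> ` ?O"
   then obtain d where d: "d \<in> D" "t = \<phi> (apply d z)" by blast
   have "apply d z \<in> R" using d(1) Of by (auto simp: R_def)
   then have "t = apply (prm \<phi> * d) z" using d(2) apply_prm[OF \<phi>(1)] by (simp add: apply_times)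
   moreover have "prm \<phi> * d \<in> D" using mem[OF \<phi>(1)] \<phi>(2) d(1) subgrp_mult[OF D(1)] by blast
   ultimately show "t \<in> ?O" by blast
  qed
  show "\<exists>\<phi>\<in>ac_aut. \<phi> z = t" if "t \<in> fibre f" for t using tr[of f z t] that z ac_aut_funpow[OF \<sigma>] by blast
  fix h w assume "f = pcompose h w" "degree w = card ?O" "\<And>t. t \<in> fibre f ==> (ev t w = ev z w) = (t \<in> ?O)"
  then show thesis by (rule that)
 qed
 show ?thesis
 proof (rule that[OF hw(1,2)])
  fix \<phi> :: "'k poly fract alg_closure \<Rightarrow> 'k poly fract alg_closure" assume \<phi>: "\<phi> \<in> ac_aut"
  have "\<phi> (ev z w) = ev (\<phi> z) w" using ac_aut_poly_kc[OF \<phi>] by (simp add: ev_def)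
  then show "\<phi> (ev z w) = ev z w \<longleftrightarrow> prm \<phi> \<in> D" using hw(3)[OF ac_aut_fibre[OF \<phi> z]] mem[OF \<phi>] by simp
 qed
qed

text \<open>If the product were \<open>G\<close>, the stabilizer of \<open>y\<close> would be
  transitive on the fibre of \<open>f\<close>. The roots of a proper factor specialized at
  \<open>y\<close> form a set stable under that stabilizer, hence would be the whole fibre, more
  roots than its degree allows.\<close>

lemma stab_product_ne:
 assumes red: "\<not> Factorial_Ring.irreducible (bivariate_diff f g)"
 shows "stab x * stab y \<noteq> G"
proof
 assume "stab x * stab y = G"
 then have BA: "stab y * stab x = G" by (rule product2_flip[OF subgrp_G subgrp_stab subgrp_stab])
 let ?F = "bivariate_diff f g"
 have "degree (map_poly (\<lambda>c. [:c:]) f) = degree f" by (rule degree_map_poly) simp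
 then have dF: "degree ?F = degree f" and lF: "lead_coeff ?F = [:lead_coeff f:]"
 proof -
  assume e: "degree (map_poly (\<lambda>c. [:c:]) f) = degree f"
  have "degree (map_poly (\<lambda>c. [:c:]) f + (- [:g:])) = degree f" unfolding e[symmetric]
   by (rule degree_add_eq_left) (use df e in simp)
  then show 1: "degree ?F = degree f" unfolding bivariate_diff_def by (simp only: diff_conv_add_uminus)
  show "lead_coeff ?F = [:lead_coeff f:]" unfolding 1 using df
   by (simp add: bivariate_diff_def rhom_coeff[OF rhom_const_poly] coeff_pCons split: nat.splits)
 qed
 have "?F \<noteq> 0" "\<not> ?F dvd 1"
  using dF df by (auto dest!: dvd_imp_degree_le)
 then obtain P Q where PQ: "?F = P * Q" "\<not> P dvd 1" "\<not> Q dvd 1" using red unfolding Factorial_Ring.irreducible_def by blast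
 \<comment> \<open>The leading coefficient of \<open>f(X) - g(Y)\<close> in \<open>X\<close> is a
   nonzero constant, so a factor free of \<open>X\<close> divides a unit.\<close>
 have pos: "degree P' > 0" if "?F = P' * Q'" "\<not> P' dvd 1" for P' Q'
 proof (rule ccontr)
  assume "\<not> ?thesis"
  then obtain c where c: "P' = [:c:]" using degree_eq_zeroE by blast
  have "c * lead_coeff Q' = [:lead_coeff f:]" using lF lead_coeff_mult[of P' Q'] that(1) c by simp
  then have "c dvd [:lead_coeff f:]" by (metis dvd_triv_left)
  moreover have "[:lead_coeff f:] dvd 1" using df by (auto simp: is_unit_pCons_iff)
  ultimately have "c dvd 1" by (rule dvd_trans)
  then show False using that(2) c by (simp add: is_unit_const_poly_iff)
 qed
 have dP: "degree P > 0" "degree Q > 0" using pos[OF PQ(1,2)] pos[of Q P] PQ by (auto simp: mult.commute)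
 let ?P = "map_poly (ev y) P" and ?Q = "map_poly (ev y) Q"
 have prod: "?P * ?Q = map_poly kc f - [:tv:]"
  using map_ev_bivariate_diff[OF y, of f] unfolding PQ(1) rhom_mult[OF rhom_map_poly[OF rhom_ev]] .
 note nz = fibre_poly_nonzero[OF df]
 have n0: "?P \<noteq> 0" "?Q \<noteq> 0" using prod nz(2) by auto
 have "degree ?P + degree ?Q = degree P + degree Q"
  using arg_cong[OF prod, of degree] nz(1) dF PQ(1) n0 \<open>?F \<noteq> 0\<close> by (auto simp: Polynomial.degree_mult_eq)
 moreover have "degree ?P \<le> degree P" "degree ?Q \<le> degree Q" 
  by (rule degree_le, simp add: rhom_coeff[OF rhom_ev] coeff_eq_0 rhom_0[OF rhom_ev])+
 moreover have "degree P + degree Q = degree f" using dF PQ(1) \<open>?F \<noteq> 0\<close> by (auto simp: Polynomial.degree_mult_eq)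
 ultimately have d: "degree ?P > 0" "degree ?P < degree f" using dP by auto
 obtain z0 where z0: "poly ?P z0 = 0" using alg_closed_imp_poly_has_root[OF d(1)] by blast
 have "poly (map_poly kc f - [:tv:]) z0 = 0" unfolding prod[symmetric] using z0 by simp
 then have z0f: "z0 \<in> fibre f" unfolding fibre_roots by simp
 have "poly ?P z = 0" if z: "z \<in> fibre f" for z
 proof -
  have orb: "\<exists>b\<in>stab y. apply b x = t" if t: "t \<in> fibre f" for t
  proof -
   obtain p where p: "p \<in> G" "apply p x = t" using orbit_transitive[OF x t] .
   have "p \<in> stab y * stab x" using p(1) BA by simp
   then obtain b a where "b \<in> stab y" "a \<in> stab x" "p = b * a" by (rule in_set_timesE)
   then show ?thesis using p(2) by (auto simp: stab_def apply_times)
  qed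
  obtain b0 b1 where b: "b0 \<in> stab y" "apply b0 x = z0" "b1 \<in> stab y" "apply b1 x = z" using orb z0f z by blast
  have sy: "b1 * inverse b0 \<in> stab y" using b(1,3) subgrp_stab by (simp add: subgrp_mult subgrp_inverse)
  have "apply (b1 * inverse b0) z0 = z" unfolding b(2)[symmetric] b(4)[symmetric] by (simp add: apply_sequence mult.assoc)
  moreover obtain \<phi> where \<phi>: "\<phi> \<in> ac_aut" "b1 * inverse b0 = prm \<phi>" using sy by (auto simp: stab_def G_def)
  ultimately have \<phi>z: "\<phi> z0 = z" using apply_prm[OF \<phi>(1)] z0f by (simp add: R_def)
  have \<phi>y: "\<phi> y = y" using sy prm_stab[OF \<phi>(1) xyR(2)] \<phi>(2) by simp
  have "\<phi> (ev y c) = ev y c" for c using ac_aut_poly_kc[OF \<phi>(1), of c y] \<phi>y by (simp add: ev_def)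
  then have "map_poly \<phi> ?P = ?P" unfolding map_poly_comp_rhom[OF ac_autD(1)[OF \<phi>(1)] rhom_ev] by simp
  then have "\<phi> (poly ?P z0) = poly ?P z" unfolding rhom_poly[OF ac_autD(1)[OF \<phi>(1)]] \<phi>z by simp
  then show ?thesis using z0 rhom_0[OF ac_autD(1)[OF \<phi>(1)]] by simp
 qed
 then have "card (fibre f) \<le> card {z. poly ?P z = 0}" by (intro card_mono poly_roots_finite n0(1)) auto
 also have "\<dots> \<le> degree ?P" by (rule card_poly_roots_bound[OF n0(1)])
 finally show False using cf[of f] d(2) by simp
qed

end

section \<open>From groups back to polynomials\<close>

lemma card_fibre: "degree h > 0 ==> card (fibre h) = degree h"
 using inertia_generator[of h h] by (metis insertI1)

lemma ev_fibre: "x \<in> fibre (pcompose h w) ==> ev x w \<in> fibre h"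
 by (simp add: fibre_def ev_def rhom_map_pcompose[OF rhom_kc] poly_pcompose)

context fibres
begin

text \<open>A proper \<open>D\<close> containing a conjugate of the stabilizer of \<open>x\<close>
  gives \<open>f = h \<circ> w\<close> with \<open>degree h \<ge> 2\<close>, and the value of
  \<open>w\<close> at the moved root is fixed by \<open>D\<close>. If \<open>D\<close> also contains
  a conjugate of the stabilizer of \<open>y\<close>, this value is a root of \<open>h(X) - t\<close>
  fixed by that group. Then \<open>h(X) - g(Y)\<close> has a linear factor and
  \<open>g = h \<circ> v\<close>.\<close>

lemma generated_by_stabilizers:
 assumes nd: "\<nexists>h f\<^sub>1 g\<^sub>1. degree h \<ge> 2 \<and> degree f\<^sub>1 > 0 \<and> degree g\<^sub>1 > 0 \<and>
   f = pcompose h f\<^sub>1 \<and> g = pcompose h g\<^sub>1"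
  and D: "subgrp D" "D \<subseteq> G" and pq: "p \<in> G" "q \<in> G" and sub: "cnj p (stab x) \<subseteq> D" "cnj q (stab y) \<subseteq> D"
 shows "D = G"
proof (rule ccontr)
 assume n: "D \<noteq> G"
 define x' y' where "x' = apply p x" and "y' = apply q y"
 have x': "x' \<in> fibre f" and y': "y' \<in> fibre g" using G_apply(2)[OF pq(1) x] G_apply(3)[OF pq(2) y] by (simp_all add: x'_def y'_def)
 have sx: "stab x' \<subseteq> D" and sy: "stab y' \<subseteq> D"
  using stab_cnj[OF pq(1), of x] stab_cnj[OF pq(2), of y] sub by (auto simp: x'_def y'_def)
 obtain h w where hw: "f = pcompose h w" "degree w = card ((\<lambda>p. apply p x') ` D)"
  "\<And>\<phi>. \<phi> \<in> ac_aut ==> \<phi> (ev x' w) = ev x' w \<longleftrightarrow> prm \<phi> \<in> D"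
  by (rule intermediate_group_decomposition[OF D sx x']) blast
 have dm: "degree f = degree h * degree w" unfolding hw(1) degree_pcompose ..
 have "(\<lambda>p. apply p x') ` D \<noteq> fibre f"
 proof
  assume e: "(\<lambda>p. apply p x') ` D = fibre f"
  have "r \<in> D" if r: "r \<in> G" for r
  proof -
   have "apply r x' \<in> (\<lambda>p. apply p x') ` D" unfolding e using G_apply(2)[OF r x'] .
   then obtain d where d: "d \<in> D" "apply r x' = apply d x'" by blast
   have "apply (inverse d * r) x' = apply (inverse d) (apply d x')" unfolding apply_times o_apply d(2) ..
   then have "apply (inverse d * r) x' = x'" by (simp add: apply_sequence)
   moreover have "inverse d * r \<in> G" using d(1) D(2) r subgrp_G by (meson subgrp_inverse subgrp_mult subsetD)
   ultimately have "inverse d * r \<in> D" using sx by (auto simp: stab_def)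
   then show ?thesis using subgrp_mult_iff1[OF D(1) subgrp_inverse[OF D(1) d(1)]] by blast
  qed
  then show False using n D(2) by blast
 qed
 moreover have "(\<lambda>p. apply p x') ` D \<subseteq> fibre f" using D(2) G_apply(2)[OF _ x'] by blast
 ultimately have "degree w < degree f"
  using psubset_card_mono[OF finite_fibre[OF df]] cf[of f] hw(2) by (metis insertI1 psubsetI)
 then have dh: "degree h \<ge> 2" using dm by (cases "degree h = 0 \<or> degree h = 1") auto
 then have h0: "degree h > 0" by simp
 have w0: "degree w > 0" using dm df by (cases "degree w") auto
 define \<omega> where "\<omega> = ev x' w"
 have \<omega>: "{\<omega>} \<subseteq> fibre h" using ev_fibre[of x' h w] x' hw(1) by (simp add: \<omega>_def)
 have st: "\<phi> ` {\<omega>} \<subseteq> {\<omega>}" if \<phi>: "\<phi> \<in> ac_aut" "\<phi> y' = y'" for \<phi>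
 proof -
  have "prm \<phi> \<in> D" using prm_stab[OF \<phi>(1), of y'] \<phi>(2) y' sy by (auto simp: R_def)
  then show ?thesis using hw(3)[OF \<phi>(1)] by (simp add: \<omega>_def)
 qed
 obtain P Q where P: "lead_coeff P = 1" "bivariate_diff h g = smult [:lead_coeff h:] (P * Q)" "degree P = card {\<omega>}"
  by (rule fibre_factor[OF h0 card_fibre[OF h0] y' \<omega>]) (use st in blast)+
 obtain v where v: "g = pcompose h v" using linear_factor_decomposition[OF P(2,1)] P(3) by auto
 have "degree v > 0" using dg unfolding v degree_pcompose by (cases "degree v") auto
 then show False using nd dh w0 hw(1) v by blast
qed

text \<open>The subgroup of index four yields a quartic left factor of \<open>f\<close>, made
  depressed by a shift. An orbit of the stabilizer of \<open>y\<close> on its fibre is proper; if it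
  has one or three points, the quartic itself would be a common left factor. So there are two
  quadratic factors, and \<open>quartic_factorization\<close> decides.\<close>

theorem quartic_conclusion:
 assumes red: "\<not> Factorial_Ring.irreducible (bivariate_diff f g)"
  and nd: "\<nexists>h f\<^sub>1 g\<^sub>1. degree h \<ge> 2 \<and> degree f\<^sub>1 > 0 \<and> degree g\<^sub>1 > 0 \<and>
   f = pcompose h f\<^sub>1 \<and> g = pcompose h g\<^sub>1"
 shows "\<exists>\<mu> \<alpha> f\<^sub>1 g\<^sub>1. degree \<mu> = 1 \<and> f = pcompose (pcompose \<mu> (dickson 4 \<alpha>)) f\<^sub>1 \<and>
  g = pcompose (pcompose \<mu> (smult (- (1 / 4)) (dickson 4 (2 * \<alpha>)))) g\<^sub>1"
proof -
 obtain n where der: "(der ^^ n) G = {1}" by (rule der_trivial)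
 have sG: "stab z \<subseteq> G" for z by (auto simp: stab_def)
 have \<sigma>G: "prm \<sigma> \<in> G" using \<sigma> by (simp add: G_def)
 have ci: "stab x * cyc (prm \<sigma>) = G" "stab y * cyc (prm \<sigma>) = G" using stab_cyc[of f x] stab_cyc[of g y] x y by simp_all
 obtain A' where A': "subgrp A'" "stab x \<subseteq> A'" "A' \<subseteq> G" "card G = 4 * card A'" "A' * stab y \<noteq> G"
  using cyclic_factorization_index_four[OF subgrp_G fin_G der subgrp_stab sG subgrp_stab sG \<sigma>G ci stab_product_ne[OF red]]
   generated_by_stabilizers[OF nd] by metis
 obtain h w where hw: "f = pcompose h w" "degree w = card ((\<lambda>p. apply p x) ` A')"
  "\<And>\<phi>. \<phi> \<in> ac_aut ==> \<phi> (ev x w) = ev x w \<longleftrightarrow> prm \<phi> \<in> A'"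
  by (rule intermediate_group_decomposition[OF A'(1,3,2) x]) blast
 have dm: "degree f = degree h * degree w" unfolding hw(1) degree_pcompose ..
 have act: "grp_action H apply" for H :: "'k poly fract alg_closure Perm.perm set" by (simp add: grp_action_def apply_times)
 have "(\<lambda>p. apply p x) ` G = fibre f" using G_apply(2)[OF _ x] orbit_transitive[OF x] by blast
 then have c1: "card G = card (stab x) * degree f"
  using orbit_stabilizer[OF subgrp_G fin_G act, of x] cf[of f] by (simp add: stab_def)
 have "{a \<in> A'. apply a x = x} = stab x" using A'(2,3) by (auto simp: stab_def)
 then have c2: "card A' = card (stab x) * degree w"
  using orbit_stabilizer[OF A'(1) finite_subset[OF A'(3) fin_G] act, of x] hw(2) by simp
 have "card (stab x) > 0" using card_subgrp_pos[OF subgrp_stab finite_subset[OF sG fin_G]] .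
 then have "degree f = 4 * degree w" using A'(4) c1 c2 by simp
 then have dh: "degree h = 4" using dm df by simp
 obtain s c0 c1 c2 l where dep: "pcompose h [:- s, 1:] = [:c0, c1, c2, 0, l:]" "l \<noteq> 0" by (rule depressed_quartic[OF dh])
 define f0 w0 where "f0 = pcompose h [:- s, 1:]" and "w0 = w + [:s:]"
 have "pcompose [:- s, 1:] w0 = w" by (rule poly_ext) (simp add: w0_def poly_pcompose)
 then have f0: "f = pcompose f0 w0" unfolding f0_def pcompose_assoc[symmetric] using hw(1) by simp
 have d0: "degree f0 = 4" "lead_coeff f0 = l" using dep by (simp_all add: f0_def)
 then have p0: "degree f0 > 0" by simp
 have dw0: "degree w0 > 0" using df unfolding f0 degree_pcompose by (cases "degree w0") auto
 define \<omega> where "\<omega> = ev x w0"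
 have fix\<omega>: "\<phi> \<omega> = \<omega> \<longleftrightarrow> prm \<phi> \<in> A'" if \<phi>: "\<phi> \<in> ac_aut" for \<phi>
  unfolding \<omega>_def w0_def rhom_add[OF rhom_ev] ev_const rhom_add[OF ac_autD(1)[OF \<phi>]] ac_aut_kc(1)[OF \<phi>] using hw(3)[OF \<phi>] by simp
 have \<omega>f: "\<omega> \<in> fibre f0" using ev_fibre[of x f0 w0] x f0 by (simp add: \<omega>_def)
 \<comment> \<open>The orbit of \<open>\<omega>\<close> under the stabilizer of \<open>y\<close>.
   Since \<open>A'\<close> is the stabilizer of \<open>\<omega>\<close>, this orbit could be the
   whole fibre of \<open>f0\<close> only if \<open>stab y * A' = G\<close>.\<close>
 define D where "D = {\<phi> \<omega> |\<phi>. \<phi> \<in> ac_aut \<and> \<phi> y = y}"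
 have Df: "D \<subseteq> fibre f0" using ac_aut_fibre[OF _ \<omega>f] by (auto simp: D_def)
 have \<omega>D: "\<omega> \<in> D" unfolding D_def using ac_aut_id by fastforce
 have st: "\<phi> ` D \<subseteq> D" if \<phi>: "\<phi> \<in> ac_aut" "\<phi> y = y" for \<phi>
 proof
  fix t assume "t \<in> \<phi> ` D"
  then obtain \<psi> where \<psi>: "\<psi> \<in> ac_aut" "\<psi> y = y" "t = \<phi> (\<psi> \<omega>)" by (auto simp: D_def)
  then show "t \<in> D" unfolding D_def using ac_aut_comp[OF \<phi>(1) \<psi>(1)] \<phi>(2) by (intro CollectI exI[of _ "\<lambda>z. \<phi> (\<psi> z)"]) simp
 qed
 have "D \<noteq> fibre f0"
 proof
  assume e: "D = fibre f0"
  have "p \<in> stab y * A'" if p: "p \<in> G" for p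
  proof -
   obtain \<psi> where \<psi>: "\<psi> \<in> ac_aut" "p = prm \<psi>" using p by (auto simp: G_def)
   have "\<psi> \<omega> \<in> D" unfolding e by (rule ac_aut_fibre[OF \<psi>(1) \<omega>f])
   then obtain \<phi> where \<phi>: "\<phi> \<in> ac_aut" "\<phi> y = y" "\<psi> \<omega> = \<phi> \<omega>" by (auto simp: D_def)
   let ?\<chi> = "\<lambda>z. (inv_into UNIV \<phi>) (\<psi> z)"
   have \<chi>: "?\<chi> \<in> ac_aut" by (rule ac_aut_comp[OF ac_aut_inv(1)[OF \<phi>(1)] \<psi>(1)])
   have "?\<chi> \<omega> = \<omega>" unfolding \<phi>(3) by (rule ac_aut_inv(3)[OF \<phi>(1)])
   then have a: "prm ?\<chi> \<in> A'" using fix\<omega>[OF \<chi>] by blast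
   have b: "prm \<phi> \<in> stab y" using prm_stab[OF \<phi>(1) xyR(2)] \<phi>(2) by blast
   have "p = prm \<phi> * prm ?\<chi>" unfolding prm_mult[OF \<phi>(1) \<chi>] \<psi>(2) by (simp only: ac_aut_inv(2)[OF \<phi>(1)])
   then show ?thesis using set_times_intro[OF b a] by simp
  qed
  then have "stab y * A' = G" using set_times_subset[OF subgrp_G sG A'(3), of y] by blast
  then show False using product2_flip[OF subgrp_G subgrp_stab A'(1)] A'(5) by blast
 qed
 then have "card D < 4" using psubset_card_mono[OF finite_fibre[OF p0], of D] Df card_fibre[OF p0] d0 by auto
 moreover have "card D > 0" using \<omega>D finite_subset[OF Df finite_fibre[OF p0]] card_gt_0_iff by blast
 ultimately consider "card D = 1" | "card D = 3" | "card D = 2" by linarith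
 moreover obtain P Q where P: "lead_coeff P = 1" "lead_coeff Q = 1" "bivariate_diff f0 g = smult [:lead_coeff f0:] (P * Q)"
  "degree P = card D" "degree Q = degree f0 - card D"
  by (rule fibre_factor[OF p0 card_fibre[OF p0] y Df]) (use st in blast)+
 have no_linear: False if lin: "bivariate_diff f0 g = smult u (P' * Q')" "lead_coeff P' = 1" "degree P' = 1" for u P' Q'
 proof -
  obtain v where v: "g = pcompose f0 v" by (rule linear_factor_decomposition[OF lin]) blast
  have "degree v > 0" using dg unfolding v degree_pcompose by (cases "degree v") auto
  moreover have "degree f0 \<ge> 2" using d0(1) by simp
  ultimately show False using nd dw0 f0 v by blast
 qed
 ultimately show ?thesis
 proof cases
  case 1
  then show ?thesis using no_linear[OF P(3,1)] P(4) by simp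
 next
  case 2
  have QP: "bivariate_diff f0 g = smult [:lead_coeff f0:] (Q * P)" using P(3) by (simp only: mult.commute)
  have False by (rule no_linear[OF QP P(2)]) (use P(5) d0(1) 2 in simp)
  then show ?thesis ..
 next
  case 3
  have PQ: "bivariate_diff f0 g = smult [:l:] (P * Q)" using P(3) d0(2) by simp
  have dPQ: "degree P = 2" "degree Q = 2" using P(4,5) 3 d0(1) by simp_all
  from quartic_factorization[OF dep(1)[folded f0_def] dep(2) dg PQ P(1) dPQ(1) P(2) dPQ(2)] show ?thesis
  proof (elim disjE exE conjE)
   fix h' u v assume a: "degree h' = 2" "degree u > 0" "f0 = pcompose h' u" "g = pcompose h' v"
   have "degree v > 0" using dg unfolding a(4) degree_pcompose by (cases "degree v") auto
   moreover have "f = pcompose h' (pcompose u w0)" using f0 a(3) pcompose_assoc by metis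
   moreover have "degree (pcompose u w0) > 0" using a(2) dw0 by (simp add: degree_pcompose)
   ultimately show ?thesis using nd a(1,4) by (metis order_refl)
  next
   fix \<mu> \<alpha> v assume "degree \<mu> = 1" "f0 = pcompose \<mu> (dickson 4 \<alpha>)"
    "g = pcompose (pcompose \<mu> (smult (- (1 / 4)) (dickson 4 (2 * \<alpha>)))) v"
   then show ?thesis using f0 by blast
  qed
 qed
qed

end

theorem theorem5p1:
  fixes f g :: "'k::field_char_0 poly"
  assumes "Polynomial.degree f > 0" and "Polynomial.degree g > 0"
    and "solvable (monodromy_group f)" and "solvable (monodromy_group g)"
    and "\<not> Factorial_Ring.irreducible (bivariate_diff f g)"
  shows "(\<exists>h f\<^sub>1 g\<^sub>1. Polynomial.degree h \<ge> 2 \<and>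
            Polynomial.degree f\<^sub>1 > 0 \<and> Polynomial.degree g\<^sub>1 > 0 \<and>
            f = pcompose h f\<^sub>1 \<and> g = pcompose h g\<^sub>1) \<or>
         (\<exists>\<mu> \<alpha> f\<^sub>1 g\<^sub>1. Polynomial.degree \<mu> = 1 \<and>
            f = pcompose (pcompose \<mu> (dickson 4 \<alpha>)) f\<^sub>1 \<and>
            g = pcompose (pcompose \<mu> (Polynomial.smult (- (1 / 4)) (dickson 4 (2 * \<alpha>)))) g\<^sub>1)"
proof -
 obtain \<sigma> where \<sigma>: "\<sigma> \<in> ac_aut" "\<And>h. h \<in> {f, g} ==> card (fibre h) = degree h"
  "\<And>h z z'. h \<in> {f, g} ==> z \<in> fibre h ==> z' \<in> fibre h ==> \<exists>i. (\<sigma> ^^ i) z = z'"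
  by (rule inertia_generator[OF assms(1,2)]) blast
 have "fibre f \<noteq> {}" "fibre g \<noteq> {}" using \<sigma>(2)[of f] \<sigma>(2)[of g] assms(1,2) by auto
 then obtain x y where xy: "x \<in> fibre f" "y \<in> fibre g" by blast
 have "fibres f g \<sigma> x y" by (rule fibres.intro[OF assms(1-4) \<sigma> xy])
 then show ?thesis using fibres.quartic_conclusion assms(5) by blast
qed

end
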